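(* For every $b>0$ there exists a constant $C(b)>0$ such that $$\mathbb{E}\exp\big(b\|(U_n,V_n)\|_{L^2\times L^2}\big)<C(b)\quad\text{and}\quad\mathbb{E}\exp\big(b\|(U,V)\|_{L^2\times L^2}\big)<C(b)$$ for every $n\in\mathbb{N}$.
   Context: $\|(f,g)\|_{L^2\times L^2}=\sqrt{\|f\|_{L^2}^2+\|g\|_{L^2}^2}$ for $f,g\in L^2(\mathbb{T})$. $\mathbb{T}$ is the unit circle, identified with $[0,1]$ with $1$ identified with $0$. Fix $\epsilon>0$ and $q>1$. $H^s(\mathbb{T})$ is the real $L^2$-based Sobolev space with inner product $\langle\phi,\psi\rangle_{H^s}=\int_{\mathbb{T}}((I-\Delta)^{s/2}\phi)((I-\Delta)^{s/2}\psi)\,dx$; $W^{t,p}(\mathbb{T})$ is the $L^p$-based Sobolev space. Let $D$ be the derivative, $Pf=\big(\int_{\mathbb{T}}f\,dt\big)\mathbf{1}$ with $\mathbf{1}(x)\equiv1$, and $D_q=D+\epsilon^qP:H^1(\mathbb{T})\to L^2(\mathbb{T})$, which is invertible. The probability space for the prior is $\Omega=\Omega_1\times\Omega_2$ with product probability $\mathbb{P}_1\otimes\mathbb{P}_2$ (completed). Continuous model. $V:\Omega_2\to L^2(\mathbb{T})$ is Gaussian with mean $\mathbf{1}$ and covariance operator $C_V=\big(\frac1{4\epsilon}I-\epsilon\Delta\big)^{-1}$ on $L^2(\mathbb{T})$; $V$ is replaced by a version with values in $W^{t_0,p_0}(\mathbb{T})$ for all $\omega_2$ and measurable into that space, for some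 fixed $t_0<1/2$, $1<p_0<\infty$ with $t_0>1/p_0$ (so $W^{t_0,p_0}(\mathbb{T})\subset C^{0,\alpha}(\mathbb{T})$ for some $\alpha>0$). For $v\in C^{0,\alpha}(\mathbb{T})$, $\alpha>0$, $B_v:H^1(\mathbb{T})\to H^{-1}(\mathbb{T})$ is given by $\langle B_v\phi,\psi\rangle_{H^{-1}\times H^1}=\int_{\mathbb{T}}(\epsilon^2+v^2)D_q\phi\,D_q\psi\,dx$. Choose $\delta>0$, independent of $v$, with $\langle B_vu,u\rangle_{H^{-1}\times H^1}\ge\delta\|u\|_{H^1}^2$ for all $u\in H^1(\mathbb{T})$, and define (on complexified spaces) $$\Gamma_v=\frac1{2\pi i}\int_\gamma z^{-1/2}(B_v-z)^{-1}\,dz:H^{-1}(\mathbb{T})\to H^{-1}(\mathbb{T}),\qquad \gamma=\{z\in\mathbb{C}:\mathrm{dist}(z,\mathbb{R}_-)=\delta/2\},$$ with $\gamma$ oriented positively around the origin and $z^{-1/2}$ the branch on $\mathbb{C}\setminus\overline{\mathbb{R}_-}$ mapping $\mathbb{R}_+$ to itself. $\Gamma_v$ maps $H^s(\mathbb{T})$ boundedly into $L^2(\mathbb{T})$ for $s>-1$. Let $-1<s<-1/2$ and let $W:\Omega_1\to H^s(\mathbb{T})$ be centered Gaussian with $\mathbb{E}\langle W,\phi\rangle_{H^s}\langle W,\psi\rangle_{H^s}=\langle(I-\Delta)^s\phi,\psi\rangle_{H^s}$ for all $\phi,\psi\in H^s(\mathbb{T})$ (white noise). Then $U:\Omega\to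 L^2(\mathbb{T})$ is $U(\omega_1,\omega_2)=\Gamma_{V(\omega_2)}W(\omega_1)$. Discrete model. For $n\in\mathbb{N}$ let $N=2^n$, $K_j^N=[(j-1)/N,j/N)$, $j=1,\dots,N$, and $PL(n)=\{f\in C(\mathbb{T}): f\text{ linear on each }K_j^N\}$. Let $\{g_j\}_{j\ge1}$ be an orthonormal basis of $H^1(\mathbb{T})$ for the inner product $\frac1{4\epsilon}\langle f,g\rangle_{L^2}+\epsilon\langle Df,Dg\rangle_{L^2}$ such that $\{g_j\}_{j=1}^{N}$ spans $PL(n)$ for every $n$; let $\{f_j\}_{j\ge1}$ be an orthonormal basis of $H^1(\mathbb{T})$ for the inner product $\langle D_qf,D_qg\rangle_{L^2}$ such that $\{f_j\}_{j=1}^{N}$ spans $PL(n)$ for every $n$. Set $V_n(\omega_2)=\sum_{j=1}^N\mathbf{V}_j^N(\omega_2)g_j+\mathbf{1}$ with $\mathbf{V}_j^N:\Omega_2\to\mathbb{R}$ independent standard normal. For $v\in L^2(\mathbb{T})$ let $Q_nv=N\sum_{j=1}^N\big(\int_{K_j^N}v\,dx\big)\mathbf{1}_{K_j^N}$ and $\Lambda_n(v)f=(\epsilon^2+(Q_nv)^2)^{-1}f$ for $f\in L^2(\mathbb{T})$. Let $\mathbf{C}(\omega_2)\in\mathbb{R}^{N\times N}$ have entries $\mathbf{C}_{jk}(\omega_2)=\langle\Lambda_n(V_n(\omega_2))D_qf_j,D_qf_k\rangle_{L^2}$, let $\mathbf{W}_N:\Omega_1\to\mathbb{R}^N$ be centered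 Gaussian with identity covariance, and set $U_n(\omega_1,\omega_2)=\sum_{j=1}^N\big(\mathbf{C}(\omega_2)^{1/2}\mathbf{W}_N(\omega_1)\big)_jf_j$. *)

theory Defs
  imports
    "HOL-Complex_Analysis.Complex_Analysis"
    "HOL-Probability.Probability"
    "Jordan_Normal_Form.Matrix"
begin

hide_const (open) Finite_Cartesian_Product.vec_nth
no_notation Finite_Cartesian_Product.vec_nth (infixl "$" 90)
no_notation inner (infix "\<bullet>" 70)

text \<open>
  A function on the circle is a function on the reals of which only the restriction to \<open>[0,1]\<close>
  matters, up to null sets.
\<close>

definition circ :: "real measure" where
  "circ = lebesgue_on {0..1}"

definition Lp :: "real \<Rightarrow> (real \<Rightarrow> 'a::{real_normed_vector,second_countable_topology}) set" where
  "Lp p = {f \<in> borel_measurable circ. integrable circ (\<lambda>x. norm (f x) powr p)}"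

definition Lp_norm :: "real \<Rightarrow> (real \<Rightarrow> 'a::real_normed_vector) \<Rightarrow> real" where
  "Lp_norm p f = (LINT x|circ. norm (f x) powr p) powr (1 / p)"

definition L2_inner :: "(real \<Rightarrow> real) \<Rightarrow> (real \<Rightarrow> real) \<Rightarrow> real" where
  "L2_inner f g = (LINT x|circ. f x * g x)"

definition L2_pair_norm :: "(real \<Rightarrow> real) \<Rightarrow> (real \<Rightarrow> real) \<Rightarrow> real" where
  "L2_pair_norm f g = sqrt ((Lp_norm 2 f)\<^sup>2 + (Lp_norm 2 g)\<^sup>2)"

text \<open>
  A (complexified) periodic distribution \<open>u\<close> is represented by its Fourier coefficients
  \<open>u k = \<langle>u, exp (-2 \<pi> i k x)\<rangle>\<close>.  Translation-invariant operators, such as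
  the derivative and the powers of \<open>I - \<Delta>\<close>, act by their Fourier symbols.
\<close>

type_synonym pdistr = "int \<Rightarrow> complex"

definition fourier :: "(real \<Rightarrow> complex) \<Rightarrow> pdistr" where
  "fourier f k = (LINT x|circ. f x * cis (- 2 * pi * of_int k * x))"

abbreviation fourier_real :: "(real \<Rightarrow> real) \<Rightarrow> pdistr" where
  "fourier_real f \<equiv> fourier (\<lambda>x. complex_of_real (f x))"

text \<open>The integrable function, unique up to null sets, that represents a regular distribution.\<close>

definition fun_of :: "pdistr \<Rightarrow> real \<Rightarrow> complex" where
  "fun_of u = (SOME f. f \<in> Lp 1 \<and> fourier f = u)"

definition real_fun_of :: "pdistr \<Rightarrow> real \<Rightarrow> real" where
  "real_fun_of u x = Re (fun_of u x)"

definition real_distr :: "pdistr \<Rightarrow> bool" where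
  "real_distr u \<longleftrightarrow> (\<forall>k. u (- k) = cnj (u k))"

definition deriv_distr :: "pdistr \<Rightarrow> pdistr" where
  "deriv_distr u k = 2 * of_real pi * \<i> * of_int k * u k"

definition laplace :: "pdistr \<Rightarrow> pdistr" where
  "laplace u = deriv_distr (deriv_distr u)"

text \<open>\<open>bessel t u\<close> is \<open>(I - \<Delta>)\<^bsup>t/2\<^esup> u\<close>.\<close>

definition bessel :: "real \<Rightarrow> pdistr \<Rightarrow> pdistr" where
  "bessel t u k = of_real ((1 + (2 * pi * of_int k)\<^sup>2) powr (t / 2)) * u k"

text \<open>\<open>Sob\<close> and \<open>H\<close> are the complexified spaces, \<open>Sob_real\<close> and \<open>H_real\<close> the real ones.\<close>

definition Sob :: "real \<Rightarrow> real \<Rightarrow> pdistr set" where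
  "Sob t p = {u. \<exists>f \<in> Lp p. fourier f = bessel t u}"

definition Sob_real :: "real \<Rightarrow> real \<Rightarrow> pdistr set" where
  "Sob_real t p = {u \<in> Sob t p. real_distr u}"

definition Sob_norm :: "real \<Rightarrow> real \<Rightarrow> pdistr \<Rightarrow> real" where
  "Sob_norm t p u = Lp_norm p (fun_of (bessel t u))"

definition Sob_borel :: "real \<Rightarrow> real \<Rightarrow> pdistr measure" where
  "Sob_borel t p = sigma (Sob_real t p)
     {S. S \<subseteq> Sob_real t p \<and>
         (\<forall>u\<in>S. \<exists>e>0. \<forall>w\<in>Sob_real t p. Sob_norm t p (\<lambda>k. w k - u k) < e \<longrightarrow> w \<in> S)}"

abbreviation H :: "real \<Rightarrow> pdistr set" where
  "H s \<equiv> Sob s 2"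

abbreviation H_real :: "real \<Rightarrow> pdistr set" where
  "H_real s \<equiv> Sob_real s 2"

definition H_inner :: "real \<Rightarrow> pdistr \<Rightarrow> pdistr \<Rightarrow> real" where
  "H_inner s u w = L2_inner (real_fun_of (bessel s u)) (real_fun_of (bessel s w))"

text \<open>The bilinear duality between \<open>H (-1)\<close> and \<open>H 1\<close> that extends \<open>\<integral> w \<psi> dx\<close>.\<close>

definition duality :: "pdistr \<Rightarrow> pdistr \<Rightarrow> complex" where
  "duality w \<psi> = (\<Sum>\<^sub>\<infinity>k. w k * \<psi> (- k))"

text \<open>The zeroth Fourier coefficient is the mean value.\<close>

definition mean_op :: "pdistr \<Rightarrow> pdistr" where
  "mean_op u k = (if k = 0 then u 0 else 0)"

definition Dq :: "real \<Rightarrow> real \<Rightarrow> pdistr \<Rightarrow> pdistr" where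
  "Dq \<epsilon> q u k = deriv_distr u k + of_real (\<epsilon> powr q) * mean_op u k"

definition hoelder :: "real \<Rightarrow> (real \<Rightarrow> real) \<Rightarrow> bool" where
  "hoelder \<alpha> v \<longleftrightarrow> (\<forall>x. v (x + 1) = v x) \<and> (\<exists>c. \<forall>x y. \<bar>v x - v y\<bar> \<le> c * \<bar>x - y\<bar> powr \<alpha>)"

definition B_op :: "real \<Rightarrow> real \<Rightarrow> (real \<Rightarrow> real) \<Rightarrow> pdistr \<Rightarrow> pdistr" where
  "B_op \<epsilon> q v \<phi> = (THE w. w \<in> H (- 1) \<and> (\<forall>\<psi> \<in> H 1. duality w \<psi> =
     (LINT x|circ. of_real (\<epsilon>\<^sup>2 + (v x)\<^sup>2) * fun_of (Dq \<epsilon> q \<phi>) x * fun_of (Dq \<epsilon> q \<psi>) x)))"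

definition B_resolvent :: "real \<Rightarrow> real \<Rightarrow> (real \<Rightarrow> real) \<Rightarrow> complex \<Rightarrow> pdistr \<Rightarrow> pdistr" where
  "B_resolvent \<epsilon> q v z h = (THE u. u \<in> H 1 \<and> (\<lambda>k. B_op \<epsilon> q v u k - z * u k) = h)"

text \<open>
  The part in \<open>Re z \<ge> -R\<close> of the curve of all points at distance \<open>r\<close> from the negative
  real axis, running counterclockwise around the origin, from the lower to the upper half plane.
\<close>

definition gamma_path :: "real \<Rightarrow> real \<Rightarrow> real \<Rightarrow> complex" where
  "gamma_path r R = linepath (Complex (- R) (- r)) (Complex 0 (- r))
     +++ part_circlepath 0 r (- pi / 2) (pi / 2)
     +++ linepath (Complex 0 r) (Complex (- R) r)"

text \<open>
  The operator-valued integral is evaluated on \<open>h\<close> and on each Fourier coefficient.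
\<close>

definition Gamma_op :: "real \<Rightarrow> real \<Rightarrow> real \<Rightarrow> (real \<Rightarrow> real) \<Rightarrow> pdistr \<Rightarrow> pdistr" where
  "Gamma_op \<epsilon> q \<delta> v h k = 1 / (2 * of_real pi * \<i>) *
     Lim at_top (\<lambda>R. contour_integral (gamma_path (\<delta> / 2) R)
       (\<lambda>z. z powr (- 1 / 2) * B_resolvent \<epsilon> q v z h k))"

definition gaussian_rv :: "'a measure \<Rightarrow> ('a \<Rightarrow> real) \<Rightarrow> bool" where
  "gaussian_rv M X \<longleftrightarrow> X \<in> borel_measurable M \<and>
     (\<exists>m \<sigma>. \<sigma> \<ge> 0 \<and> distr M borel X =
       (if \<sigma> = 0 then return borel m else density lborel (normal_density m \<sigma>)))"

definition gaussian_L2 ::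
  "'a measure \<Rightarrow> ('a \<Rightarrow> real \<Rightarrow> real) \<Rightarrow> (real \<Rightarrow> real) \<Rightarrow> ((real \<Rightarrow> real) \<Rightarrow> real \<Rightarrow> real) \<Rightarrow> bool"
where
  "gaussian_L2 M X m C \<longleftrightarrow>
     (\<forall>\<omega> \<in> space M. X \<omega> \<in> Lp 2) \<and>
     (\<forall>\<phi> \<in> Lp 2. gaussian_rv M (\<lambda>\<omega>. L2_inner (X \<omega>) \<phi>) \<and>
        (LINT \<omega>|M. L2_inner (X \<omega>) \<phi>) = L2_inner m \<phi>) \<and>
     (\<forall>\<phi> \<in> Lp 2. \<forall>\<psi> \<in> Lp 2.
        (LINT \<omega>|M. (L2_inner (X \<omega>) \<phi> - L2_inner m \<phi>) * (L2_inner (X \<omega>) \<psi> - L2_inner m \<psi>)) =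
        L2_inner (C \<phi>) \<psi>)"

definition white_noise :: "'a measure \<Rightarrow> real \<Rightarrow> ('a \<Rightarrow> pdistr) \<Rightarrow> bool" where
  "white_noise M s W \<longleftrightarrow>
     (\<forall>\<omega> \<in> space M. W \<omega> \<in> H_real s) \<and>
     (\<forall>\<phi> \<in> H_real s. gaussian_rv M (\<lambda>\<omega>. H_inner s (W \<omega>) \<phi>) \<and>
        (LINT \<omega>|M. H_inner s (W \<omega>) \<phi>) = 0) \<and>
     (\<forall>\<phi> \<in> H_real s. \<forall>\<psi> \<in> H_real s.
        (LINT \<omega>|M. H_inner s (W \<omega>) \<phi> * H_inner s (W \<omega>) \<psi>) = H_inner s (bessel (2 * s) \<phi>) \<psi>)"

definition gaussian_vec_id :: "'a measure \<Rightarrow> nat \<Rightarrow> ('a \<Rightarrow> real vec) \<Rightarrow> bool" where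
  "gaussian_vec_id M N X \<longleftrightarrow>
     (\<forall>\<omega> \<in> space M. X \<omega> \<in> carrier_vec N) \<and>
     (\<forall>a \<in> carrier_vec N. gaussian_rv M (\<lambda>\<omega>. a \<bullet> X \<omega>)) \<and>
     (\<forall>j<N. (LINT \<omega>|M. X \<omega> $ j) = 0) \<and>
     (\<forall>j<N. \<forall>k<N. (LINT \<omega>|M. X \<omega> $ j * X \<omega> $ k) = 1\<^sub>m N $$ (j, k))"

definition C_V :: "real \<Rightarrow> (real \<Rightarrow> real) \<Rightarrow> real \<Rightarrow> real" where
  "C_V \<epsilon> \<phi> = real_fun_of
     (THE u. u \<in> H 2 \<and> (\<lambda>k. u k / of_real (4 * \<epsilon>) - of_real \<epsilon> * laplace u k) = fourier_real \<phi>)"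

definition U_cont :: "real \<Rightarrow> real \<Rightarrow> real \<Rightarrow> ('a \<Rightarrow> pdistr) \<Rightarrow> ('b \<Rightarrow> real \<Rightarrow> real) \<Rightarrow> 'a \<times> 'b \<Rightarrow> real \<Rightarrow> real"
where
  "U_cont \<epsilon> q \<delta> W V \<omega> = real_fun_of (Gamma_op \<epsilon> q \<delta> (V (snd \<omega>)) (W (fst \<omega>)))"

text \<open>All indices start at \<open>0\<close>; the \<open>N = 2 ^ n\<close> cells of level \<open>n\<close> are \<open>cell n j\<close> for \<open>j < N\<close>.\<close>

definition cell :: "nat \<Rightarrow> nat \<Rightarrow> real set" where
  "cell n j = {real j / 2 ^ n ..< (real j + 1) / 2 ^ n}"

definition PL :: "nat \<Rightarrow> (real \<Rightarrow> real) set" where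
  "PL n = {f. continuous_on UNIV f \<and> (\<forall>x. f (x + 1) = f x) \<and>
     (\<forall>j < 2 ^ n. \<exists>a b. \<forall>x \<in> cell n j. f x = a + b * x)}"

definition orthonormal_basis_H1 :: "(pdistr \<Rightarrow> pdistr \<Rightarrow> real) \<Rightarrow> (nat \<Rightarrow> pdistr) \<Rightarrow> bool" where
  "orthonormal_basis_H1 ip e \<longleftrightarrow>
     (\<forall>j. e j \<in> H_real 1) \<and>
     (\<forall>i j. ip (e i) (e j) = (if i = j then 1 else 0)) \<and>
     (\<forall>u \<in> H_real 1. \<forall>r>0. \<exists>m (c :: nat \<Rightarrow> real).
        let w = (\<lambda>k. u k - (\<Sum>j<m. of_real (c j) * e j k)) in sqrt (ip w w) < r)"

definition spans_PL :: "(nat \<Rightarrow> real \<Rightarrow> real) \<Rightarrow> bool" where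
  "spans_PL e \<longleftrightarrow>
     (\<forall>n. {f. \<exists>c :: nat \<Rightarrow> real. f = (\<lambda>x. \<Sum>j<2^n. c j * e j x)} = PL n)"

text \<open>\<open>H_inner 0\<close> is the inner product of \<open>L\<^sup>2\<close>.\<close>

definition ip_V :: "real \<Rightarrow> pdistr \<Rightarrow> pdistr \<Rightarrow> real" where
  "ip_V \<epsilon> u w = 1 / (4 * \<epsilon>) * H_inner 0 u w + \<epsilon> * H_inner 0 (deriv_distr u) (deriv_distr w)"

definition ip_D :: "real \<Rightarrow> real \<Rightarrow> pdistr \<Rightarrow> pdistr \<Rightarrow> real" where
  "ip_D \<epsilon> q u w = H_inner 0 (Dq \<epsilon> q u) (Dq \<epsilon> q w)"

definition V_disc ::
  "(nat \<Rightarrow> real \<Rightarrow> real) \<Rightarrow> (nat \<Rightarrow> nat \<Rightarrow> 'b \<Rightarrow> real) \<Rightarrow> nat \<Rightarrow> 'b \<Rightarrow> real \<Rightarrow> real" where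
  "V_disc g VV n \<omega> x = (\<Sum>j<2^n. VV n j \<omega> * g j x) + 1"

definition Q_op :: "nat \<Rightarrow> (real \<Rightarrow> real) \<Rightarrow> real \<Rightarrow> real" where
  "Q_op n v x = 2 ^ n * (\<Sum>j<2^n. (LINT y:cell n j|circ. v y) * indicator (cell n j) x)"

definition Lambda_op :: "real \<Rightarrow> nat \<Rightarrow> (real \<Rightarrow> real) \<Rightarrow> (real \<Rightarrow> real) \<Rightarrow> real \<Rightarrow> real" where
  "Lambda_op \<epsilon> n v f x = inverse (\<epsilon>\<^sup>2 + (Q_op n v x)\<^sup>2) * f x"

definition C_mat ::
  "real \<Rightarrow> real \<Rightarrow> (nat \<Rightarrow> real \<Rightarrow> real) \<Rightarrow> nat \<Rightarrow> (real \<Rightarrow> real) \<Rightarrow> real mat" where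
  "C_mat \<epsilon> q f n v = mat (2 ^ n) (2 ^ n) (\<lambda>(j, k).
     L2_inner (Lambda_op \<epsilon> n v (real_fun_of (Dq \<epsilon> q (fourier_real (f j)))))
              (real_fun_of (Dq \<epsilon> q (fourier_real (f k)))))"

definition pos_semidef :: "real mat \<Rightarrow> bool" where
  "pos_semidef A \<longleftrightarrow> A\<^sup>T = A \<and> (\<forall>x \<in> carrier_vec (dim_row A). 0 \<le> x \<bullet> (A *\<^sub>v x))"

definition mat_sqrt :: "real mat \<Rightarrow> real mat" where
  "mat_sqrt A = (THE S. S \<in> carrier_mat (dim_row A) (dim_row A) \<and> pos_semidef S \<and> S * S = A)"

definition U_disc ::
  "real \<Rightarrow> real \<Rightarrow> (nat \<Rightarrow> real \<Rightarrow> real) \<Rightarrow> (nat \<Rightarrow> 'b \<Rightarrow> real \<Rightarrow> real) \<Rightarrow>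
   (nat \<Rightarrow> 'a \<Rightarrow> real vec) \<Rightarrow> nat \<Rightarrow> 'a \<times> 'b \<Rightarrow> real \<Rightarrow> real" where
  "U_disc \<epsilon> q f Vn WN n \<omega> x =
     (\<Sum>j<2^n. (mat_sqrt (C_mat \<epsilon> q f n (Vn n (snd \<omega>))) *\<^sub>v WN n (fst \<omega>)) $ j * f j x)"

end

theory Submission
  imports Defs
begin

text \<open>
  All four fields are handled through their Fourier coefficients.  If the real and imaginary parts of
  the \<open>k\<close>-th coefficient are sub-Gaussian with a variance \<open>\<nu> k\<close> and \<open>\<nu>\<close> is summable, then the
  \<open>L\<^sup>2\<close> norm has exponential moments bounded in terms of the sum of \<open>\<nu>\<close> alone; no independence between
  the coefficients is needed.  Bessel's inequality for the two orthonormal bases makes the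
  variances of the discrete fields summable uniformly in \<open>n\<close>; for \<open>U\<^sub>n\<close> this is done for a fixed value
  of \<open>V\<^sub>n\<close>, the matrix \<open>C\<close> being at most \<open>\<epsilon>\<^bsup>-2\<^esup>\<close>.

  For \<open>U\<close>, coercivity gives \<open>\<Sum>k. (m k + x) * \<bar>u k\<bar>\<^sup>2 \<le> c * \<bar>\<langle>h, u\<rangle>\<bar>\<close> for \<open>u = (B\<^sub>v - z)\<^sup>-\<^sup>1 h\<close>, where
  \<open>x = max 0 (- Re z)\<close> and \<open>m k = 1 + (2 \<pi> k)\<^sup>2\<close>.  Hence the \<open>L\<^sup>2\<close> norm of \<open>u\<close> is at most a multiple of
  \<open>(1 + x) powr (- s / 2 - 1)\<close> times the \<open>H\<^sup>s\<close> norm of \<open>h\<close>; after multiplication by \<open>z\<^bsup>-1/2\<^esup>\<close>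
  this is integrable along the contour, uniformly in \<open>v\<close>.  So the norm of \<open>U\<close> is at most a constant times
  the \<open>H\<^sup>s\<close> norm of the white noise.  Joint measurability of \<open>U\<close> comes from writing the resolvent as
  a limit of Richardson iterates, which are explicit expressions in the Fourier coefficients.
\<close>

section \<open>Fourier series on the circle\<close>

text \<open>Two exponents decide the matter. In \<open>H s\<close> the coefficients of white noise
  have variances \<open>bessel_wt k powr s\<close>, summable for s < -1/2. Along the contour the
  integrand decays like \<open>(1 + x) powr (- ((s + 3) / 2))\<close>, integrable for s > -1. The
  main obstacle is measurability. The conclusion asserts integrability on the product space, while
  the resolvent, the matrix root and the functions representing distributions come from definite
  descriptions or choice. Each is rewritten as a countable limit of expressions in Fourier
  coefficients. The step size admissible in the Richardson iteration depends on the supremum of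
  \<open>V \<omega>\<close>, for which no measurability is established; hence all steps 1/(m+1) are
  run and a second limit is taken over m. That supremum is finite by the Sobolev embedding. As the
  integrability exponent need not be 2, Parseval does not give it, and Fejer kernels are used.
  Coercivity at v = 0 compares \<delta> with the symbol of \<open>Dq\<close>. Since
  \<open>\<epsilon>\<^sup>2 + v\<^sup>2 \<ge> \<epsilon>\<^sup>2\<close>, the comparison yields
  coercivity for every bounded coefficient.\<close>

definition expi :: "int \<Rightarrow> real \<Rightarrow> complex" where
  "expi k x = cis (2 * pi * of_int k * x)"

lemma fourier_expi: "fourier f k = (LINT x|circ. f x * expi (- k) x)"
  by (simp add: fourier_def expi_def)

lemma norm_expi [simp]: "norm (expi k x) = 1"
  by (simp add: expi_def)

lemma expi_mult: "expi j x * expi k x = expi (j + k) x"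
  by (simp add: expi_def cis_mult algebra_simps)

lemma cnj_expi: "cnj (expi k x) = expi (- k) x"
  by (simp add: expi_def cis_cnj)

lemma expi_0 [simp]: "expi 0 x = 1"
  by (simp add: expi_def)

lemma continuous_expi [continuous_intros]: "continuous_on S (expi k)"
  unfolding expi_def by (intro continuous_intros)

lemma space_circ [simp]: "space circ = {0..1}"
  by (simp add: circ_def)

lemma prob_space_circ: "prob_space circ"
  by standard (simp add: circ_def emeasure_restrict_space)

interpretation circ: prob_space circ
  by (rule prob_space_circ)

lemma borel_measurable_circI: "f \<in> borel_measurable borel \<Longrightarrow> f \<in> borel_measurable circ"
  unfolding circ_def
  by (intro measurable_restrict_space1 measurable_completion) simp

lemma borel_measurable_circ_continuous:
  "continuous_on UNIV f \<Longrightarrow> f \<in> borel_measurable circ"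
  by (intro borel_measurable_circI borel_measurable_continuous_onI)

lemma measurable_expi [measurable]: "expi k \<in> borel_measurable circ"
  by (intro borel_measurable_circ_continuous continuous_intros)

lemma integrable_circ_bounded:
  fixes f :: "real \<Rightarrow> 'b::{banach,second_countable_topology}"
  assumes "f \<in> borel_measurable circ" "\<And>x. x \<in> {0..1} \<Longrightarrow> norm (f x) \<le> c"
  shows "integrable circ f"
  using assms by (intro circ.integrable_const_bound[where B=c]) auto

lemma integrable_mult_bounded:
  fixes f g :: "real \<Rightarrow> 'b::{real_normed_field,banach,second_countable_topology}"
  assumes "integrable circ f" "g \<in> borel_measurable circ"
    "\<And>x. x \<in> {0..1} \<Longrightarrow> norm (g x) \<le> c"
  shows "integrable circ (\<lambda>x. f x * g x)"
proof (rule Bochner_Integration.integrable_bound[where f="\<lambda>x. c * norm (f x)"])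
  show "AE x in circ. norm (f x * g x) \<le> norm (c * norm (f x))"
  proof (rule AE_I2)
    fix x assume "x \<in> space circ"
    then have "norm (g x) \<le> c" using assms(3) by simp
    then have "norm (f x) * norm (g x) \<le> norm (f x) * \<bar>c\<bar>"
      by (intro mult_left_mono) auto
    then show "norm (f x * g x) \<le> norm (c * norm (f x))"
      by (simp add: norm_mult abs_mult mult.commute)
  qed
qed (use assms in auto)

lemma integrable_mult_expi:
  "integrable circ f \<Longrightarrow> integrable circ (\<lambda>x. f x * expi k x)"
  by (rule integrable_mult_bounded[where c=1]) auto

lemma integrable_expi [simp]: "integrable circ (expi k)"
  by (rule integrable_circ_bounded[where c=1]) auto

lemma integral_expi: "(LINT x|circ. expi k x) = (if k = 0 then 1 else 0)"
proof (cases "k = 0")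
  case False
  define a where "a = 2 * of_real pi * \<i> * of_int k"
  have a: "a \<noteq> 0" using False by (simp add: a_def)
  have e: "expi k x = exp (a * of_real x)" for x
    by (simp add: expi_def cis_conv_exp a_def mult_ac)
  have "((\<lambda>x. exp (a * of_real x)) has_integral
          (exp (a * of_real 1) / a - exp (a * of_real 0) / a)) {0..1}"
  proof (rule fundamental_theorem_of_calculus)
    fix x :: real
    show "((\<lambda>x. exp (a * complex_of_real x) / a) has_vector_derivative
         exp (a * complex_of_real x)) (at x within {0..1})"
      using a by (auto intro!: derivative_eq_intros simp: has_vector_derivative_def[symmetric]
          intro: has_vector_derivative_eq_rhs[OF has_vector_derivative_real_field])
  qed simp
  moreover have "exp (a * of_real 1) = 1"
  proof -
    have "exp (a * of_real 1) = expi k 1" by (simp add: e)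
    also have "\<dots> = cis (2 * pi * of_int k)" by (simp add: expi_def)
    also have "\<dots> = 1" by (rule cis_multiple_2pi) auto
    finally show ?thesis .
  qed
  ultimately have "integral {0..1} (expi k) = 0"
    unfolding ext[of "expi k" "\<lambda>x. exp (a * of_real x)", OF e] by (simp add: integral_unique)
  moreover have "(LINT x|circ. expi k x) = integral {0..1} (expi k)"
    unfolding circ_def by (rule lebesgue_integral_eq_integral)
      (use integrable_expi[of k] in \<open>auto simp: circ_def\<close>)
  ultimately show ?thesis using False by simp
qed (simp add: circ.prob_space[unfolded space_circ])

lemma fourier_expi_self: "fourier (expi j) k = (if j = k then 1 else 0)"
  unfolding fourier_expi expi_mult integral_expi by simp

lemma fourier_cong_AE:
  assumes "AE x in circ. f x = g x" "f \<in> borel_measurable circ" "g \<in> borel_measurable circ"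
  shows "fourier f = fourier g"
  unfolding fourier_expi
proof (intro ext integral_cong_AE)
  show "AE x in circ. f x * expi (- k) x = g x * expi (- k) x" for k
    using assms(1) by eventually_elim simp
qed (use assms(2,3) in measurable)

lemma fourier_add:
  "integrable circ f \<Longrightarrow> integrable circ g \<Longrightarrow>
    fourier (\<lambda>x. f x + g x) k = fourier f k + fourier g k"
  unfolding fourier_expi distrib_right by (intro Bochner_Integration.integral_add integrable_mult_expi)

lemma fourier_diff:
  "integrable circ f \<Longrightarrow> integrable circ g \<Longrightarrow>
    fourier (\<lambda>x. f x - g x) k = fourier f k - fourier g k"
  unfolding fourier_expi left_diff_distrib by (intro Bochner_Integration.integral_diff integrable_mult_expi)

lemma fourier_cmult: "fourier (\<lambda>x. c * f x) k = c * fourier f k"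
  by (simp add: fourier_expi mult.assoc)

lemma fourier_sum:
  assumes "\<And>i. i \<in> I \<Longrightarrow> integrable circ (f i)"
  shows "fourier (\<lambda>x. \<Sum>i\<in>I. f i x) k = (\<Sum>i\<in>I. fourier (f i) k)"
  unfolding fourier_expi sum_distrib_right
  by (intro Bochner_Integration.integral_sum integrable_mult_expi assms)

lemma fourier_mult_expi: "fourier (\<lambda>x. f x * expi j x) k = fourier f (k - j)"
  by (simp add: fourier_expi mult.assoc expi_mult)

lemma fourier_cnj: "fourier (\<lambda>x. cnj (f x)) k = cnj (fourier f (- k))"
proof -
  have "fourier (\<lambda>x. cnj (f x)) k = (LINT x|circ. cnj (f x * expi k x))"
    by (simp add: fourier_expi cnj_expi)
  also have "\<dots> = cnj (LINT x|circ. f x * expi k x)" by (rule Bochner_Integration.integral_cnj)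
  finally show ?thesis by (simp add: fourier_expi)
qed

lemma real_distr_fourier_real: "real_distr (fourier_real f)"
  using fourier_cnj[of "\<lambda>x. complex_of_real (f x)" "- k" for k]
  unfolding real_distr_def by simp

text \<open>Multiplying by \<open>expi 1\<close> or \<open>expi (-1)\<close> only shifts the
  coefficients, so their vanishing survives multiplication by any real polynomial in the point
  \<open>expi 1 x\<close>. The function \<open>f\<close> is generalised because the product case
  applies the second hypothesis to \<open>f\<close> times the first factor.\<close>

lemma fourier_trig_polynomial_0:
  assumes "real_polynomial_function p" "integrable circ f" "\<And>k. fourier f k = 0"
  shows "integrable circ (\<lambda>x. f x * complex_of_real (p (expi 1 x))) \<and>
         (\<forall>k. fourier (\<lambda>x. f x * complex_of_real (p (expi 1 x))) k = 0)"
  using assms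
proof (induction arbitrary: f rule: real_polynomial_function.induct)
  case (linear p)
  note f = linear.prems
  interpret bounded_linear p by fact
  \<comment> \<open>A real-linear functional on the complex plane is a combination of
    \<open>z\<close> and \<open>cnj z\<close>; these are its two coefficients.\<close>
  define c1 c2 where "c1 = (of_real (p 1) - \<i> * of_real (p \<i>)) / 2"
    and "c2 = (of_real (p 1) + \<i> * of_real (p \<i>)) / 2"
  have eq: "complex_of_real (p z) = c1 * z + c2 * cnj z" for z
  proof -
    have "z = Re z *\<^sub>R 1 + Im z *\<^sub>R \<i>" by (simp add: complex_eq_iff)
    then have "p z = Re z * p 1 + Im z * p \<i>" by (metis add scaleR real_scaleR_def)
    then show ?thesis by (simp add: c1_def c2_def complex_eq_iff field_simps)
  qed
  have fe: "(\<lambda>x. f x * complex_of_real (p (expi 1 x))) =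
      (\<lambda>x. c1 * (f x * expi 1 x) + c2 * (f x * expi (-1) x))"
    by (simp add: eq cnj_expi fun_eq_iff algebra_simps)
  have "fourier (\<lambda>x. c1 * (f x * expi 1 x) + c2 * (f x * expi (-1) x)) k = 0" for k
    using f by (subst fourier_add) (auto intro!: integrable_mult_expi simp: fourier_cmult fourier_mult_expi)
  then show ?case unfolding fe using f by (auto intro!: integrable_mult_expi)
next
  case (const c)
  then show ?case by (simp add: fourier_cmult mult.commute[of _ "complex_of_real c"])
next
  case (add p r)
  then have "integrable circ (\<lambda>x. f x * complex_of_real (p (expi 1 x)))"
    "integrable circ (\<lambda>x. f x * complex_of_real (r (expi 1 x)))" by blast+
  moreover have "(\<lambda>x. f x * complex_of_real (p (expi 1 x) + r (expi 1 x))) =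
     (\<lambda>x. f x * complex_of_real (p (expi 1 x)) + f x * complex_of_real (r (expi 1 x)))"
    by (simp add: algebra_simps)
  ultimately show ?case using add by (simp add: fourier_add)
next
  case (mult p r)
  have "integrable circ (\<lambda>x. f x * complex_of_real (p (expi 1 x))) \<and>
         (\<forall>k. fourier (\<lambda>x. f x * complex_of_real (p (expi 1 x))) k = 0)"
    by (rule mult.IH(1)[OF mult.prems])
  then show ?case using mult.IH(2)[of "\<lambda>x. f x * complex_of_real (p (expi 1 x))"]
    by (simp add: mult.assoc)
qed

lemma expi_in_sphere: "expi k x \<in> sphere 0 1"
  by (simp add: dist_norm)

text \<open>Stone-Weierstrass on the unit circle: replacing \<open>g\<close> by a polynomial within
  \<open>e\<close> of it changes the integral by at most \<open>e\<close> times the L1 norm of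
  \<open>f\<close>, and the polynomial contributes zero.\<close>

lemma integral_mult_continuous_0:
  fixes g :: "complex \<Rightarrow> real"
  assumes "integrable circ f" "\<And>k. fourier f k = 0" "continuous_on UNIV g"
  shows "(LINT x|circ. f x * complex_of_real (g (expi 1 x))) = 0"
proof -
  let ?I = "LINT x|circ. norm (f x)"
  have cg: "continuous_on UNIV (\<lambda>x. complex_of_real (g (expi 1 x)))"
    by (intro continuous_intros continuous_on_compose2[OF assms(3)]) auto
  have gm: "(\<lambda>x. complex_of_real (g (expi 1 x))) \<in> borel_measurable circ"
    by (rule borel_measurable_circ_continuous[OF cg])
  have "compact (g ` sphere 0 1)"
    by (intro compact_continuous_image continuous_on_subset[OF assms(3)]) auto
  then obtain c where c: "\<And>z. z \<in> sphere 0 1 \<Longrightarrow> norm (g z) \<le> c"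
    by (meson compact_imp_bounded bounded_iff image_eqI)
  have gi: "integrable circ (\<lambda>x. f x * complex_of_real (g (expi 1 x)))"
  proof (rule integrable_mult_bounded[OF assms(1) gm, where c=c])
    show "norm (complex_of_real (g (expi 1 x))) \<le> c" for x
      using c[OF expi_in_sphere, of 1 x] by simp
  qed
  have small: "norm (LINT x|circ. f x * complex_of_real (g (expi 1 x))) \<le> e * ?I" if e: "e > 0" for e
  proof -
    obtain p where p: "real_polynomial_function p" "\<And>z. z \<in> sphere 0 1 \<Longrightarrow> \<bar>g z - p z\<bar> < e"
      by (rule Stone_Weierstrass_real_polynomial_function
          [OF compact_sphere continuous_on_subset[OF assms(3) subset_UNIV] e]) blast
    have p0: "integrable circ (\<lambda>x. f x * complex_of_real (p (expi 1 x)))"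
       "fourier (\<lambda>x. f x * complex_of_real (p (expi 1 x))) 0 = 0"
      using fourier_trig_polynomial_0[OF p(1) assms(1,2)] by auto
    have "(LINT x|circ. f x * complex_of_real (g (expi 1 x))) =
       (LINT x|circ. f x * complex_of_real (g (expi 1 x)) - f x * complex_of_real (p (expi 1 x)))"
      using gi p0 by (simp add: fourier_expi)
    also have "norm \<dots> \<le> (LINT x|circ. e * norm (f x))"
    proof (rule Bochner_Integration.integral_norm_bound_integral)
      fix x
      have "f x * complex_of_real (g (expi 1 x)) - f x * complex_of_real (p (expi 1 x)) =
          f x * complex_of_real (g (expi 1 x) - p (expi 1 x))" by (simp add: algebra_simps)
      then show "norm (f x * complex_of_real (g (expi 1 x)) - f x * complex_of_real (p (expi 1 x))) \<le> e * norm (f x)"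
        using mult_right_mono[OF less_imp_le[OF p(2)[OF expi_in_sphere, of 1 x]], of "norm (f x)"]
        by (simp only: norm_mult norm_of_real) (simp add: mult.commute)
    qed (use gi p0 assms(1) in auto)
    finally show ?thesis by simp
  qed
  have "norm (LINT x|circ. f x * complex_of_real (g (expi 1 x))) \<le> 0"
  proof (rule field_le_epsilon)
    fix d :: real assume "d > 0"
    \<comment> \<open>Dividing by \<open>?I + 1\<close> instead of \<open>?I\<close> covers the case
      that the L1 norm is zero.\<close>
    have I: "?I + 1 > 0" by (intro add_nonneg_pos) auto
    have "norm (LINT x|circ. f x * complex_of_real (g (expi 1 x))) \<le> d / (?I + 1) * ?I"
      by (intro small divide_pos_pos \<open>d > 0\<close> I)
    also have "\<dots> \<le> d / (?I + 1) * (?I + 1)"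
      using less_imp_le[OF divide_pos_pos[OF \<open>d > 0\<close> I]] by (intro mult_left_mono) auto
    also have "\<dots> = d" using less_imp_neq[OF I] by (intro nonzero_eq_divide_eq[THEN iffD1]) auto
    finally show "norm (LINT x|circ. f x * complex_of_real (g (expi 1 x))) \<le> 0 + d" by simp
  qed
  then show ?thesis by simp
qed

text \<open>The parametrisation of the circle by \<open>{0..1}\<close> identifies only the two end
  points, so it is injective once 0 is removed.\<close>

lemma expi_1_eq_iff:
  assumes "expi 1 x = expi 1 y" "x \<in> {0..1}" "y \<in> {0..1}" "x \<noteq> 0" "y \<noteq> 0"
  shows "x = y"
proof -
  have "cis (2 * pi * x) / cis (2 * pi * y) = 1" using assms(1) by (simp add: expi_def)
  then have "cis (2 * pi * x - 2 * pi * y) = 1" by (simp add: cis_divide)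
  then have "cos (2 * pi * x - 2 * pi * y) = 1" by (metis cis.sel(1) one_complex.sel(1))
  then obtain n :: int where "2 * pi * x - 2 * pi * y = of_int n * 2 * pi"
    using cos_one_2pi_int by (metis mult.commute mult.left_commute)
  then have "2 * pi * (x - y - of_int n) = 0" by (simp add: algebra_simps)
  then have n: "x - y = of_int n" by simp
  then have "\<bar>real_of_int n\<bar> < 1" using assms by auto
  then have "n = 0" by linarith
  with n show ?thesis by simp
qed

text \<open>The indicator of \<open>C\<close> is an almost everywhere limit of continuous functions
  of the distance to the image of \<open>C\<close> on the circle. The point 0 is kept out of
  \<open>C\<close> because the circle does not separate it from 1.\<close>

lemma integral_compact_0:
  assumes f: "integrable circ f" "\<And>k. fourier f k = 0" and C: "compact C" "C \<subseteq> {0<..1}"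
  shows "(LINT x|circ. f x * indicator C x) = 0"
proof (cases "C = {}")
  case False
  define K where "K = expi 1 ` C"
  have K: "compact K" "K \<noteq> {}"
    unfolding K_def using C False by (auto intro!: compact_continuous_image continuous_intros)
  \<comment> \<open>Equal to 1 on \<open>K\<close> and to 0 as soon as
    \<open>real m * infdist z K\<close> reaches 1.\<close>
  define g where "g m z = max 0 (1 - real m * infdist z K)" for m z
  have cg: "continuous_on UNIV (g m)" for m
    unfolding g_def by (intro continuous_intros)
  have lim: "(\<lambda>m. g m (expi 1 x)) \<longlonglongrightarrow> indicator C x" if x: "x \<in> {0..1}" "x \<noteq> 0" for x
  proof (cases "x \<in> C")
    case True
    then have "infdist (expi 1 x) K = 0" by (auto simp: K_def)
    then show ?thesis using True by (simp add: g_def)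
  next
    case False
    have "expi 1 x \<notin> K"
      using expi_1_eq_iff[OF _ x(1) _ x(2)] False C by (force simp: K_def)
    then have pos: "infdist (expi 1 x) K > 0"
      using K by (metis compact_imp_closed in_closed_iff_infdist_zero infdist_nonneg less_eq_real_def)
    obtain m0 :: nat where m0: "real m0 * infdist (expi 1 x) K > 1"
      using pos by (metis reals_Archimedean3)
    have "g m (expi 1 x) = 0" if "m \<ge> m0" for m
    proof -
      have "real m0 * infdist (expi 1 x) K \<le> real m * infdist (expi 1 x) K"
        using that by (intro mult_right_mono infdist_nonneg) auto
      then show ?thesis using m0 by (simp add: g_def)
    qed
    then have "\<forall>\<^sub>F m in sequentially. g m (expi 1 x) = 0"
      unfolding eventually_sequentially by blast
    then show ?thesis using False by (simp add: tendsto_eventually)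
  qed
  have AE0: "AE x in circ. x \<noteq> 0"
    unfolding circ_def
    by (subst AE_restrict_space_iff) (auto simp: AE_completion_iff intro: AE_mp[OF AE_lborel_singleton[of 0]])
  have "(\<lambda>m. LINT x|circ. f x * complex_of_real (g m (expi 1 x))) \<longlonglongrightarrow>
        (LINT x|circ. f x * indicator C x)"
  proof (rule integral_dominated_convergence[where w="\<lambda>x. norm (f x)"])
    show "AE x in circ. (\<lambda>m. f x * complex_of_real (g m (expi 1 x))) \<longlonglongrightarrow> f x * indicator C x"
      using AE0
    proof (rule AE_mp, intro AE_I2 impI)
      fix x assume "x \<in> space circ" "x \<noteq> 0"
      then have "(\<lambda>m. f x * complex_of_real (g m (expi 1 x))) \<longlonglongrightarrow> f x * complex_of_real (indicator C x)"
        by (intro tendsto_intros lim) auto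
      then show "(\<lambda>m. f x * complex_of_real (g m (expi 1 x))) \<longlonglongrightarrow> f x * indicator C x"
        by (cases "x \<in> C") simp_all
    qed
    show "AE x in circ. norm (f x * complex_of_real (g m (expi 1 x))) \<le> norm (f x)" for m
      by (intro AE_I2) (auto simp: norm_mult g_def infdist_nonneg intro!: mult_left_le)
    show "(\<lambda>x. f x * complex_of_real (g m (expi 1 x))) \<in> borel_measurable circ" for m
    proof (rule borel_measurable_times)
      show "(\<lambda>x. complex_of_real (g m (expi 1 x))) \<in> borel_measurable circ"
        by (intro borel_measurable_circ_continuous continuous_intros continuous_on_compose2[OF cg]) auto
    qed (use f in auto)
    have "C \<in> sets borel" using C by (simp add: borel_compact)
    then have "(indicator C :: real \<Rightarrow> complex) \<in> borel_measurable circ"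
      by (intro borel_measurable_circI borel_measurable_indicator)
    then show "(\<lambda>x. f x * indicator C x) \<in> borel_measurable circ"
      using f by auto
  qed (use f in auto)
  then show ?thesis
    using integral_mult_continuous_0[OF f cg] by (simp add: LIMSEQ_const_iff)
qed simp

text \<open>Inner regularity of Lebesgue measure exhausts \<open>A\<close>, up to a null set, by
  countably many compact sets; removing the point 0 first makes \<open>integral_compact_0\<close>
  applicable to their finite unions.\<close>

lemma integral_set_0:
  assumes f: "integrable circ f" "\<And>k. fourier f k = 0" and A: "A \<in> sets circ"
  shows "(LINT x|circ. f x * indicator A x) = 0"
proof -
  have Al: "A - {0} \<in> sets lebesgue" "A \<subseteq> {0..1}"
    using A by (auto simp: circ_def sets_restrict_space_iff)
  obtain N C where NC: "negligible N" "\<And>n::nat. compact (C n)" "A - {0} = (\<Union>n. C n) \<union> N"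
    using lebesgue_regular_inner[OF Al(1)] by metis
  define D where "D n = (\<Union>i\<le>n. C i)" for n
  have D: "compact (D n)" "D n \<subseteq> {0<..1}" for n
  proof -
    show "compact (D n)" unfolding D_def using NC by (intro compact_UN) auto
    have "D n \<subseteq> A - {0}" unfolding D_def NC(3) by auto
    then show "D n \<subseteq> {0<..1}" using Al(2) by force
  qed
  have AEN: "AE x in circ. x \<notin> N \<union> {0}"
  proof -
    have "negligible (N \<union> {0})" using NC(1) by simp
    then have "AE x in lebesgue. x \<notin> N \<union> {0}"
      by (intro AE_not_in) (simp add: negligible_iff_null_sets)
    then show ?thesis unfolding circ_def by (subst AE_restrict_space_iff) auto
  qed
  have im: "(indicator S :: real \<Rightarrow> complex) \<in> borel_measurable circ" if "compact S" for S
    using borel_compact[OF that] by (intro borel_measurable_circI borel_measurable_indicator)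
  have "(\<lambda>n. LINT x|circ. f x * indicator (D n) x) \<longlonglongrightarrow> (LINT x|circ. f x * indicator A x)"
  proof (rule integral_dominated_convergence[where w="\<lambda>x. norm (f x)"])
    show "AE x in circ. (\<lambda>n. f x * indicator (D n) x) \<longlonglongrightarrow> f x * indicator A x"
      using AEN
    proof (rule AE_mp, intro AE_I2 impI)
      fix x assume x: "x \<in> space circ" "x \<notin> N \<union> {0}"
      have "(\<lambda>n. indicator (D n) x :: complex) \<longlonglongrightarrow> indicator (\<Union>n. C n) x"
        using LIMSEQ_indicator_UN[of C x] unfolding D_def lessThan_Suc_atMost[symmetric]
        by (rule LIMSEQ_Suc)
      moreover have "x \<in> (\<Union>n. C n) \<longleftrightarrow> x \<in> A"
        using x NC(3) by auto
      ultimately show "(\<lambda>n. f x * indicator (D n) x) \<longlonglongrightarrow> f x * indicator A x"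
        by (intro tendsto_intros) (simp add: indicator_def)
    qed
    show "AE x in circ. norm (f x * indicator (D n) x) \<le> norm (f x)" for n
      by (intro AE_I2) (auto simp: indicator_def)
    show "(\<lambda>x. f x * indicator (D n) x) \<in> borel_measurable circ" for n
      using f by (intro borel_measurable_times im D) auto
  qed (use f A in auto)
  then show ?thesis
    using integral_compact_0[OF f D] by (simp add: LIMSEQ_const_iff)
qed

text \<open>The real and imaginary parts integrate to zero over every measurable set, so both vanish
  as densities.\<close>

lemma fourier_eq_0_imp_AE:
  assumes f: "integrable circ f" "\<And>k. fourier f k = 0"
  shows "AE x in circ. f x = 0"
proof -
  have i: "integrable circ (\<lambda>x. Re (f x))" "integrable circ (\<lambda>x. Im (f x))" using f by auto
  have z: "(LINT x|circ. f x * indicator A x) = 0" "integrable circ (\<lambda>x. f x * indicator A x)"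
    if "A \<in> sets circ" for A
  proof -
    show "(LINT x|circ. f x * indicator A x) = 0" by (rule integral_set_0[OF f that])
    show "integrable circ (\<lambda>x. f x * indicator A x)"
      by (rule integrable_mult_bounded[OF f(1), where c=1])
        (use that in \<open>auto split: split_indicator\<close>)
  qed
  have "AE x in circ. Re (f x) = 0"
  proof (rule density_unique_real[OF i(1)])
    fix A assume "A \<in> sets circ"
    have "(\<integral>x\<in>A. Re (f x)\<partial>circ) = (LINT x|circ. Re (f x * indicator A x))"
      unfolding set_lebesgue_integral_def
      by (rule Bochner_Integration.integral_cong) (auto simp: indicator_def)
    also have "\<dots> = Re (LINT x|circ. f x * indicator A x)"
      by (rule integral_Re[OF z(2)[OF \<open>A \<in> sets circ\<close>]])
    finally show "(\<integral>x\<in>A. Re (f x)\<partial>circ) = (\<integral>x\<in>A. 0\<partial>circ)"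
      by (simp add: z(1)[OF \<open>A \<in> sets circ\<close>] set_lebesgue_integral_def)
  qed simp
  moreover have "AE x in circ. Im (f x) = 0"
  proof (rule density_unique_real[OF i(2)])
    fix A assume "A \<in> sets circ"
    have "(\<integral>x\<in>A. Im (f x)\<partial>circ) = (LINT x|circ. Im (f x * indicator A x))"
      unfolding set_lebesgue_integral_def
      by (rule Bochner_Integration.integral_cong) (auto simp: indicator_def)
    also have "\<dots> = Im (LINT x|circ. f x * indicator A x)"
      by (rule integral_Im[OF z(2)[OF \<open>A \<in> sets circ\<close>]])
    finally show "(\<integral>x\<in>A. Im (f x)\<partial>circ) = (\<integral>x\<in>A. 0\<partial>circ)"
      by (simp add: z(1)[OF \<open>A \<in> sets circ\<close>] set_lebesgue_integral_def)
  qed simp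
  ultimately show ?thesis by eventually_elim (simp add: complex_eq_iff)
qed

lemma fourier_inj_AE:
  assumes "integrable circ f" "integrable circ g" "fourier f = fourier g"
  shows "AE x in circ. f x = g x"
proof -
  have "AE x in circ. f x - g x = 0"
    by (rule fourier_eq_0_imp_AE) (use assms in \<open>auto simp: fourier_diff\<close>)
  then show ?thesis by eventually_elim simp
qed

section \<open>Square-integrable functions on the circle\<close>

lemma powr_2: "(x::real) \<ge> 0 \<Longrightarrow> x powr 2 = x\<^sup>2"
  using powr_realpow'[of x 2] by simp

lemma Lp_2_iff:
  "f \<in> Lp 2 \<longleftrightarrow> f \<in> borel_measurable circ \<and> integrable circ (\<lambda>x. (norm (f x))\<^sup>2)"
  by (simp add: Lp_def powr_2)

lemma Lp_1_iff:
  fixes f :: "real \<Rightarrow> 'b::{banach,second_countable_topology}"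
  shows "f \<in> Lp 1 \<longleftrightarrow> integrable circ f"
  by (auto simp: Lp_def integrable_norm_iff)

lemma Lp_norm_2_power2: "(Lp_norm 2 f)\<^sup>2 = (LINT x|circ. (norm (f x))\<^sup>2)"
proof -
  have "((LINT x|circ. (norm (f x))\<^sup>2) powr (1/2))\<^sup>2 = (LINT x|circ. (norm (f x))\<^sup>2)"
    by (subst powr_half_sqrt) auto
  then show ?thesis by (simp add: Lp_norm_def powr_2)
qed

lemma Lp_norm_nonneg: "Lp_norm p f \<ge> 0"
  by (simp add: Lp_norm_def)

lemma Lp_2_measurable: "f \<in> Lp 2 \<Longrightarrow> f \<in> borel_measurable circ"
  by (simp add: Lp_2_iff)

lemma Lp_2_bounded:
  fixes f :: "real \<Rightarrow> 'b::{banach,second_countable_topology}"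
  assumes "f \<in> borel_measurable circ" "\<And>x. x \<in> {0..1} \<Longrightarrow> norm (f x) \<le> c"
  shows "f \<in> Lp 2"
  unfolding Lp_2_iff
  by (intro conjI integrable_circ_bounded[where c="c\<^sup>2"] assms)
    (use assms in \<open>auto intro!: power_mono\<close>)

lemma integrable_mult_Lp_2:
  fixes f g :: "real \<Rightarrow> 'b::{real_normed_field,banach,second_countable_topology}"
  assumes "f \<in> Lp 2" "g \<in> Lp 2"
  shows "integrable circ (\<lambda>x. f x * g x)"
proof (rule Bochner_Integration.integrable_bound)
  show "integrable circ (\<lambda>x. (norm (f x))\<^sup>2 + (norm (g x))\<^sup>2)"
    using assms by (auto simp: Lp_2_iff)
  show "AE x in circ. norm (f x * g x) \<le> norm ((norm (f x))\<^sup>2 + (norm (g x))\<^sup>2)"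
  proof (rule AE_I2)
    fix x
    have "norm (f x) * norm (g x) \<le> (norm (f x))\<^sup>2 + (norm (g x))\<^sup>2"
      using sum_squares_bound[of "norm (f x)" "norm (g x)"]
        zero_le_power2[of "norm (f x)"] zero_le_power2[of "norm (g x)"] by linarith
    then show "norm (f x * g x) \<le> norm ((norm (f x))\<^sup>2 + (norm (g x))\<^sup>2)"
      by (simp add: norm_mult)
  qed
qed (use assms in \<open>auto simp: Lp_2_iff\<close>)

lemma integrable_Lp_2:
  fixes f :: "real \<Rightarrow> 'b::{real_normed_field,banach,second_countable_topology}"
  assumes "f \<in> Lp 2" shows "integrable circ f"
proof -
  have "(\<lambda>x. 1 :: 'b) \<in> Lp 2" by (rule Lp_2_bounded[where c=1]) auto
  from integrable_mult_Lp_2[OF assms this] show ?thesis by simp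
qed

lemma Lp_2_add:
  fixes f g :: "real \<Rightarrow> 'b::{banach,second_countable_topology}"
  assumes "f \<in> Lp 2" "g \<in> Lp 2" shows "(\<lambda>x. f x + g x) \<in> Lp 2"
  unfolding Lp_2_iff
proof (rule conjI[OF _ Bochner_Integration.integrable_bound])
  show "integrable circ (\<lambda>x. 2 * (norm (f x))\<^sup>2 + 2 * (norm (g x))\<^sup>2)"
    using assms by (auto simp: Lp_2_iff)
  show "AE x in circ. norm ((norm (f x + g x))\<^sup>2) \<le> norm (2 * (norm (f x))\<^sup>2 + 2 * (norm (g x))\<^sup>2)"
  proof (rule AE_I2)
    fix x
    have "(norm (f x + g x))\<^sup>2 \<le> (norm (f x) + norm (g x))\<^sup>2"
      by (intro power_mono norm_triangle_ineq) auto
    also have "\<dots> \<le> 2 * (norm (f x))\<^sup>2 + 2 * (norm (g x))\<^sup>2"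
      using sum_squares_bound[of "norm (f x)" "norm (g x)"] by (simp add: power2_sum)
    finally show "norm ((norm (f x + g x))\<^sup>2) \<le> norm (2 * (norm (f x))\<^sup>2 + 2 * (norm (g x))\<^sup>2)"
      by simp
  qed
qed (use assms in \<open>auto simp: Lp_2_iff\<close>)

lemma Lp_2_cmult:
  fixes f :: "real \<Rightarrow> 'b::{real_normed_field,banach,second_countable_topology}"
  assumes "f \<in> Lp 2" shows "(\<lambda>x. c * f x) \<in> Lp 2"
  using assms by (auto simp: Lp_2_iff norm_mult power_mult_distrib)

lemma Lp_2_diff:
  fixes f g :: "real \<Rightarrow> 'b::{real_normed_field,banach,second_countable_topology}"
  assumes "f \<in> Lp 2" "g \<in> Lp 2" shows "(\<lambda>x. f x - g x) \<in> Lp 2"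
  using Lp_2_add[OF assms(1) Lp_2_cmult[OF assms(2), of "-1"]] by simp

lemma Lp_2_sum:
  fixes f :: "'i \<Rightarrow> real \<Rightarrow> 'b::{banach,second_countable_topology}"
  assumes "\<And>i. i \<in> I \<Longrightarrow> f i \<in> Lp 2" shows "(\<lambda>x. \<Sum>i\<in>I. f i x) \<in> Lp 2"
  using assms
  by (induction I rule: infinite_finite_induct) (auto intro: Lp_2_add Lp_2_bounded[where c=0])

lemma Lp_2_mult_bounded:
  fixes f a :: "real \<Rightarrow> 'b::{real_normed_field,banach,second_countable_topology}"
  assumes "f \<in> Lp 2" "a \<in> borel_measurable circ" "AE x in circ. norm (a x) \<le> c"
  shows "(\<lambda>x. a x * f x) \<in> Lp 2"
  unfolding Lp_2_iff
proof (rule conjI[OF _ Bochner_Integration.integrable_bound])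
  show "integrable circ (\<lambda>x. c\<^sup>2 * (norm (f x))\<^sup>2)" using assms by (auto simp: Lp_2_iff)
  show "AE x in circ. norm ((norm (a x * f x))\<^sup>2) \<le> norm (c\<^sup>2 * (norm (f x))\<^sup>2)"
    using assms(3)
  proof eventually_elim
    case (elim x)
    then have "(norm (a x))\<^sup>2 \<le> c\<^sup>2" by (intro power_mono) auto
    then have "(norm (a x))\<^sup>2 * (norm (f x))\<^sup>2 \<le> c\<^sup>2 * (norm (f x))\<^sup>2" by (intro mult_right_mono) auto
    then show ?case by (simp add: norm_mult power_mult_distrib)
  qed
qed (use assms in \<open>auto simp: Lp_2_iff\<close>)

lemma Lp_2_expi: "expi k \<in> Lp 2"
  by (rule Lp_2_bounded[where c=1]) auto

lemma Lp_2_of_real: "f \<in> Lp 2 \<Longrightarrow> (\<lambda>x. complex_of_real (f x)) \<in> Lp 2"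
  by (auto simp: Lp_2_iff)

lemma Lp_2_Re: "f \<in> Lp 2 \<Longrightarrow> (\<lambda>x. Re (f x)) \<in> Lp 2"
  unfolding Lp_2_iff
  by (elim conjE, rule conjI[OF _ Bochner_Integration.integrable_bound[of circ "\<lambda>x. (norm (f x))\<^sup>2"]])
    (auto simp: cmod_power2)

lemma Lp_2_cnj: "f \<in> Lp 2 \<Longrightarrow> (\<lambda>x. cnj (f x)) \<in> Lp 2"
  using measurable_compose[OF _ borel_measurable_continuous_onI[of cnj], of f circ]
  by (auto simp: Lp_2_iff intro: continuous_intros)

lemma Lp_2_continuous:
  fixes f :: "real \<Rightarrow> 'b::{banach,second_countable_topology}"
  assumes "continuous_on UNIV f" shows "f \<in> Lp 2"
proof -
  have "compact (f ` {0..1})"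
    by (intro compact_continuous_image continuous_on_subset[OF assms]) auto
  then obtain c where "\<And>x. x \<in> {0..1} \<Longrightarrow> norm (f x) \<le> c"
    by (meson compact_imp_bounded bounded_iff image_eqI)
  then show ?thesis by (rule Lp_2_bounded[OF borel_measurable_circ_continuous[OF assms]])
qed

abbreviation trig :: "(int \<Rightarrow> complex) \<Rightarrow> int set \<Rightarrow> real \<Rightarrow> complex" where
  "trig c F x \<equiv> (\<Sum>k\<in>F. c k * expi k x)"

lemma Lp_2_trig: "trig c F \<in> Lp 2"
  by (intro Lp_2_sum Lp_2_cmult Lp_2_expi)

lemma fourier_trig:
  assumes "finite F" shows "fourier (trig c F) k = (if k \<in> F then c k else 0)"
proof -
  have "fourier (trig c F) k = (\<Sum>j\<in>F. fourier (\<lambda>x. c j * expi j x) k)"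
    by (intro fourier_sum) auto
  also have "\<dots> = (\<Sum>j\<in>F. if j = k then c j else 0)"
    by (intro sum.cong refl) (simp only: fourier_cmult fourier_expi_self, simp)
  finally show ?thesis using assms by simp
qed

lemma integral_mult_cnj_trig:
  assumes "integrable circ f"
  shows "(LINT x|circ. f x * cnj (trig c F x)) = (\<Sum>k\<in>F. cnj (c k) * fourier f k)"
proof -
  have "(LINT x|circ. f x * cnj (trig c F x)) = (LINT x|circ. (\<Sum>k\<in>F. cnj (c k) * (f x * expi (- k) x)))"
    by (intro Bochner_Integration.integral_cong refl)
      (simp add: sum_distrib_left cnj_expi mult_ac)
  also have "\<dots> = (\<Sum>k\<in>F. LINT x|circ. cnj (c k) * (f x * expi (- k) x))"
    by (intro Bochner_Integration.integral_sum integrable_mult_right integrable_mult_expi assms)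
  finally show ?thesis by (simp add: fourier_expi)
qed

lemma integral_norm_trig:
  assumes "finite F" shows "(LINT x|circ. (norm (trig c F x))\<^sup>2) = (\<Sum>k\<in>F. (norm (c k))\<^sup>2)"
proof -
  have "complex_of_real (LINT x|circ. (norm (trig c F x))\<^sup>2) = (LINT x|circ. trig c F x * cnj (trig c F x))"
    by (subst integral_complex_of_real[symmetric]) (simp only: complex_norm_square)
  also have "\<dots> = (\<Sum>k\<in>F. cnj (c k) * fourier (trig c F) k)"
    by (rule integral_mult_cnj_trig[OF integrable_Lp_2[OF Lp_2_trig]])
  also have "\<dots> = (\<Sum>k\<in>F. complex_of_real ((norm (c k))\<^sup>2))"
    using assms by (intro sum.cong refl) (simp only: fourier_trig complex_norm_square, simp)
  also have "\<dots> = complex_of_real (\<Sum>k\<in>F. (norm (c k))\<^sup>2)" by simp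
  finally show ?thesis by (simp only: of_real_eq_iff)
qed

lemma norm_diff_power2: "(norm (a - b))\<^sup>2 = (norm a)\<^sup>2 - 2 * Re (a * cnj b) + (norm b)\<^sup>2"
  for a b :: complex
  by (simp only: cmod_power2) (simp add: power2_eq_square algebra_simps)

text \<open>Pythagoras: the partial sum is the orthogonal projection of \<open>f\<close> onto the
  modes in \<open>F\<close>, so the cross term equals the squared norm of the projection.\<close>

lemma integral_norm_diff_trig:
  assumes "f \<in> Lp 2" "finite F"
  shows "(LINT x|circ. (norm (f x - trig (fourier f) F x))\<^sup>2) =
    (LINT x|circ. (norm (f x))\<^sup>2) - (\<Sum>k\<in>F. (norm (fourier f k))\<^sup>2)"
proof -
  let ?S = "trig (fourier f) F"
  have i: "integrable circ (\<lambda>x. f x * cnj (?S x))"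
    by (intro integrable_mult_Lp_2 assms Lp_2_cnj Lp_2_trig)
  have i2: "integrable circ (\<lambda>x. (norm (f x))\<^sup>2)" "integrable circ (\<lambda>x. (norm (?S x))\<^sup>2)"
    using assms Lp_2_trig[of "fourier f" F] by (auto simp: Lp_2_iff)
  have j: "integrable circ (\<lambda>x. 2 * Re (f x * cnj (?S x)))"
    by (intro integrable_mult_right integrable_Re i)
  have "(LINT x|circ. Re (f x * cnj (?S x))) = Re (LINT x|circ. f x * cnj (?S x))"
    by (rule integral_Re[OF i])
  also have "\<dots> = (\<Sum>k\<in>F. (norm (fourier f k))\<^sup>2)"
    by (subst integral_mult_cnj_trig[OF integrable_Lp_2[OF assms(1)]])
      (simp add: cmod_power2, simp add: power2_eq_square)
  finally have c: "(LINT x|circ. Re (f x * cnj (?S x))) = (\<Sum>k\<in>F. (norm (fourier f k))\<^sup>2)" .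
  have "(LINT x|circ. (norm (f x - ?S x))\<^sup>2) = (LINT x|circ. (norm (f x))\<^sup>2 - 2 * Re (f x * cnj (?S x)) + (norm (?S x))\<^sup>2)"
    by (simp only: norm_diff_power2)
  also have "\<dots> = (LINT x|circ. (norm (f x))\<^sup>2) - 2 * (LINT x|circ. Re (f x * cnj (?S x))) + (LINT x|circ. (norm (?S x))\<^sup>2)"
    by (simp only: Bochner_Integration.integral_add[OF Bochner_Integration.integrable_diff[OF i2(1) j] i2(2)]
      Bochner_Integration.integral_diff[OF i2(1) j] integral_mult_right_zero)
  finally show ?thesis by (simp only: c integral_norm_trig[OF assms(2)])
qed

lemma bessel_inequality:
  assumes "f \<in> Lp 2" "finite F"
  shows "(\<Sum>k\<in>F. (norm (fourier f k))\<^sup>2) \<le> (LINT x|circ. (norm (f x))\<^sup>2)"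
proof -
  have "0 \<le> (LINT x|circ. (norm (f x - trig (fourier f) F x))\<^sup>2)" by simp
  then show ?thesis by (simp only: integral_norm_diff_trig[OF assms])
qed

lemma summable_fourier_Lp_2:
  assumes "f \<in> Lp 2" shows "(\<lambda>k. (norm (fourier f k))\<^sup>2) summable_on UNIV"
  by (rule nonneg_bdd_above_summable_on)
    (auto intro!: bdd_aboveI2 bessel_inequality[OF assms])

text \<open>Unordered sums are limits along all finite sets. Symmetric intervals give a sequence
  running through that filter, and sequences are what Fatou's lemma and the measurability of limits
  work with.\<close>

lemma filterlim_symmetric_intervals:
  "filterlim (\<lambda>n::nat. {- int n..int n}) (finite_subsets_at_top UNIV) sequentially"
  unfolding filterlim_finite_subsets_at_top
proof (intro allI impI)
  fix X :: "int set" assume "finite X \<and> X \<subseteq> UNIV"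
  then obtain b where b: "\<forall>k\<in>X. \<bar>k\<bar> \<le> b"
    using finite_nat_set_iff_bounded_le by (metis finite_imageI bdd_above_finite bdd_above.unfold imageI)
  have "X \<subseteq> {- int n..int n}" if "n \<ge> nat b" for n
    using b that by (force simp: subset_iff)
  then show "\<forall>\<^sub>F n in sequentially. finite {- int n..int n} \<and> X \<subseteq> {- int n..int n} \<and> {- int n..int n} \<subseteq> UNIV"
    unfolding eventually_sequentially by auto
qed

lemma has_sum_imp_symmetric_tendsto:
  fixes f :: "int \<Rightarrow> 'b::{comm_monoid_add,topological_space}"
  assumes "(f has_sum s) UNIV"
  shows "(\<lambda>n. \<Sum>k\<in>{- int n..int n}. f k) \<longlonglongrightarrow> s"
  using filterlim_compose[OF assms[unfolded has_sum_def] filterlim_symmetric_intervals] .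

text \<open>The classical proof that L2 is complete: along a sparse subsequence the partial sums
  converge almost everywhere, and Fatou's lemma carries the tail estimate over to the limit.\<close>

lemma riesz_fischer_aux:
  fixes x :: "int \<Rightarrow> complex"
  assumes "(\<lambda>k. (norm (x k))\<^sup>2) summable_on UNIV"
  obtains f a r where "f \<in> borel_measurable circ" "a \<longlonglongrightarrow> 0" "filterlim r at_top sequentially"
    "\<And>j::nat. (\<integral>\<^sup>+t. ennreal ((norm (f t - trig x {- int (r j)..int (r j)} t))\<^sup>2) \<partial>circ) \<le> ennreal (a j)"
proof -
  define A where "A = (\<Sum>\<^sub>\<infinity>k. (norm (x k))\<^sup>2)"
  define I where "I n = {- int n..int n}" for n :: nat
  define a where "a n = A - (\<Sum>k\<in>I n. (norm (x k))\<^sup>2)" for n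
  define S where "S n = trig x (I n)" for n
  have Im: "m \<le> n \<Longrightarrow> I m \<subseteq> I n" for m n by (auto simp: I_def)
  have fin: "finite (I n)" for n by (simp add: I_def)
  have a0: "a \<longlonglongrightarrow> 0"
    using has_sum_imp_symmetric_tendsto[OF has_sum_infsum[OF assms]]
    unfolding a_def I_def A_def[symmetric] by (auto intro!: tendsto_eq_intros)
  have le_A: "(\<Sum>k\<in>F. (norm (x k))\<^sup>2) \<le> A" if "finite F" for F
    unfolding A_def by (rule finite_sum_le_infsum[OF assms that]) auto
  have a_nonneg: "a n \<ge> 0" for n
    using le_A[OF fin] by (simp add: a_def)
  have Sdiff: "S m t - S n t = trig x (I m - I n) t" if "n \<le> m" for m n t
    unfolding S_def using Im[OF that] fin by (simp add: sum_diff)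
  have int_diff: "(LINT t|circ. (norm (S m t - S n t))\<^sup>2) \<le> a n" if "n \<le> m" for m n
  proof -
    have "(LINT t|circ. (norm (S m t - S n t))\<^sup>2) = (\<Sum>k\<in>I m - I n. (norm (x k))\<^sup>2)"
      unfolding Sdiff[OF that] by (rule integral_norm_trig) (simp add: fin)
    also have "\<dots> = (\<Sum>k\<in>I m. (norm (x k))\<^sup>2) - (\<Sum>k\<in>I n. (norm (x k))\<^sup>2)"
      by (intro sum_diff fin Im that)
    also have "\<dots> \<le> a n" using le_A[OF fin] by (simp add: a_def)
    finally show ?thesis .
  qed
  have S_Lp: "S n \<in> Lp 2" for n unfolding S_def by (rule Lp_2_trig)
  have S_meas [measurable]: "S n \<in> borel_measurable circ" for n using S_Lp by (rule Lp_2_measurable)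
  have Sd_int: "integrable circ (\<lambda>t. (norm (S m t - S n t))\<^sup>2)" for m n
    using Lp_2_diff[OF S_Lp S_Lp] by (simp add: Lp_2_iff)
  \<comment> \<open>The rate \<open>(1/4)^j\<close> for squared norms makes the L1 norms of
    successive differences at most \<open>(1/2)^j\<close>, which is summable.\<close>
  have "\<exists>N. \<forall>n\<ge>N. a n < (1/4)^j" for j :: nat
    using order_tendstoD(2)[OF a0, of "(1/4)^j"] by (simp add: eventually_sequentially)
  then obtain N where N: "\<And>j n. n \<ge> N j \<Longrightarrow> a n < (1/4)^j" by metis
  \<comment> \<open>The sum makes the indices monotone and at least \<open>N j\<close>; the summand
    \<open>j\<close> makes them tend to infinity.\<close>
  define r where "r j = j + (\<Sum>i\<le>j. N i)" for j
  have r: "r j \<le> r (Suc j)" "N j \<le> r j" "j \<le> r j" for j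
    by (auto simp: r_def intro: member_le_sum trans_le_add2)
  have r_mono: "i \<le> j \<Longrightarrow> r i \<le> r j" for i j
    by (rule lift_Suc_mono_le[of r, OF r(1)])
  have r_top: "filterlim r at_top sequentially"
    by (rule filterlim_at_top_mono[OF filterlim_ident]) (simp add: r(3))
  define d where "d j t = norm (S (r (Suc j)) t - S (r j) t)" for j t
  have d_meas [measurable]: "d j \<in> borel_measurable circ" for j unfolding d_def by measurable
  \<comment> \<open>The inequality between the means of \<open>(1/2)^j\<close> and
    \<open>2^j * (d j t)\<^sup>2\<close> replaces Cauchy-Schwarz.\<close>
  have d_bound: "(\<integral>\<^sup>+t. ennreal (d j t) \<partial>circ) \<le> ennreal ((1/2)^j)" for j
  proof -
    have i: "integrable circ (\<lambda>t. (d j t)\<^sup>2)" unfolding d_def by (rule Sd_int)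
    have "(\<integral>\<^sup>+t. ennreal (d j t) \<partial>circ) \<le> (\<integral>\<^sup>+t. ennreal (((1/2)^j + 2^j * (d j t)\<^sup>2) / 2) \<partial>circ)"
    proof (intro nn_integral_mono ennreal_leI)
      fix t
      have "0 \<le> ((1/2)^j - d j t)\<^sup>2 * 2^j" by simp
      also have "\<dots> = (1/2)^j - 2 * d j t + 2^j * (d j t)\<^sup>2"
        by (simp add: power2_eq_square algebra_simps power_divide)
      finally show "d j t \<le> ((1/2)^j + 2^j * (d j t)\<^sup>2) / 2" by simp
    qed
    also have "\<dots> = ennreal (LINT t|circ. ((1/2)^j + 2^j * (d j t)\<^sup>2) / 2)"
      using i by (intro nn_integral_eq_integral) auto
    also have "(LINT t|circ. ((1/2)^j + 2^j * (d j t)\<^sup>2) / 2) = ((1/2)^j + 2^j * (LINT t|circ. (d j t)\<^sup>2)) / 2"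
      using i circ.prob_space by simp
    also have "\<dots> \<le> ((1/2)^j + 2^j * (1/4)^j) / 2"
    proof -
      have "(LINT t|circ. (d j t)\<^sup>2) \<le> a (r j)"
        unfolding d_def by (rule int_diff[OF r(1)])
      also have "\<dots> \<le> (1/4)^j" using N[OF r(2)] by (rule less_imp_le)
      finally show ?thesis by simp
    qed
    also have "\<dots> = (1/2)^j" by (simp add: power_mult_distrib[symmetric])
    finally show ?thesis by (simp add: ennreal_leI)
  qed
  have "(\<integral>\<^sup>+t. (\<Sum>j. ennreal (d j t)) \<partial>circ) = (\<Sum>j. \<integral>\<^sup>+t. ennreal (d j t) \<partial>circ)"
    by (rule nn_integral_suminf) simp
  also have "\<dots> \<le> (\<Sum>j. ennreal ((1/2)^j))"
    by (intro suminf_le d_bound summableI)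
  also have "\<dots> = ennreal (\<Sum>j. (1/2)^j)"
    by (intro suminf_ennreal2) (auto intro: summable_geometric)
  finally have "(\<integral>\<^sup>+t. (\<Sum>j. ennreal (d j t)) \<partial>circ) \<noteq> \<infinity>"
    by (auto simp: top_unique)
  then have "AE t in circ. (\<Sum>j. ennreal (d j t)) \<noteq> \<infinity>"
    by (intro nn_integral_PInf_AE) auto
  then have conv: "AE t in circ. convergent (\<lambda>j. S (r j) t)"
  proof eventually_elim
    case (elim t)
    then have "summable (\<lambda>j. d j t)"
      by (intro summable_suminf_not_top) (auto simp: d_def)
    then have "summable (\<lambda>j. S (r (Suc j)) t - S (r j) t)"
      unfolding d_def by (rule summable_norm_cancel)
    then have "convergent (\<lambda>n. S (r n) t - S (r 0) t)"
      unfolding summable_iff_convergent sum_lessThan_telescope[of "\<lambda>j. S (r j) t"] .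
    then show ?case unfolding convergent_diff_const_right_iff .
  qed
  define f where "f t = lim (\<lambda>j. S (r j) t)" for t
  have f_meas: "f \<in> borel_measurable circ" unfolding f_def by measurable
  have f_lim: "AE t in circ. (\<lambda>j. S (r j) t) \<longlonglongrightarrow> f t"
    using conv unfolding f_def by eventually_elim (simp add: convergent_LIMSEQ_iff)
  have "(\<integral>\<^sup>+t. ennreal ((norm (f t - S (r j) t))\<^sup>2) \<partial>circ) \<le> ennreal (a (r j))" for j
  proof -
    have "(\<integral>\<^sup>+t. ennreal ((norm (f t - S (r j) t))\<^sup>2) \<partial>circ) =
        (\<integral>\<^sup>+t. liminf (\<lambda>i. ennreal ((norm (S (r i) t - S (r j) t))\<^sup>2)) \<partial>circ)"
    proof (rule nn_integral_cong_AE)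
      show "AE t in circ. ennreal ((norm (f t - S (r j) t))\<^sup>2) = liminf (\<lambda>i. ennreal ((norm (S (r i) t - S (r j) t))\<^sup>2))"
        using f_lim
      proof eventually_elim
        case (elim t)
        have "(\<lambda>i. ennreal ((norm (S (r i) t - S (r j) t))\<^sup>2)) \<longlonglongrightarrow> ennreal ((norm (f t - S (r j) t))\<^sup>2)"
          by (intro tendsto_intros elim)
        then show ?case by (intro lim_imp_Liminf[symmetric]) simp_all
      qed
    qed
    also have "\<dots> \<le> liminf (\<lambda>i. \<integral>\<^sup>+t. ennreal ((norm (S (r i) t - S (r j) t))\<^sup>2) \<partial>circ)"
      by (rule nn_integral_liminf) measurable
    also have "\<dots> \<le> ennreal (a (r j))"
    proof (rule Liminf_le)
      have "(\<integral>\<^sup>+t. ennreal ((norm (S (r i) t - S (r j) t))\<^sup>2) \<partial>circ) \<le> ennreal (a (r j))" if "i \<ge> j" for i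
        using int_diff[OF r_mono[OF that]]
        by (subst nn_integral_eq_integral[OF Sd_int]) (auto intro: ennreal_leI)
      then show "\<forall>\<^sub>F i in sequentially. (\<integral>\<^sup>+t. ennreal ((norm (S (r i) t - S (r j) t))\<^sup>2) \<partial>circ) \<le> ennreal (a (r j))"
        unfolding eventually_sequentially by blast
    qed simp
    finally show ?thesis .
  qed
  then show thesis
    using that[OF f_meas filterlim_compose[OF a0 r_top] r_top] by (simp add: S_def I_def)
qed

text \<open>The coefficients are identified by Bessel's inequality for \<open>f\<close> minus a
  partial sum, the squared norm by the Pythagorean identity
  \<open>integral_norm_diff_trig\<close>.\<close>

lemma riesz_fischer:
  fixes x :: "int \<Rightarrow> complex"
  assumes "(\<lambda>k. (norm (x k))\<^sup>2) summable_on UNIV"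
  obtains f where "f \<in> Lp 2" "fourier f = x"
    "((\<lambda>k. (norm (x k))\<^sup>2) has_sum (LINT t|circ. (norm (f t))\<^sup>2)) UNIV"
proof -
  obtain f a r where f: "f \<in> borel_measurable circ" and a: "a \<longlonglongrightarrow> 0"
    and r: "filterlim r at_top sequentially"
    and le: "\<And>j::nat. (\<integral>\<^sup>+t. ennreal ((norm (f t - trig x {- int (r j)..int (r j)} t))\<^sup>2) \<partial>circ) \<le> ennreal (a j)"
    using riesz_fischer_aux[OF assms] by blast
  define I where "I j = {- int (r j)..int (r j)}" for j
  define S where "S j = trig x (I j)" for j
  have S: "S j \<in> Lp 2" for j unfolding S_def by (rule Lp_2_trig)
  have D: "(\<lambda>t. f t - S j t) \<in> Lp 2" for j
    unfolding Lp_2_iff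
  proof
    show m: "(\<lambda>t. f t - S j t) \<in> borel_measurable circ"
      using f Lp_2_measurable[OF S] by auto
    show "integrable circ (\<lambda>t. (norm (f t - S j t))\<^sup>2)"
      using le[of j] m by (intro integrableI_bounded) (auto simp: S_def I_def less_top[symmetric] top_unique)
  qed
  have fL: "f \<in> Lp 2" using Lp_2_add[OF D[of 0] S[of 0]] by simp
  have D_le: "(LINT t|circ. (norm (f t - S j t))\<^sup>2) \<le> \<bar>a j\<bar>" for j
  proof -
    have "ennreal (LINT t|circ. (norm (f t - S j t))\<^sup>2) \<le> ennreal (a j)"
      using le[of j] D[of j]
      by (subst nn_integral_eq_integral[symmetric]) (auto simp: Lp_2_iff S_def I_def)
    then show ?thesis by (auto simp: ennreal_le_iff2)
  qed
  have D0: "(\<lambda>j. LINT t|circ. (norm (f t - S j t))\<^sup>2) \<longlonglongrightarrow> 0"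
    by (rule tendsto_sandwich[OF _ _ tendsto_const tendsto_rabs_zero[OF a]]) (auto simp: D_le)
  have fx: "fourier f k = x k" for k
  proof -
    have sq: "(norm (fourier f k - x k))\<^sup>2 \<le> (LINT t|circ. (norm (f t - S j t))\<^sup>2)" if "k \<in> I j" for j
    proof -
      have "fourier (\<lambda>t. f t - S j t) k = fourier f k - x k"
        using that by (simp add: fourier_diff integrable_Lp_2 fL S) (simp add: S_def fourier_trig I_def)
      then show ?thesis using bessel_inequality[OF D, of "{k}" j] by simp
    qed
    have "(norm (fourier f k - x k))\<^sup>2 \<le> 0"
    proof (rule tendsto_lowerbound[OF D0])
      have "\<forall>\<^sub>F j in sequentially. r j \<ge> nat \<bar>k\<bar>"
        using r by (simp add: filterlim_at_top)
      then show "\<forall>\<^sub>F j in sequentially. (norm (fourier f k - x k))\<^sup>2 \<le> (LINT t|circ. (norm (f t - S j t))\<^sup>2)"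
        by eventually_elim (rule sq, auto simp: I_def)
    qed simp
    then show ?thesis by simp
  qed
  have fx': "fourier f = x" using fx by blast
  define T where "T = (LINT t|circ. (norm (f t))\<^sup>2)"
  have "(\<lambda>j. T - (LINT t|circ. (norm (f t - S j t))\<^sup>2)) \<longlonglongrightarrow> T - 0"
    by (intro tendsto_intros D0)
  moreover have "T - (LINT t|circ. (norm (f t - S j t))\<^sup>2) = (\<Sum>k\<in>I j. (norm (x k))\<^sup>2)" for j
    using integral_norm_diff_trig[OF fL, of "I j"] unfolding fx' S_def T_def by (simp add: I_def)
  ultimately have "(\<lambda>j. \<Sum>k\<in>I j. (norm (x k))\<^sup>2) \<longlonglongrightarrow> T" by simp
  moreover have "(\<lambda>j. \<Sum>k\<in>I j. (norm (x k))\<^sup>2) \<longlonglongrightarrow> (\<Sum>\<^sub>\<infinity>k. (norm (x k))\<^sup>2)"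
    unfolding I_def using filterlim_compose[OF has_sum_imp_symmetric_tendsto[OF has_sum_infsum[OF assms]] r] .
  ultimately have "T = (\<Sum>\<^sub>\<infinity>k. (norm (x k))\<^sup>2)" by (rule LIMSEQ_unique)
  then show thesis using that[OF fL fx'] has_sum_infsum[OF assms] by (simp add: T_def)
qed

text \<open>Completeness of the characters is drawn from uniqueness: the function that Riesz-Fischer
  builds from the coefficients of \<open>f\<close> equals \<open>f\<close> almost
  everywhere.\<close>

theorem parseval_norm:
  assumes "f \<in> Lp 2"
  shows "((\<lambda>k. (norm (fourier f k))\<^sup>2) has_sum (LINT x|circ. (norm (f x))\<^sup>2)) UNIV"
proof -
  obtain g where g: "g \<in> Lp 2" "fourier g = fourier f"
    "((\<lambda>k. (norm (fourier f k))\<^sup>2) has_sum (LINT t|circ. (norm (g t))\<^sup>2)) UNIV"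
    using riesz_fischer[OF summable_fourier_Lp_2[OF assms]] .
  have "AE x in circ. g x = f x"
    by (rule fourier_inj_AE[OF integrable_Lp_2[OF g(1)] integrable_Lp_2[OF assms] g(2)])
  then have "(LINT t|circ. (norm (g t))\<^sup>2) = (LINT t|circ. (norm (f t))\<^sup>2)"
    using Lp_2_measurable[OF g(1)] Lp_2_measurable[OF assms] by (intro integral_cong_AE) auto
  with g(3) show ?thesis by simp
qed

text \<open>Polarisation: \<open>a * cnj b\<close> is a combination of four squared norms, so the
  identity for norms is applied to \<open>f + c * g\<close> with \<open>c\<close> running through
  the fourth roots of unity.\<close>

theorem parseval:
  assumes f: "f \<in> Lp 2" and g: "g \<in> Lp 2"
  shows "((\<lambda>k. fourier f k * cnj (fourier g k)) has_sum (LINT x|circ. f x * cnj (g x))) UNIV"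
proof -
  have pol: "a * cnj b = (complex_of_real ((norm (a + 1 * b))\<^sup>2) + (-1) * complex_of_real ((norm (a + (-1) * b))\<^sup>2)
     + \<i> * complex_of_real ((norm (a + \<i> * b))\<^sup>2) + (-\<i>) * complex_of_real ((norm (a + (-\<i>) * b))\<^sup>2)) / 4" for a b
    by (simp only: complex_norm_square) (simp add: algebra_simps)
  define N where "N c = (LINT x|circ. (norm (f x + c * g x))\<^sup>2)" for c
  have Lc: "(\<lambda>x. f x + c * g x) \<in> Lp 2" for c
    by (intro Lp_2_add Lp_2_cmult f g)
  have sN: "((\<lambda>k. complex_of_real ((norm (fourier f k + c * fourier g k))\<^sup>2)) has_sum complex_of_real (N c)) UNIV" for c
    using has_sum_of_real[OF parseval_norm[OF Lc[of c]], where 'a=complex] unfolding N_def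
    by (simp add: fourier_add fourier_cmult integrable_Lp_2 f g)
  have iN: "complex_of_real (N c) = (LINT x|circ. complex_of_real ((norm (f x + c * g x))\<^sup>2))" for c
    unfolding N_def by (rule integral_complex_of_real[symmetric])
  have ii: "integrable circ (\<lambda>x. complex_of_real ((norm (f x + c * g x))\<^sup>2))" for c
    using Lc[of c] by (auto simp: Lp_2_iff simp del: of_real_power)
  have "(LINT x|circ. f x * cnj (g x)) = (complex_of_real (N 1) + (-1) * complex_of_real (N (-1))
     + \<i> * complex_of_real (N \<i>) + (-\<i>) * complex_of_real (N (-\<i>))) / 4"
    unfolding pol iN
    by (simp only: Bochner_Integration.integral_add Bochner_Integration.integrable_add integrable_mult_right ii
        integral_mult_right_zero integral_divide_zero)
  then show ?thesis unfolding pol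
    by (auto simp only: divide_inverse intro!: has_sum_cmult_left has_sum_add has_sum_cmult_right sN)
qed

corollary parseval_bilinear:
  assumes f: "f \<in> Lp 2" and g: "g \<in> Lp 2"
  shows "((\<lambda>k. fourier f k * fourier g (- k)) has_sum (LINT x|circ. f x * g x)) UNIV"
  using parseval[OF f Lp_2_cnj[OF g]] fourier_cnj[of g] by simp

section \<open>Square-summable coefficient sequences and the functions that they represent\<close>

definition sq_summable :: "(int \<Rightarrow> complex) \<Rightarrow> bool" where
  "sq_summable u \<longleftrightarrow> (\<lambda>k. (norm (u k))\<^sup>2) summable_on UNIV"

lemma sq_summable_fourier: "f \<in> Lp 2 \<Longrightarrow> sq_summable (fourier f)"
  unfolding sq_summable_def by (rule summable_fourier_Lp_2)

lemma sq_summable_mono: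
  assumes "sq_summable w" "\<And>k. norm (u k) \<le> c * norm (w k)"
  shows "sq_summable u"
  unfolding sq_summable_def
proof (rule summable_on_comparison_test)
  show "(\<lambda>k. c\<^sup>2 * (norm (w k))\<^sup>2) summable_on UNIV"
    using assms(1) unfolding sq_summable_def by (rule summable_on_cmult_right)
  show "(norm (u k))\<^sup>2 \<le> c\<^sup>2 * (norm (w k))\<^sup>2" for k
    using power_mono[OF assms(2)[of k], of 2] by (simp add: power_mult_distrib)
qed simp

lemma sq_summable_finite: "finite F \<Longrightarrow> (\<And>k. k \<notin> F \<Longrightarrow> u k = 0) \<Longrightarrow> sq_summable u"
  unfolding sq_summable_def
  by (rule summable_on_cong_neutral[THEN iffD2, OF _ _ _ summable_on_finite[of F]]) auto

text \<open>The choice in \<open>fun_of\<close> promises no more than an integrable function;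
  uniqueness of coefficients identifies it almost everywhere with the square-integrable function
  from Riesz-Fischer.\<close>

lemma
  assumes "sq_summable u"
  shows fun_of_Lp_2: "fun_of u \<in> Lp 2" and fourier_fun_of: "fourier (fun_of u) = u"
proof -
  obtain f where f: "f \<in> Lp 2" "fourier f = u"
    using riesz_fischer[OF assms[unfolded sq_summable_def]] by metis
  have ex: "fun_of u \<in> Lp 1 \<and> fourier (fun_of u) = u"
    unfolding fun_of_def
    by (rule someI[of "\<lambda>f. f \<in> Lp 1 \<and> fourier f = u" f]) (use f integrable_Lp_2 in \<open>auto simp: Lp_1_iff\<close>)
  then show "fourier (fun_of u) = u" by blast
  have ae: "AE x in circ. fun_of u x = f x"
    using ex f(2) by (intro fourier_inj_AE integrable_Lp_2[OF f(1)]) (auto simp: Lp_1_iff)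
  have m: "fun_of u \<in> borel_measurable circ" using ex by (auto simp: Lp_1_iff)
  have "integrable circ (\<lambda>x. (norm (fun_of u x))\<^sup>2) \<longleftrightarrow> integrable circ (\<lambda>x. (norm (f x))\<^sup>2)"
    using ae m Lp_2_measurable[OF f(1)] by (intro integrable_cong_AE) auto
  then show "fun_of u \<in> Lp 2" using f m by (auto simp: Lp_2_iff)
qed

lemma real_fun_of_Lp_2: "sq_summable u \<Longrightarrow> real_fun_of u \<in> Lp 2"
  using Lp_2_Re[OF fun_of_Lp_2] unfolding real_fun_of_def[abs_def] .

lemma fourier_real_fun_of:
  assumes "sq_summable u"
  shows "fourier_real (real_fun_of u) k = (u k + cnj (u (- k))) / 2"
proof -
  have i: "integrable circ (fun_of u)" by (rule integrable_Lp_2[OF fun_of_Lp_2[OF assms]])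
  have "fourier_real (real_fun_of u) k = fourier (\<lambda>x. (1/2) * (fun_of u x + cnj (fun_of u x))) k"
    by (simp add: real_fun_of_def complex_add_cnj)
  also have "\<dots> = (1/2) * (fourier (fun_of u) k + fourier (\<lambda>x. cnj (fun_of u x)) k)"
    unfolding fourier_cmult
    by (subst fourier_add[OF i]) (use i in auto)
  also have "\<dots> = (u k + cnj (u (- k))) / 2"
    by (subst fourier_cnj) (simp add: fourier_fun_of[OF assms])
  finally show ?thesis .
qed

lemma fourier_real_fun_of_real:
  assumes "sq_summable u" "real_distr u"
  shows "fourier_real (real_fun_of u) = u"
  using assms(2) by (intro ext) (simp add: fourier_real_fun_of[OF assms(1)] real_distr_def)

lemma L2_inner_has_sum:
  assumes "f \<in> Lp 2" "g \<in> Lp 2"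
  shows "((\<lambda>k. fourier_real f k * cnj (fourier_real g k)) has_sum complex_of_real (L2_inner f g)) UNIV"
  using parseval[OF Lp_2_of_real[OF assms(1)] Lp_2_of_real[OF assms(2)]]
  by (simp add: L2_inner_def flip: of_real_mult)

lemma Lp_norm_2_has_sum:
  fixes f :: "real \<Rightarrow> real"
  assumes "f \<in> Lp 2"
  shows "((\<lambda>k. (norm (fourier_real f k))\<^sup>2) has_sum (Lp_norm 2 f)\<^sup>2) UNIV"
  using parseval_norm[OF Lp_2_of_real[OF assms]] by (simp add: Lp_norm_2_power2)

lemma Lp_norm_2_eq_infsum:
  fixes f :: "real \<Rightarrow> real"
  assumes "f \<in> Lp 2"
  shows "Lp_norm 2 f = sqrt (\<Sum>\<^sub>\<infinity>k. (norm (fourier_real f k))\<^sup>2)"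
  using infsumI[OF Lp_norm_2_has_sum[OF assms]] by (simp add: Lp_norm_nonneg)

section \<open>Fourier weights of the Sobolev spaces\<close>

definition bessel_wt :: "int \<Rightarrow> real" where
  "bessel_wt k = 1 + (2 * pi * of_int k)\<^sup>2"

lemma bessel_wt_ge_1: "bessel_wt k \<ge> 1"
  by (simp add: bessel_wt_def)

lemma bessel_wt_pos [simp]: "bessel_wt k > 0"
  using bessel_wt_ge_1[of k] by linarith

lemma bessel_wt_minus [simp]: "bessel_wt (- k) = bessel_wt k"
  by (simp add: bessel_wt_def)

lemma bessel_eq: "bessel t u k = complex_of_real (bessel_wt k powr (t / 2)) * u k"
  by (simp add: bessel_def bessel_wt_def)

lemma norm_bessel_power2: "(norm (bessel t u k))\<^sup>2 = bessel_wt k powr t * (norm (u k))\<^sup>2"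
proof -
  have "(bessel_wt k powr (t / 2))\<^sup>2 = bessel_wt k powr t"
    by (simp add: power2_eq_square powr_add[symmetric])
  then show ?thesis by (simp add: bessel_eq norm_mult power_mult_distrib)
qed

lemma H_iff: "u \<in> H t \<longleftrightarrow> sq_summable (bessel t u)"
  using fourier_fun_of fun_of_Lp_2 sq_summable_fourier unfolding Sob_def by fastforce

lemma H_iff_summable: "u \<in> H t \<longleftrightarrow> (\<lambda>k. bessel_wt k powr t * (norm (u k))\<^sup>2) summable_on UNIV"
  unfolding H_iff sq_summable_def norm_bessel_power2 ..

lemma H_mono: "s \<le> t \<Longrightarrow> u \<in> H t \<Longrightarrow> u \<in> H s"
  unfolding H_iff_summable
  by (erule summable_on_comparison_test) (auto intro!: mult_right_mono powr_mono bessel_wt_ge_1)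

lemma H_finite: "finite F \<Longrightarrow> (\<And>k. k \<notin> F \<Longrightarrow> u k = 0) \<Longrightarrow> u \<in> H t"
  unfolding H_iff by (rule sq_summable_finite[of F]) (auto simp: bessel_eq)

lemma real_distr_bessel: "real_distr u \<Longrightarrow> real_distr (bessel t u)"
  by (simp add: real_distr_def bessel_eq)

lemma Sob_norm_power2:
  assumes "u \<in> H t"
  shows "((\<lambda>k. bessel_wt k powr t * (norm (u k))\<^sup>2) has_sum (Sob_norm t 2 u)\<^sup>2) UNIV"
  using parseval_norm[OF fun_of_Lp_2[OF assms[unfolded H_iff]]]
  by (simp add: fourier_fun_of[OF assms[unfolded H_iff]] norm_bessel_power2 Sob_norm_def Lp_norm_2_power2)

lemma H_inner_has_sum:
  assumes "u \<in> H_real s" "w \<in> H_real s"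
  shows "((\<lambda>k. bessel_wt k powr s * Re (u k * cnj (w k))) has_sum H_inner s u w) UNIV"
proof -
  have u: "sq_summable (bessel s u)" "real_distr (bessel s u)"
    and w: "sq_summable (bessel s w)" "real_distr (bessel s w)"
    using assms by (auto simp: Sob_real_def H_iff real_distr_bessel)
  have eq: "bessel s u k * cnj (bessel s w k) = complex_of_real (bessel_wt k powr s) * (u k * cnj (w k))" for k
  proof -
    have "bessel_wt k powr (s/2) * bessel_wt k powr (s/2) = bessel_wt k powr s"
      by (simp add: powr_add[symmetric])
    then show ?thesis by (simp add: bessel_eq mult_ac flip: of_real_mult)
  qed
  have "((\<lambda>k. bessel s u k * cnj (bessel s w k)) has_sum complex_of_real (H_inner s u w)) UNIV"
    using L2_inner_has_sum[OF real_fun_of_Lp_2[OF u(1)] real_fun_of_Lp_2[OF w(1)]]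
    unfolding H_inner_def fourier_real_fun_of_real[OF u] fourier_real_fun_of_real[OF w] .
  then have "((\<lambda>k. Re (complex_of_real (bessel_wt k powr s) * (u k * cnj (w k)))) has_sum H_inner s u w) UNIV"
    unfolding eq by (auto dest: has_sum_Re)
  then show ?thesis by simp
qed

section \<open>Sub-Gaussian coefficients\<close>

text \<open>Completing the square: tilting a Gaussian density by \<open>exp (t * x)\<close> shifts
  its mean by \<open>\<sigma>\<^sup>2 * t\<close>, and the factor left over is constant.\<close>

lemma nn_integral_exp_normal:
  assumes "\<sigma> > 0"
  shows "(\<integral>\<^sup>+x. ennreal (exp (t * x)) \<partial>density lborel (normal_density m \<sigma>)) = ennreal (exp (m * t + \<sigma>\<^sup>2 * t\<^sup>2 / 2))"
proof -
  have eq: "normal_density m \<sigma> x * exp (t * x) =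
      exp (m * t + \<sigma>\<^sup>2 * t\<^sup>2 / 2) * normal_density (m + \<sigma>\<^sup>2 * t) \<sigma> x" for x
  proof -
    have "- (x - m)\<^sup>2 / (2 * \<sigma>\<^sup>2) + t * x = (m * t + \<sigma>\<^sup>2 * t\<^sup>2 / 2) - (x - (m + \<sigma>\<^sup>2 * t))\<^sup>2 / (2 * \<sigma>\<^sup>2)"
      using assms by (simp add: field_simps power2_eq_square)
    then have "exp (- (x - m)\<^sup>2 / (2 * \<sigma>\<^sup>2)) * exp (t * x) =
        exp (m * t + \<sigma>\<^sup>2 * t\<^sup>2 / 2) * exp (- (x - (m + \<sigma>\<^sup>2 * t))\<^sup>2 / (2 * \<sigma>\<^sup>2))"
      by (simp only: exp_add[symmetric]) simp
    then show ?thesis by (simp add: normal_density_def)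
  qed
  have one: "(\<integral>\<^sup>+x. ennreal (normal_density \<mu> \<sigma> x) \<partial>lborel) = 1" for \<mu>
    using prob_space.emeasure_space_1[OF prob_space_normal_density[OF assms, of \<mu>]]
    by (simp add: emeasure_density)
  have "(\<integral>\<^sup>+x. ennreal (exp (t * x)) \<partial>density lborel (normal_density m \<sigma>)) =
      (\<integral>\<^sup>+x. ennreal (normal_density m \<sigma> x * exp (t * x)) \<partial>lborel)"
    by (subst nn_integral_density) (auto simp: ennreal_mult)
  also have "\<dots> = ennreal (exp (m * t + \<sigma>\<^sup>2 * t\<^sup>2 / 2)) * (\<integral>\<^sup>+x. ennreal (normal_density (m + \<sigma>\<^sup>2 * t) \<sigma> x) \<partial>lborel)"
    unfolding eq by (subst nn_integral_cmult[symmetric]) (auto simp: ennreal_mult)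
  finally show ?thesis by (simp add: one)
qed

text \<open>A nonnegative integral is used so that finiteness is part of the bound. The parameter
  bounds a variance from above and may therefore be enlarged.\<close>

definition subgaussian :: "'a measure \<Rightarrow> ('a \<Rightarrow> real) \<Rightarrow> real \<Rightarrow> bool" where
  "subgaussian M X v \<longleftrightarrow> X \<in> borel_measurable M \<and>
     (\<forall>t. (\<integral>\<^sup>+\<omega>. ennreal (exp (t * X \<omega>)) \<partial>M) \<le> ennreal (exp (t\<^sup>2 * v / 2)))"

lemma subgaussian_mono: "subgaussian M X v \<Longrightarrow> v \<le> w \<Longrightarrow> subgaussian M X w"
  unfolding subgaussian_def
  by (meson order_trans ennreal_leI exp_le_cancel_iff divide_right_mono mult_left_mono zero_le_power2
      zero_le_numeral)

lemma subgaussian_cmult: "subgaussian M X v \<Longrightarrow> subgaussian M (\<lambda>\<omega>. c * X \<omega>) (c\<^sup>2 * v)"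
  unfolding subgaussian_def
proof (elim conjE, intro conjI allI)
  fix t assume *: "\<forall>t. (\<integral>\<^sup>+\<omega>. ennreal (exp (t * X \<omega>)) \<partial>M) \<le> ennreal (exp (t\<^sup>2 * v / 2))"
  show "(\<integral>\<^sup>+\<omega>. ennreal (exp (t * (c * X \<omega>))) \<partial>M) \<le> ennreal (exp (t\<^sup>2 * (c\<^sup>2 * v) / 2))"
    using *[rule_format, of "t * c"] by (simp add: power_mult_distrib mult_ac)
qed auto

text \<open>The degenerate case \<sigma> = 0 is a point mass. Settling it here lets later arguments
  work with the exponential moments alone.\<close>

lemma gaussian_rv_cases:
  assumes "prob_space M" "gaussian_rv M X"
  obtains m \<sigma> where "\<sigma> \<ge> 0" "\<And>t. (\<integral>\<^sup>+\<omega>. ennreal (exp (t * X \<omega>)) \<partial>M) = ennreal (exp (m * t + \<sigma>\<^sup>2 * t\<^sup>2 / 2))"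
    "(LINT \<omega>|M. X \<omega>) = m" "(LINT \<omega>|M. (X \<omega> - m)\<^sup>2) = \<sigma>\<^sup>2"
proof -
  interpret prob_space M by fact
  from assms(2) obtain m \<sigma> where X[measurable]: "X \<in> borel_measurable M" and s: "\<sigma> \<ge> 0"
    and d: "distr M borel X = (if \<sigma> = 0 then return borel m else density lborel (normal_density m \<sigma>))"
    unfolding gaussian_rv_def by blast
  have nn: "(\<integral>\<^sup>+\<omega>. ennreal (exp (t * X \<omega>)) \<partial>M) = (\<integral>\<^sup>+x. ennreal (exp (t * x)) \<partial>distr M borel X)" for t
    by (subst nn_integral_distr) auto
  have int: "(LINT \<omega>|M. g (X \<omega>)) = (LINT x|distr M borel X. g x)"
    if "g \<in> borel_measurable borel" for g :: "real \<Rightarrow> real"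
    using that by (subst integral_distr) auto
  show thesis
  proof (cases "\<sigma> = 0")
    case True
    show thesis
    proof (rule that[of 0 m])
      show "(\<integral>\<^sup>+\<omega>. ennreal (exp (t * X \<omega>)) \<partial>M) = ennreal (exp (m * t + 0\<^sup>2 * t\<^sup>2 / 2))" for t
        unfolding nn d using True by (simp add: nn_integral_return mult.commute)
      show "(LINT \<omega>|M. X \<omega>) = m"
        using int[of "\<lambda>x. x"] True by (simp add: d integral_return)
      show "(LINT \<omega>|M. (X \<omega> - m)\<^sup>2) = 0\<^sup>2"
        using int[of "\<lambda>x. (x - m)\<^sup>2"] True by (simp add: d integral_return)
    qed simp
  next
    case False
    then have s: "\<sigma> > 0" using s by simp
    have D: "distributed M lborel X (normal_density m \<sigma>)"
      unfolding distributed_def using d False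
      using distr_cong[OF refl sets_lborel refl, of M X] by auto
    show thesis
    proof (rule that[of \<sigma> m])
      show "(\<integral>\<^sup>+\<omega>. ennreal (exp (t * X \<omega>)) \<partial>M) = ennreal (exp (m * t + \<sigma>\<^sup>2 * t\<^sup>2 / 2))" for t
        unfolding nn d using False by (simp add: nn_integral_exp_normal[OF s])
      show m: "(LINT \<omega>|M. X \<omega>) = m"
        using normal_distributed_expectation[OF s D] .
      show "(LINT \<omega>|M. (X \<omega> - m)\<^sup>2) = \<sigma>\<^sup>2"
        using normal_distributed_variance[OF s D] m by simp
    qed (use s in simp)
  qed
qed

lemma gaussian_rv_subgaussian:
  assumes "prob_space M" "gaussian_rv M X" "(LINT \<omega>|M. X \<omega>) = 0" "(LINT \<omega>|M. X \<omega> * X \<omega>) = v"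
  shows "subgaussian M X v"
proof -
  obtain m \<sigma> where "\<And>t. (\<integral>\<^sup>+\<omega>. ennreal (exp (t * X \<omega>)) \<partial>M) = ennreal (exp (m * t + \<sigma>\<^sup>2 * t\<^sup>2 / 2))"
    "(LINT \<omega>|M. X \<omega>) = m" "(LINT \<omega>|M. (X \<omega> - m)\<^sup>2) = \<sigma>\<^sup>2"
    using gaussian_rv_cases[OF assms(1,2)] by metis
  then show ?thesis using assms
    by (auto simp: subgaussian_def gaussian_rv_def power2_eq_square mult_ac)
qed

text \<open>The square is dominated by \<open>2 * (exp x + exp (- x))\<close>, whose integral is
  finite by the formula for the exponential moments.\<close>

lemma gaussian_rv_integrable:
  assumes "prob_space M" "gaussian_rv M X"
  shows "integrable M (\<lambda>\<omega>. (X \<omega>)\<^sup>2)" "integrable M X"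
proof -
  interpret prob_space M by fact
  obtain m \<sigma> where e: "\<And>t. (\<integral>\<^sup>+\<omega>. ennreal (exp (t * X \<omega>)) \<partial>M) = ennreal (exp (m * t + \<sigma>\<^sup>2 * t\<^sup>2 / 2))"
    using gaussian_rv_cases[OF assms(1,2)] by metis
  have [measurable]: "X \<in> borel_measurable M" using assms(2) by (simp add: gaussian_rv_def)
  have E: "integrable M (\<lambda>\<omega>. exp (t * X \<omega>))" for t
    by (intro integrableI_bounded) (use e[of t] in auto)
  have q: "x\<^sup>2 \<le> 2 * (exp (1 * x) + exp ((-1) * x))" for x :: real
  proof -
    have "y\<^sup>2 \<le> 2 * exp y" if "y \<ge> 0" for y :: real
      using exp_lower_Taylor_quadratic[OF that] that by simp
    from this[of "\<bar>x\<bar>"] show ?thesis by (cases "x \<ge> 0") (auto simp: add_increasing add_increasing2)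
  qed
  show sq: "integrable M (\<lambda>\<omega>. (X \<omega>)\<^sup>2)"
  proof (rule Bochner_Integration.integrable_bound)
    show "integrable M (\<lambda>\<omega>. 2 * (exp (1 * X \<omega>) + exp ((-1) * X \<omega>)))"
      by (intro integrable_mult_right Bochner_Integration.integrable_add E)
    show "AE \<omega> in M. norm ((X \<omega>)\<^sup>2) \<le> norm (2 * (exp (1 * X \<omega>) + exp ((-1) * X \<omega>)))"
      using q by (intro AE_I2) (simp add: abs_of_pos add_pos_pos)
  qed simp
  show "integrable M X" using square_integrable_imp_integrable[OF _ sq] by simp
qed

text \<open>As a power series in \<open>y\<close> the function is the sum of the terms
  \<open>b ^ (2 * n) * y ^ n / fact (2 * n)\<close>, each of which is convex for
  \<open>y \<ge> 0\<close>.\<close>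

lemma convex_on_cosh_sqrt: "convex_on {0..} (\<lambda>y. cosh (b * sqrt y))"
proof (rule convex_onI)
  have S: "(\<lambda>n. if even n then b ^ n * y ^ (n div 2) /\<^sub>R fact n else 0) sums cosh (b * sqrt y)" if "y \<ge> 0" for y
  proof -
    have "(b * sqrt y) ^ n = b ^ n * y ^ (n div 2)" if "even n" for n
      using that \<open>y \<ge> 0\<close> by (auto elim!: evenE simp: power_mult_distrib power_mult)
    then show ?thesis using cosh_converges[of "b * sqrt y"] by (simp cong: if_cong)
  qed
  have pc: "convex_on {0..} (\<lambda>y::real. y ^ n)" for n
    using convex_power_even[of n] convex_power_odd[of n] by (cases "even n") (auto intro: convex_on_subset)
  fix t x y :: real assume t: "0 < t" "t < 1" and xy: "x \<in> {0..}" "y \<in> {0..}"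
  have z: "(1 - t) * x + t * y \<ge> 0" using t xy by auto
  have "cosh (b * sqrt ((1 - t) * x + t * y)) \<le> (1 - t) * cosh (b * sqrt x) + t * cosh (b * sqrt y)"
  proof (rule sums_le[OF _ S[OF z] sums_add[OF sums_mult[OF S] sums_mult[OF S]]])
    fix n
    have "b ^ n * ((1 - t) * x + t * y) ^ (n div 2) /\<^sub>R fact n \<le>
      b ^ n * ((1 - t) * x ^ (n div 2) + t * y ^ (n div 2)) /\<^sub>R fact n" if "even n"
      using convex_onD[OF pc, of t x y "n div 2"] t xy that
      by (intro scaleR_left_mono mult_left_mono) auto
    then show "(if even n then b ^ n * ((1 - t) * x + t * y) ^ (n div 2) /\<^sub>R fact n else 0) \<le>
      (1 - t) * (if even n then b ^ n * x ^ (n div 2) /\<^sub>R fact n else 0) +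
      t * (if even n then b ^ n * y ^ (n div 2) /\<^sub>R fact n else 0)"
      by (auto simp: algebra_simps)
  qed (use xy in auto)
  then show "cosh (b * sqrt ((1 - t) *\<^sub>R x + t *\<^sub>R y)) \<le> (1 - t) * cosh (b * sqrt x) + t * cosh (b * sqrt y)"
    by simp
qed simp

text \<open>Jensen's inequality. The mass missing from the total 1 is placed at the point 0, under
  the index \<open>None\<close>, where the hyperbolic cosine equals 1.\<close>

lemma cosh_sqrt_weighted_sum_le:
  assumes "finite F" "\<And>k. k \<in> F \<Longrightarrow> p k \<ge> 0" "(\<Sum>k\<in>F. p k) \<le> 1" "\<And>k. k \<in> F \<Longrightarrow> y k \<ge> 0"
  shows "cosh (b * sqrt (\<Sum>k\<in>F. p k * y k)) \<le> (\<Sum>k\<in>F. p k * cosh (b * sqrt (y k))) + (1 - (\<Sum>k\<in>F. p k))"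
proof -
  define S where "S = insert None (Some ` F)"
  define P where "P i = (case i of None \<Rightarrow> 1 - (\<Sum>k\<in>F. p k) | Some k \<Rightarrow> p k)" for i
  define Y where "Y i = (case i of None \<Rightarrow> 0 | Some k \<Rightarrow> y k)" for i
  have sum: "(\<Sum>i\<in>S. h i) = h None + (\<Sum>k\<in>F. h (Some k))" for h :: "_ \<Rightarrow> real"
    unfolding S_def using assms(1) by (simp add: sum.reindex)
  have "cosh (b * sqrt (\<Sum>i\<in>S. P i *\<^sub>R Y i)) \<le> (\<Sum>i\<in>S. P i * cosh (b * sqrt (Y i)))"
    by (rule convex_on_sum[OF _ _ convex_on_cosh_sqrt])
      (use assms in \<open>auto simp: sum, auto simp: S_def P_def Y_def\<close>)
  then show ?thesis by (simp add: sum) (simp add: P_def Y_def)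
qed

lemma measurable_cosh [measurable]: "(cosh :: real \<Rightarrow> real) \<in> borel_measurable borel"
  by (intro borel_measurable_continuous_onI continuous_intros)

lemma nn_integral_cosh_subgaussian:
  assumes "subgaussian M X v" "v \<le> w"
  shows "(\<integral>\<^sup>+\<omega>. ennreal (cosh (X \<omega>)) \<partial>M) \<le> ennreal (exp (w / 2))"
proof -
  have [measurable]: "X \<in> borel_measurable M" using assms by (simp add: subgaussian_def)
  have s: "(\<integral>\<^sup>+\<omega>. ennreal (exp (t * X \<omega>)) \<partial>M) \<le> ennreal (exp (t\<^sup>2 * w / 2))" for t
    using subgaussian_mono[OF assms] by (simp add: subgaussian_def)
  define c :: real where "c = 1 / 2"
  have c: "c \<ge> 0" "cosh y = c * exp (1 * y) + c * exp ((-1) * y)" "c * z + c * z = z" for y z :: real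
    by (simp_all add: c_def cosh_def field_simps)
  have "(\<integral>\<^sup>+\<omega>. ennreal (cosh (X \<omega>)) \<partial>M) = (\<integral>\<^sup>+\<omega>. ennreal c * ennreal (exp (1 * X \<omega>)) + ennreal c * ennreal (exp ((-1) * X \<omega>)) \<partial>M)"
    unfolding c(2) using c(1) by (intro nn_integral_cong) (simp add: ennreal_mult ennreal_plus)
  also have "\<dots> = ennreal c * (\<integral>\<^sup>+\<omega>. ennreal (exp (1 * X \<omega>)) \<partial>M) + ennreal c * (\<integral>\<^sup>+\<omega>. ennreal (exp ((-1) * X \<omega>)) \<partial>M)"
    by (subst nn_integral_add) (auto simp: nn_integral_cmult)
  also have "\<dots> \<le> ennreal c * ennreal (exp (w / 2)) + ennreal c * ennreal (exp (w / 2))"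
    using s[of 1] s[of "-1"] by (intro add_mono mult_left_mono) auto
  also have "\<dots> = ennreal (exp (w / 2))"
    using c(1) by (simp only: ennreal_mult[symmetric] ennreal_plus[symmetric] c(3) exp_ge_zero mult_nonneg_nonneg)
  finally show ?thesis .
qed

text \<open>
  Only the marginals of the coefficients enter: \<open>exp (b * r)\<close> is dominated by \<open>2 * cosh (b * r)\<close>,
  and \<open>cosh (b * sqrt y)\<close> is convex in \<open>y\<close>, so that Jensen's inequality with weights proportional
  to the variances separates the coefficients.
\<close>

lemma nn_integral_exp_l2_norm_finite:
  fixes X :: "int \<Rightarrow> 'a \<Rightarrow> complex"
  assumes M: "prob_space M" and pos: "\<And>k. \<nu> k > 0" and sum: "\<nu> summable_on UNIV"
    and X: "\<And>k. subgaussian M (\<lambda>\<omega>. Re (X k \<omega>)) (\<nu> k)" "\<And>k. subgaussian M (\<lambda>\<omega>. Im (X k \<omega>)) (\<nu> k)"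
    and F: "finite F"
  shows "(\<integral>\<^sup>+\<omega>. ennreal (exp (b * sqrt (\<Sum>k\<in>F. (norm (X k \<omega>))\<^sup>2))) \<partial>M) \<le> ennreal (2 * exp (b\<^sup>2 * infsum \<nu> UNIV))"
proof -
  interpret prob_space M by fact
  define L where "L = infsum \<nu> UNIV"
  have "\<nu> 0 \<le> L"
    unfolding L_def using finite_sum_le_infsum[OF sum, of "{0}"] pos by (simp add: less_imp_le)
  then have L: "L > 0" using pos[of 0] by linarith
  define p where "p k = \<nu> k / L" for k
  have p: "p k > 0" for k using pos L by (simp add: p_def)
  have p1: "(\<Sum>k\<in>F. p k) \<le> 1"
    unfolding p_def sum_divide_distrib[symmetric] using L finite_sum_le_infsum[OF sum F] pos
    by (simp add: L_def less_imp_le)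
  \<comment> \<open>With this scaling the real part becomes sub-Gaussian with parameter
    \<open>2 * L\<close> whatever \<open>k\<close> is, and the squared norm of
    \<open>X k \<omega>\<close> is \<open>p k\<close> times a mean of two squares.\<close>
  define u where "u k \<omega> = sqrt (2 / p k) * Re (X k \<omega>)" for k \<omega>
  define v where "v k \<omega> = sqrt (2 / p k) * Im (X k \<omega>)" for k \<omega>
  have uv: "p k * (((u k \<omega>)\<^sup>2 + (v k \<omega>)\<^sup>2) / 2) = (norm (X k \<omega>))\<^sup>2" for k \<omega>
    using p[of k] by (simp add: u_def v_def power_mult_distrib cmod_power2 field_simps)
  \<comment> \<open>Convexity once more, with weight 1/2, to separate the real from the imaginary
    part.\<close>
  have cosh_uv: "cosh (b * sqrt ((c\<^sup>2 + d\<^sup>2) / 2)) \<le> (cosh (b * c) + cosh (b * d)) / 2" for c d :: real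
  proof -
    have "cosh (b * sqrt ((1 - 1/2) *\<^sub>R c\<^sup>2 + (1/2) *\<^sub>R d\<^sup>2)) \<le>
        (1 - 1/2) * cosh (b * sqrt (c\<^sup>2)) + (1/2) * cosh (b * sqrt (d\<^sup>2))"
      by (intro convex_onD[OF convex_on_cosh_sqrt]) auto
    moreover have "cosh (b * \<bar>x\<bar>) = cosh (b * x)" for x
      by (cases "x \<ge> 0") (auto simp: abs_if)
    ultimately show ?thesis by (simp add: field_simps)
  qed
  have mu[measurable]: "u k \<in> borel_measurable M" "v k \<in> borel_measurable M" for k
    using X[of k] unfolding u_def v_def subgaussian_def by auto
  have Ecosh: "(\<integral>\<^sup>+\<omega>. ennreal (cosh (b * u k \<omega>)) \<partial>M) \<le> ennreal (exp (b\<^sup>2 * L))"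
    "(\<integral>\<^sup>+\<omega>. ennreal (cosh (b * v k \<omega>)) \<partial>M) \<le> ennreal (exp (b\<^sup>2 * L))" for k
  proof -
    have "(b * sqrt (2 / p k))\<^sup>2 * \<nu> k = 2 * (b\<^sup>2 * L)"
      using p[of k] L pos[of k] by (simp add: power_mult_distrib p_def)
    then have le: "(b * sqrt (2 / p k))\<^sup>2 * \<nu> k \<le> 2 * (b\<^sup>2 * L)" by simp
    show "(\<integral>\<^sup>+\<omega>. ennreal (cosh (b * u k \<omega>)) \<partial>M) \<le> ennreal (exp (b\<^sup>2 * L))"
      using nn_integral_cosh_subgaussian[OF subgaussian_cmult[OF X(1)[of k], of "b * sqrt (2 / p k)"] le]
      by (simp add: u_def mult_ac)
    show "(\<integral>\<^sup>+\<omega>. ennreal (cosh (b * v k \<omega>)) \<partial>M) \<le> ennreal (exp (b\<^sup>2 * L))"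
      using nn_integral_cosh_subgaussian[OF subgaussian_cmult[OF X(2)[of k], of "b * sqrt (2 / p k)"] le]
      by (simp add: v_def mult_ac)
  qed
  define q where "q = 1 - (\<Sum>k\<in>F. p k)"
  have q: "q \<ge> 0" using p1 by (simp add: q_def)
  have "exp (b * sqrt (\<Sum>k\<in>F. (norm (X k \<omega>))\<^sup>2)) \<le>
     (\<Sum>k\<in>F. p k * cosh (b * u k \<omega>) + p k * cosh (b * v k \<omega>)) + 2 * q" for \<omega>
  proof -
    let ?r = "sqrt (\<Sum>k\<in>F. (norm (X k \<omega>))\<^sup>2)"
    have "exp (b * ?r) \<le> 2 * cosh (b * ?r)" by (simp add: cosh_def)
    also have "cosh (b * ?r) = cosh (b * sqrt (\<Sum>k\<in>F. p k * (((u k \<omega>)\<^sup>2 + (v k \<omega>)\<^sup>2) / 2)))"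
      by (simp only: uv)
    also have "\<dots> \<le> (\<Sum>k\<in>F. p k * cosh (b * sqrt (((u k \<omega>)\<^sup>2 + (v k \<omega>)\<^sup>2) / 2))) + q"
      unfolding q_def by (rule cosh_sqrt_weighted_sum_le[OF F _ p1]) (auto simp: p less_imp_le)
    also have "\<dots> \<le> (\<Sum>k\<in>F. p k * ((cosh (b * u k \<omega>) + cosh (b * v k \<omega>)) / 2)) + q"
      by (intro add_right_mono sum_mono mult_left_mono cosh_uv) (simp add: p less_imp_le)
    also have "(\<Sum>k\<in>F. p k * ((cosh (b * u k \<omega>) + cosh (b * v k \<omega>)) / 2)) =
        (\<Sum>k\<in>F. p k * cosh (b * u k \<omega>) + p k * cosh (b * v k \<omega>)) / 2"
      by (simp add: sum_divide_distrib distrib_left)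
    finally show ?thesis by (simp add: field_simps)
  qed
  then have "(\<integral>\<^sup>+\<omega>. ennreal (exp (b * sqrt (\<Sum>k\<in>F. (norm (X k \<omega>))\<^sup>2))) \<partial>M) \<le>
    (\<integral>\<^sup>+\<omega>. ennreal ((\<Sum>k\<in>F. p k * cosh (b * u k \<omega>) + p k * cosh (b * v k \<omega>)) + 2 * q) \<partial>M)"
    by (intro nn_integral_mono ennreal_leI)
  also have "\<dots> = (\<integral>\<^sup>+\<omega>. (\<Sum>k\<in>F. ennreal (p k) * ennreal (cosh (b * u k \<omega>)) + ennreal (p k) * ennreal (cosh (b * v k \<omega>))) + ennreal (2 * q) \<partial>M)"
    using p q by (intro nn_integral_cong)
      (simp add: ennreal_mult[symmetric] ennreal_plus[symmetric] sum_ennreal less_imp_le cosh_real_nonneg sum_nonneg del: ennreal_plus)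
  also have "\<dots> = (\<Sum>k\<in>F. ennreal (p k) * (\<integral>\<^sup>+\<omega>. ennreal (cosh (b * u k \<omega>)) \<partial>M) + ennreal (p k) * (\<integral>\<^sup>+\<omega>. ennreal (cosh (b * v k \<omega>)) \<partial>M)) + ennreal (2 * q)"
    by (simp add: nn_integral_add nn_integral_sum nn_integral_cmult emeasure_space_1)
  also have "\<dots> \<le> (\<Sum>k\<in>F. ennreal (p k) * ennreal (exp (b\<^sup>2 * L)) + ennreal (p k) * ennreal (exp (b\<^sup>2 * L))) + ennreal (2 * q)"
    by (intro add_right_mono sum_mono add_mono mult_left_mono Ecosh) auto
  also have "\<dots> = ennreal ((\<Sum>k\<in>F. p k * exp (b\<^sup>2 * L) + p k * exp (b\<^sup>2 * L)) + 2 * q)"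
    using p q by (simp add: ennreal_mult[symmetric] ennreal_plus[symmetric] sum_ennreal less_imp_le sum_nonneg del: ennreal_plus)
  also have "\<dots> \<le> ennreal (2 * exp (b\<^sup>2 * L))"
  proof (rule ennreal_leI)
    have "q * 1 \<le> q * exp (b\<^sup>2 * L)" using q L by (intro mult_left_mono) auto
    then show "(\<Sum>k\<in>F. p k * exp (b\<^sup>2 * L) + p k * exp (b\<^sup>2 * L)) + 2 * q \<le> 2 * exp (b\<^sup>2 * L)"
      by (simp add: q_def sum.distrib sum_distrib_right[symmetric] algebra_simps)
  qed
  finally show ?thesis by (simp add: L_def)
qed

lemma sq_summable_symmetric_tendsto:
  assumes "sq_summable x"
  shows "(\<lambda>n. \<Sum>k\<in>{- int n..int n}. (norm (x k))\<^sup>2) \<longlonglongrightarrow> (\<Sum>\<^sub>\<infinity>k. (norm (x k))\<^sup>2)"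
  using has_sum_imp_symmetric_tendsto[OF has_sum_infsum[OF assms[unfolded sq_summable_def]]] .

lemma borel_measurable_infsum_norm:
  fixes X :: "int \<Rightarrow> 'a \<Rightarrow> complex"
  assumes "\<And>k. X k \<in> borel_measurable M" "\<And>\<omega>. \<omega> \<in> space M \<Longrightarrow> sq_summable (\<lambda>k. X k \<omega>)"
  shows "(\<lambda>\<omega>. \<Sum>\<^sub>\<infinity>k. (norm (X k \<omega>))\<^sup>2) \<in> borel_measurable M"
proof (rule borel_measurable_LIMSEQ_real)
  show "(\<lambda>n. \<Sum>k\<in>{- int n..int n}. (norm (X k \<omega>))\<^sup>2) \<longlonglongrightarrow> (\<Sum>\<^sub>\<infinity>k. (norm (X k \<omega>))\<^sup>2)"
    if "\<omega> \<in> space M" for \<omega>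
    by (rule sq_summable_symmetric_tendsto[OF assms(2)[OF that]])
qed (use assms in measurable)

text \<open>Fatou's lemma along symmetric intervals; the finite bound involves only the total of
  \<open>\<nu>\<close>, so it passes to the limit unchanged.\<close>

lemma nn_integral_exp_l2_norm:
  fixes X :: "int \<Rightarrow> 'a \<Rightarrow> complex"
  assumes M: "prob_space M" and pos: "\<And>k. \<nu> k > 0" and sum: "\<nu> summable_on UNIV"
    and X: "\<And>k. subgaussian M (\<lambda>\<omega>. Re (X k \<omega>)) (\<nu> k)" "\<And>k. subgaussian M (\<lambda>\<omega>. Im (X k \<omega>)) (\<nu> k)"
    and S: "\<And>\<omega>. \<omega> \<in> space M \<Longrightarrow> sq_summable (\<lambda>k. X k \<omega>)"
  shows "(\<integral>\<^sup>+\<omega>. ennreal (exp (b * sqrt (\<Sum>\<^sub>\<infinity>k. (norm (X k \<omega>))\<^sup>2))) \<partial>M) \<le> ennreal (2 * exp (b\<^sup>2 * infsum \<nu> UNIV))"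
proof -
  let ?g = "\<lambda>n \<omega>. ennreal (exp (b * sqrt (\<Sum>k\<in>{- int n..int n}. (norm (X k \<omega>))\<^sup>2)))"
  have [measurable]: "X k \<in> borel_measurable M" for k
    using X[of k] by (simp add: subgaussian_def borel_measurable_complex_iff)
  have "(\<integral>\<^sup>+\<omega>. ennreal (exp (b * sqrt (\<Sum>\<^sub>\<infinity>k. (norm (X k \<omega>))\<^sup>2))) \<partial>M) = (\<integral>\<^sup>+\<omega>. liminf (\<lambda>n. ?g n \<omega>) \<partial>M)"
  proof (rule nn_integral_cong)
    fix \<omega> assume "\<omega> \<in> space M"
    have "(\<lambda>n. ?g n \<omega>) \<longlonglongrightarrow> ennreal (exp (b * sqrt (\<Sum>\<^sub>\<infinity>k. (norm (X k \<omega>))\<^sup>2)))"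
      by (intro tendsto_intros sq_summable_symmetric_tendsto S \<open>\<omega> \<in> space M\<close>)
    then show "ennreal (exp (b * sqrt (\<Sum>\<^sub>\<infinity>k. (norm (X k \<omega>))\<^sup>2))) = liminf (\<lambda>n. ?g n \<omega>)"
      by (intro lim_imp_Liminf[symmetric]) simp_all
  qed
  also have "\<dots> \<le> liminf (\<lambda>n. \<integral>\<^sup>+\<omega>. ?g n \<omega> \<partial>M)"
    by (rule nn_integral_liminf) measurable
  also have "\<dots> \<le> ennreal (2 * exp (b\<^sup>2 * infsum \<nu> UNIV))"
    by (intro Liminf_le always_eventually allI nn_integral_exp_l2_norm_finite[OF M pos sum X]) auto
  finally show ?thesis .
qed

section \<open>The discrete prior\<close>

lemma std_normal_nn_integral_exp:
  assumes "prob_space M" "distributed M lborel X std_normal_density"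
  shows "(\<integral>\<^sup>+\<omega>. ennreal (exp (t * X \<omega>)) \<partial>M) = ennreal (exp (t\<^sup>2 / 2))"
proof -
  interpret prob_space M by fact
  have [measurable]: "X \<in> borel_measurable M"
    using distributed_measurable[OF assms(2)] by simp
  have "(\<integral>\<^sup>+\<omega>. ennreal (exp (t * X \<omega>)) \<partial>M) = (\<integral>\<^sup>+x. ennreal (exp (t * x)) \<partial>distr M lborel X)"
    by (subst nn_integral_distr) auto
  also have "distr M lborel X = density lborel std_normal_density"
    by (rule distributed_distr_eq_density[OF assms(2)])
  finally show ?thesis by (simp add: nn_integral_exp_normal)
qed

text \<open>Independence of the variables \<open>X j\<close> factorises the exponential of the sum
  into exact Gaussian moments.\<close>

lemma subgaussian_indep_normal_sum:
  assumes M: "prob_space M" and J: "finite J"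
    and ind: "prob_space.indep_vars M (\<lambda>_. borel) X J"
    and X: "\<And>j. j \<in> J \<Longrightarrow> distributed M lborel (X j) std_normal_density"
  shows "subgaussian M (\<lambda>\<omega>. \<Sum>j\<in>J. X j \<omega> * c j) (\<Sum>j\<in>J. (c j)\<^sup>2)"
proof -
  interpret prob_space M by fact
  have m[measurable]: "X j \<in> borel_measurable M" if "j \<in> J" for j
    using distributed_measurable[OF X[OF that]] by simp
  have "(\<integral>\<^sup>+\<omega>. ennreal (exp (t * (\<Sum>j\<in>J. X j \<omega> * c j))) \<partial>M) = ennreal (exp (t\<^sup>2 * (\<Sum>j\<in>J. (c j)\<^sup>2) / 2))" for t
  proof -
    have i: "indep_vars (\<lambda>_. borel) (\<lambda>j \<omega>. ennreal (exp (t * c j * X j \<omega>))) J"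
      using ind by (rule indep_vars_compose2) measurable
    have "(\<integral>\<^sup>+\<omega>. ennreal (exp (t * (\<Sum>j\<in>J. X j \<omega> * c j))) \<partial>M) = (\<integral>\<^sup>+\<omega>. (\<Prod>j\<in>J. ennreal (exp (t * c j * X j \<omega>))) \<partial>M)"
      using J by (simp add: prod_ennreal exp_sum[symmetric] sum_distrib_left mult_ac)
    also have "\<dots> = (\<Prod>j\<in>J. \<integral>\<^sup>+\<omega>. ennreal (exp (t * c j * X j \<omega>)) \<partial>M)"
      by (rule indep_vars_nn_integral[OF J i]) simp
    also have "\<dots> = (\<Prod>j\<in>J. ennreal (exp ((t * c j)\<^sup>2 / 2)))"
      by (intro prod.cong refl std_normal_nn_integral_exp[OF M X])
    also have "\<dots> = ennreal (exp (t\<^sup>2 * (\<Sum>j\<in>J. (c j)\<^sup>2) / 2))"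
      using J by (simp add: prod_ennreal exp_sum[symmetric] sum_distrib_left power_mult_distrib sum_divide_distrib)
    finally show ?thesis .
  qed
  then show ?thesis by (auto simp: subgaussian_def)
qed

text \<open>The variance is found by expanding the square into products of components; these are
  integrable because the components are Gaussian themselves.\<close>

lemma subgaussian_gaussian_vec:
  assumes M: "prob_space M" and X: "gaussian_vec_id M N X" and a: "a \<in> carrier_vec N"
  shows "subgaussian M (\<lambda>\<omega>. a \<bullet> X \<omega>) (a \<bullet> a)"
proof -
  have g: "gaussian_rv M (\<lambda>\<omega>. a \<bullet> X \<omega>)" if "a \<in> carrier_vec N" for a
    using X that by (simp add: gaussian_vec_id_def)
  have dim: "dim_vec (X \<omega>) = N" if "\<omega> \<in> space M" for \<omega>
    using X that by (auto simp: gaussian_vec_id_def)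
  have g1: "gaussian_rv M (\<lambda>\<omega>. X \<omega> $ j)" if "j < N" for j
  proof -
    have "unit_vec N j \<bullet> X \<omega> = X \<omega> $ j" if "\<omega> \<in> space M" for \<omega>
      using dim[OF that] \<open>j < N\<close> by (intro scalar_prod_left_unit) auto
    then show ?thesis using g[of "unit_vec N j"]
      unfolding gaussian_rv_def
      by (simp cong: measurable_cong distr_cong)
  qed
  have i1: "integrable M (\<lambda>\<omega>. X \<omega> $ j)" if "j < N" for j
    by (rule gaussian_rv_integrable[OF M g1[OF that]])
  have i2: "integrable M (\<lambda>\<omega>. X \<omega> $ j * X \<omega> $ k)" if "j < N" "k < N" for j k
  proof (rule Bochner_Integration.integrable_bound)
    show "integrable M (\<lambda>\<omega>. (X \<omega> $ j)\<^sup>2 + (X \<omega> $ k)\<^sup>2)"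
      by (intro Bochner_Integration.integrable_add gaussian_rv_integrable[OF M g1] that)
    show "(\<lambda>\<omega>. X \<omega> $ j * X \<omega> $ k) \<in> borel_measurable M"
      using i1[OF that(1)] i1[OF that(2)] by simp
    have "\<bar>x * y\<bar> \<le> x\<^sup>2 + y\<^sup>2" for x y :: real
      using sum_squares_bound[of "\<bar>x\<bar>" "\<bar>y\<bar>"] zero_le_power2[of x] zero_le_power2[of y]
      by (simp only: abs_mult power2_abs)
    then show "AE \<omega> in M. norm (X \<omega> $ j * X \<omega> $ k) \<le> norm ((X \<omega> $ j)\<^sup>2 + (X \<omega> $ k)\<^sup>2)"
      by (intro AE_I2) simp
  qed
  have e: "a \<bullet> X \<omega> = (\<Sum>j<N. a $ j * X \<omega> $ j)" if "\<omega> \<in> space M" for \<omega>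
    using dim[OF that] by (simp add: scalar_prod_def atLeast0LessThan)
  have "(LINT \<omega>|M. a \<bullet> X \<omega>) = (LINT \<omega>|M. (\<Sum>j<N. a $ j * X \<omega> $ j))"
    by (intro Bochner_Integration.integral_cong refl e)
  also have "\<dots> = (\<Sum>j<N. a $ j * (LINT \<omega>|M. X \<omega> $ j))"
    using i1 by (subst Bochner_Integration.integral_sum) auto
  also have "\<dots> = 0" using X by (simp add: gaussian_vec_id_def)
  finally have mean: "(LINT \<omega>|M. a \<bullet> X \<omega>) = 0" .
  have "(LINT \<omega>|M. (a \<bullet> X \<omega>) * (a \<bullet> X \<omega>)) = (LINT \<omega>|M. (\<Sum>j<N. \<Sum>k<N. a $ j * a $ k * (X \<omega> $ j * X \<omega> $ k)))"
    by (intro Bochner_Integration.integral_cong refl) (simp add: e sum_product mult_ac)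
  also have "\<dots> = (\<Sum>j<N. \<Sum>k<N. a $ j * a $ k * (LINT \<omega>|M. X \<omega> $ j * X \<omega> $ k))"
    using i2 by (subst Bochner_Integration.integral_sum; auto intro!: Bochner_Integration.integrable_sum sum.cong)
  also have "\<dots> = (\<Sum>j<N. \<Sum>k<N. if k = j then a $ j * a $ k else 0)"
    using X by (intro sum.cong refl) (auto simp: gaussian_vec_id_def)
  also have "\<dots> = a \<bullet> a" using a by (simp add: scalar_prod_def atLeast0LessThan)
  finally show ?thesis by (rule gaussian_rv_subgaussian[OF M g[OF a] mean])
qed

lemma infsum_ge_term:
  fixes f :: "int \<Rightarrow> real"
  assumes "(f has_sum s) UNIV" "\<And>k. f k \<ge> 0" shows "f k \<le> s"
  using finite_sum_le_infsum[of f UNIV "{k}"] assms infsumI[OF assms(1)]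
  by (auto simp: summable_on_def)

lemma has_sum_finite_sum:
  fixes f :: "'i \<Rightarrow> 'k \<Rightarrow> 'b::topological_comm_monoid_add"
  assumes "\<And>i. i \<in> I \<Longrightarrow> (f i has_sum s i) B"
  shows "((\<lambda>x. \<Sum>i\<in>I. f i x) has_sum (\<Sum>i\<in>I. s i)) B"
  using assms by (induction I rule: infinite_finite_induct) (auto intro: has_sum_add)

text \<open>A Bessel inequality for evaluation at the frequency \<open>k\<close>. Orthonormality
  bounds the weighted squared coefficient of a combination by
  \<open>\<Sum>j<N. (c j)\<^sup>2\<close>. The choice \<open>c j = Re (e j k)\<close> turns this
  into \<open>w * s\<^sup>2 \<le> s\<close> for the sum \<open>s\<close> to be estimated, and
  likewise for imaginary parts.\<close>

lemma orthonormal_coeff_bound: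
  fixes e :: "nat \<Rightarrow> int \<Rightarrow> complex" and ip :: "pdistr \<Rightarrow> pdistr \<Rightarrow> real"
  assumes sums: "\<And>i j. i < N \<Longrightarrow> j < N \<Longrightarrow> ((\<lambda>k. wt k * Re (e i k * cnj (e j k))) has_sum ip (e i) (e j)) UNIV"
    and orth: "\<And>i j. i < N \<Longrightarrow> j < N \<Longrightarrow> ip (e i) (e j) = (if i = j then 1 else 0)"
    and wt: "\<And>k. wt k \<ge> 0"
  shows "wt k * (\<Sum>j<N. (Re (e j k))\<^sup>2) \<le> 1" "wt k * (\<Sum>j<N. (Im (e j k))\<^sup>2) \<le> 1"
proof -
  have main: "wt k * (norm (\<Sum>j<N. complex_of_real (c j) * e j k))\<^sup>2 \<le> (\<Sum>j<N. (c j)\<^sup>2)" for c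
  proof (rule infsum_ge_term)
    have eq: "wt l * (norm (\<Sum>j<N. complex_of_real (c j) * e j l))\<^sup>2 =
       (\<Sum>i<N. \<Sum>j<N. c i * c j * (wt l * Re (e i l * cnj (e j l))))" for l
    proof -
      have "complex_of_real ((norm (\<Sum>j<N. complex_of_real (c j) * e j l))\<^sup>2) =
         (\<Sum>i<N. \<Sum>j<N. complex_of_real (c i * c j) * (e i l * cnj (e j l)))"
        by (simp only: complex_norm_square cnj_sum complex_cnj_mult complex_cnj_complex_of_real)
           (simp add: sum_product mult_ac)
      from arg_cong[OF this, of Re]
      have "(norm (\<Sum>j<N. complex_of_real (c j) * e j l))\<^sup>2 = (\<Sum>i<N. \<Sum>j<N. c i * c j * Re (e i l * cnj (e j l)))"
        by (simp only: Re_complex_of_real Re_sum Re_complex_of_real times_complex.sel Im_complex_of_real mult_zero_left diff_zero)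
      then show ?thesis by (simp only: sum_distrib_left mult_ac)
    qed
    have "((\<lambda>l. \<Sum>i<N. \<Sum>j<N. c i * c j * (wt l * Re (e i l * cnj (e j l)))) has_sum
       (\<Sum>i<N. \<Sum>j<N. c i * c j * ip (e i) (e j))) UNIV"
      by (intro has_sum_finite_sum has_sum_cmult_right sums) auto
    also have "(\<Sum>i<N. \<Sum>j<N. c i * c j * ip (e i) (e j)) = (\<Sum>i<N. \<Sum>j<N. if j = i then c i * c j else 0)"
      by (intro sum.cong refl) (auto simp: orth)
    also have "\<dots> = (\<Sum>j<N. (c j)\<^sup>2)" by (simp add: power2_eq_square)
    finally show "((\<lambda>l. wt l * (norm (\<Sum>j<N. complex_of_real (c j) * e j l))\<^sup>2) has_sum (\<Sum>j<N. (c j)\<^sup>2)) UNIV"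
      unfolding eq .
  qed (simp add: wt)
  have arith: "w * s \<le> 1" if "w * s\<^sup>2 \<le> s" "s \<ge> 0" "w \<ge> 0" for w s :: real
  proof (cases "s = 0")
    case False
    then have "s * (w * s) \<le> s * 1" using that by (simp add: power2_eq_square mult_ac)
    then show ?thesis using that False by (simp add: mult_le_cancel_left)
  qed simp
  let ?s = "\<Sum>j<N. (Re (e j k))\<^sup>2"
  have "wt k * ?s\<^sup>2 \<le> wt k * (norm (\<Sum>j<N. complex_of_real (Re (e j k)) * e j k))\<^sup>2"
    using abs_Re_le_cmod[of "\<Sum>j<N. complex_of_real (Re (e j k)) * e j k"]
    by (intro mult_left_mono power_mono wt sum_nonneg) (auto simp: power2_eq_square[symmetric] abs_le_iff)
  also have "\<dots> \<le> ?s" by (rule main)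
  finally show "wt k * ?s \<le> 1" by (intro arith wt sum_nonneg) auto
  let ?s = "\<Sum>j<N. (Im (e j k))\<^sup>2"
  have "wt k * ?s\<^sup>2 \<le> wt k * (norm (\<Sum>j<N. complex_of_real (Im (e j k)) * e j k))\<^sup>2"
    using abs_Im_le_cmod[of "\<Sum>j<N. complex_of_real (Im (e j k)) * e j k"]
    by (intro mult_left_mono power_mono wt sum_nonneg) (auto simp: power2_eq_square[symmetric] abs_le_iff)
  also have "\<dots> \<le> ?s" by (rule main)
  finally show "wt k * ?s \<le> 1" by (intro arith wt sum_nonneg) auto
qed

text \<open>Since \<open>j < 2^j\<close>, the function \<open>e j\<close> is itself one of the
  functions spanning \<open>PL j\<close>.\<close>

lemma spans_PL_continuous:
  assumes "spans_PL e" shows "continuous_on UNIV (e j)"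
proof -
  have "e j = (\<lambda>x. \<Sum>i<2^j. (if i = j then 1 else 0) * e i x)"
    using less_exp[of j] by (simp add: if_distrib[of "\<lambda>c. c * _"] cong: if_cong)
  then have "e j \<in> {f. \<exists>c :: nat \<Rightarrow> real. f = (\<lambda>x. \<Sum>i<2^j. c i * e i x)}"
    by (intro CollectI exI)
  also have "\<dots> = PL j" using assms by (simp add: spans_PL_def)
  finally show ?thesis by (simp add: PL_def)
qed

text \<open>Comparison with \<open>n powr (2 * s)\<close>, where \<open>2 * s < - 1\<close>; the
  integers are split into 0 and the two half-lines.\<close>

lemma summable_bessel_wt_powr:
  assumes "s < - 1/2" shows "(\<lambda>k. bessel_wt k powr s) summable_on UNIV"
proof -
  have le: "bessel_wt (int (Suc n)) powr s \<le> real (Suc n) powr (2 * s)" for n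
  proof -
    have "1 * 1 \<le> 2 * pi" using pi_gt3 by linarith
    then have "1\<^sup>2 * (real (Suc n))\<^sup>2 \<le> (2 * pi)\<^sup>2 * (real (Suc n))\<^sup>2"
      by (intro mult_right_mono power_mono) auto
    also have "\<dots> \<le> bessel_wt (int (Suc n))"
      by (simp add: bessel_wt_def power_mult_distrib del: of_nat_Suc)
    finally have "(real (Suc n))\<^sup>2 \<le> bessel_wt (int (Suc n))" by (simp only: power_one mult_1_left)
    then have "bessel_wt (int (Suc n)) powr s \<le> ((real (Suc n))\<^sup>2) powr s"
      using assms by (intro powr_mono2') auto
    also have "\<dots> = real (Suc n) powr (2 * s)"
      by (simp add: powr_powr[symmetric] powr_2 del: of_nat_Suc)
    finally show ?thesis .
  qed
  have "summable (\<lambda>n. real n powr (2 * s))" using assms by (simp add: summable_real_powr_iff)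
  then have "summable (\<lambda>n. real (Suc n) powr (2 * s))" by (subst summable_Suc_iff)
  then have "summable (\<lambda>n. bessel_wt (int (Suc n)) powr s)"
    by (rule summable_comparison_test'[where N=0]) (use le in simp)
  then have S: "(\<lambda>n. bessel_wt (int (Suc n)) powr s) summable_on UNIV"
    by (subst summable_on_UNIV_nonneg_real_iff) auto
  have pos: "(\<lambda>k. bessel_wt k powr s) summable_on (range (\<lambda>n. int (Suc n)))"
    by (subst summable_on_reindex) (use S in \<open>auto simp: inj_on_def o_def\<close>)
  have neg: "(\<lambda>k. bessel_wt k powr s) summable_on (range (\<lambda>n. - int (Suc n)))"
    using S by (subst summable_on_reindex) (auto simp: inj_on_def o_def simp del: of_nat_Suc)
  have "(UNIV :: int set) = {0} \<union> (range (\<lambda>n. int (Suc n)) \<union> range (\<lambda>n. - int (Suc n)))"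
  proof (intro equalityI subsetI)
    fix k :: int
    show "k \<in> {0} \<union> (range (\<lambda>n. int (Suc n)) \<union> range (\<lambda>n. - int (Suc n)))"
      by (cases k rule: int_cases3) (auto simp: image_iff gr0_conv_Suc simp del: of_nat_Suc)
  qed simp
  moreover have "(\<lambda>k. bessel_wt k powr s) summable_on ({0} \<union> (range (\<lambda>n. int (Suc n)) \<union> range (\<lambda>n. - int (Suc n))))"
    by (intro summable_on_Un_disjoint pos neg summable_on_finite) (auto simp del: of_nat_Suc)
  ultimately show ?thesis by simp
qed

text \<open>The symbol of the inverse of \<open>C_V\<close> and, at the same time, the Fourier
  weight of the inner product \<open>ip_V\<close>.\<close>

definition prior_wt :: "real \<Rightarrow> int \<Rightarrow> real" where
  "prior_wt \<epsilon> k = 1 / (4 * \<epsilon>) + \<epsilon> * (2 * pi * of_int k)\<^sup>2"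

text \<open>The mean-value term acts at the one frequency that the derivative annihilates, so for
  positive \<epsilon> the symbol has no zero.\<close>

definition Dq_symbol :: "real \<Rightarrow> real \<Rightarrow> int \<Rightarrow> complex" where
  "Dq_symbol \<epsilon> q k = 2 * of_real pi * \<i> * of_int k + (if k = 0 then of_real (\<epsilon> powr q) else 0)"

lemma Dq_eq: "Dq \<epsilon> q u k = Dq_symbol \<epsilon> q k * u k"
  by (simp add: Dq_def Dq_symbol_def deriv_distr_def mean_op_def algebra_simps)

lemma Dq_symbol_uminus: "Dq_symbol \<epsilon> q (- k) = cnj (Dq_symbol \<epsilon> q k)"
  by (simp add: Dq_symbol_def)

lemma norm_Dq_symbol_power2:
  "(norm (Dq_symbol \<epsilon> q k))\<^sup>2 = (2 * pi * of_int k)\<^sup>2 + (if k = 0 then (\<epsilon> powr q)\<^sup>2 else 0)"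
  by (simp add: Dq_symbol_def norm_mult power_mult_distrib)

lemma bessel_0 [simp]: "bessel 0 u = u"
  by (simp add: bessel_eq less_imp_neq[symmetric] fun_eq_iff powr_def)

text \<open>A Fourier multiplier of order one maps H1 into L2, and the symmetry of the multiplier
  keeps distributions real.\<close>

lemma H_real_1_imp_0:
  assumes "u \<in> H_real 1" "\<And>k. norm (c k) \<le> C * sqrt (bessel_wt k)" "\<And>k. c (- k) = cnj (c k)"
  shows "(\<lambda>k. c k * u k) \<in> H_real 0"
proof -
  have "sq_summable (\<lambda>k. c k * u k)"
  proof (rule sq_summable_mono)
    show "sq_summable (bessel 1 u)" using assms(1) by (simp add: Sob_real_def H_iff)
    show "norm (c k * u k) \<le> C * norm (bessel 1 u k)" for k
      using mult_right_mono[OF assms(2), of "norm (u k)" k]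
      by (simp add: norm_mult bessel_eq powr_half_sqrt mult_ac less_imp_le)
  qed
  then show ?thesis using assms(1,3) by (simp add: Sob_real_def H_iff real_distr_def)
qed

lemma ip_V_has_sum:
  assumes u: "u \<in> H_real 1" and w: "w \<in> H_real 1"
  shows "((\<lambda>k. prior_wt \<epsilon> k * Re (u k * cnj (w k))) has_sum ip_V \<epsilon> u w) UNIV"
proof -
  have i: "(\<lambda>k. 1 * u k) \<in> H_real 0" if "u \<in> H_real 1" for u
    by (rule H_real_1_imp_0[OF that, of _ 1]) (use bessel_wt_ge_1 in auto)
  have d: "deriv_distr u \<in> H_real 0" if "u \<in> H_real 1" for u
    unfolding deriv_distr_def[abs_def]
    by (rule H_real_1_imp_0[OF that, of _ 1])
      (auto simp: norm_mult bessel_wt_def power_mult_distrib intro!: real_le_rsqrt)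
  have r: "Re (deriv_distr u k * cnj (deriv_distr w k)) = (2 * pi * of_int k)\<^sup>2 * Re (u k * cnj (w k))" for k
    by (simp add: deriv_distr_def power2_eq_square algebra_simps)
  have "((\<lambda>k. 1 / (4 * \<epsilon>) * (bessel_wt k powr 0 * Re (u k * cnj (w k))) +
      \<epsilon> * (bessel_wt k powr 0 * Re (deriv_distr u k * cnj (deriv_distr w k)))) has_sum ip_V \<epsilon> u w) UNIV"
    unfolding ip_V_def using i[OF u] i[OF w] d[OF u] d[OF w]
    by (intro has_sum_add has_sum_cmult_right H_inner_has_sum) auto
  moreover have "1 / (4 * \<epsilon>) * (bessel_wt k powr 0 * Re (u k * cnj (w k))) +
      \<epsilon> * (bessel_wt k powr 0 * Re (deriv_distr u k * cnj (deriv_distr w k))) =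
      prior_wt \<epsilon> k * Re (u k * cnj (w k))" for k
    unfolding r by (simp add: prior_wt_def less_imp_neq[symmetric] algebra_simps del: times_complex.sel)
  ultimately show ?thesis by simp
qed

lemma norm_Dq_symbol_le:
  "norm (Dq_symbol \<epsilon> q k) \<le> (1 + \<epsilon> powr q) * sqrt (bessel_wt k)"
proof -
  have "norm (Dq_symbol \<epsilon> q k) \<le> norm (2 * of_real pi * \<i> * of_int k :: complex) + \<epsilon> powr q"
    unfolding Dq_symbol_def by (rule order_trans[OF norm_triangle_ineq]) (simp add: norm_mult)
  also have "\<dots> \<le> sqrt (bessel_wt k) + \<epsilon> powr q * sqrt (bessel_wt k)"
  proof (rule add_mono)
    show "norm (2 * of_real pi * \<i> * of_int k :: complex) \<le> sqrt (bessel_wt k)"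
      by (auto simp: norm_mult bessel_wt_def power_mult_distrib intro!: real_le_rsqrt)
    have "sqrt (bessel_wt k) \<ge> 1" using bessel_wt_ge_1[of k] by simp
    then show "\<epsilon> powr q \<le> \<epsilon> powr q * sqrt (bessel_wt k)"
      using mult_left_mono[of 1 "sqrt (bessel_wt k)" "\<epsilon> powr q"] by simp
  qed
  finally show ?thesis by (simp add: distrib_right)
qed

lemma Dq_H_real_0: "u \<in> H_real 1 \<Longrightarrow> Dq \<epsilon> q u \<in> H_real 0"
  unfolding Dq_eq[abs_def]
  by (rule H_real_1_imp_0[OF _ norm_Dq_symbol_le Dq_symbol_uminus])

lemma ip_D_has_sum:
  assumes u: "u \<in> H_real 1" and w: "w \<in> H_real 1"
  shows "((\<lambda>k. (norm (Dq_symbol \<epsilon> q k))\<^sup>2 * Re (u k * cnj (w k))) has_sum ip_D \<epsilon> q u w) UNIV"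
proof -
  have r: "Re (Dq \<epsilon> q u k * cnj (Dq \<epsilon> q w k)) = (norm (Dq_symbol \<epsilon> q k))\<^sup>2 * Re (u k * cnj (w k))" for k
    unfolding Dq_eq cmod_power2 by (simp add: power2_eq_square algebra_simps)
  show ?thesis
    using H_inner_has_sum[OF Dq_H_real_0[OF u] Dq_H_real_0[OF w], of \<epsilon> q \<epsilon> q]
    unfolding r ip_D_def by (simp add: less_imp_neq[symmetric] del: times_complex.sel)
qed

lemma summable_inverse_weight:
  assumes "c > 0" "\<And>k. wt k \<ge> c * bessel_wt k"
  shows "(\<lambda>k. 1 / wt k) summable_on UNIV"
proof (rule summable_on_comparison_test)
  show "(\<lambda>k. 1 / c * bessel_wt k powr (-1)) summable_on UNIV"
    by (intro summable_on_cmult_right summable_bessel_wt_powr) simp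
  have pos: "c * bessel_wt k > 0" for k using assms(1) by simp
  show "1 / wt k \<le> 1 / c * bessel_wt k powr (-1)" for k
    using divide_left_mono[OF assms(2)[of k], of 1] pos[of k] assms(2)[of k]
    by (simp add: powr_minus_divide mult_pos_pos abs_of_pos)
  show "0 \<le> 1 / wt k" for k using pos[of k] assms(2)[of k] by simp
qed

lemma prior_wt_ge:
  assumes "\<epsilon> > 0" shows "prior_wt \<epsilon> k \<ge> min (1 / (4 * \<epsilon>)) \<epsilon> * bessel_wt k"
proof -
  have "min (1 / (4 * \<epsilon>)) \<epsilon> * 1 + min (1 / (4 * \<epsilon>)) \<epsilon> * (2 * pi * of_int k)\<^sup>2 \<le> prior_wt \<epsilon> k"
    unfolding prior_wt_def by (intro add_mono mult_right_mono) auto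
  then show ?thesis by (simp add: bessel_wt_def distrib_left)
qed

lemma prior_wt_pos: "\<epsilon> > 0 \<Longrightarrow> prior_wt \<epsilon> k > 0"
  by (simp add: prior_wt_def add_pos_nonneg)

lemma summable_inverse_prior_wt: "\<epsilon> > 0 \<Longrightarrow> (\<lambda>k. 1 / prior_wt \<epsilon> k) summable_on UNIV"
  by (rule summable_inverse_weight[OF _ prior_wt_ge]) auto

text \<open>For \<open>k \<noteq> 0\<close> the square of \<open>2 * pi * k\<close> is at least 1
  and hence at least half of \<open>bessel_wt k\<close>; the other constant is the value at
  \<open>k = 0\<close>.\<close>

lemma norm_Dq_symbol_ge:
  assumes "\<epsilon> > 0"
  shows "(norm (Dq_symbol \<epsilon> q k))\<^sup>2 \<ge> min ((\<epsilon> powr q)\<^sup>2) (1/2) * bessel_wt k"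
proof (cases "k = 0")
  case False
  have "1 * 1 \<le> 2 * pi" using pi_gt3 by linarith
  moreover have "1 \<le> \<bar>real_of_int k\<bar>" using False by linarith
  ultimately have "1 * 1 \<le> 2 * pi * \<bar>real_of_int k\<bar>" by (intro mult_mono) auto
  then have "1\<^sup>2 \<le> (2 * pi * \<bar>real_of_int k\<bar>)\<^sup>2" by (intro power_mono) auto
  then have "1 \<le> (2 * pi * real_of_int k)\<^sup>2" by (simp add: power_mult_distrib)
  then have "(1/2) * bessel_wt k \<le> (2 * pi * real_of_int k)\<^sup>2" by (simp add: bessel_wt_def)
  moreover have "min ((\<epsilon> powr q)\<^sup>2) (1/2) * bessel_wt k \<le> (1/2) * bessel_wt k"
    using bessel_wt_ge_1[of k] by (intro mult_right_mono) auto
  ultimately have "min ((\<epsilon> powr q)\<^sup>2) (1/2) * bessel_wt k \<le> (2 * pi * of_int k)\<^sup>2"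
    by (rule order_trans[rotated])
  then show ?thesis using False by (simp only: norm_Dq_symbol_power2 if_False add_0_right)
qed (simp add: norm_Dq_symbol_power2 bessel_wt_def)

lemma Dq_symbol_nz: "\<epsilon> > 0 \<Longrightarrow> Dq_symbol \<epsilon> q k \<noteq> 0"
  by (auto simp: Dq_symbol_def)

lemma summable_inverse_Dq_symbol: "\<epsilon> > 0 \<Longrightarrow> (\<lambda>k. 1 / (norm (Dq_symbol \<epsilon> q k))\<^sup>2) summable_on UNIV"
  by (rule summable_inverse_weight[OF _ norm_Dq_symbol_ge]) auto

lemma exp_Lp_norm_bound:
  fixes Z :: "'a \<Rightarrow> real \<Rightarrow> real" and c :: "int \<Rightarrow> real"
  assumes M: "prob_space M" and pos: "\<And>k. \<nu> k > 0" and sum: "\<nu> summable_on UNIV"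
    and Z: "\<And>\<omega>. \<omega> \<in> space M \<Longrightarrow> Z \<omega> \<in> Lp 2"
    and sub: "\<And>k. subgaussian M (\<lambda>\<omega>. Re (fourier_real (Z \<omega>) k)) (\<nu> k)"
      "\<And>k. subgaussian M (\<lambda>\<omega>. Im (fourier_real (Z \<omega>) k)) (\<nu> k)"
  shows "(\<lambda>\<omega>. Lp_norm 2 (Z \<omega>)) \<in> borel_measurable M"
    "(\<integral>\<^sup>+\<omega>. ennreal (exp (b * Lp_norm 2 (Z \<omega>))) \<partial>M) \<le> ennreal (2 * exp (b\<^sup>2 * infsum \<nu> UNIV))"
proof -
  have S: "sq_summable (\<lambda>k. fourier_real (Z \<omega>) k)" if "\<omega> \<in> space M" for \<omega>
    using sq_summable_fourier[OF Lp_2_of_real[OF Z[OF that]]] .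
  have eq: "Lp_norm 2 (Z \<omega>) = sqrt (\<Sum>\<^sub>\<infinity>k. (norm (fourier_real (Z \<omega>) k))\<^sup>2)" if "\<omega> \<in> space M" for \<omega>
    by (rule Lp_norm_2_eq_infsum[OF Z[OF that]])
  have "(\<lambda>\<omega>. \<Sum>\<^sub>\<infinity>k. (norm (fourier_real (Z \<omega>) k))\<^sup>2) \<in> borel_measurable M"
    using sub by (intro borel_measurable_infsum_norm S) (auto simp: subgaussian_def borel_measurable_complex_iff)
  then have "(\<lambda>\<omega>. sqrt (\<Sum>\<^sub>\<infinity>k. (norm (fourier_real (Z \<omega>) k))\<^sup>2)) \<in> borel_measurable M"
    by measurable
  then show "(\<lambda>\<omega>. Lp_norm 2 (Z \<omega>)) \<in> borel_measurable M"
    by (subst measurable_cong[OF eq])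
  have "(\<integral>\<^sup>+\<omega>. ennreal (exp (b * Lp_norm 2 (Z \<omega>))) \<partial>M) =
      (\<integral>\<^sup>+\<omega>. ennreal (exp (b * sqrt (\<Sum>\<^sub>\<infinity>k. (norm (fourier_real (Z \<omega>) k))\<^sup>2))) \<partial>M)"
    by (intro nn_integral_cong) (simp add: eq)
  also have "\<dots> \<le> ennreal (2 * exp (b\<^sup>2 * infsum \<nu> UNIV))"
    by (rule nn_integral_exp_l2_norm[OF M pos sum sub S])
  finally show "(\<integral>\<^sup>+\<omega>. ennreal (exp (b * Lp_norm 2 (Z \<omega>))) \<partial>M) \<le> ennreal (2 * exp (b\<^sup>2 * infsum \<nu> UNIV))" .
qed

text \<open>Follows from the pointwise bound
  \<open>(f x + 1)\<^sup>2 \<le> 2 * (f x)\<^sup>2 + 2\<close>. The price is the factor 2, which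
  doubles \<open>b\<close> in the exponential moments of fields with mean one.\<close>

lemma Lp_norm_2_add_1_le:
  fixes f :: "real \<Rightarrow> real"
  assumes "f \<in> Lp 2" shows "Lp_norm 2 (\<lambda>x. f x + 1) \<le> 2 * Lp_norm 2 f + 2"
proof -
  have "(Lp_norm 2 (\<lambda>x. f x + 1))\<^sup>2 = (LINT x|circ. (f x + 1)\<^sup>2)"
    by (simp add: Lp_norm_2_power2)
  also have "\<dots> \<le> (LINT x|circ. 2 * (f x)\<^sup>2 + 2)"
  proof (rule Bochner_Integration.integral_mono)
    show "integrable circ (\<lambda>x. (f x + 1)\<^sup>2)"
      using Lp_2_add[OF assms Lp_2_bounded[where f="\<lambda>x. 1" and c=1]] by (simp add: Lp_2_iff)
    show "integrable circ (\<lambda>x. 2 * (f x)\<^sup>2 + 2)" using assms by (simp add: Lp_2_iff)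
    show "(f x + 1)\<^sup>2 \<le> 2 * (f x)\<^sup>2 + 2" for x
      using sum_squares_bound[of "f x" 1] by (simp add: power2_sum)
  qed
  also have "\<dots> = 2 * (Lp_norm 2 f)\<^sup>2 + 2"
    using assms circ.prob_space by (simp add: Lp_norm_2_power2 Lp_2_iff)
  also have "\<dots> \<le> (2 * Lp_norm 2 f + 2)\<^sup>2"
    using Lp_norm_nonneg[of 2 f] by (simp add: power2_sum power_mult_distrib)
  finally show ?thesis
    by (rule power2_le_imp_le) (use Lp_norm_nonneg[of 2 f] in simp)
qed

text \<open>The mean is subtracted before the sub-Gaussian estimate and restored by
  \<open>Lp_norm_2_add_1_le\<close>; this produces the factor \<open>exp (2 * b)\<close> and the
  argument \<open>2 * b\<close>.\<close>

lemma
  fixes V :: "'a \<Rightarrow> real \<Rightarrow> real"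
  assumes M: "prob_space M" and pos: "\<And>k. \<nu> k > 0" and sum: "\<nu> summable_on UNIV"
    and V: "\<And>\<omega>. \<omega> \<in> space M \<Longrightarrow> V \<omega> \<in> Lp 2"
    and sub: "\<And>k. subgaussian M (\<lambda>\<omega>. Re (fourier_real (\<lambda>x. V \<omega> x - 1) k)) (\<nu> k)"
      "\<And>k. subgaussian M (\<lambda>\<omega>. Im (fourier_real (\<lambda>x. V \<omega> x - 1) k)) (\<nu> k)"
    and b: "b \<ge> 0"
  shows exp_Lp_norm_mean_1_measurable: "(\<lambda>\<omega>. Lp_norm 2 (V \<omega>)) \<in> borel_measurable M"
    and exp_Lp_norm_mean_1_bound: "(\<integral>\<^sup>+\<omega>. ennreal (exp (b * Lp_norm 2 (V \<omega>))) \<partial>M) \<le> ennreal (exp (2 * b) * (2 * exp ((2 * b)\<^sup>2 * infsum \<nu> UNIV)))"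
proof -
  interpret prob_space M by fact
  have one: "(\<lambda>x. 1 :: real) \<in> Lp 2" by (rule Lp_2_bounded[where c=1]) auto
  have Z: "(\<lambda>x. V \<omega> x - 1) \<in> Lp 2" if "\<omega> \<in> space M" for \<omega>
    by (rule Lp_2_diff[OF V[OF that] one])
  have fV: "fourier_real (V \<omega>) k = fourier_real (\<lambda>x. V \<omega> x - 1) k + fourier_real (\<lambda>x. 1) k"
    if "\<omega> \<in> space M" for \<omega> k
    using fourier_add[OF integrable_Lp_2[OF Lp_2_of_real[OF Z[OF that]]] integrable_Lp_2[OF Lp_2_of_real[OF one]], of k]
    by simp
  have m: "(\<lambda>\<omega>. fourier_real (V \<omega>) k) \<in> borel_measurable M" for k
  proof (subst measurable_cong[OF fV])
    have "(\<lambda>\<omega>. fourier_real (\<lambda>x. V \<omega> x - 1) k) \<in> borel_measurable M"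
      using sub[of k] by (simp add: borel_measurable_complex_iff subgaussian_def)
    then show "(\<lambda>\<omega>. fourier_real (\<lambda>x. V \<omega> x - 1) k + fourier_real (\<lambda>x. 1) k) \<in> borel_measurable M"
      by (intro borel_measurable_add) auto
  qed
  have "(\<lambda>\<omega>. sqrt (\<Sum>\<^sub>\<infinity>k. (norm (fourier_real (V \<omega>) k))\<^sup>2)) \<in> borel_measurable M"
    using m sq_summable_fourier[OF Lp_2_of_real[OF V]]
    by (intro measurable_compose[OF _ borel_measurable_sqrt] borel_measurable_infsum_norm) auto
  then show "(\<lambda>\<omega>. Lp_norm 2 (V \<omega>)) \<in> borel_measurable M"
    by (subst measurable_cong[OF Lp_norm_2_eq_infsum[OF V]])
  have "Lp_norm 2 (V \<omega>) \<le> 2 * Lp_norm 2 (\<lambda>x. V \<omega> x - 1) + 2" if "\<omega> \<in> space M" for \<omega>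
    using Lp_norm_2_add_1_le[OF Z[OF that]] by simp
  then have "(\<integral>\<^sup>+\<omega>. ennreal (exp (b * Lp_norm 2 (V \<omega>))) \<partial>M) \<le> (\<integral>\<^sup>+\<omega>. ennreal (exp (2 * b)) * ennreal (exp ((2 * b) * Lp_norm 2 (\<lambda>x. V \<omega> x - 1))) \<partial>M)"
    using b by (intro nn_integral_mono)
      (simp add: ennreal_mult[symmetric] exp_add[symmetric], metis (no_types) add.commute distrib_left mult.assoc mult.commute mult_left_mono)
  also have "\<dots> = ennreal (exp (2 * b)) * (\<integral>\<^sup>+\<omega>. ennreal (exp ((2 * b) * Lp_norm 2 (\<lambda>x. V \<omega> x - 1))) \<partial>M)"
    using exp_Lp_norm_bound(1)[OF M pos sum Z sub]
    by (intro nn_integral_cmult) auto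
  also have "\<dots> \<le> ennreal (exp (2 * b)) * ennreal (2 * exp ((2 * b)\<^sup>2 * infsum \<nu> UNIV))"
    by (intro mult_left_mono exp_Lp_norm_bound(2)[OF M pos sum Z sub]) auto
  finally show "(\<integral>\<^sup>+\<omega>. ennreal (exp (b * Lp_norm 2 (V \<omega>))) \<partial>M) \<le> ennreal (exp (2 * b) * (2 * exp ((2 * b)\<^sup>2 * infsum \<nu> UNIV)))"
    by (simp add: ennreal_mult)
qed

context
  fixes \<epsilon> :: real and M :: "'b measure" and g :: "nat \<Rightarrow> real \<Rightarrow> real" and VV :: "nat \<Rightarrow> nat \<Rightarrow> 'b \<Rightarrow> real"
  assumes \<epsilon>: "\<epsilon> > 0" and M: "prob_space M"
    and g: "orthonormal_basis_H1 (ip_V \<epsilon>) (\<lambda>j. fourier_real (g j))" "spans_PL g"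
    and ind: "\<And>n. prob_space.indep_vars M (\<lambda>_. borel) (VV n) {..<2^n}"
    and normal: "\<And>n j. j < 2^n \<Longrightarrow> distributed M lborel (VV n j) std_normal_density"
begin

lemma V_disc_Lp_2: "V_disc g VV n \<omega> \<in> Lp 2"
proof (rule Lp_2_continuous)
  show "continuous_on UNIV (V_disc g VV n \<omega>)"
    unfolding V_disc_def by (intro continuous_intros spans_PL_continuous[OF g(2)])
qed

lemma fourier_V_disc: "fourier_real (\<lambda>x. V_disc g VV n \<omega> x - 1) k = (\<Sum>j<2^n. of_real (VV n j \<omega>) * fourier_real (g j) k)"
proof -
  have "integrable circ (\<lambda>x. complex_of_real (g j x))" for j
    by (intro integrable_Lp_2 Lp_2_of_real Lp_2_continuous spans_PL_continuous[OF g(2)])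
  then have "fourier (\<lambda>x. \<Sum>j<2^n. of_real (VV n j \<omega>) * complex_of_real (g j x)) k =
     (\<Sum>j<2^n. fourier (\<lambda>x. of_real (VV n j \<omega>) * complex_of_real (g j x)) k)"
    by (intro fourier_sum integrable_mult_right)
  then show ?thesis by (simp add: V_disc_def fourier_cmult)
qed

text \<open>The coefficient at \<open>k\<close> combines independent normals with the weights
  \<open>fourier_real (g j) k\<close>, so its variance is at most
  \<open>1 / prior_wt \<epsilon> k\<close> by \<open>orthonormal_coeff_bound\<close>. The same bound
  holds for all \<open>n\<close>, which is the origin of the uniformity.\<close>

lemma
  assumes b: "b \<ge> 0"
  shows V_disc_norm_measurable: "(\<lambda>\<omega>. Lp_norm 2 (V_disc g VV n \<omega>)) \<in> borel_measurable M"
    and V_disc_exp_bound: "(\<integral>\<^sup>+\<omega>. ennreal (exp (b * Lp_norm 2 (V_disc g VV n \<omega>))) \<partial>M) \<le>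
       ennreal (exp (2 * b) * (2 * exp ((2 * b)\<^sup>2 * (\<Sum>\<^sub>\<infinity>k. 1 / prior_wt \<epsilon> k))))"
proof -
  have on: "fourier_real (g j) \<in> H_real 1" "ip_V \<epsilon> (fourier_real (g i)) (fourier_real (g j)) = (if i = j then 1 else 0)" for i j
    using g(1) by (auto simp: orthonormal_basis_H1_def)
  have bd: "(\<Sum>j<2^n. (Re (fourier_real (g j) k))\<^sup>2) \<le> 1 / prior_wt \<epsilon> k"
    "(\<Sum>j<2^n. (Im (fourier_real (g j) k))\<^sup>2) \<le> 1 / prior_wt \<epsilon> k" for k
    using orthonormal_coeff_bound[of "2^n" "prior_wt \<epsilon>" "\<lambda>j. fourier_real (g j)" "ip_V \<epsilon>" k,
        OF ip_V_has_sum[OF on(1) on(1)] on(2) less_imp_le[OF prior_wt_pos[OF \<epsilon>]]]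
    by (simp_all only: pos_le_divide_eq[OF prior_wt_pos[OF \<epsilon>]] mult.commute)
  have sub: "subgaussian M (\<lambda>\<omega>. Re (fourier_real (\<lambda>x. V_disc g VV n \<omega> x - 1) k)) (1 / prior_wt \<epsilon> k)"
    "subgaussian M (\<lambda>\<omega>. Im (fourier_real (\<lambda>x. V_disc g VV n \<omega> x - 1) k)) (1 / prior_wt \<epsilon> k)" for k
    unfolding fourier_V_disc
    using subgaussian_mono[OF subgaussian_indep_normal_sum[OF M finite_lessThan ind[of n]
        normal, where c="\<lambda>j. Re (fourier_real (g j) k)"] bd(1)[of k]]
      subgaussian_mono[OF subgaussian_indep_normal_sum[OF M finite_lessThan ind[of n]
        normal, where c="\<lambda>j. Im (fourier_real (g j) k)"] bd(2)[of k]]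
    by simp_all
  have pos: "1 / prior_wt \<epsilon> k > 0" for k using prior_wt_pos[OF \<epsilon>] by simp
  show "(\<lambda>\<omega>. Lp_norm 2 (V_disc g VV n \<omega>)) \<in> borel_measurable M"
    by (rule exp_Lp_norm_mean_1_measurable[OF M pos summable_inverse_prior_wt[OF \<epsilon>] V_disc_Lp_2 sub b])
  show "(\<integral>\<^sup>+\<omega>. ennreal (exp (b * Lp_norm 2 (V_disc g VV n \<omega>))) \<partial>M) \<le>
       ennreal (exp (2 * b) * (2 * exp ((2 * b)\<^sup>2 * (\<Sum>\<^sub>\<infinity>k. 1 / prior_wt \<epsilon> k))))"
    by (rule exp_Lp_norm_mean_1_bound[OF M pos summable_inverse_prior_wt[OF \<epsilon>] V_disc_Lp_2 sub b])
qed

end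

section \<open>Square roots of positive semidefinite matrices\<close>

text \<open>
  The coefficients of \<open>1 - sqrt (1 - x)\<close>: a power series \<open>p\<close> with \<open>p = (x + p\<^sup>2) / 2\<close>.
\<close>

fun sqrt_coeff :: "nat \<Rightarrow> real" where
  "sqrt_coeff n = (if n = 0 then 0 else if n = 1 then 1 / 2
     else (\<Sum>i\<in>{1..<n}. sqrt_coeff i * sqrt_coeff (n - i)) / 2)"

declare sqrt_coeff.simps [simp del]

lemma sqrt_coeff_0 [simp]: "sqrt_coeff 0 = 0"
  by (simp add: sqrt_coeff.simps)

lemma sqrt_coeff_nonneg: "sqrt_coeff n \<ge> 0"
proof (induction n rule: less_induct)
  case (less n)
  then show ?case
    by (subst sqrt_coeff.simps) (auto intro!: sum_nonneg mult_nonneg_nonneg)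
qed

text \<open>The coefficientwise form of \<open>p\<^sup>2 = 2 * p - x\<close>; the exceptional term
  at 1 is the monomial \<open>x\<close>.\<close>

lemma sqrt_coeff_cauchy:
  "(\<Sum>i\<le>n. sqrt_coeff i * sqrt_coeff (n - i)) = 2 * sqrt_coeff n - (if n = 1 then 1 else 0)"
proof -
  have "(\<Sum>i\<le>n. sqrt_coeff i * sqrt_coeff (n - i)) = (\<Sum>i\<in>{1..<n}. sqrt_coeff i * sqrt_coeff (n - i))"
    by (rule sum.mono_neutral_right) (auto simp: not_le Suc_le_eq not_less)
  also have "\<dots> = 2 * sqrt_coeff n - (if n = 1 then 1 else 0)"
    by (subst (3) sqrt_coeff.simps) auto
  finally show ?thesis .
qed

text \<open>As the coefficients are nonnegative, the partial sums satisfy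
  \<open>P (n + 1) \<le> (1 + (P n)\<^sup>2) / 2\<close>, which preserves the bound 1.\<close>

lemma sum_sqrt_coeff_le_1: "(\<Sum>i<n. sqrt_coeff i) \<le> 1"
proof (induction n)
  case (Suc n)
  let ?s = "\<Sum>i<n. sqrt_coeff i"
  have s0: "?s \<ge> 0" by (intro sum_nonneg sqrt_coeff_nonneg)
  have "2 * (\<Sum>k<Suc n. sqrt_coeff k) \<le> 1 + (\<Sum>k<Suc n. \<Sum>i\<le>k. sqrt_coeff i * sqrt_coeff (k - i))"
    unfolding sqrt_coeff_cauchy sum_subtractf sum_distrib_left
    by (cases "n = 0") auto
  also have "(\<Sum>k<Suc n. \<Sum>i\<le>k. sqrt_coeff i * sqrt_coeff (k - i)) = (\<Sum>(k,i)\<in>Sigma {..<Suc n} (\<lambda>k. {..k}). sqrt_coeff i * sqrt_coeff (k - i))"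
    by (rule sum.Sigma) auto
  also have "\<dots> = (\<Sum>(k,i)\<in>{(k,i). k < Suc n \<and> 0 < i \<and> i < k}. sqrt_coeff i * sqrt_coeff (k - i))"
  proof (rule sum.mono_neutral_right)
    show "\<forall>x\<in>Sigma {..<Suc n} (\<lambda>k. {..k}) - {(k, i). k < Suc n \<and> 0 < i \<and> i < k}.
        (case x of (k, i) \<Rightarrow> sqrt_coeff i * sqrt_coeff (k - i)) = 0"
      by clarsimp (metis diff_self_eq_0 gr0I le_neq_implies_less sqrt_coeff_0)
  qed auto
  also have "\<dots> = (\<Sum>(i,j)\<in>(\<lambda>(k,i). (i, k - i)) ` {(k,i). k < Suc n \<and> 0 < i \<and> i < k}. sqrt_coeff i * sqrt_coeff j)"
    by (subst sum.reindex) (auto simp: inj_on_def case_prod_beta)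
  \<comment> \<open>Both indices are positive and add up to at most \<open>n\<close>, so each lies
    below \<open>n\<close>.\<close>
  also have "\<dots> \<le> (\<Sum>(i,j)\<in>{..<n} \<times> {..<n}. sqrt_coeff i * sqrt_coeff j)"
    by (rule sum_mono2) (auto simp: sqrt_coeff_nonneg)
  also have "\<dots> = ?s * ?s" by (simp add: sum_product sum.cartesian_product)
  also have "\<dots> \<le> 1" using mult_mono[OF Suc Suc] s0 by simp
  finally show ?case by simp
qed simp

lemma summable_sqrt_coeff: "summable sqrt_coeff"
  by (rule summableI_nonneg_bounded[OF sqrt_coeff_nonneg sum_sqrt_coeff_le_1])

lemma suminf_sqrt_coeff_le_1: "(\<Sum>n. sqrt_coeff n) \<le> 1"
  by (rule suminf_le_const[OF summable_sqrt_coeff sum_sqrt_coeff_le_1])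

section \<open>Symmetric matrices between 0 and the identity\<close>

lemma scalar_prod_self_ge_0: "(x :: real vec) \<bullet> x \<ge> 0"
  by (simp add: scalar_prod_def sum_nonneg)

lemma scalar_prod_self_eq_0:
  assumes "(x :: real vec) \<in> carrier_vec N" "x \<bullet> x = 0" shows "x = 0\<^sub>v N"
proof -
  have "(\<Sum>i\<in>{0..<dim_vec x}. x $ i * x $ i) = 0" using assms(2) by (simp add: scalar_prod_def)
  then have "\<forall>i\<in>{0..<dim_vec x}. x $ i * x $ i = 0"
    by (subst (asm) sum_nonneg_eq_0_iff) auto
  then show ?thesis using assms(1) by (intro eq_vecI) auto
qed

lemma abs_scalar_prod_le:
  assumes "(x :: real vec) \<in> carrier_vec N" "y \<in> carrier_vec N"
  shows "\<bar>x \<bullet> y\<bar> \<le> (x \<bullet> x + y \<bullet> y) / 2"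
proof -
  have "\<bar>x \<bullet> y\<bar> \<le> (\<Sum>i\<in>{0..<N}. \<bar>x $ i * y $ i\<bar>)"
    using assms by (simp add: scalar_prod_def sum_abs)
  also have "\<dots> \<le> (\<Sum>i\<in>{0..<N}. (x $ i * x $ i + y $ i * y $ i) / 2)"
  proof (rule sum_mono)
    fix i
    show "\<bar>x $ i * y $ i\<bar> \<le> (x $ i * x $ i + y $ i * y $ i) / 2"
      using sum_squares_bound[of "\<bar>x $ i\<bar>" "\<bar>y $ i\<bar>"] by (simp add: abs_mult power2_eq_square)
  qed
  also have "\<dots> = (x \<bullet> x + y \<bullet> y) / 2"
    using assms by (simp add: scalar_prod_def sum_divide_distrib[symmetric] sum.distrib)
  finally show ?thesis .
qed

lemma symmetric_scalar_prod:
  assumes "(B :: real mat) \<in> carrier_mat N N" "B\<^sup>T = B" "x \<in> carrier_vec N" "y \<in> carrier_vec N"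
  shows "(B *\<^sub>v x) \<bullet> y = x \<bullet> (B *\<^sub>v y)"
  using transpose_vec_mult_scalar[OF assms(1,4,3)] assms(2) by simp

lemma scalar_prod_mult_vec_expand:
  assumes "(P :: real mat) \<in> carrier_mat N N" "x \<in> carrier_vec N"
  shows "x \<bullet> (P *\<^sub>v x) = (\<Sum>i<N. \<Sum>j<N. x $ i * x $ j * P $$ (i, j))"
  using assms by (auto simp: scalar_prod_def mult_mat_vec_def atLeast0LessThan sum_distrib_left mult.commute
      mult.left_commute intro!: sum.cong)

lemma mult_entry:
  assumes "(P :: real mat) \<in> carrier_mat N N" "Q \<in> carrier_mat N N" "i < N" "j < N"
  shows "(P * Q) $$ (i, j) = (\<Sum>k<N. P $$ (i, k) * Q $$ (k, j))"
  using assms by (simp add: scalar_prod_def atLeast0LessThan)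

text \<open>The binomial series of \<open>1 - sqrt (1 - B)\<close>. It is summed entry by entry,
  which makes its measurable dependence on \<open>B\<close> visible.\<close>

definition sqrt_series :: "real mat \<Rightarrow> nat \<Rightarrow> real mat" where
  "sqrt_series B N = mat N N (\<lambda>(i, j). \<Sum>m. sqrt_coeff m * (B ^\<^sub>m m) $$ (i, j))"

lemma sqrt_series_carrier [simp]: "sqrt_series B N \<in> carrier_mat N N"
  by (simp add: sqrt_series_def)

lemma sqrt_series_dim [simp]: "dim_row (sqrt_series B N) = N" "dim_col (sqrt_series B N) = N"
  by (simp_all add: sqrt_series_def)

context
  fixes B :: "real mat" and N :: nat
  assumes B: "B \<in> carrier_mat N N" and sym: "B\<^sup>T = B"
    and B0: "\<And>x. x \<in> carrier_vec N \<Longrightarrow> 0 \<le> x \<bullet> (B *\<^sub>v x)"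
    and B1: "\<And>x. x \<in> carrier_vec N \<Longrightarrow> x \<bullet> (B *\<^sub>v x) \<le> x \<bullet> x"
begin

text \<open>Positivity is applied to the vector \<open>x - B *\<^sub>v x\<close>, the upper bound to
  \<open>x\<close> and to \<open>B *\<^sub>v x\<close>. This gives the operator bound without
  eigenvalues.\<close>

lemma pos_contraction_norm_le:
  assumes x: "x \<in> carrier_vec N"
  shows "(B *\<^sub>v x) \<bullet> (B *\<^sub>v x) \<le> x \<bullet> x"
proof -
  define w where "w = B *\<^sub>v x"
  have w: "w \<in> carrier_vec N" using B x by (simp add: w_def)
  have Bw: "B *\<^sub>v w \<in> carrier_vec N" using B w by simp
  have "(x - w) \<bullet> (B *\<^sub>v (x - w)) = (x - w) \<bullet> (w - B *\<^sub>v w)"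
    using B x w by (simp add: mult_minus_distrib_mat_vec w_def)
  also have "\<dots> = x \<bullet> w - x \<bullet> (B *\<^sub>v w) - (w \<bullet> w - w \<bullet> (B *\<^sub>v w))"
    using x w Bw by (simp add: minus_scalar_prod_distrib[of _ N] scalar_prod_minus_distrib[of _ N])
  also have "x \<bullet> (B *\<^sub>v w) = w \<bullet> w"
    using symmetric_scalar_prod[OF B sym x w] by (simp add: w_def)
  finally have "0 \<le> x \<bullet> w - w \<bullet> w - (w \<bullet> w - w \<bullet> (B *\<^sub>v w))"
    using B0[of "x - w"] x w by simp
  moreover have "w \<bullet> (B *\<^sub>v w) \<le> w \<bullet> w" by (rule B1[OF w])
  moreover have "x \<bullet> w \<le> x \<bullet> x" using B1[OF x] by (simp add: w_def)
  ultimately show ?thesis unfolding w_def[symmetric] by linarith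
qed

lemma pow_carrier: "B ^\<^sub>m m \<in> carrier_mat N N"
  using B by simp

lemma pow_mult_vec_carrier: "x \<in> carrier_vec N \<Longrightarrow> (B ^\<^sub>m m) *\<^sub>v x \<in> carrier_vec N"
  using pow_carrier[of m] by simp

lemma pow_norm_le:
  "x \<in> carrier_vec N \<Longrightarrow> ((B ^\<^sub>m m) *\<^sub>v x) \<bullet> ((B ^\<^sub>m m) *\<^sub>v x) \<le> x \<bullet> x"
proof (induction m arbitrary: x)
  case 0
  then show ?case using B by simp
next
  case (Suc m)
  have "(B ^\<^sub>m Suc m) *\<^sub>v x = (B ^\<^sub>m m) *\<^sub>v (B *\<^sub>v x)"
    using assoc_mult_mat_vec[OF pow_carrier[of m] B Suc.prems] by simp
  then show ?case using Suc.IH[of "B *\<^sub>v x"] pos_contraction_norm_le[OF Suc.prems] B Suc.prems by simp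
qed

lemma pow_scalar_prod_le:
  assumes "x \<in> carrier_vec N" "y \<in> carrier_vec N"
  shows "\<bar>x \<bullet> ((B ^\<^sub>m m) *\<^sub>v y)\<bar> \<le> (x \<bullet> x + y \<bullet> y) / 2"
  by (rule order_trans[OF abs_scalar_prod_le[OF assms(1) pow_mult_vec_carrier[OF assms(2)]]])
    (simp add: divide_right_mono pow_norm_le[OF assms(2)])

lemma pow_entry: "i < N \<Longrightarrow> j < N \<Longrightarrow> (B ^\<^sub>m m) $$ (i, j) = unit_vec N i \<bullet> ((B ^\<^sub>m m) *\<^sub>v unit_vec N j)"
  using pow_carrier[of m] B by (simp add: mult_mat_vec_def scalar_prod_right_unit)

lemma pow_entry_le_1: "i < N \<Longrightarrow> j < N \<Longrightarrow> \<bar>(B ^\<^sub>m m) $$ (i, j)\<bar> \<le> 1"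
  using pow_scalar_prod_le[of "unit_vec N i" "unit_vec N j" m] by (simp add: pow_entry)

lemma summable_sqrt_entry:
  assumes "i < N" "j < N"
  shows "summable (\<lambda>m. norm (sqrt_coeff m * (B ^\<^sub>m m) $$ (i, j)))"
proof (rule summable_comparison_test'[OF summable_sqrt_coeff, where N=0])
  show "norm (norm (sqrt_coeff m * (B ^\<^sub>m m) $$ (i, j))) \<le> sqrt_coeff m" for m
    using mult_left_mono[OF pow_entry_le_1[OF assms, of m] sqrt_coeff_nonneg[of m]] sqrt_coeff_nonneg[of m]
    by (simp add: abs_mult)
qed

lemma sqrt_series_entry_sums:
  "i < N \<Longrightarrow> j < N \<Longrightarrow> (\<lambda>m. sqrt_coeff m * (B ^\<^sub>m m) $$ (i, j)) sums sqrt_series B N $$ (i, j)"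
  using summable_sums[OF summable_norm_cancel[OF summable_sqrt_entry]] by (simp add: sqrt_series_def)

lemma pow_add: "(B ^\<^sub>m a) * (B ^\<^sub>m b) = B ^\<^sub>m (a + b)"
proof (induction b)
  case 0
  then show ?case using B pow_carrier[of a] by (simp add: right_mult_one_mat[of _ N N])
next
  case (Suc b)
  have "(B ^\<^sub>m a) * (B ^\<^sub>m Suc b) = ((B ^\<^sub>m a) * (B ^\<^sub>m b)) * B"
    using pow_carrier[of a] pow_carrier[of b] B by (simp add: assoc_mult_mat[of _ N N _ N _ N])
  then show ?case using Suc by simp
qed

text \<open>A Cauchy product of the series of the entries: powers of \<open>B\<close> combine by
  \<open>pow_add\<close>, and the scalar identity \<open>sqrt_coeff_cauchy\<close> does the
  rest.\<close>

lemma sqrt_series_square: "sqrt_series B N * sqrt_series B N = 2 \<cdot>\<^sub>m sqrt_series B N - B"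
proof (rule eq_matI)
  fix i j assume "i < dim_row (2 \<cdot>\<^sub>m sqrt_series B N - B)" "j < dim_col (2 \<cdot>\<^sub>m sqrt_series B N - B)"
  then have ij: "i < N" "j < N" using B by auto
  let ?P = "\<lambda>i j m. sqrt_coeff m * (B ^\<^sub>m m) $$ (i, j)"
  have "(\<lambda>n. \<Sum>k<N. \<Sum>a\<le>n. ?P i k a * ?P k j (n - a)) sums (\<Sum>k<N. sqrt_series B N $$ (i, k) * sqrt_series B N $$ (k, j))"
  proof (rule sums_sum)
    fix k assume "k \<in> {..<N}"
    then have k: "k < N" by simp
    show "(\<lambda>n. \<Sum>a\<le>n. ?P i k a * ?P k j (n - a)) sums (sqrt_series B N $$ (i, k) * sqrt_series B N $$ (k, j))"
      using Cauchy_product_sums[OF summable_sqrt_entry[OF ij(1) k] summable_sqrt_entry[OF k ij(2)]]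
        sqrt_series_entry_sums[OF ij(1) k] sqrt_series_entry_sums[OF k ij(2)]
      by (simp add: sums_iff)
  qed
  moreover have "(\<Sum>k<N. \<Sum>a\<le>n. ?P i k a * ?P k j (n - a)) = 2 * ?P i j n - (if n = 1 then B $$ (i, j) else 0)" for n
  proof -
    have "(\<Sum>k<N. \<Sum>a\<le>n. ?P i k a * ?P k j (n - a)) =
       (\<Sum>a\<le>n. sqrt_coeff a * sqrt_coeff (n - a) * (\<Sum>k<N. (B ^\<^sub>m a) $$ (i, k) * (B ^\<^sub>m (n - a)) $$ (k, j)))"
      by (subst sum.swap) (simp add: sum_distrib_left mult_ac)
    also have "\<dots> = (\<Sum>a\<le>n. sqrt_coeff a * sqrt_coeff (n - a) * (B ^\<^sub>m n) $$ (i, j))"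
      using ij by (intro sum.cong refl) (simp add: mult_entry[OF pow_carrier pow_carrier, symmetric] pow_add)
    also have "\<dots> = (2 * sqrt_coeff n - (if n = 1 then 1 else 0)) * (B ^\<^sub>m n) $$ (i, j)"
      by (simp add: sum_distrib_right[symmetric] sqrt_coeff_cauchy)
    also have "\<dots> = 2 * ?P i j n - (if n = 1 then B $$ (i, j) else 0)"
      using B ij by (auto simp: algebra_simps)
    finally show ?thesis .
  qed
  moreover have "(\<lambda>n. 2 * ?P i j n - (if n = 1 then B $$ (i, j) else 0)) sums (2 * sqrt_series B N $$ (i, j) - B $$ (i, j))"
    by (intro sums_diff sums_mult sqrt_series_entry_sums ij sums_If_finite_set[of "{1}", simplified])
      (use sums_single[of 1 "\<lambda>_. B $$ (i, j)"] in simp)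
  ultimately have "(\<Sum>k<N. sqrt_series B N $$ (i, k) * sqrt_series B N $$ (k, j)) = 2 * sqrt_series B N $$ (i, j) - B $$ (i, j)"
    by (simp add: sums_iff)
  then show "(sqrt_series B N * sqrt_series B N) $$ (i, j) = (2 \<cdot>\<^sub>m sqrt_series B N - B) $$ (i, j)"
    using ij B by (simp only: mult_entry[OF sqrt_series_carrier sqrt_series_carrier ij]) simp
qed (use B in auto)

lemma pow_symmetric: "(B ^\<^sub>m m)\<^sup>T = B ^\<^sub>m m"
proof (induction m)
  case 0
  then show ?case by simp
next
  case (Suc m)
  have "(B ^\<^sub>m Suc m)\<^sup>T = B\<^sup>T * (B ^\<^sub>m m)\<^sup>T"
    using B pow_carrier[of m] by (simp add: transpose_mult[of _ N N _ N])
  also have "\<dots> = B ^\<^sub>m 1 * B ^\<^sub>m m" using B by (simp add: sym Suc)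
  also have "\<dots> = B ^\<^sub>m Suc m" by (simp only: pow_add) simp
  finally show ?case .
qed

lemma sqrt_series_symmetric: "(sqrt_series B N)\<^sup>T = sqrt_series B N"
proof (rule eq_matI)
  fix i j assume "i < dim_row (sqrt_series B N)" "j < dim_col (sqrt_series B N)"
  then have ij: "i < N" "j < N" by (auto simp: sqrt_series_def)
  have "(B ^\<^sub>m m) $$ (j, i) = (B ^\<^sub>m m) $$ (i, j)" for m
    using arg_cong[OF pow_symmetric[of m], of "\<lambda>A. A $$ (i, j)"]
      index_transpose_mat(1)[of i "B ^\<^sub>m m" j] ij carrier_matD[OF pow_carrier[of m]] by metis
  then show "(sqrt_series B N)\<^sup>T $$ (i, j) = sqrt_series B N $$ (i, j)"
    using ij by (simp add: sqrt_series_def)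
qed (auto simp: sqrt_series_def)

text \<open>The coefficients add up to at most 1 and the powers of \<open>B\<close> are
  contractions. Consequently the identity minus the series is positive semidefinite, which settles
  the sign of the root.\<close>

lemma sqrt_series_le:
  assumes x: "x \<in> carrier_vec N" shows "x \<bullet> (sqrt_series B N *\<^sub>v x) \<le> x \<bullet> x"
proof -
  have "(\<lambda>m. \<Sum>i<N. \<Sum>j<N. x $ i * x $ j * (sqrt_coeff m * (B ^\<^sub>m m) $$ (i, j))) sums (x \<bullet> (sqrt_series B N *\<^sub>v x))"
    unfolding scalar_prod_mult_vec_expand[OF sqrt_series_carrier x]
    by (intro sums_sum sums_mult sqrt_series_entry_sums) auto
  moreover have "(\<Sum>i<N. \<Sum>j<N. x $ i * x $ j * (sqrt_coeff m * (B ^\<^sub>m m) $$ (i, j))) = sqrt_coeff m * (x \<bullet> ((B ^\<^sub>m m) *\<^sub>v x))" for m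
    unfolding scalar_prod_mult_vec_expand[OF pow_carrier x] by (simp add: sum_distrib_left mult_ac)
  ultimately have s: "(\<lambda>m. sqrt_coeff m * (x \<bullet> ((B ^\<^sub>m m) *\<^sub>v x))) sums (x \<bullet> (sqrt_series B N *\<^sub>v x))" by simp
  have "x \<bullet> (sqrt_series B N *\<^sub>v x) \<le> (\<Sum>m. sqrt_coeff m) * (x \<bullet> x)"
  proof (rule sums_le[OF _ s sums_mult2[OF summable_sums[OF summable_sqrt_coeff]]])
    fix m
    show "sqrt_coeff m * (x \<bullet> ((B ^\<^sub>m m) *\<^sub>v x)) \<le> sqrt_coeff m * (x \<bullet> x)"
      using pow_scalar_prod_le[OF x x, of m] by (intro mult_left_mono sqrt_coeff_nonneg) auto
  qed
  also have "\<dots> \<le> 1 * (x \<bullet> x)"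
    by (intro mult_right_mono suminf_sqrt_coeff_le_1 scalar_prod_self_ge_0)
  finally show ?thesis by simp
qed

text \<open>What commutes with \<open>B\<close> commutes with its powers. It serves to show that an
  arbitrary root commutes with the one built from the series.\<close>

lemma sqrt_series_commute:
  assumes S: "S \<in> carrier_mat N N" and comm: "S * B = B * S"
  shows "S * sqrt_series B N = sqrt_series B N * S"
proof -
  have pc: "S * (B ^\<^sub>m m) = (B ^\<^sub>m m) * S" for m
  proof (induction m)
    case 0
    then show ?case using S B by simp
  next
    case (Suc m)
    have "S * (B ^\<^sub>m Suc m) = (S * (B ^\<^sub>m m)) * B"
      using S B pow_carrier[of m] by (simp add: assoc_mult_mat[of _ N N _ N _ N])
    also have "\<dots> = (B ^\<^sub>m m) * (S * B)"
      using S B pow_carrier[of m] by (simp add: Suc assoc_mult_mat[of _ N N _ N _ N])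
    also have "\<dots> = (B ^\<^sub>m Suc m) * S"
      using S B pow_carrier[of m] by (simp add: comm assoc_mult_mat[of _ N N _ N _ N])
    finally show ?case .
  qed
  show ?thesis
  proof (rule eq_matI)
    fix i j assume "i < dim_row (sqrt_series B N * S)" "j < dim_col (sqrt_series B N * S)"
    then have ij: "i < N" "j < N" using S by (auto simp: sqrt_series_def)
    have "(\<lambda>m. \<Sum>k<N. S $$ (i, k) * (sqrt_coeff m * (B ^\<^sub>m m) $$ (k, j))) sums (S * sqrt_series B N) $$ (i, j)"
      using ij by (subst mult_entry[OF S sqrt_series_carrier ij]) (intro sums_sum sums_mult sqrt_series_entry_sums; simp)
    moreover have "(\<lambda>m. \<Sum>k<N. sqrt_coeff m * (B ^\<^sub>m m) $$ (i, k) * S $$ (k, j)) sums (sqrt_series B N * S) $$ (i, j)"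
      using ij by (subst mult_entry[OF sqrt_series_carrier S ij]) (intro sums_sum sums_mult2 sqrt_series_entry_sums; simp)
    moreover have "(\<Sum>k<N. S $$ (i, k) * (sqrt_coeff m * (B ^\<^sub>m m) $$ (k, j))) = (\<Sum>k<N. sqrt_coeff m * (B ^\<^sub>m m) $$ (i, k) * S $$ (k, j))" for m
    proof -
      have "sqrt_coeff m * (S * (B ^\<^sub>m m)) $$ (i, j) = sqrt_coeff m * ((B ^\<^sub>m m) * S) $$ (i, j)"
        by (simp only: pc)
      then show ?thesis
        by (simp only: mult_entry[OF S pow_carrier ij] mult_entry[OF pow_carrier S ij] sum_distrib_left mult_ac)
    qed
    ultimately show "(S * sqrt_series B N) $$ (i, j) = (sqrt_series B N * S) $$ (i, j)"
      by (simp add: sums_iff)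
  qed (use S in \<open>auto simp: sqrt_series_def\<close>)
qed

end

text \<open>Put \<open>D = S - T\<close> and \<open>y = D *\<^sub>v x\<close>. Commutation and
  equality of the squares give \<open>y \<bullet> (S *\<^sub>v y) + y \<bullet> (T *\<^sub>v y) =
  0\<close>; both terms are nonnegative, so both vanish.\<close>

lemma pos_semidef_sqrt_unique:
  assumes S: "S \<in> carrier_mat N N" "pos_semidef S" and T: "T \<in> carrier_mat N N" "pos_semidef T"
    and eq: "S * S = T * T" and comm: "S * T = T * S"
  shows "S = T"
proof -
  define D where "D = S - T"
  have D: "D \<in> carrier_mat N N" unfolding D_def by (rule minus_carrier_mat[OF T(1)])
  have ST: "S\<^sup>T = S" "T\<^sup>T = T" using S T by (auto simp: pos_semidef_def)
  have "D\<^sup>T = S\<^sup>T - T\<^sup>T" unfolding D_def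
    by (rule eq_matI) (use S(1) T(1) in auto)
  then have Dsym: "D\<^sup>T = D" by (simp only: ST D_def)
  have D_mult: "D *\<^sub>v x = S *\<^sub>v x - T *\<^sub>v x" if "x \<in> carrier_vec N" for x
    unfolding D_def using S T that by (simp add: minus_mult_distrib_mat_vec)
  have SS: "S *\<^sub>v (S *\<^sub>v x) = T *\<^sub>v (T *\<^sub>v x)" and STc: "S *\<^sub>v (T *\<^sub>v x) = T *\<^sub>v (S *\<^sub>v x)"
    if "x \<in> carrier_vec N" for x
    using arg_cong[OF eq, of "\<lambda>A. A *\<^sub>v x"] arg_cong[OF comm, of "\<lambda>A. A *\<^sub>v x"]
      assoc_mult_mat_vec[OF S(1) S(1) that] assoc_mult_mat_vec[OF T(1) T(1) that]
      assoc_mult_mat_vec[OF S(1) T(1) that] assoc_mult_mat_vec[OF T(1) S(1) that] by simp_all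
  have y0: "(D *\<^sub>v x) \<bullet> (D *\<^sub>v (D *\<^sub>v x)) = 0" if x: "x \<in> carrier_vec N" for x
  proof -
    define y where "y = D *\<^sub>v x"
    have y: "y \<in> carrier_vec N" using D x by (simp add: y_def)
    have c: "S *\<^sub>v x \<in> carrier_vec N" "T *\<^sub>v x \<in> carrier_vec N" "S *\<^sub>v (S *\<^sub>v x) \<in> carrier_vec N"
      "S *\<^sub>v (T *\<^sub>v x) \<in> carrier_vec N" "T *\<^sub>v (T *\<^sub>v x) \<in> carrier_vec N" "T *\<^sub>v (S *\<^sub>v x) \<in> carrier_vec N"
      using S T x by auto
    have Sy: "S *\<^sub>v y = S *\<^sub>v (S *\<^sub>v x) - S *\<^sub>v (T *\<^sub>v x)"
      unfolding y_def D_mult[OF x] by (rule mult_minus_distrib_mat_vec[OF S(1) c(1,2)])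
    have Ty: "T *\<^sub>v y = T *\<^sub>v (S *\<^sub>v x) - T *\<^sub>v (T *\<^sub>v x)"
      unfolding y_def D_mult[OF x] by (rule mult_minus_distrib_mat_vec[OF T(1) c(1,2)])
    have neg: "y \<bullet> (T *\<^sub>v y) = - (y \<bullet> (S *\<^sub>v y))"
      unfolding Sy Ty STc[OF x] SS[OF x]
      using y c by (simp add: scalar_prod_minus_distrib[of _ N])
    have "y \<bullet> (S *\<^sub>v y) \<ge> 0" "y \<bullet> (T *\<^sub>v y) \<ge> 0"
      using S T y unfolding pos_semidef_def by auto
    with neg have "y \<bullet> (S *\<^sub>v y) = 0" "y \<bullet> (T *\<^sub>v y) = 0" by linarith+
    then have "y \<bullet> (D *\<^sub>v y) = 0"
      unfolding D_mult[OF y] using y S T by (simp add: scalar_prod_minus_distrib[of _ N])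
    then show ?thesis by (simp add: y_def)
  qed
  \<comment> \<open>By \<open>y0\<close> the product of \<open>D x\<close> and
    \<open>D (D x)\<close> vanishes for all \<open>x\<close>; taken at \<open>x + D x\<close> it
    leaves twice the squared length of \<open>D (D x)\<close>.\<close>
  have D0: "D *\<^sub>v x = 0\<^sub>v N" if x: "x \<in> carrier_vec N" for x
  proof -
    define d1 where "d1 = D *\<^sub>v x"
    define d2 where "d2 = D *\<^sub>v d1"
    define d3 where "d3 = D *\<^sub>v d2"
    have d: "d1 \<in> carrier_vec N" "d2 \<in> carrier_vec N" "d3 \<in> carrier_vec N"
      using D x by (auto simp: d1_def d2_def d3_def)
    have "D *\<^sub>v (x + d1) = d1 + d2"
      unfolding d1_def d2_def using D x by (simp add: mult_add_distrib_mat_vec)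
    moreover have "D *\<^sub>v (d1 + d2) = d2 + d3"
      unfolding d2_def d3_def using D d by (simp add: mult_add_distrib_mat_vec)
    ultimately have "(d1 + d2) \<bullet> (d2 + d3) = 0"
      using y0[of "x + d1"] x d by simp
    then have "d1 \<bullet> d2 + d1 \<bullet> d3 + (d2 \<bullet> d2 + d2 \<bullet> d3) = 0"
      using d by (simp add: add_scalar_prod_distrib[of _ N] scalar_prod_add_distrib[of _ N])
    moreover have "d1 \<bullet> d2 = 0" using y0[OF x] by (simp add: d1_def d2_def)
    moreover have "d2 \<bullet> d3 = 0" using y0[OF d(1)] by (simp add: d2_def d3_def)
    moreover have "d1 \<bullet> d3 = d2 \<bullet> d2"
      using symmetric_scalar_prod[OF D Dsym d(1,2)] by (simp add: d2_def d3_def)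
    ultimately have "d2 \<bullet> d2 = 0" by simp
    then have "d2 = 0\<^sub>v N" by (rule scalar_prod_self_eq_0[OF d(2)])
    then have "d1 \<bullet> d1 = 0"
      using symmetric_scalar_prod[OF D Dsym x d(1)] x by (simp add: d1_def[symmetric] d2_def[symmetric])
    then show ?thesis using scalar_prod_self_eq_0[OF d(1)] by (simp add: d1_def)
  qed
  show ?thesis
  proof (rule eq_matI)
    fix i j assume "i < dim_row T" "j < dim_col T"
    then have ij: "i < N" "j < N" using T by auto
    have "(D *\<^sub>v unit_vec N j) $ i = 0" using D0[of "unit_vec N j"] ij by simp
    then have "D $$ (i, j) = 0" using D ij by (simp add: mult_mat_vec_def scalar_prod_right_unit)
    then show "S $$ (i, j) = T $$ (i, j)" using ij S T by (simp add: D_def)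
  qed (use S T in auto)
qed

text \<open>Rescaling puts \<open>B = 1 - A / c\<^sup>2\<close> between 0 and 1, and
  \<open>c\<close> times \<open>1 - sqrt_series B N\<close> is a root of \<open>A\<close>. The
  uniqueness demanded by the definite description is reduced to commuting roots.\<close>

lemma
  fixes A :: "real mat"
  assumes A: "A \<in> carrier_mat N N" and sym: "A\<^sup>T = A" and c: "c > 0"
    and A0: "\<And>x. x \<in> carrier_vec N \<Longrightarrow> 0 \<le> x \<bullet> (A *\<^sub>v x)"
    and A1: "\<And>x. x \<in> carrier_vec N \<Longrightarrow> x \<bullet> (A *\<^sub>v x) \<le> c\<^sup>2 * (x \<bullet> x)"
  shows mat_sqrt_eq: "mat_sqrt A = c \<cdot>\<^sub>m (1\<^sub>m N - sqrt_series (1\<^sub>m N - (1 / c\<^sup>2) \<cdot>\<^sub>m A) N)" (is "_ = ?T")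
    and mat_sqrt_carrier: "mat_sqrt A \<in> carrier_mat N N"
    and mat_sqrt_symmetric: "(mat_sqrt A)\<^sup>T = mat_sqrt A"
    and mat_sqrt_square: "mat_sqrt A * mat_sqrt A = A"
proof -
  define B where "B = 1\<^sub>m N - (1 / c\<^sup>2) \<cdot>\<^sub>m A"
  have B: "B \<in> carrier_mat N N"
    unfolding B_def by (rule minus_carrier_mat[OF smult_carrier_mat[OF A]])
  have A_ij: "A $$ (j, i) = A $$ (i, j)" if "i < N" "j < N" for i j
    using arg_cong[OF sym, of "\<lambda>A. A $$ (i, j)"] index_transpose_mat(1)[of i A j] that A by auto
  have symB: "B\<^sup>T = B"
    by (rule eq_matI) (use A A_ij in \<open>auto simp: B_def\<close>)
  have Bx: "x \<bullet> (B *\<^sub>v x) = x \<bullet> x - (1 / c\<^sup>2) * (x \<bullet> (A *\<^sub>v x))" if x: "x \<in> carrier_vec N" for x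
  proof -
    have Ax: "A *\<^sub>v x \<in> carrier_vec N" using A x by simp
    have "((1 / c\<^sup>2) \<cdot>\<^sub>m A) *\<^sub>v x = (1 / c\<^sup>2) \<cdot>\<^sub>v (A *\<^sub>v x)"
      using A x by (intro eq_vecI) (auto simp: mult_mat_vec_def)
    then have "B *\<^sub>v x = x - (1 / c\<^sup>2) \<cdot>\<^sub>v (A *\<^sub>v x)"
      unfolding B_def using A x by (simp add: minus_mult_distrib_mat_vec[of _ N N])
    then show ?thesis using x Ax by (simp add: scalar_prod_minus_distrib[of _ N])
  qed
  have B0: "0 \<le> x \<bullet> (B *\<^sub>v x)" and B1: "x \<bullet> (B *\<^sub>v x) \<le> x \<bullet> x" if x: "x \<in> carrier_vec N" for x
    using A0[OF x] A1[OF x] c unfolding Bx[OF x] by (auto simp: field_simps)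
  define P where "P = sqrt_series B N"
  have P: "P \<in> carrier_mat N N" "P\<^sup>T = P" "P * P = 2 \<cdot>\<^sub>m P - B"
    using sqrt_series_carrier[of B N] sqrt_series_symmetric[OF B symB B0 B1] sqrt_series_square[OF B symB B0 B1]
    unfolding P_def by simp_all
  have P_ij: "P $$ (j, i) = P $$ (i, j)" if "i < N" "j < N" for i j
    using arg_cong[OF P(2), of "\<lambda>A. A $$ (i, j)"] index_transpose_mat(1)[of i P j] that P(1) by auto
  define T where "T = c \<cdot>\<^sub>m (1\<^sub>m N - P)"
  have oneP: "1\<^sub>m N - P \<in> carrier_mat N N" by (rule minus_carrier_mat[OF P(1)])
  have T: "T \<in> carrier_mat N N" unfolding T_def by (rule smult_carrier_mat[OF oneP])
  have Tsym: "T\<^sup>T = T"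
    by (rule eq_matI) (use P P_ij in \<open>auto simp: T_def\<close>)
  have Tx: "x \<bullet> (T *\<^sub>v x) = c * (x \<bullet> x - x \<bullet> (P *\<^sub>v x))" if x: "x \<in> carrier_vec N" for x
  proof -
    have Px: "P *\<^sub>v x \<in> carrier_vec N" using P x by simp
    have "T *\<^sub>v x = c \<cdot>\<^sub>v ((1\<^sub>m N - P) *\<^sub>v x)"
      unfolding T_def using P x by (intro eq_vecI) (auto simp: mult_mat_vec_def)
    also have "(1\<^sub>m N - P) *\<^sub>v x = x - P *\<^sub>v x"
      using P x by (simp add: minus_mult_distrib_mat_vec[of _ N N])
    finally show ?thesis using x Px by (simp add: scalar_prod_minus_distrib[of _ N])
  qed
  have Tpsd: "pos_semidef T"
    unfolding pos_semidef_def
  proof (intro conjI Tsym ballI)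
    fix x :: "real vec" assume "x \<in> carrier_vec (dim_row T)"
    then have x: "x \<in> carrier_vec N" using T by simp
    show "0 \<le> x \<bullet> (T *\<^sub>v x)"
      unfolding Tx[OF x] using c sqrt_series_le[OF B symB B0 B1 x] by (simp add: P_def)
  qed
  have TT: "T * T = A"
  proof -
    have "(1\<^sub>m N - P) * (1\<^sub>m N - P) = 1\<^sub>m N - P - (P - P * P)"
      unfolding minus_mult_distrib_mat[OF one_carrier_mat P(1) oneP] mult_minus_distrib_mat[OF P(1) one_carrier_mat P(1)]
        left_mult_one_mat[OF oneP] right_mult_one_mat[OF P(1)] ..
    moreover have "T * T = c \<cdot>\<^sub>m (c \<cdot>\<^sub>m ((1\<^sub>m N - P) * (1\<^sub>m N - P)))"
      unfolding T_def mult_smult_assoc_mat[OF oneP smult_carrier_mat[OF oneP]] mult_smult_distrib[OF oneP oneP] ..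
    ultimately have "T * T = c \<cdot>\<^sub>m (c \<cdot>\<^sub>m (1\<^sub>m N - P - (P - P * P)))" by simp
    also have "\<dots> = A"
    proof (rule eq_matI)
      fix i j assume "i < dim_row A" "j < dim_col A"
      then have ij: "i < N" "j < N" using A by auto
      have "(c \<cdot>\<^sub>m (c \<cdot>\<^sub>m (1\<^sub>m N - P - (P - P * P)))) $$ (i, j) =
          (c * c) * (1\<^sub>m N $$ (i, j) - P $$ (i, j) - (P $$ (i, j) - (P * P) $$ (i, j)))"
        using ij P(1) by simp
      also have "(P * P) $$ (i, j) = 2 * P $$ (i, j) - (1\<^sub>m N $$ (i, j) - (1 / c\<^sup>2) * A $$ (i, j))"
        unfolding P(3) using ij P(1) A carrier_matD[OF B] by (simp, simp add: B_def)
      finally show "(c \<cdot>\<^sub>m (c \<cdot>\<^sub>m (1\<^sub>m N - P - (P - P * P)))) $$ (i, j) = A $$ (i, j)"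
        using c by (simp add: power2_eq_square)
    qed (use P(1) A in auto)
    finally show ?thesis .
  qed
  have "mat_sqrt A = T"
    unfolding mat_sqrt_def
  proof (rule the_equality)
    show "T \<in> carrier_mat (dim_row A) (dim_row A) \<and> pos_semidef T \<and> T * T = A"
      using T A Tpsd TT by simp
    fix S assume "S \<in> carrier_mat (dim_row A) (dim_row A) \<and> pos_semidef S \<and> S * S = A"
    then have S: "S \<in> carrier_mat N N" "pos_semidef S" "S * S = A" using A by auto
    \<comment> \<open>Any root commutes with its own square \<open>A\<close>, hence with the series
      in \<open>A\<close>.\<close>
    have "S * A = A * S"
      using S(1) by (simp add: S(3)[symmetric] assoc_mult_mat[of _ N N _ N _ N])
    then have "S * B = B * S"
      unfolding B_def minus_mult_distrib_mat[OF one_carrier_mat smult_carrier_mat[OF A] S(1)]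
        mult_minus_distrib_mat[OF S(1) one_carrier_mat smult_carrier_mat[OF A]]
        mult_smult_assoc_mat[OF A S(1)] mult_smult_distrib[OF S(1) A]
        left_mult_one_mat[OF S(1)] right_mult_one_mat[OF S(1)] by simp
    then have "S * P = P * S"
      unfolding P_def using sqrt_series_commute[OF B symB B0 B1 S(1)] by blast
    then have "S * T = T * S"
      unfolding T_def mult_smult_assoc_mat[OF oneP S(1)] mult_smult_distrib[OF S(1) oneP]
        minus_mult_distrib_mat[OF one_carrier_mat P(1) S(1)] mult_minus_distrib_mat[OF S(1) one_carrier_mat P(1)]
        left_mult_one_mat[OF S(1)] right_mult_one_mat[OF S(1)] by simp
    then show "S = T"
      by (intro pos_semidef_sqrt_unique[OF S(1,2) T Tpsd]) (simp_all add: S(3) TT)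
  qed
  then show "mat_sqrt A = ?T" "mat_sqrt A \<in> carrier_mat N N" "(mat_sqrt A)\<^sup>T = mat_sqrt A" "mat_sqrt A * mat_sqrt A = A"
    using T Tsym TT by (simp_all add: T_def P_def B_def)
qed

lemma borel_measurable_pow_entry:
  assumes "\<And>\<omega>. \<omega> \<in> space M \<Longrightarrow> B \<omega> \<in> carrier_mat N N"
    and "\<And>i j. i < N \<Longrightarrow> j < N \<Longrightarrow> (\<lambda>\<omega>. (B \<omega> $$ (i, j) :: real)) \<in> borel_measurable M"
    and "i < N" "j < N"
  shows "(\<lambda>\<omega>. (B \<omega> ^\<^sub>m m) $$ (i, j)) \<in> borel_measurable M"
  using assms(3,4)
proof (induction m arbitrary: i j)
  case 0
  have "(B \<omega> ^\<^sub>m 0) $$ (i, j) = (1\<^sub>m N :: real mat) $$ (i, j)" if "\<omega> \<in> space M" for \<omega>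
    using assms(1)[OF that] by simp
  then show ?case by (simp cong: measurable_cong)
next
  case (Suc m)
  have "(B \<omega> ^\<^sub>m Suc m) $$ (i, j) = (\<Sum>k<N. (B \<omega> ^\<^sub>m m) $$ (i, k) * B \<omega> $$ (k, j))" if "\<omega> \<in> space M" for \<omega>
    using assms(1)[OF that] Suc.prems by (simp add: scalar_prod_def atLeast0LessThan)
  moreover have "(\<lambda>\<omega>. \<Sum>k<N. (B \<omega> ^\<^sub>m m) $$ (i, k) * B \<omega> $$ (k, j)) \<in> borel_measurable M"
    using Suc assms(2) by (intro borel_measurable_sum borel_measurable_times) auto
  ultimately show ?case by (simp cong: measurable_cong)
qed

text \<open>A definite description carries no measurability; the series writes each entry of the
  root as a countable sum of polynomials in the entries of \<open>A\<close>.\<close>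

lemma borel_measurable_mat_sqrt:
  fixes A :: "'a \<Rightarrow> real mat"
  assumes A: "\<And>\<omega>. \<omega> \<in> space M \<Longrightarrow> A \<omega> \<in> carrier_mat N N" and sym: "\<And>\<omega>. \<omega> \<in> space M \<Longrightarrow> (A \<omega>)\<^sup>T = A \<omega>" and c: "c > 0"
    and A0: "\<And>\<omega> x. \<omega> \<in> space M \<Longrightarrow> x \<in> carrier_vec N \<Longrightarrow> 0 \<le> x \<bullet> (A \<omega> *\<^sub>v x)"
    and A1: "\<And>\<omega> x. \<omega> \<in> space M \<Longrightarrow> x \<in> carrier_vec N \<Longrightarrow> x \<bullet> (A \<omega> *\<^sub>v x) \<le> c\<^sup>2 * (x \<bullet> x)"
    and meas: "\<And>i j. i < N \<Longrightarrow> j < N \<Longrightarrow> (\<lambda>\<omega>. A \<omega> $$ (i, j)) \<in> borel_measurable M"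
    and ij: "i < N" "j < N"
  shows "(\<lambda>\<omega>. mat_sqrt (A \<omega>) $$ (i, j)) \<in> borel_measurable M"
proof -
  define B where "B \<omega> = 1\<^sub>m N - (1 / c\<^sup>2) \<cdot>\<^sub>m A \<omega>" for \<omega>
  have B: "B \<omega> \<in> carrier_mat N N" if "\<omega> \<in> space M" for \<omega>
    unfolding B_def by (rule minus_carrier_mat[OF smult_carrier_mat[OF A[OF that]]])
  have mB: "(\<lambda>\<omega>. B \<omega> $$ (i, j)) \<in> borel_measurable M" if "i < N" "j < N" for i j
  proof -
    have "B \<omega> $$ (i, j) = (1\<^sub>m N) $$ (i, j) - (1 / c\<^sup>2) * A \<omega> $$ (i, j)" if "\<omega> \<in> space M" for \<omega>
      using A[OF that] \<open>i < N\<close> \<open>j < N\<close> by (simp add: B_def)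
    moreover have "(\<lambda>\<omega>. (1\<^sub>m N) $$ (i, j) - (1 / c\<^sup>2) * A \<omega> $$ (i, j)) \<in> borel_measurable M"
      using meas[OF that] by measurable
    ultimately show ?thesis by (simp cong: measurable_cong)
  qed
  have "mat_sqrt (A \<omega>) $$ (i, j) = c * ((1\<^sub>m N) $$ (i, j) - (\<Sum>m. sqrt_coeff m * (B \<omega> ^\<^sub>m m) $$ (i, j)))"
    if w: "\<omega> \<in> space M" for \<omega>
  proof -
    have "mat_sqrt (A \<omega>) = c \<cdot>\<^sub>m (1\<^sub>m N - sqrt_series (1\<^sub>m N - (1 / c\<^sup>2) \<cdot>\<^sub>m A \<omega>) N)"
      by (rule mat_sqrt_eq[OF A[OF w] sym[OF w] c]) (use w in \<open>auto intro: A0 A1\<close>)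
    then show ?thesis using ij by (simp add: B_def sqrt_series_def)
  qed
  moreover have "(\<lambda>\<omega>. c * ((1\<^sub>m N) $$ (i, j) - (\<Sum>m. sqrt_coeff m * (B \<omega> ^\<^sub>m m) $$ (i, j)))) \<in> borel_measurable M"
    using borel_measurable_pow_entry[OF B mB ij]
    by (intro borel_measurable_times borel_measurable_diff borel_measurable_suminf borel_measurable_const) auto
  ultimately show ?thesis by (simp cong: measurable_cong)
qed

section \<open>Cell averages, the matrix \<open>C_mat\<close> and the field
  \<open>U_disc\<close>\<close>

lemma cell_unique:
  assumes "x \<in> cell n i" "x \<in> cell n j" shows "i = j"
proof -
  have *: "real i \<le> x * 2 ^ n" "x * 2 ^ n < real i + 1" "real j \<le> x * 2 ^ n" "x * 2 ^ n < real j + 1"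
    using assms by (auto simp: cell_def field_simps)
  then have "real i < real j + 1" "real j < real i + 1" by linarith+
  then show ?thesis by linarith
qed

lemma cell_ex:
  assumes "0 \<le> x" "x < 1" obtains i where "i < 2 ^ n" "x \<in> cell n i"
proof -
  define i where "i = nat \<lfloor>x * 2 ^ n\<rfloor>"
  have "real i = of_int \<lfloor>x * 2 ^ n\<rfloor>" using assms by (simp add: i_def)
  then have i: "real i \<le> x * 2 ^ n" "x * 2 ^ n < real i + 1" by linarith+
  have "x * 2 ^ n < 1 * 2 ^ n" using assms by (intro mult_strict_right_mono) auto
  then have "real i < 2 ^ n" using i(1) by linarith
  then have "i < 2 ^ n" by (metis of_nat_less_iff of_nat_numeral of_nat_power)
  moreover have "x \<in> cell n i" using i by (auto simp: cell_def field_simps)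
  ultimately show thesis by (rule that)
qed

lemma indicator_cell_measurable [measurable]: "(indicator (cell n i) :: real \<Rightarrow> real) \<in> borel_measurable circ"
  by (intro borel_measurable_circI borel_measurable_indicator) (simp add: cell_def)

lemma Q_op_measurable [measurable]: "Q_op n v \<in> borel_measurable circ"
  unfolding Q_op_def[abs_def]
  by (rule borel_measurable_times[OF borel_measurable_const], rule borel_measurable_sum,
      rule borel_measurable_times[OF borel_measurable_const], rule indicator_cell_measurable)

lemma sum_indicator_cell:
  assumes "i < 2 ^ n" "x \<in> cell n i"
  shows "(\<Sum>j<2^n. c j * indicator (cell n j) x) = (c i :: real)"
proof -
  have "(\<Sum>j<2^n. c j * indicator (cell n j) x) = (\<Sum>j<2^n. if j = i then c j else 0)"
    using assms(2) by (intro sum.cong refl) (auto simp: indicator_def dest: cell_unique[OF assms(2)])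
  then show ?thesis using assms by simp
qed

text \<open>Holds only almost everywhere, as the point 1 lies in no cell. It exhibits the multiplier
  as a step function determined by finitely many cell integrals.\<close>

lemma inverse_Q_op_AE:
  "AE x in circ. inverse (\<epsilon>\<^sup>2 + (Q_op n v x)\<^sup>2) =
     (\<Sum>i<2^n. inverse (\<epsilon>\<^sup>2 + (2 ^ n * (LINT y:cell n i|circ. v y))\<^sup>2) * indicator (cell n i) x)"
proof -
  have "AE x in circ. x \<noteq> 1"
    unfolding circ_def
    by (subst AE_restrict_space_iff) (auto simp: AE_completion_iff intro: AE_mp[OF AE_lborel_singleton[of 1]])
  then show ?thesis
  proof (rule AE_mp, intro AE_I2 impI)
    fix x :: real assume "x \<in> space circ" "x \<noteq> 1"
    then obtain i where i: "i < 2 ^ n" "x \<in> cell n i" using cell_ex[of x n] by auto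
    show "inverse (\<epsilon>\<^sup>2 + (Q_op n v x)\<^sup>2) =
     (\<Sum>i<2^n. inverse (\<epsilon>\<^sup>2 + (2 ^ n * (LINT y:cell n i|circ. v y))\<^sup>2) * indicator (cell n i) x)"
      unfolding Q_op_def sum_indicator_cell[OF i] ..
  qed
qed

context
  fixes \<epsilon> q :: real and f :: "nat \<Rightarrow> real \<Rightarrow> real"
  assumes \<epsilon>: "\<epsilon> > 0"
    and f: "orthonormal_basis_H1 (ip_D \<epsilon> q) (\<lambda>j. fourier_real (f j))" "spans_PL f"
begin

lemma f_H_real_1: "fourier_real (f j) \<in> H_real 1"
  and f_orthonormal: "ip_D \<epsilon> q (fourier_real (f i)) (fourier_real (f j)) = (if i = j then 1 else 0)"
  using f(1) by (auto simp: orthonormal_basis_H1_def)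

definition Df :: "nat \<Rightarrow> real \<Rightarrow> real" where
  "Df j = real_fun_of (Dq \<epsilon> q (fourier_real (f j)))"

lemma Df_Lp_2: "Df j \<in> Lp 2"
  unfolding Df_def using Dq_H_real_0[OF f_H_real_1[of j]]
  by (intro real_fun_of_Lp_2) (auto simp: Sob_real_def H_iff)

lemma Df_orthonormal: "(LINT x|circ. Df i x * Df j x) = (if i = j then 1 else 0)"
  using f_orthonormal[of i j] by (simp add: ip_D_def H_inner_def Df_def L2_inner_def)

lemma C_mat_carrier: "C_mat \<epsilon> q f n v \<in> carrier_mat (2^n) (2^n)"
  by (simp add: C_mat_def)

lemma C_mat_entry: "j < 2^n \<Longrightarrow> k < 2^n \<Longrightarrow> C_mat \<epsilon> q f n v $$ (j, k) =
    (LINT x|circ. inverse (\<epsilon>\<^sup>2 + (Q_op n v x)\<^sup>2) * (Df j x * Df k x))"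
  by (simp add: C_mat_def L2_inner_def Lambda_op_def Df_def mult_ac)

lemma lambda_bounds: "0 \<le> inverse (\<epsilon>\<^sup>2 + (Q_op n v x)\<^sup>2)" "inverse (\<epsilon>\<^sup>2 + (Q_op n v x)\<^sup>2) \<le> (1 / \<epsilon>)\<^sup>2"
proof -
  have "inverse (\<epsilon>\<^sup>2 + (Q_op n v x)\<^sup>2) \<le> inverse (\<epsilon>\<^sup>2)"
    using \<epsilon> by (intro le_imp_inverse_le) auto
  then show "inverse (\<epsilon>\<^sup>2 + (Q_op n v x)\<^sup>2) \<le> (1 / \<epsilon>)\<^sup>2" by (simp add: power_divide inverse_eq_divide)
qed simp

lemma integrable_lambda: "h \<in> borel_measurable circ \<Longrightarrow> integrable circ h \<Longrightarrow> integrable circ (\<lambda>x. inverse (\<epsilon>\<^sup>2 + (Q_op n v x)\<^sup>2) * (h x :: real))"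
  using integrable_mult_bounded[of h "\<lambda>x. inverse (\<epsilon>\<^sup>2 + (Q_op n v x)\<^sup>2)" "(1 / \<epsilon>)\<^sup>2"] lambda_bounds
  by (simp add: mult.commute abs_of_nonneg)

lemma integrable_Df_mult: "integrable circ (\<lambda>x. Df i x * Df j x)"
  by (rule integrable_mult_Lp_2[OF Df_Lp_2 Df_Lp_2])

lemma C_mat_symmetric: "(C_mat \<epsilon> q f n v)\<^sup>T = C_mat \<epsilon> q f n v"
  by (rule eq_matI) (auto simp: C_mat_def L2_inner_def Lambda_op_def mult_ac)

lemma sum_Df_square: "(\<Sum>i<N. (x :: real vec) $ i * Df i t)\<^sup>2 = (\<Sum>i<N. \<Sum>j<N. x $ i * x $ j * (Df i t * Df j t))"
  by (simp add: power2_eq_square sum_product mult_ac)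

text \<open>\<open>C_mat\<close> is the Gram matrix of the functions \<open>Df i\<close> for the
  weight by which \<open>Lambda_op\<close> multiplies.\<close>

lemma C_mat_form:
  assumes x: "x \<in> carrier_vec (2^n)"
  shows "x \<bullet> (C_mat \<epsilon> q f n v *\<^sub>v x) =
    (LINT t|circ. inverse (\<epsilon>\<^sup>2 + (Q_op n v t)\<^sup>2) * (\<Sum>i<2^n. x $ i * Df i t)\<^sup>2)"
proof -
  have "(LINT t|circ. inverse (\<epsilon>\<^sup>2 + (Q_op n v t)\<^sup>2) * (\<Sum>i<2^n. x $ i * Df i t)\<^sup>2) =
    (LINT t|circ. (\<Sum>i<2^n. \<Sum>j<2^n. x $ i * x $ j * (inverse (\<epsilon>\<^sup>2 + (Q_op n v t)\<^sup>2) * (Df i t * Df j t))))"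
    unfolding sum_Df_square by (simp add: sum_distrib_left mult_ac)
  also have "\<dots> = (\<Sum>i<2^n. \<Sum>j<2^n. x $ i * x $ j * (LINT t|circ. inverse (\<epsilon>\<^sup>2 + (Q_op n v t)\<^sup>2) * (Df i t * Df j t)))"
    using integrable_lambda[OF _ integrable_Df_mult] integrable_Df_mult
    by (subst Bochner_Integration.integral_sum; auto intro!: Bochner_Integration.integrable_sum sum.cong integrable_mult_right)
  also have "\<dots> = x \<bullet> (C_mat \<epsilon> q f n v *\<^sub>v x)"
    unfolding scalar_prod_mult_vec_expand[OF C_mat_carrier x] by (intro sum.cong refl) (simp add: C_mat_entry)
  finally show ?thesis by simp
qed

lemma integral_sum_Df_square:
  assumes x: "x \<in> carrier_vec N"
  shows "(LINT t|circ. (\<Sum>i<N. x $ i * Df i t)\<^sup>2) = x \<bullet> x"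
proof -
  have "(LINT t|circ. (\<Sum>i<N. x $ i * Df i t)\<^sup>2) = (\<Sum>i<N. \<Sum>j<N. x $ i * x $ j * (LINT t|circ. Df i t * Df j t))"
    unfolding sum_Df_square using integrable_Df_mult
    by (subst Bochner_Integration.integral_sum; auto intro!: Bochner_Integration.integrable_sum sum.cong integrable_mult_right)
  also have "\<dots> = (\<Sum>i<N. \<Sum>j<N. if j = i then x $ i * x $ j else 0)"
    by (intro sum.cong refl) (auto simp: Df_orthonormal)
  also have "\<dots> = x \<bullet> x" using x by (simp add: scalar_prod_def atLeast0LessThan)
  finally show ?thesis .
qed

text \<open>The weight lies between 0 and \<open>(1 / \<epsilon>)\<^sup>2\<close> and the functions
  \<open>Df i\<close> are orthonormal in L2, so the Gram form is bounded whatever \<open>v\<close>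
  is.\<close>

lemma C_mat_bounds:
  assumes x: "x \<in> carrier_vec (2^n)"
  shows "0 \<le> x \<bullet> (C_mat \<epsilon> q f n v *\<^sub>v x)" "x \<bullet> (C_mat \<epsilon> q f n v *\<^sub>v x) \<le> (1 / \<epsilon>)\<^sup>2 * (x \<bullet> x)"
proof -
  let ?s = "\<lambda>t. (\<Sum>i<2^n. x $ i * Df i t)\<^sup>2"
  show "0 \<le> x \<bullet> (C_mat \<epsilon> q f n v *\<^sub>v x)"
    unfolding C_mat_form[OF x] using lambda_bounds by (intro integral_nonneg_AE AE_I2 mult_nonneg_nonneg) auto
  have "(\<lambda>t. \<Sum>i<2^n. x $ i * Df i t) \<in> Lp 2" by (intro Lp_2_sum Lp_2_cmult Df_Lp_2)
  then have i: "integrable circ ?s" by (simp add: Lp_2_iff)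
  have "x \<bullet> (C_mat \<epsilon> q f n v *\<^sub>v x) \<le> (LINT t|circ. (1 / \<epsilon>)\<^sup>2 * ?s t)"
    unfolding C_mat_form[OF x]
    by (rule Bochner_Integration.integral_mono) (use i in \<open>auto intro!: integrable_lambda mult_right_mono lambda_bounds\<close>)
  also have "\<dots> = (1 / \<epsilon>)\<^sup>2 * (LINT t|circ. ?s t)" by (rule integral_mult_right_zero)
  also have "\<dots> = (1 / \<epsilon>)\<^sup>2 * (x \<bullet> x)" by (simp only: integral_sum_Df_square[OF x])
  finally show "x \<bullet> (C_mat \<epsilon> q f n v *\<^sub>v x) \<le> (1 / \<epsilon>)\<^sup>2 * (x \<bullet> x)" .
qed

lemma mat_sqrt_C_mat:
  shows "mat_sqrt (C_mat \<epsilon> q f n v) \<in> carrier_mat (2^n) (2^n)"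
    "(mat_sqrt (C_mat \<epsilon> q f n v))\<^sup>T = mat_sqrt (C_mat \<epsilon> q f n v)"
    "mat_sqrt (C_mat \<epsilon> q f n v) * mat_sqrt (C_mat \<epsilon> q f n v) = C_mat \<epsilon> q f n v"
proof -
  have c: "1 / \<epsilon> > 0" using \<epsilon> by simp
  note * = C_mat_carrier C_mat_symmetric c C_mat_bounds
  show "mat_sqrt (C_mat \<epsilon> q f n v) \<in> carrier_mat (2^n) (2^n)"
    by (rule mat_sqrt_carrier[OF *(1-3)]) (auto intro: C_mat_bounds)
  show "(mat_sqrt (C_mat \<epsilon> q f n v))\<^sup>T = mat_sqrt (C_mat \<epsilon> q f n v)"
    by (rule mat_sqrt_symmetric[OF *(1-3)]) (auto intro: C_mat_bounds)
  show "mat_sqrt (C_mat \<epsilon> q f n v) * mat_sqrt (C_mat \<epsilon> q f n v) = C_mat \<epsilon> q f n v"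
    by (rule mat_sqrt_square[OF *(1-3)]) (auto intro: C_mat_bounds)
qed

lemma U_disc_Lp_2: "U_disc \<epsilon> q f Vn WN n \<omega> \<in> Lp 2"
proof (rule Lp_2_continuous)
  show "continuous_on UNIV (U_disc \<epsilon> q f Vn WN n \<omega>)"
    unfolding U_disc_def by (intro continuous_intros spans_PL_continuous[OF f(2)])
qed

lemma fourier_U_disc: "fourier_real (U_disc \<epsilon> q f Vn WN n \<omega>) k =
   (\<Sum>j<2^n. of_real ((mat_sqrt (C_mat \<epsilon> q f n (Vn n (snd \<omega>))) *\<^sub>v WN n (fst \<omega>)) $ j) * fourier_real (f j) k)"
proof -
  have "integrable circ (\<lambda>x. complex_of_real (f j x))" for j
    by (intro integrable_Lp_2 Lp_2_of_real Lp_2_continuous spans_PL_continuous[OF f(2)])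
  then have "fourier (\<lambda>x. \<Sum>j<2^n. of_real ((mat_sqrt (C_mat \<epsilon> q f n (Vn n (snd \<omega>))) *\<^sub>v WN n (fst \<omega>)) $ j) * complex_of_real (f j x)) k =
     (\<Sum>j<2^n. fourier (\<lambda>x. of_real ((mat_sqrt (C_mat \<epsilon> q f n (Vn n (snd \<omega>))) *\<^sub>v WN n (fst \<omega>)) $ j) * complex_of_real (f j x)) k)"
    by (intro fourier_sum integrable_mult_right)
  then show ?thesis by (simp add: U_disc_def fourier_cmult)
qed

lemma f_coeff_bounds:
  "(\<Sum>j<2^n. (Re (fourier_real (f j) k))\<^sup>2) \<le> 1 / (norm (Dq_symbol \<epsilon> q k))\<^sup>2"
  "(\<Sum>j<2^n. (Im (fourier_real (f j) k))\<^sup>2) \<le> 1 / (norm (Dq_symbol \<epsilon> q k))\<^sup>2"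
proof -
  have pos: "(norm (Dq_symbol \<epsilon> q k))\<^sup>2 > 0" for k using Dq_symbol_nz[OF \<epsilon>] by simp
  show "(\<Sum>j<2^n. (Re (fourier_real (f j) k))\<^sup>2) \<le> 1 / (norm (Dq_symbol \<epsilon> q k))\<^sup>2"
    "(\<Sum>j<2^n. (Im (fourier_real (f j) k))\<^sup>2) \<le> 1 / (norm (Dq_symbol \<epsilon> q k))\<^sup>2"
    using orthonormal_coeff_bound[of "2^n" "\<lambda>k. (norm (Dq_symbol \<epsilon> q k))\<^sup>2" "\<lambda>j. fourier_real (f j)" "ip_D \<epsilon> q" k,
        OF ip_D_has_sum[OF f_H_real_1 f_H_real_1] f_orthonormal less_imp_le[OF pos]]
    by (simp_all only: pos_le_divide_eq[OF pos] mult.commute)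
qed

text \<open>With \<open>S\<close> the symmetric root,
  \<open>r \<bullet> (S *\<^sub>v W \<omega>)\<close> equals
  \<open>(S *\<^sub>v r) \<bullet> W \<omega>\<close>, and its variance is
  \<open>r \<bullet> (C *\<^sub>v r)\<close> for the matrix \<open>C = S * S\<close>. The function
  \<open>v\<close> is frozen, so only the Gaussian vector is random.\<close>

lemma subgaussian_sqrt_C_mat:
  assumes M: "prob_space M" and W: "gaussian_vec_id M (2^n) W"
    and c: "(\<Sum>j<2^n. (c j)\<^sup>2) \<le> 1 / (norm (Dq_symbol \<epsilon> q k))\<^sup>2"
  shows "subgaussian M (\<lambda>\<omega>. \<Sum>j<2^n. (mat_sqrt (C_mat \<epsilon> q f n v) *\<^sub>v W \<omega>) $ j * c j)
     ((1 / \<epsilon>)\<^sup>2 * (1 / (norm (Dq_symbol \<epsilon> q k))\<^sup>2))"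
proof -
  define S where "S = mat_sqrt (C_mat \<epsilon> q f n v)"
  note S = mat_sqrt_C_mat[of n v, folded S_def]
  define r where "r = vec (2^n) c"
  have r: "r \<in> carrier_vec (2^n)" by (simp add: r_def)
  have Sr: "S *\<^sub>v r \<in> carrier_vec (2^n)" using S(1) r by simp
  have Wc: "W \<omega> \<in> carrier_vec (2^n)" if "\<omega> \<in> space M" for \<omega>
    using W that by (simp add: gaussian_vec_id_def)
  have eq: "(\<Sum>j<2^n. (S *\<^sub>v W \<omega>) $ j * c j) = (S *\<^sub>v r) \<bullet> W \<omega>" if "\<omega> \<in> space M" for \<omega>
  proof -
    have "(\<Sum>j<2^n. (S *\<^sub>v W \<omega>) $ j * c j) = r \<bullet> (S *\<^sub>v W \<omega>)"
      using S(1) by (simp add: scalar_prod_def atLeast0LessThan r_def mult.commute)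
    then show ?thesis using symmetric_scalar_prod[OF S(1,2) r Wc[OF that]] by simp
  qed
  have var: "(S *\<^sub>v r) \<bullet> (S *\<^sub>v r) \<le> (1 / \<epsilon>)\<^sup>2 * (1 / (norm (Dq_symbol \<epsilon> q k))\<^sup>2)"
  proof -
    have "(S *\<^sub>v r) \<bullet> (S *\<^sub>v r) = r \<bullet> (S *\<^sub>v (S *\<^sub>v r))"
      by (rule symmetric_scalar_prod[OF S(1,2) r Sr])
    also have "\<dots> = r \<bullet> (C_mat \<epsilon> q f n v *\<^sub>v r)"
      by (simp only: assoc_mult_mat_vec[OF S(1) S(1) r, symmetric] S(3))
    also have "\<dots> \<le> (1 / \<epsilon>)\<^sup>2 * (r \<bullet> r)" by (rule C_mat_bounds(2)[OF r])
    also have "r \<bullet> r = (\<Sum>j<2^n. (c j)\<^sup>2)"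
      by (simp add: r_def scalar_prod_def atLeast0LessThan power2_eq_square)
    also have "(1 / \<epsilon>)\<^sup>2 * (\<Sum>j<2^n. (c j)\<^sup>2) \<le> (1 / \<epsilon>)\<^sup>2 * (1 / (norm (Dq_symbol \<epsilon> q k))\<^sup>2)"
      by (intro mult_left_mono c) auto
    finally show ?thesis .
  qed
  have "subgaussian M (\<lambda>\<omega>. (S *\<^sub>v r) \<bullet> W \<omega>) ((1 / \<epsilon>)\<^sup>2 * (1 / (norm (Dq_symbol \<epsilon> q k))\<^sup>2))"
    by (rule subgaussian_mono[OF subgaussian_gaussian_vec[OF M W Sr] var])
  then show ?thesis unfolding S_def[symmetric]
    unfolding subgaussian_def by (simp add: eq cong: measurable_cong nn_integral_cong)
qed

text \<open>The second sample point is a parameter here, and the bound depends neither on it nor on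
  \<open>n\<close>; this permits integrating over it afterwards.\<close>

lemma U_disc_exp_bound:
  assumes M: "prob_space M" and W: "gaussian_vec_id M (2^n) (WN n)"
  shows "(\<integral>\<^sup>+\<omega>. ennreal (exp (b * Lp_norm 2 (U_disc \<epsilon> q f Vn WN n (\<omega>, \<omega>2)))) \<partial>M) \<le>
    ennreal (2 * exp (b\<^sup>2 * (\<Sum>\<^sub>\<infinity>k. (1 / \<epsilon>)\<^sup>2 * (1 / (norm (Dq_symbol \<epsilon> q k))\<^sup>2))))"
proof (rule exp_Lp_norm_bound(2)[OF M])
  show "(1 / \<epsilon>)\<^sup>2 * (1 / (norm (Dq_symbol \<epsilon> q k))\<^sup>2) > 0" for k
    using \<epsilon> Dq_symbol_nz[OF \<epsilon>] by simp
  show "(\<lambda>k. (1 / \<epsilon>)\<^sup>2 * (1 / (norm (Dq_symbol \<epsilon> q k))\<^sup>2)) summable_on UNIV"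
    by (intro summable_on_cmult_right summable_inverse_Dq_symbol \<epsilon>)
  show "subgaussian M (\<lambda>\<omega>. Re (fourier_real (U_disc \<epsilon> q f Vn WN n (\<omega>, \<omega>2)) k)) ((1 / \<epsilon>)\<^sup>2 * (1 / (norm (Dq_symbol \<epsilon> q k))\<^sup>2))" for k
    unfolding fourier_U_disc using subgaussian_sqrt_C_mat[OF M W f_coeff_bounds(1)] by simp
  show "subgaussian M (\<lambda>\<omega>. Im (fourier_real (U_disc \<epsilon> q f Vn WN n (\<omega>, \<omega>2)) k)) ((1 / \<epsilon>)\<^sup>2 * (1 / (norm (Dq_symbol \<epsilon> q k))\<^sup>2))" for k
    unfolding fourier_U_disc using subgaussian_sqrt_C_mat[OF M W f_coeff_bounds(2)] by simp
qed (rule U_disc_Lp_2)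

text \<open>By \<open>inverse_Q_op_AE\<close> each entry is a finite sum of rational functions of
  the cell integrals, multiplied by fixed integrals of the \<open>Df\<close>.\<close>

lemma C_mat_measurable:
  assumes V: "\<And>i. i < 2^n \<Longrightarrow> (\<lambda>\<omega>. LINT y:cell n i|circ. Vn n \<omega> y) \<in> borel_measurable M"
    and jk: "j < 2^n" "k < 2^n"
  shows "(\<lambda>\<omega>. C_mat \<epsilon> q f n (Vn n \<omega>) $$ (j, k)) \<in> borel_measurable M"
proof -
  have i: "integrable circ (\<lambda>x. indicator (cell n i) x * (Df j x * Df k x))" for i
    using integrable_mult_bounded[OF integrable_Df_mult[of j k] indicator_cell_measurable[of n i], of 1]
    by (auto simp: mult.commute split: split_indicator)
  have "C_mat \<epsilon> q f n (Vn n \<omega>) $$ (j, k) = (\<Sum>i<2^n. inverse (\<epsilon>\<^sup>2 + (2 ^ n * (LINT y:cell n i|circ. Vn n \<omega> y))\<^sup>2) *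
        (LINT x|circ. indicator (cell n i) x * (Df j x * Df k x)))" for \<omega>
  proof -
    let ?c = "\<lambda>i. inverse (\<epsilon>\<^sup>2 + (2 ^ n * (LINT y:cell n i|circ. Vn n \<omega> y))\<^sup>2)"
    have "C_mat \<epsilon> q f n (Vn n \<omega>) $$ (j, k) = (LINT x|circ. (\<Sum>i<2^n. ?c i * (indicator (cell n i) x * (Df j x * Df k x))))"
      unfolding C_mat_entry[OF jk]
    proof (rule integral_cong_AE)
      show "AE x in circ. inverse (\<epsilon>\<^sup>2 + (Q_op n (Vn n \<omega>) x)\<^sup>2) * (Df j x * Df k x) =
        (\<Sum>i<2^n. ?c i * (indicator (cell n i) x * (Df j x * Df k x)))"
        using inverse_Q_op_AE[of \<epsilon> n "Vn n \<omega>"]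
        by eventually_elim (simp only: sum_distrib_right mult.assoc)
    qed (use Lp_2_measurable[OF Df_Lp_2] in measurable)
    also have "\<dots> = (\<Sum>i<2^n. ?c i * (LINT x|circ. indicator (cell n i) x * (Df j x * Df k x)))"
      using i by (subst Bochner_Integration.integral_sum) auto
    finally show ?thesis .
  qed
  then show ?thesis using V by simp
qed

lemma U_disc_norm_measurable:
  assumes V: "\<And>i. i < 2^n \<Longrightarrow> (\<lambda>\<omega>. LINT y:cell n i|circ. Vn n \<omega> y) \<in> borel_measurable M2"
    and W: "gaussian_vec_id M1 (2^n) (WN n)"
  shows "(\<lambda>\<omega>. Lp_norm 2 (U_disc \<epsilon> q f Vn WN n \<omega>)) \<in> borel_measurable (M1 \<Otimes>\<^sub>M M2)"
proof -
  let ?S = "\<lambda>\<omega>. mat_sqrt (C_mat \<epsilon> q f n (Vn n \<omega>))"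
  have S: "(\<lambda>\<omega>. ?S \<omega> $$ (i, j)) \<in> borel_measurable M2" if "i < 2^n" "j < 2^n" for i j
    by (rule borel_measurable_mat_sqrt[where N="2^n" and c="1 / \<epsilon>"])
      (use \<epsilon> that in \<open>auto intro: C_mat_carrier C_mat_symmetric C_mat_bounds C_mat_measurable V\<close>)
  have Wd: "dim_vec (WN n \<omega>) = 2^n" if "\<omega> \<in> space M1" for \<omega>
    using W that by (auto simp: gaussian_vec_id_def)
  have Wm: "(\<lambda>\<omega>. WN n \<omega> $ j) \<in> borel_measurable M1" if "j < 2^n" for j
  proof -
    have "gaussian_rv M1 (\<lambda>\<omega>. unit_vec (2^n) j \<bullet> WN n \<omega>)"
      using W by (simp add: gaussian_vec_id_def)
    then have "(\<lambda>\<omega>. unit_vec (2^n) j \<bullet> WN n \<omega>) \<in> borel_measurable M1" by (simp add: gaussian_rv_def)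
    moreover have "unit_vec (2^n) j \<bullet> WN n \<omega> = WN n \<omega> $ j" if "\<omega> \<in> space M1" for \<omega>
      using carrier_vecI[OF Wd[OF that]] \<open>j < 2^n\<close> by (rule scalar_prod_left_unit)
    ultimately show ?thesis by (simp cong: measurable_cong)
  qed
  have SW: "(?S (snd \<omega>) *\<^sub>v WN n (fst \<omega>)) $ j = (\<Sum>i<2^n. ?S (snd \<omega>) $$ (j, i) * WN n (fst \<omega>) $ i)"
    if "\<omega> \<in> space (M1 \<Otimes>\<^sub>M M2)" "j < 2^n" for \<omega> j
    using that mat_sqrt_C_mat(1)[of n "Vn n (snd \<omega>)"] Wd[of "fst \<omega>"]
    by (auto simp: space_pair_measure mult_mat_vec_def scalar_prod_def atLeast0LessThan intro!: sum.cong)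
  have m: "(\<lambda>\<omega>. fourier_real (U_disc \<epsilon> q f Vn WN n \<omega>) k) \<in> borel_measurable (M1 \<Otimes>\<^sub>M M2)" for k
  proof -
    have "fourier_real (U_disc \<epsilon> q f Vn WN n \<omega>) k = (\<Sum>j<2^n. of_real (\<Sum>i<2^n. ?S (snd \<omega>) $$ (j, i) * WN n (fst \<omega>) $ i) * fourier_real (f j) k)"
      if "\<omega> \<in> space (M1 \<Otimes>\<^sub>M M2)" for \<omega>
      unfolding fourier_U_disc by (intro sum.cong refl) (simp add: SW[OF that])
    moreover have "(\<lambda>\<omega>. \<Sum>j<2^n. complex_of_real (\<Sum>i<2^n. ?S (snd \<omega>) $$ (j, i) * WN n (fst \<omega>) $ i) * fourier_real (f j) k) \<in> borel_measurable (M1 \<Otimes>\<^sub>M M2)"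
      by (intro borel_measurable_sum borel_measurable_times borel_measurable_const
          measurable_compose[OF _ borel_measurable_of_real]
          measurable_compose[OF measurable_snd S] measurable_compose[OF measurable_fst Wm]) auto
    ultimately show ?thesis by (simp cong: measurable_cong)
  qed
  have "(\<lambda>\<omega>. sqrt (\<Sum>\<^sub>\<infinity>k. (norm (fourier_real (U_disc \<epsilon> q f Vn WN n \<omega>) k))\<^sup>2)) \<in> borel_measurable (M1 \<Otimes>\<^sub>M M2)"
    using m sq_summable_fourier[OF Lp_2_of_real[OF U_disc_Lp_2]]
    by (intro measurable_compose[OF _ borel_measurable_sqrt] borel_measurable_infsum_norm) auto
  then show ?thesis by (simp only: Lp_norm_2_eq_infsum[OF U_disc_Lp_2])
qed

end

text \<open>The cell integral is affine in the random coefficients \<open>VV n j\<close>.\<close>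

lemma V_disc_cell_measurable:
  assumes "spans_PL g" "\<And>j. j < 2^n \<Longrightarrow> VV n j \<in> borel_measurable M"
  shows "(\<lambda>\<omega>. LINT y:cell n i|circ. V_disc g VV n \<omega> y) \<in> borel_measurable M"
proof -
  have i: "integrable circ (\<lambda>y. indicator (cell n i) y * h y)" if "integrable circ h" for h :: "real \<Rightarrow> real"
    using integrable_mult_bounded[OF that indicator_cell_measurable[of n i], of 1]
    by (auto simp: mult.commute split: split_indicator)
  have gi: "integrable circ (g j)" for j
    by (intro integrable_Lp_2 Lp_2_continuous spans_PL_continuous[OF assms(1)])
  have one: "integrable circ (\<lambda>y. 1 :: real)" by simp
  have "(LINT y:cell n i|circ. V_disc g VV n \<omega> y) =
     (\<Sum>j<2^n. VV n j \<omega> * (LINT y|circ. indicator (cell n i) y * g j y)) + (LINT y|circ. indicator (cell n i) y * 1)" for \<omega>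
  proof -
    have "(LINT y:cell n i|circ. V_disc g VV n \<omega> y) =
       (LINT y|circ. (\<Sum>j<2^n. VV n j \<omega> * (indicator (cell n i) y * g j y)) + indicator (cell n i) y * 1)"
      unfolding set_lebesgue_integral_def V_disc_def
      by (intro Bochner_Integration.integral_cong refl) (simp add: sum_distrib_left distrib_left mult_ac)
    also have "\<dots> = (LINT y|circ. (\<Sum>j<2^n. VV n j \<omega> * (indicator (cell n i) y * g j y))) + (LINT y|circ. indicator (cell n i) y * 1)"
    proof (rule Bochner_Integration.integral_add[OF Bochner_Integration.integrable_sum i[OF one]])
      show "integrable circ (\<lambda>y. VV n j \<omega> * (indicator (cell n i) y * g j y))" for j
        by (rule integrable_mult_right[OF i[OF gi]])
    qed
    also have "(LINT y|circ. (\<Sum>j<2^n. VV n j \<omega> * (indicator (cell n i) y * g j y))) = (\<Sum>j<2^n. VV n j \<omega> * (LINT y|circ. indicator (cell n i) y * g j y))"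
      by (subst Bochner_Integration.integral_sum[OF integrable_mult_right[OF i[OF gi]]])
        (simp only: integral_mult_right_zero)
    finally show ?thesis .
  qed
  then show ?thesis
    by (simp only:) (intro borel_measurable_add borel_measurable_sum borel_measurable_times borel_measurable_const assms(2); simp)
qed

section \<open>The continuous Gaussian fields\<close>

lemma subgaussian_cong:
  assumes "\<And>\<omega>. \<omega> \<in> space M \<Longrightarrow> X \<omega> = Y \<omega>" "subgaussian M Y v" shows "subgaussian M X v"
  using assms unfolding subgaussian_def
  by (simp cong: measurable_cong nn_integral_cong)

lemma gaussian_rv_subgaussian_centered:
  assumes "prob_space M" "gaussian_rv M X" "(LINT \<omega>|M. X \<omega>) = m" "(LINT \<omega>|M. (X \<omega> - m) * (X \<omega> - m)) = v"
  shows "subgaussian M (\<lambda>\<omega>. X \<omega> - m) v"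
proof -
  obtain m' \<sigma> where *: "\<And>t. (\<integral>\<^sup>+\<omega>. ennreal (exp (t * X \<omega>)) \<partial>M) = ennreal (exp (m' * t + \<sigma>\<^sup>2 * t\<^sup>2 / 2))"
    "(LINT \<omega>|M. X \<omega>) = m'" "(LINT \<omega>|M. (X \<omega> - m')\<^sup>2) = \<sigma>\<^sup>2"
    using gaussian_rv_cases[OF assms(1,2)] by metis
  have m: "m' = m" and v: "\<sigma>\<^sup>2 = v" using * assms by (auto simp: power2_eq_square)
  have [measurable]: "X \<in> borel_measurable M" using assms(2) by (simp add: gaussian_rv_def)
  have "(\<integral>\<^sup>+\<omega>. ennreal (exp (t * (X \<omega> - m))) \<partial>M) = ennreal (exp (t\<^sup>2 * v / 2))" for t
  proof -
    have "(\<integral>\<^sup>+\<omega>. ennreal (exp (t * (X \<omega> - m))) \<partial>M) = (\<integral>\<^sup>+\<omega>. ennreal (exp (- t * m)) * ennreal (exp (t * X \<omega>)) \<partial>M)"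
      by (intro nn_integral_cong) (simp add: ennreal_mult[symmetric] exp_add[symmetric] algebra_simps)
    also have "\<dots> = ennreal (exp (- t * m)) * ennreal (exp (m * t + v * t\<^sup>2 / 2))"
      by (subst nn_integral_cmult) (simp_all add: *(1) m v)
    also have "\<dots> = ennreal (exp (t\<^sup>2 * v / 2))"
      by (simp add: ennreal_mult[symmetric] exp_add[symmetric] mult_ac)
    finally show ?thesis .
  qed
  then show ?thesis by (simp add: subgaussian_def)
qed

text \<open>On the Fourier side the equation in the definition of \<open>C_V\<close> is a
  multiplication by \<open>prior_wt\<close>. This weight grows like \<open>bessel_wt\<close>, so
  dividing by it lands in H2.\<close>

lemma C_V_eq:
  assumes \<epsilon>: "\<epsilon> > 0" and \<phi>: "\<phi> \<in> Lp 2"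
  shows "C_V \<epsilon> \<phi> = real_fun_of (\<lambda>k. fourier_real \<phi> k / of_real (prior_wt \<epsilon> k))"
proof -
  define u where "u k = fourier_real \<phi> k / of_real (prior_wt \<epsilon> k)" for k
  have lap: "w k / of_real (4 * \<epsilon>) - of_real \<epsilon> * laplace w k = of_real (prior_wt \<epsilon> k) * w k" for w k
    by (simp add: laplace_def deriv_distr_def prior_wt_def power2_eq_square algebra_simps)
  have nz: "complex_of_real (prior_wt \<epsilon> k) \<noteq> 0" for k using prior_wt_pos[OF \<epsilon>, of k] by simp
  have "sq_summable (bessel 2 u)"
  proof (rule sq_summable_mono[OF sq_summable_fourier[OF Lp_2_of_real[OF \<phi>]]])
    fix k
    define c where "c = min (1 / (4 * \<epsilon>)) \<epsilon>"
    have c: "c > 0" using \<epsilon> by (simp add: c_def)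
    have "c * bessel_wt k \<le> prior_wt \<epsilon> k" unfolding c_def by (rule prior_wt_ge[OF \<epsilon>])
    then have "bessel_wt k / prior_wt \<epsilon> k \<le> 1 / c"
      using prior_wt_pos[OF \<epsilon>, of k] c by (simp add: field_simps)
    then have "bessel_wt k / prior_wt \<epsilon> k * norm (fourier_real \<phi> k) \<le> 1 / c * norm (fourier_real \<phi> k)"
      by (intro mult_right_mono) auto
    then show "norm (bessel 2 u k) \<le> 1 / c * norm (fourier_real \<phi> k)"
      using prior_wt_pos[OF \<epsilon>, of k] by (simp add: bessel_eq u_def norm_mult norm_divide less_imp_le)
  qed
  then have "u \<in> H 2" by (simp add: H_iff)
  then have "(THE u. u \<in> H 2 \<and> (\<lambda>k. u k / of_real (4 * \<epsilon>) - of_real \<epsilon> * laplace u k) = fourier_real \<phi>) = u"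
    unfolding lap using nz
    by (intro the_equality) (auto simp: u_def fun_eq_iff nonzero_eq_divide_eq[OF nz] mult.commute)
  then show ?thesis by (simp add: C_V_def u_def[abs_def])
qed

lemma prior_wt_uminus [simp]: "prior_wt \<epsilon> (- k) = prior_wt \<epsilon> k"
  by (simp add: prior_wt_def)

lemma L2_inner_C_V:
  assumes \<epsilon>: "\<epsilon> > 0" and \<phi>: "\<phi> \<in> Lp 2"
  shows "((\<lambda>k. (norm (fourier_real \<phi> k))\<^sup>2 / prior_wt \<epsilon> k) has_sum L2_inner (C_V \<epsilon> \<phi>) \<phi>) UNIV"
proof -
  define u where "u k = fourier_real \<phi> k / of_real (prior_wt \<epsilon> k)" for k
  have "sq_summable u"
  proof (rule sq_summable_mono[OF sq_summable_fourier[OF Lp_2_of_real[OF \<phi>]]])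
    fix k
    have c: "min (1 / (4 * \<epsilon>)) \<epsilon> > 0" using \<epsilon> by simp
    have "min (1 / (4 * \<epsilon>)) \<epsilon> * 1 \<le> prior_wt \<epsilon> k"
      using order_trans[OF mult_left_mono[OF bessel_wt_ge_1 less_imp_le[OF c]] prior_wt_ge[OF \<epsilon>]] .
    then have "1 / prior_wt \<epsilon> k \<le> 1 / min (1 / (4 * \<epsilon>)) \<epsilon>"
      using c by (intro divide_left_mono) (auto simp: prior_wt_pos[OF \<epsilon>])
    then have "1 / prior_wt \<epsilon> k * norm (fourier_real \<phi> k) \<le> 1 / min (1 / (4 * \<epsilon>)) \<epsilon> * norm (fourier_real \<phi> k)"
      by (intro mult_right_mono) auto
    then show "norm (u k) \<le> 1 / min (1 / (4 * \<epsilon>)) \<epsilon> * norm (fourier_real \<phi> k)"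
      using prior_wt_pos[OF \<epsilon>, of k] by (simp add: u_def norm_divide less_imp_le)
  qed
  moreover have "real_distr u"
    using real_distr_fourier_real[of \<phi>] by (simp add: real_distr_def u_def)
  ultimately have "((\<lambda>k. u k * cnj (fourier_real \<phi> k)) has_sum complex_of_real (L2_inner (C_V \<epsilon> \<phi>) \<phi>)) UNIV"
    using L2_inner_has_sum[OF real_fun_of_Lp_2[of u] \<phi>] fourier_real_fun_of_real[of u]
    by (simp add: C_V_eq[OF \<epsilon> \<phi>] u_def[abs_def])
  moreover have "u k * cnj (fourier_real \<phi> k) = complex_of_real ((norm (fourier_real \<phi> k))\<^sup>2 / prior_wt \<epsilon> k)" for k
    unfolding u_def of_real_divide complex_norm_square by simp
  ultimately have "((\<lambda>k. complex_of_real ((norm (fourier_real \<phi> k))\<^sup>2 / prior_wt \<epsilon> k)) has_sum complex_of_real (L2_inner (C_V \<epsilon> \<phi>) \<phi>)) UNIV"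
    by simp
  then show ?thesis by (simp only: has_sum_of_real_iff)
qed

lemma
  shows Re_expi_Lp_2: "(\<lambda>x. Re (expi k x)) \<in> Lp 2" and Im_expi_Lp_2: "(\<lambda>x. Im (expi k x)) \<in> Lp 2"
  unfolding expi_def by (auto intro!: Lp_2_continuous continuous_intros)

lemma
  assumes "f \<in> Lp 2"
  shows Re_fourier_real: "Re (fourier_real f k) = L2_inner f (\<lambda>x. Re (expi k x))"
    and Im_fourier_real: "Im (fourier_real f k) = - L2_inner f (\<lambda>x. Im (expi k x))"
proof -
  have i: "integrable circ (\<lambda>x. complex_of_real (f x) * expi (- k) x)"
    by (intro integrable_mult_expi integrable_Lp_2 Lp_2_of_real assms)
  have "Re (fourier_real f k) = (LINT x|circ. Re (complex_of_real (f x) * expi (- k) x))"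
    unfolding fourier_expi by (rule integral_Re[OF i, symmetric])
  also have "\<dots> = L2_inner f (\<lambda>x. Re (expi k x))"
    unfolding L2_inner_def by (simp add: cnj_expi[symmetric])
  finally show "Re (fourier_real f k) = L2_inner f (\<lambda>x. Re (expi k x))" .
  have "Im (fourier_real f k) = (LINT x|circ. Im (complex_of_real (f x) * expi (- k) x))"
    unfolding fourier_expi by (rule integral_Im[OF i, symmetric])
  also have "\<dots> = - L2_inner f (\<lambda>x. Im (expi k x))"
    unfolding L2_inner_def by (simp add: cnj_expi[symmetric])
  finally show "Im (fourier_real f k) = - L2_inner f (\<lambda>x. Im (expi k x))" .
qed

lemma
  shows fourier_Re_expi: "l \<noteq> k \<Longrightarrow> l \<noteq> - k \<Longrightarrow> fourier_real (\<lambda>x. Re (expi k x)) l = 0"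
    and fourier_Im_expi: "l \<noteq> k \<Longrightarrow> l \<noteq> - k \<Longrightarrow> fourier_real (\<lambda>x. Im (expi k x)) l = 0"
proof -
  assume l: "l \<noteq> k" "l \<noteq> - k"
  have "complex_of_real (Re (expi k x)) = (1/2) * (expi k x + expi (- k) x)"
    "complex_of_real (Im (expi k x)) = (- \<i>/2) * (expi k x - expi (- k) x)" for x
    by (simp_all add: cnj_expi[symmetric] complex_eq_iff)
  then show "fourier_real (\<lambda>x. Re (expi k x)) l = 0" "fourier_real (\<lambda>x. Im (expi k x)) l = 0"
    using l by (simp_all only: fourier_cmult fourier_add[OF integrable_expi integrable_expi]
        fourier_diff[OF integrable_expi integrable_expi] fourier_expi_self) auto
qed

text \<open>On functions with the frequencies \<open>k\<close> and \<open>- k\<close> only,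
  \<open>C_V\<close> acts as the scalar \<open>1 / prior_wt \<epsilon> k\<close>, and a function
  bounded by 1 has L2 norm at most 1 over the probability measure \<open>circ\<close>.\<close>

lemma L2_inner_C_V_mode:
  assumes \<epsilon>: "\<epsilon> > 0" and \<phi>: "\<phi> \<in> Lp 2" and supp: "\<And>l. l \<noteq> k \<Longrightarrow> l \<noteq> - k \<Longrightarrow> fourier_real \<phi> l = 0"
    and le: "\<And>x. \<bar>\<phi> x\<bar> \<le> 1"
  shows "L2_inner (C_V \<epsilon> \<phi>) \<phi> \<le> 1 / prior_wt \<epsilon> k"
proof -
  have eq: "(norm (fourier_real \<phi> l))\<^sup>2 / prior_wt \<epsilon> l = 1 / prior_wt \<epsilon> k * (norm (fourier_real \<phi> l))\<^sup>2" for l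
    using supp[of l] by (cases "l = k \<or> l = - k") auto
  have "((\<lambda>l. 1 / prior_wt \<epsilon> k * (norm (fourier_real \<phi> l))\<^sup>2) has_sum 1 / prior_wt \<epsilon> k * (Lp_norm 2 \<phi>)\<^sup>2) UNIV"
    by (intro has_sum_cmult_right Lp_norm_2_has_sum \<phi>)
  then have "L2_inner (C_V \<epsilon> \<phi>) \<phi> = 1 / prior_wt \<epsilon> k * (Lp_norm 2 \<phi>)\<^sup>2"
    using L2_inner_C_V[OF \<epsilon> \<phi>] unfolding eq by (intro has_sum_unique)
  also have "(Lp_norm 2 \<phi>)\<^sup>2 \<le> 1"
  proof -
    have "(Lp_norm 2 \<phi>)\<^sup>2 \<le> (LINT x|circ. 1)"
      unfolding Lp_norm_2_power2
      using \<phi> le by (intro Bochner_Integration.integral_mono) (auto simp: Lp_2_iff abs_square_le_1)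
    then show ?thesis by (simp add: circ.prob_space[unfolded space_circ])
  qed
  then have "1 / prior_wt \<epsilon> k * (Lp_norm 2 \<phi>)\<^sup>2 \<le> 1 / prior_wt \<epsilon> k * 1"
    using prior_wt_pos[OF \<epsilon>, of k] by (intro mult_left_mono) auto
  finally show ?thesis by simp
qed

lemma gaussian_L2_subgaussian:
  assumes \<epsilon>: "\<epsilon> > 0" and M: "prob_space M" and V: "gaussian_L2 M V (\<lambda>x. 1) (C_V \<epsilon>)"
    and \<phi>: "\<phi> \<in> Lp 2" and supp: "\<And>l. l \<noteq> k \<Longrightarrow> l \<noteq> - k \<Longrightarrow> fourier_real \<phi> l = 0"
    and le: "\<And>x. \<bar>\<phi> x\<bar> \<le> 1"
  shows "subgaussian M (\<lambda>\<omega>. L2_inner (\<lambda>x. V \<omega> x - 1) \<phi>) (1 / prior_wt \<epsilon> k)"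
proof -
  have VL: "V \<omega> \<in> Lp 2" if "\<omega> \<in> space M" for \<omega> using V that by (simp add: gaussian_L2_def)
  have one: "(\<lambda>x. 1 :: real) \<in> Lp 2" by (rule Lp_2_bounded[where c=1]) auto
  have "subgaussian M (\<lambda>\<omega>. L2_inner (V \<omega>) \<phi> - L2_inner (\<lambda>x. 1) \<phi>) (1 / prior_wt \<epsilon> k)"
    by (rule subgaussian_mono[OF gaussian_rv_subgaussian_centered[OF M] L2_inner_C_V_mode[OF \<epsilon> \<phi> supp le]])
      (use V \<phi> in \<open>auto simp: gaussian_L2_def\<close>)
  moreover have "L2_inner (\<lambda>x. V \<omega> x - 1) \<phi> = L2_inner (V \<omega>) \<phi> - L2_inner (\<lambda>x. 1) \<phi>" if "\<omega> \<in> space M" for \<omega>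
    unfolding L2_inner_def left_diff_distrib
    by (intro Bochner_Integration.integral_diff integrable_mult_Lp_2 VL[OF that] one \<phi>)
  ultimately show ?thesis
    unfolding subgaussian_def by (simp cong: measurable_cong nn_integral_cong)
qed

text \<open>Real and imaginary parts of a coefficient are pairings with cosine and sine modes, to
  which the covariance bound for a single frequency applies.\<close>

lemma
  assumes \<epsilon>: "\<epsilon> > 0" and M: "prob_space M" and V: "gaussian_L2 M V (\<lambda>x. 1) (C_V \<epsilon>)" and b: "b \<ge> 0"
  shows V_norm_measurable: "(\<lambda>\<omega>. Lp_norm 2 (V \<omega>)) \<in> borel_measurable M"
    and V_exp_bound: "(\<integral>\<^sup>+\<omega>. ennreal (exp (b * Lp_norm 2 (V \<omega>))) \<partial>M) \<le>
      ennreal (exp (2 * b) * (2 * exp ((2 * b)\<^sup>2 * (\<Sum>\<^sub>\<infinity>k. 1 / prior_wt \<epsilon> k))))"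
    and V_coeff_measurable: "(\<lambda>\<omega>. fourier_real (V \<omega>) k) \<in> borel_measurable M"
proof -
  have VL: "V \<omega> \<in> Lp 2" if "\<omega> \<in> space M" for \<omega> using V that by (simp add: gaussian_L2_def)
  have one: "(\<lambda>x. 1 :: real) \<in> Lp 2" by (rule Lp_2_bounded[where c=1]) auto
  have Z: "(\<lambda>x. V \<omega> x - 1) \<in> Lp 2" if "\<omega> \<in> space M" for \<omega>
    by (rule Lp_2_diff[OF VL[OF that] one])
  have sub: "subgaussian M (\<lambda>\<omega>. Re (fourier_real (\<lambda>x. V \<omega> x - 1) k)) (1 / prior_wt \<epsilon> k)"
     "subgaussian M (\<lambda>\<omega>. Im (fourier_real (\<lambda>x. V \<omega> x - 1) k)) (1 / prior_wt \<epsilon> k)" for k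
  proof -
    have r: "\<bar>Re (expi k x)\<bar> \<le> 1" "\<bar>Im (expi k x)\<bar> \<le> 1" for x
      using abs_Re_le_cmod[of "expi k x"] abs_Im_le_cmod[of "expi k x"] by simp_all
    show "subgaussian M (\<lambda>\<omega>. Re (fourier_real (\<lambda>x. V \<omega> x - 1) k)) (1 / prior_wt \<epsilon> k)"
      by (rule subgaussian_cong[OF Re_fourier_real[OF Z]], assumption,
          rule gaussian_L2_subgaussian[OF \<epsilon> M V Re_expi_Lp_2 _ r(1)], rule fourier_Re_expi)
    have "subgaussian M (\<lambda>\<omega>. (-1) * L2_inner (\<lambda>x. V \<omega> x - 1) (\<lambda>x. Im (expi k x))) ((-1)\<^sup>2 * (1 / prior_wt \<epsilon> k))"
      by (rule subgaussian_cmult, rule gaussian_L2_subgaussian[OF \<epsilon> M V Im_expi_Lp_2 _ r(2)], rule fourier_Im_expi)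
    then have "subgaussian M (\<lambda>\<omega>. - L2_inner (\<lambda>x. V \<omega> x - 1) (\<lambda>x. Im (expi k x))) (1 / prior_wt \<epsilon> k)"
      by simp
    then show "subgaussian M (\<lambda>\<omega>. Im (fourier_real (\<lambda>x. V \<omega> x - 1) k)) (1 / prior_wt \<epsilon> k)"
      by (rule subgaussian_cong[OF Im_fourier_real[OF Z], rotated])
  qed
  have pos: "1 / prior_wt \<epsilon> k > 0" for k using prior_wt_pos[OF \<epsilon>] by simp
  show "(\<lambda>\<omega>. Lp_norm 2 (V \<omega>)) \<in> borel_measurable M"
    by (rule exp_Lp_norm_mean_1_measurable[OF M pos summable_inverse_prior_wt[OF \<epsilon>] VL sub b])
  show "(\<integral>\<^sup>+\<omega>. ennreal (exp (b * Lp_norm 2 (V \<omega>))) \<partial>M) \<le>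
      ennreal (exp (2 * b) * (2 * exp ((2 * b)\<^sup>2 * (\<Sum>\<^sub>\<infinity>k. 1 / prior_wt \<epsilon> k))))"
    by (rule exp_Lp_norm_mean_1_bound[OF M pos summable_inverse_prior_wt[OF \<epsilon>] VL sub b])
  have "(\<lambda>\<omega>. L2_inner (V \<omega>) \<phi>) \<in> borel_measurable M" if "\<phi> \<in> Lp 2" for \<phi>
    using V that by (simp add: gaussian_L2_def gaussian_rv_def)
  from this[OF Re_expi_Lp_2] this[OF Im_expi_Lp_2]
  have "(\<lambda>\<omega>. Re (fourier_real (V \<omega>) k)) \<in> borel_measurable M" "(\<lambda>\<omega>. Im (fourier_real (V \<omega>) k)) \<in> borel_measurable M"
    by (simp_all add: Re_fourier_real[OF VL] Im_fourier_real[OF VL] cong: measurable_cong)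
  then show "(\<lambda>\<omega>. fourier_real (V \<omega>) k) \<in> borel_measurable M"
    by (simp add: borel_measurable_complex_iff)
qed

text \<open>The Sobolev norm written through coefficients, so that no representing function has to
  be chosen.\<close>

definition Hs_norm :: "real \<Rightarrow> pdistr \<Rightarrow> real" where
  "Hs_norm s u = sqrt (\<Sum>\<^sub>\<infinity>k. (norm (bessel s u k))\<^sup>2)"

text \<open>One factor \<open>bessel_wt k powr s\<close> comes from the covariance operator, the
  other from the inner product of \<open>H s\<close>.\<close>

lemma white_noise_subgaussian:
  assumes M: "prob_space M" and W: "white_noise M s W"
    and \<phi>: "real_distr \<phi>" "\<And>l. l \<noteq> k \<Longrightarrow> l \<noteq> - k \<Longrightarrow> \<phi> l = 0" "(norm (\<phi> k))\<^sup>2 + (if k = 0 then 0 else (norm (\<phi> (- k)))\<^sup>2) \<le> 1"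
  shows "subgaussian M (\<lambda>\<omega>. H_inner s (W \<omega>) \<phi>) (bessel_wt k powr (2 * s))"
proof -
  have \<phi>H: "\<phi> \<in> H_real s"
    using \<phi> H_finite[of "{k, - k}" \<phi> s] by (auto simp: Sob_real_def)
  have b\<phi>H: "bessel (2 * s) \<phi> \<in> H_real s"
    using \<phi> H_finite[of "{k, - k}" "bessel (2 * s) \<phi>" s] real_distr_bessel[OF \<phi>(1)]
    by (auto simp: Sob_real_def bessel_eq)
  have eq: "bessel_wt l powr s * Re (bessel (2 * s) \<phi> l * cnj (\<phi> l)) = bessel_wt k powr (2 * s) * (norm (\<phi> l))\<^sup>2" for l
  proof (cases "l = k \<or> l = - k")
    case True
    have "Re (bessel (2 * s) \<phi> l * cnj (\<phi> l)) = bessel_wt l powr s * (norm (\<phi> l))\<^sup>2"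
      by (simp only: bessel_eq mult.assoc complex_norm_square[symmetric] of_real_mult[symmetric] Re_complex_of_real) simp
    moreover have "bessel_wt l powr s * bessel_wt l powr s = bessel_wt l powr (2 * s)"
      by (simp add: powr_add[symmetric])
    moreover have "bessel_wt l = bessel_wt k" using True by auto
    ultimately show ?thesis by (simp add: mult.assoc[symmetric])
  qed (use \<phi>(2) in \<open>simp add: bessel_eq\<close>)
  have "((\<lambda>l. (norm (\<phi> l))\<^sup>2) has_sum (\<Sum>l\<in>{k, - k}. (norm (\<phi> l))\<^sup>2)) UNIV"
    by (rule has_sum_finite_neutralI) (use \<phi>(2) in auto)
  then have "((\<lambda>l. bessel_wt k powr (2 * s) * (norm (\<phi> l))\<^sup>2) has_sum bessel_wt k powr (2 * s) * (\<Sum>l\<in>{k, - k}. (norm (\<phi> l))\<^sup>2)) UNIV"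
    by (rule has_sum_cmult_right)
  then have "H_inner s (bessel (2 * s) \<phi>) \<phi> = bessel_wt k powr (2 * s) * (\<Sum>l\<in>{k, - k}. (norm (\<phi> l))\<^sup>2)"
    using H_inner_has_sum[OF b\<phi>H \<phi>H] unfolding eq by (rule has_sum_unique[rotated])
  also have "(\<Sum>l\<in>{k, - k}. (norm (\<phi> l))\<^sup>2) \<le> 1" using \<phi>(3) by (cases "k = 0") auto
  then have "bessel_wt k powr (2 * s) * (\<Sum>l\<in>{k, - k}. (norm (\<phi> l))\<^sup>2) \<le> bessel_wt k powr (2 * s) * 1"
    by (intro mult_left_mono) auto
  finally have "H_inner s (bessel (2 * s) \<phi>) \<phi> \<le> bessel_wt k powr (2 * s)" by simp
  then show ?thesis
    using W \<phi>H by (intro subgaussian_mono[OF gaussian_rv_subgaussian[OF M]]) (auto simp: white_noise_def)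
qed

lemma H_inner_mode:
  assumes u: "u \<in> H_real s" and \<phi>: "\<phi> \<in> H_real s" "\<And>l. l \<noteq> k \<Longrightarrow> l \<noteq> - k \<Longrightarrow> \<phi> l = 0"
  shows "H_inner s u \<phi> = (\<Sum>l\<in>{k, - k}. bessel_wt k powr s * Re (u l * cnj (\<phi> l)))"
proof -
  have "((\<lambda>l. bessel_wt l powr s * Re (u l * cnj (\<phi> l))) has_sum (\<Sum>l\<in>{k, - k}. bessel_wt l powr s * Re (u l * cnj (\<phi> l)))) UNIV"
    by (rule has_sum_finite_neutralI) (use \<phi>(2) in auto)
  with H_inner_has_sum[OF u \<phi>(1)]
  have "H_inner s u \<phi> = (\<Sum>l\<in>{k, - k}. bessel_wt l powr s * Re (u l * cnj (\<phi> l)))"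
    by (rule has_sum_unique)
  also have "\<dots> = (\<Sum>l\<in>{k, - k}. bessel_wt k powr s * Re (u l * cnj (\<phi> l)))"
    by (intro sum.cong refl) auto
  finally show ?thesis .
qed

text \<open>A coefficient of \<open>bessel s (W \<omega>)\<close> is
  \<open>bessel_wt k powr (- s / 2)\<close> times a pairing of variance at most
  \<open>bessel_wt k powr (2 * s)\<close>. What remains is \<open>bessel_wt k powr s\<close>,
  summable for \<open>s < - 1 / 2\<close>.\<close>

lemma
  assumes M: "prob_space M" and W: "white_noise M s W" and s: "s < - 1 / 2"
  shows W_exp_bound: "(\<integral>\<^sup>+\<omega>. ennreal (exp (b * Hs_norm s (W \<omega>))) \<partial>M) \<le> ennreal (2 * exp (b\<^sup>2 * (\<Sum>\<^sub>\<infinity>k. bessel_wt k powr s)))"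
    and W_coeff_measurable: "(\<lambda>\<omega>. W \<omega> k) \<in> borel_measurable M"
proof -
  have WH: "W \<omega> \<in> H_real s" if "\<omega> \<in> space M" for \<omega> using W that by (simp add: white_noise_def)
  have sub: "subgaussian M (\<lambda>\<omega>. Re (bessel s (W \<omega>) k)) (bessel_wt k powr s)"
     "subgaussian M (\<lambda>\<omega>. Im (bessel s (W \<omega>) k)) (bessel_wt k powr s)" for k
  proof -
    \<comment> \<open>The cosine mode, with mass 1/2 at \<open>k\<close> and at \<open>- k\<close>;
      for \<open>k = 0\<close> the two coincide and the value is 1.\<close>
    define \<phi> :: pdistr where "\<phi> l = (if l = k \<or> l = - k then if k = 0 then 1 else 1 / 2 else 0)" for l
    have \<phi>: "real_distr \<phi>" "\<And>l. l \<noteq> k \<Longrightarrow> l \<noteq> - k \<Longrightarrow> \<phi> l = 0" "(norm (\<phi> k))\<^sup>2 + (if k = 0 then 0 else (norm (\<phi> (- k)))\<^sup>2) \<le> 1"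
      by (auto simp: real_distr_def \<phi>_def power2_eq_square)
    \<comment> \<open>The sine mode; it is zero for \<open>k = 0\<close>, where the coefficient of a
      real distribution has no imaginary part.\<close>
    define \<psi> :: pdistr where "\<psi> l = (if k = 0 then 0 else if l = k then \<i> / 2 else if l = - k then - \<i> / 2 else 0)" for l
    have \<psi>: "real_distr \<psi>" "\<And>l. l \<noteq> k \<Longrightarrow> l \<noteq> - k \<Longrightarrow> \<psi> l = 0" "(norm (\<psi> k))\<^sup>2 + (if k = 0 then 0 else (norm (\<psi> (- k)))\<^sup>2) \<le> 1"
      by (auto simp: real_distr_def \<psi>_def power2_eq_square)
    have H: "\<phi> \<in> H_real s" "\<psi> \<in> H_real s"
      using \<phi> \<psi> H_finite[of "{k, - k}" \<phi> s] H_finite[of "{k, - k}" \<psi> s] by (auto simp: Sob_real_def)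
    have c: "bessel_wt k powr (s / 2) = bessel_wt k powr (- s / 2) * bessel_wt k powr s"
      by (simp add: powr_add[symmetric])
    have v: "(bessel_wt k powr (- s / 2))\<^sup>2 * bessel_wt k powr (2 * s) = bessel_wt k powr s"
      by (simp add: power2_eq_square powr_add[symmetric])
    have R: "Re (bessel s (W \<omega>) k) = bessel_wt k powr (- s / 2) * H_inner s (W \<omega>) \<phi>" if "\<omega> \<in> space M" for \<omega>
    proof -
      have "W \<omega> (- k) = cnj (W \<omega> k)" using WH[OF that] by (simp add: Sob_real_def real_distr_def)
      then have "H_inner s (W \<omega>) \<phi> = bessel_wt k powr s * Re (W \<omega> k)"
        using H_inner_mode[OF WH[OF that] H(1), of k] \<phi>(2) by (cases "k = 0") (auto simp: \<phi>_def field_simps)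
      then show ?thesis unfolding bessel_eq c by simp
    qed
    have I: "Im (bessel s (W \<omega>) k) = bessel_wt k powr (- s / 2) * H_inner s (W \<omega>) \<psi>" if "\<omega> \<in> space M" for \<omega>
    proof -
      have r: "W \<omega> (- k) = cnj (W \<omega> k)" using WH[OF that] by (simp add: Sob_real_def real_distr_def)
      then have "k = 0 \<Longrightarrow> Im (W \<omega> k) = 0" by (simp add: complex_eq_iff)
      with r have "H_inner s (W \<omega>) \<psi> = bessel_wt k powr s * Im (W \<omega> k)"
        using H_inner_mode[OF WH[OF that] H(2), of k] \<psi>(2) by (cases "k = 0") (auto simp: \<psi>_def field_simps)
      then show ?thesis unfolding bessel_eq c by simp
    qed
    have "subgaussian M (\<lambda>\<omega>. bessel_wt k powr (- s / 2) * H_inner s (W \<omega>) \<phi>) (bessel_wt k powr s)"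
      unfolding v[symmetric] by (rule subgaussian_cmult, rule white_noise_subgaussian[OF M W \<phi>(1) _ \<phi>(3)], rule \<phi>(2))
    then show "subgaussian M (\<lambda>\<omega>. Re (bessel s (W \<omega>) k)) (bessel_wt k powr s)"
      by (rule subgaussian_cong[OF R, rotated])
    have "subgaussian M (\<lambda>\<omega>. bessel_wt k powr (- s / 2) * H_inner s (W \<omega>) \<psi>) (bessel_wt k powr s)"
      unfolding v[symmetric] by (rule subgaussian_cmult, rule white_noise_subgaussian[OF M W \<psi>(1) _ \<psi>(3)], rule \<psi>(2))
    then show "subgaussian M (\<lambda>\<omega>. Im (bessel s (W \<omega>) k)) (bessel_wt k powr s)"
      by (rule subgaussian_cong[OF I, rotated])
  qed
  have pos: "bessel_wt k powr s > 0" for k by (simp add: less_imp_neq[symmetric])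
  have sum: "(\<lambda>k. bessel_wt k powr s) summable_on UNIV" using s by (intro summable_bessel_wt_powr) simp
  have S: "sq_summable (bessel s (W \<omega>))" if "\<omega> \<in> space M" for \<omega>
    using WH[OF that] by (simp add: Sob_real_def H_iff)
  have m: "(\<lambda>\<omega>. bessel s (W \<omega>) k) \<in> borel_measurable M" for k
    using sub[of k] by (simp add: borel_measurable_complex_iff subgaussian_def)
  show "(\<integral>\<^sup>+\<omega>. ennreal (exp (b * Hs_norm s (W \<omega>))) \<partial>M) \<le> ennreal (2 * exp (b\<^sup>2 * (\<Sum>\<^sub>\<infinity>k. bessel_wt k powr s)))"
    unfolding Hs_norm_def by (rule nn_integral_exp_l2_norm[OF M pos sum sub S])
  have "W \<omega> k = complex_of_real (bessel_wt k powr (- (s / 2))) * bessel s (W \<omega>) k" for \<omega>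
  proof -
    have "bessel_wt k powr (- (s / 2)) * bessel_wt k powr (s / 2) = 1"
      using bessel_wt_pos[of k] by (simp add: powr_add[symmetric] del: bessel_wt_pos)
    then show ?thesis unfolding bessel_eq mult.assoc[symmetric] of_real_mult[symmetric] by simp
  qed
  then have eq: "(\<lambda>\<omega>. W \<omega> k) = (\<lambda>\<omega>. complex_of_real (bessel_wt k powr (- (s / 2))) * bessel s (W \<omega>) k)" by (rule ext)
  show "(\<lambda>\<omega>. W \<omega> k) \<in> borel_measurable M"
    unfolding eq by (rule borel_measurable_times[OF borel_measurable_const m])
qed

section \<open>Sobolev embedding\<close>

text \<open>
  The multiplier \<open>a n = bessel_wt n powr (- t / 2)\<close> is summed by parts twice, so
  that it acts as a combination of Fejer means whose weights are the second differences of \<open>a\<close>.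
\<close>

definition fejer_sum :: "(real \<Rightarrow> complex) \<Rightarrow> nat \<Rightarrow> real \<Rightarrow> complex" where
  "fejer_sum f n x = (\<Sum>i<n. \<Sum>j<n. fourier f (int i - int j) * expi (int i - int j) x)"

lemma expi_diff: "expi k (x - y) = expi k x * expi (- k) y"
  by (simp add: expi_def cis_mult algebra_simps)

lemma continuous_fejer_sum: "continuous_on UNIV (fejer_sum f n)"
  unfolding fejer_sum_def by (intro continuous_intros)

lemma fejer_kernel_eq:
  "complex_of_real ((norm (\<Sum>i<n. expi (int i) x))\<^sup>2) = (\<Sum>i<n. \<Sum>j<n. expi (int i - int j) x)"
  unfolding complex_norm_square cnj_sum cnj_expi sum_product expi_mult by simp

text \<open>The kernel \<open>K\<close> has total mass \<open>n\<close> and is at most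
  \<open>n\<^sup>2\<close>. Cutting at a level \<open>l\<close> replaces Hoelder's inequality: where
  \<open>norm (f y) \<le> l\<close> the mass of \<open>K\<close> is used, elsewhere the bound
  \<open>norm (f y) \<le> l powr (1 - p) * norm (f y) powr p\<close>.\<close>

lemma norm_fejer_sum_le:
  assumes f: "integrable circ f" "integrable circ (\<lambda>x. norm (f x) powr p)" and p: "p > 1" and n: "n > 0"
  shows "norm (fejer_sum f n x) \<le> real n * real n powr (1 / p) * (1 + (LINT y|circ. norm (f y) powr p))"
proof -
  define K where "K y = (norm (\<Sum>i<n. expi (int i) (x - y)))\<^sup>2" for y
  have Kc: "complex_of_real (K y) = (\<Sum>i<n. \<Sum>j<n. expi (int i - int j) x * expi (- (int i - int j)) y)" for y
    unfolding K_def by (simp only: fejer_kernel_eq expi_diff[symmetric])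
  have Kn: "0 \<le> K y" for y by (simp add: K_def)
  have Kle: "K y \<le> (real n)\<^sup>2" for y
  proof -
    have "norm (\<Sum>i<n. expi (int i) (x - y)) \<le> (\<Sum>i<n. 1)"
      by (rule order_trans[OF norm_sum]) simp
    then show ?thesis unfolding K_def by (intro power_mono) auto
  qed
  have K_meas: "K \<in> borel_measurable circ"
    unfolding K_def
    by (intro borel_measurable_circ_continuous continuous_intros continuous_on_compose2[OF continuous_expi[of UNIV]]) auto
  have Ki: "integrable circ K"
    by (rule integrable_circ_bounded[OF K_meas, of "(real n)\<^sup>2"]) (simp add: Kn Kle)
  have intK: "(LINT y|circ. K y) = real n"
  proof -
    have "complex_of_real (LINT y|circ. K y) = (LINT y|circ. complex_of_real (K y))"
      by (rule integral_complex_of_real[symmetric])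
    also have "\<dots> = (\<Sum>i<n. LINT y|circ. (\<Sum>j<n. expi (int i - int j) x * expi (- (int i - int j)) y))"
      unfolding Kc by (intro Bochner_Integration.integral_sum Bochner_Integration.integrable_sum integrable_mult_right integrable_expi)
    also have "\<dots> = (\<Sum>i<n. \<Sum>j<n. LINT y|circ. expi (int i - int j) x * expi (- (int i - int j)) y)"
      by (intro sum.cong refl Bochner_Integration.integral_sum integrable_mult_right integrable_expi)
    also have "\<dots> = (\<Sum>i<n. \<Sum>j<n. if j = i then 1 else 0)"
      by (intro sum.cong refl) (simp only: integral_mult_right_zero integral_expi, simp)
    also have "\<dots> = complex_of_real (real n)" by simp
    finally show ?thesis by (simp only: of_real_eq_iff)
  qed
  have conv: "fejer_sum f n x = (LINT y|circ. f y * complex_of_real (K y))"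
  proof -
    have ii: "integrable circ (\<lambda>y. expi k x * (f y * expi (- k) y))" for k
      by (intro integrable_mult_right integrable_mult_expi f)
    have "(LINT y|circ. f y * complex_of_real (K y)) = (LINT y|circ. (\<Sum>i<n. \<Sum>j<n. expi (int i - int j) x * (f y * expi (- (int i - int j)) y)))"
      unfolding Kc by (simp only: sum_distrib_left mult.left_commute)
    also have "\<dots> = (\<Sum>i<n. LINT y|circ. (\<Sum>j<n. expi (int i - int j) x * (f y * expi (- (int i - int j)) y)))"
      by (intro Bochner_Integration.integral_sum Bochner_Integration.integrable_sum ii)
    also have "\<dots> = (\<Sum>i<n. \<Sum>j<n. LINT y|circ. expi (int i - int j) x * (f y * expi (- (int i - int j)) y))"
      by (intro sum.cong refl Bochner_Integration.integral_sum ii)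
    also have "\<dots> = fejer_sum f n x"
      unfolding fejer_sum_def by (simp only: integral_mult_right_zero fourier_expi mult.commute)
    finally show ?thesis by simp
  qed
  \<comment> \<open>This level balances the two parts: with it
    \<open>(real n)\<^sup>2 * l powr (1 - p)\<close> equals \<open>real n * l\<close>.\<close>
  define l where "l = real n powr (1 / p)"
  have l: "l > 0" using n by (simp add: l_def)
  have "norm (fejer_sum f n x) \<le> (LINT y|circ. l * K y + (real n)\<^sup>2 * l powr (1 - p) * norm (f y) powr p)"
    unfolding conv
  proof (rule Bochner_Integration.integral_norm_bound_integral)
    show "integrable circ (\<lambda>y. f y * complex_of_real (K y))"
      by (rule integrable_mult_bounded[OF f(1), of _ "(real n)\<^sup>2"]) (use K_meas Kn Kle in auto)
    show "integrable circ (\<lambda>y. l * K y + (real n)\<^sup>2 * l powr (1 - p) * norm (f y) powr p)"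
      by (intro Bochner_Integration.integrable_add integrable_mult_right Ki f(2))
    fix y
    have "norm (f y) * K y \<le> l * K y + (real n)\<^sup>2 * l powr (1 - p) * norm (f y) powr p"
    proof (cases "norm (f y) \<le> l")
      case True
      then have "norm (f y) * K y \<le> l * K y" by (intro mult_right_mono Kn)
      then show ?thesis by (simp add: add_increasing2)
    next
      case False
      then have fl: "norm (f y) > l" by simp
      then have "norm (f y) = norm (f y) powr (1 - p) * norm (f y) powr p"
        using l by (simp add: powr_add[symmetric])
      also have "\<dots> \<le> l powr (1 - p) * norm (f y) powr p"
        using l fl p by (intro mult_right_mono powr_mono2') auto
      finally have "norm (f y) * K y \<le> (l powr (1 - p) * norm (f y) powr p) * (real n)\<^sup>2"
        by (intro mult_mono Kn Kle) auto
      then show ?thesis using l Kn[of y] by (simp add: mult_ac add_increasing)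
    qed
    then show "norm (f y * complex_of_real (K y)) \<le> l * K y + (real n)\<^sup>2 * l powr (1 - p) * norm (f y) powr p"
      using Kn[of y] by (simp add: norm_mult)
  qed
  also have "\<dots> = l * real n + (real n)\<^sup>2 * l powr (1 - p) * (LINT y|circ. norm (f y) powr p)"
    using Ki f(2) by (simp add: intK)
  also have "(real n)\<^sup>2 * l powr (1 - p) = real n * l"
  proof -
    have "l powr (1 - p) = real n powr (1 / p * (1 - p))" by (simp add: l_def powr_powr)
    also have "1 / p * (1 - p) = 1 / p - 1" using p by (simp add: field_simps)
    also have "real n powr (1 / p - 1) = l / real n" using n by (simp add: l_def powr_diff)
    finally show ?thesis using n by (simp add: power2_eq_square)
  qed
  finally show ?thesis by (simp add: l_def algebra_simps)
qed

text \<open>The subtraction is truncated, in accordance with there being no such pair for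
  \<open>\<bar>k\<bar> \<ge> n\<close>.\<close>

lemma card_diff_eq:
  "card {(i, j). i < n \<and> j < n \<and> int i - int j = k} = n - nat \<bar>k\<bar>"
proof (cases "k \<ge> 0")
  case True
  have "bij_betw (\<lambda>j. (j + nat k, j)) {..<n - nat k} {(i, j). i < n \<and> j < n \<and> int i - int j = k}"
    by (rule bij_betwI[where g=snd]) (use True in auto)
  from bij_betw_same_card[OF this] show ?thesis using True by simp
next
  case False
  have "bij_betw (\<lambda>i. (i, i + nat (- k))) {..<n - nat (- k)} {(i, j). i < n \<and> j < n \<and> int i - int j = k}"
    by (rule bij_betwI[where g=fst]) (use False in auto)
  from bij_betw_same_card[OF this] show ?thesis using False by simp
qed

lemma fourier_fejer_sum: "fourier (fejer_sum f n) k = of_nat (n - nat \<bar>k\<bar>) * fourier f k"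
proof -
  have "fourier (fejer_sum f n) k = (\<Sum>i<n. \<Sum>j<n. fourier (\<lambda>x. fourier f (int i - int j) * expi (int i - int j) x) k)"
    unfolding fejer_sum_def
    by (subst fourier_sum, intro Bochner_Integration.integrable_sum integrable_mult_right integrable_expi)
      (intro sum.cong refl fourier_sum integrable_mult_right integrable_expi)
  also have "\<dots> = (\<Sum>i<n. \<Sum>j<n. if int i - int j = k then fourier f k else 0)"
    by (intro sum.cong refl) (simp only: fourier_cmult fourier_expi_self, simp)
  also have "\<dots> = (\<Sum>(i,j)\<in>{..<n} \<times> {..<n}. if int i - int j = k then fourier f k else 0)"
    by (simp add: sum.cartesian_product)
  also have "\<dots> = (\<Sum>(i,j)\<in>{(i, j). i < n \<and> j < n \<and> int i - int j = k}. fourier f k)"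
    by (rule sum.mono_neutral_cong_right) (auto split: if_splits)
  also have "\<dots> = of_nat (n - nat \<bar>k\<bar>) * fourier f k"
    by (simp add: case_prod_beta card_diff_eq)
  finally show ?thesis .
qed

section \<open>Second differences of the Bessel multiplier\<close>

context
  fixes t :: real
  assumes t: "t > 0"
begin

definition mult_fun :: "real \<Rightarrow> real" where
  "mult_fun x = (1 + (2 * pi * x)\<^sup>2) powr (- t / 2)"

definition mult_fun' :: "real \<Rightarrow> real" where
  "mult_fun' x = (- t / 2) * (1 + (2 * pi * x)\<^sup>2) powr (- t / 2 - 1) * (8 * pi\<^sup>2 * x)"

definition mult_fun'' :: "real \<Rightarrow> real" where
  "mult_fun'' x = (- t / 2) * ((- t / 2 - 1) * (1 + (2 * pi * x)\<^sup>2) powr (- t / 2 - 1 - 1) * (8 * pi\<^sup>2 * x) * (8 * pi\<^sup>2 * x) +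
      (1 + (2 * pi * x)\<^sup>2) powr (- t / 2 - 1) * (8 * pi\<^sup>2))"

lemma base_pos: "1 + (2 * pi * x)\<^sup>2 > 0" for x :: real
  by (simp add: add_pos_nonneg)

lemma mult_fun_deriv: "(mult_fun has_real_derivative mult_fun' x) (at x)"
  unfolding mult_fun_def[abs_def] mult_fun'_def using base_pos[of x]
  by (auto intro!: derivative_eq_intros simp: power2_eq_square field_simps)

lemma mult_fun'_deriv: "(mult_fun' has_real_derivative mult_fun'' x) (at x)"
  unfolding mult_fun'_def[abs_def] mult_fun''_def using base_pos[of x]
  by (auto intro!: derivative_eq_intros simp: power2_eq_square algebra_simps)

lemma mult_fun''_bound:
  "\<bar>mult_fun'' x\<bar> \<le> 8 * pi\<^sup>2 * t * (t + 3) * (1 + (2 * pi * x)\<^sup>2) powr (- t / 2 - 1)"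
proof -
  let ?b = "1 + (2 * pi * x)\<^sup>2" and ?e = "- t / 2 - 1"
  have q: "?b powr (?e - 1) * (8 * pi\<^sup>2 * x)\<^sup>2 \<le> 16 * pi\<^sup>2 * ?b powr ?e"
  proof -
    have "(8 * pi\<^sup>2 * x)\<^sup>2 = 16 * pi\<^sup>2 * (2 * pi * x)\<^sup>2" by (simp add: power_mult_distrib power2_eq_square)
    also have "\<dots> \<le> 16 * pi\<^sup>2 * ?b" by (intro mult_left_mono) auto
    finally have "?b powr (?e - 1) * (8 * pi\<^sup>2 * x)\<^sup>2 \<le> ?b powr (?e - 1) * (16 * pi\<^sup>2 * ?b)"
      by (intro mult_left_mono) auto
    also have "\<dots> = 16 * pi\<^sup>2 * (?b powr (?e - 1) * ?b powr 1)" using base_pos[of x] by simp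
    also have "?b powr (?e - 1) * ?b powr 1 = ?b powr ?e" by (simp only: powr_add[symmetric] diff_add_cancel)
    finally show ?thesis .
  qed
  have "\<bar>mult_fun'' x\<bar> = (t / 2) * \<bar>- ((t / 2 + 1) * (?b powr (?e - 1) * (8 * pi\<^sup>2 * x)\<^sup>2)) + ?b powr ?e * (8 * pi\<^sup>2)\<bar>"
  proof -
    have "mult_fun'' x = - (t / 2) * (- ((t / 2 + 1) * (?b powr (?e - 1) * (8 * pi\<^sup>2 * x)\<^sup>2)) + ?b powr ?e * (8 * pi\<^sup>2))"
      unfolding mult_fun''_def by (simp add: power2_eq_square algebra_simps)
    then show ?thesis using t by (simp add: abs_mult)
  qed
  also have "\<dots> \<le> (t / 2) * ((t / 2 + 1) * (16 * pi\<^sup>2 * ?b powr ?e) + ?b powr ?e * (8 * pi\<^sup>2))"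
  proof (rule mult_left_mono)
    have "(t / 2 + 1) * (?b powr (?e - 1) * (8 * pi\<^sup>2 * x)\<^sup>2) \<le> (t / 2 + 1) * (16 * pi\<^sup>2 * ?b powr ?e)"
      using t by (intro mult_left_mono q) auto
    moreover have "0 \<le> (t / 2 + 1) * (?b powr (?e - 1) * (8 * pi\<^sup>2 * x)\<^sup>2)" "0 \<le> ?b powr ?e * (8 * pi\<^sup>2)"
      using t by auto
    ultimately show "\<bar>- ((t / 2 + 1) * (?b powr (?e - 1) * (8 * pi\<^sup>2 * x)\<^sup>2)) + ?b powr ?e * (8 * pi\<^sup>2)\<bar> \<le>
        (t / 2 + 1) * (16 * pi\<^sup>2 * ?b powr ?e) + ?b powr ?e * (8 * pi\<^sup>2)"
      by linarith
  qed (use t in simp)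
  also have "\<dots> = 8 * pi\<^sup>2 * t * ((t + 3) / 2) * ?b powr ?e"
    by (simp add: field_simps)
  also have "\<dots> \<le> 8 * pi\<^sup>2 * t * (t + 3) * ?b powr ?e"
    using t by (intro mult_right_mono mult_left_mono) auto
  finally show ?thesis .
qed

lemma mult_fun'_bound:
  "\<bar>mult_fun' x\<bar> \<le> 8 * pi\<^sup>2 * t * (1 + (2 * pi * x)\<^sup>2) powr (- t / 2 - 1) * \<bar>x\<bar>"
proof -
  have "\<bar>mult_fun' x\<bar> = (t / 2) * (1 + (2 * pi * x)\<^sup>2) powr (- t / 2 - 1) * (8 * pi\<^sup>2 * \<bar>x\<bar>)"
    using t by (simp add: mult_fun'_def abs_mult)
  also have "\<dots> = (8 * pi\<^sup>2 * t * (1 + (2 * pi * x)\<^sup>2) powr (- t / 2 - 1) * \<bar>x\<bar>) / 2"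
    by simp
  also have "\<dots> \<le> 8 * pi\<^sup>2 * t * (1 + (2 * pi * x)\<^sup>2) powr (- t / 2 - 1) * \<bar>x\<bar>"
    using t by simp
  finally show ?thesis .
qed

text \<open>For \<open>n \<ge> 2\<close> the point \<open>x\<close> is at least
  \<open>n / 2\<close>; for \<open>n = 1\<close> the summand 1 suffices. The condition
  \<open>x \<ge> real n - 1\<close> is the location that the mean value theorem provides.\<close>

lemma base_powr_le:
  assumes "n \<ge> 1" "x \<ge> real n - 1" "e \<le> 0"
  shows "(1 + (2 * pi * x)\<^sup>2) powr e \<le> (1/4) powr e * real n powr (2 * e)"
proof -
  have "(real n)\<^sup>2 / 4 \<le> 1 + (2 * pi * x)\<^sup>2"
  proof (cases "n = 1")
    case True
    then show ?thesis by (simp add: add_increasing2)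
  next
    case False
    then have "real n / 2 \<le> x" using assms by linarith
    also have "x \<le> 2 * pi * x" using pi_gt3 calculation assms(1) by simp
    finally have "(real n / 2)\<^sup>2 \<le> (2 * pi * x)\<^sup>2" by (intro power_mono) auto
    then show ?thesis by (simp add: power_divide)
  qed
  then have "(1 + (2 * pi * x)\<^sup>2) powr e \<le> ((1/4) * (real n)\<^sup>2) powr e"
    using assms by (intro powr_mono2') auto
  also have "\<dots> = (1/4) powr e * real n powr (2 * e)"
    by (subst powr_mult) (simp_all add: powr_powr[symmetric] powr_2)
  finally show ?thesis .
qed

definition second_diff :: "nat \<Rightarrow> real" where
  "second_diff n = mult_fun (real n - 1) - 2 * mult_fun (real n) + mult_fun (real n + 1)"

text \<open>Two applications of the mean value theorem express the second difference as a second
  derivative at a point above \<open>n - 1\<close>.\<close>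

lemma second_diff_bound:
  assumes n: "n \<ge> 1"
  shows "\<bar>second_diff n\<bar> \<le> 8 * pi\<^sup>2 * t * (t + 3) * (1/4) powr (- t / 2 - 1) * real n powr (- t - 2)"
proof -
  define \<psi> where "\<psi> x = mult_fun (x + 1) - mult_fun x" for x
  have d: "(\<psi> has_real_derivative (mult_fun' (x + 1) - mult_fun' x)) (at x)" for x
    unfolding \<psi>_def by (intro derivative_intros DERIV_shift[THEN iffD1] mult_fun_deriv)
  obtain \<xi> where \<xi>: "real n - 1 < \<xi>" "\<xi> < real n" "\<psi> (real n) - \<psi> (real n - 1) = (real n - (real n - 1)) * (mult_fun' (\<xi> + 1) - mult_fun' \<xi>)"
    using MVT2[of "real n - 1" "real n" \<psi> "\<lambda>x. mult_fun' (x + 1) - mult_fun' x"] d by auto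
  obtain \<eta> where \<eta>: "\<xi> < \<eta>" "\<eta> < \<xi> + 1" "mult_fun' (\<xi> + 1) - mult_fun' \<xi> = (\<xi> + 1 - \<xi>) * mult_fun'' \<eta>"
    using MVT2[of \<xi> "\<xi> + 1" mult_fun' mult_fun''] mult_fun'_deriv by auto
  have "second_diff n = mult_fun'' \<eta>" using \<xi>(3) \<eta>(3) by (simp add: second_diff_def \<psi>_def)
  also have "\<bar>\<dots>\<bar> \<le> 8 * pi\<^sup>2 * t * (t + 3) * (1 + (2 * pi * \<eta>)\<^sup>2) powr (- t / 2 - 1)"
    by (rule mult_fun''_bound)
  also have "\<dots> \<le> 8 * pi\<^sup>2 * t * (t + 3) * ((1/4) powr (- t / 2 - 1) * real n powr (2 * (- t / 2 - 1)))"
    using t n \<xi> \<eta> by (intro mult_left_mono base_powr_le) auto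
  also have "2 * (- t / 2 - 1) = - t - 2" by simp
  finally show ?thesis by (simp only: mult.assoc)
qed

text \<open>Two summations by parts in closed form, checked by induction on \<open>N\<close>; the
  truncated difference removes the terms with \<open>n \<le> m\<close>.\<close>

lemma sum_second_diff:
  assumes "N \<ge> m"
  shows "(\<Sum>n\<in>{1..N}. real (n - m) * second_diff n) =
    mult_fun (real m) - mult_fun (real N) - real (N - m) * (mult_fun (real N) - mult_fun (real N + 1))"
  using assms
proof (induction N rule: dec_induct)
  case base
  have "(\<Sum>n\<in>{1..m}. real (n - m) * second_diff n) = 0" by (intro sum.neutral) auto
  then show ?case by simp
next
  case (step N)
  have "real (Suc N - m) = real (N - m) + 1" using step by (simp add: Suc_diff_le)
  then show ?case using step by (simp add: second_diff_def algebra_simps)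
qed

text \<open>Makes the boundary term in \<open>sum_second_diff\<close> tend to 0.\<close>

lemma first_diff_bound:
  assumes n: "n \<ge> 1"
  shows "real n * \<bar>mult_fun (real n) - mult_fun (real n + 1)\<bar> \<le> 16 * pi\<^sup>2 * t * (1/4) powr (- t / 2 - 1) * real n powr (- t)"
proof -
  obtain \<xi> where \<xi>: "real n < \<xi>" "\<xi> < real n + 1" "mult_fun (real n + 1) - mult_fun (real n) = (real n + 1 - real n) * mult_fun' \<xi>"
    using MVT2[of "real n" "real n + 1" mult_fun mult_fun'] mult_fun_deriv by auto
  have "\<bar>mult_fun (real n) - mult_fun (real n + 1)\<bar> = \<bar>mult_fun' \<xi>\<bar>" using \<xi>(3) by simp
  also have "\<dots> \<le> 8 * pi\<^sup>2 * t * (1 + (2 * pi * \<xi>)\<^sup>2) powr (- t / 2 - 1) * \<bar>\<xi>\<bar>" by (rule mult_fun'_bound)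
  also have "\<dots> \<le> 8 * pi\<^sup>2 * t * ((1/4) powr (- t / 2 - 1) * real n powr (2 * (- t / 2 - 1))) * (2 * real n)"
    using t n \<xi> by (intro mult_mono mult_left_mono base_powr_le) auto
  finally have "real n * \<bar>mult_fun (real n) - mult_fun (real n + 1)\<bar> \<le>
      real n * (8 * pi\<^sup>2 * t * ((1/4) powr (- t / 2 - 1) * real n powr (2 * (- t / 2 - 1))) * (2 * real n))"
    by (intro mult_left_mono) auto
  also have "\<dots> = 16 * pi\<^sup>2 * t * (1/4) powr (- t / 2 - 1) * ((real n)\<^sup>2 * real n powr (- t - 2))"
    by (simp add: power2_eq_square)
  also have "(real n)\<^sup>2 * real n powr (- t - 2) = real n powr (- t)"
  proof -
    have "(real n)\<^sup>2 = real n powr 2" by (simp add: powr_2)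
    then have "(real n)\<^sup>2 * real n powr (- t - 2) = real n powr (2 + (- t - 2))"
      by (simp only: powr_add)
    then show ?thesis by simp
  qed
  finally show ?thesis .
qed

lemma tendsto_real_powr_neg: "(\<lambda>n. real n powr (- t)) \<longlonglongrightarrow> 0"
  using t by (intro tendsto_neg_powr filterlim_real_sequentially) auto

text \<open>The Fejer sum of order \<open>n\<close> multiplies the coefficient at \<open>m\<close>
  by \<open>n - m\<close>; weighted with \<open>second_diff n\<close>, these multipliers add up to
  the Bessel multiplier.\<close>

lemma tendsto_sum_second_diff: "(\<lambda>N. \<Sum>n\<in>{1..N}. real (n - m) * second_diff n) \<longlonglongrightarrow> mult_fun (real m)"
proof -
  have a: "(\<lambda>N. mult_fun (real N)) \<longlonglongrightarrow> 0"
  proof (rule tendsto_sandwich[OF _ _ tendsto_const])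
    have "(\<lambda>N. (1/4) powr (- t / 2) * real N powr (- t)) \<longlonglongrightarrow> (1/4) powr (- t / 2) * 0"
      by (intro tendsto_intros tendsto_real_powr_neg)
    then show "(\<lambda>N. (1/4) powr (- t / 2) * real N powr (- t)) \<longlonglongrightarrow> 0" by simp
    show "\<forall>\<^sub>F N in sequentially. mult_fun (real N) \<le> (1/4) powr (- t / 2) * real N powr (- t)"
      using eventually_ge_at_top[of 1]
    proof eventually_elim
      case (elim N)
      then show ?case using base_powr_le[of N "real N" "- t / 2"] t by (simp add: mult_fun_def)
    qed
  qed (simp add: mult_fun_def)
  have b: "(\<lambda>N. real (N - m) * (mult_fun (real N) - mult_fun (real N + 1))) \<longlonglongrightarrow> 0"
  proof (rule tendsto_0_le[where K=1])
    have "(\<lambda>N. 16 * pi\<^sup>2 * t * (1/4) powr (- t / 2 - 1) * real N powr (- t)) \<longlonglongrightarrow> 16 * pi\<^sup>2 * t * (1/4) powr (- t / 2 - 1) * 0"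
      by (intro tendsto_intros tendsto_real_powr_neg)
    then show "(\<lambda>N. 16 * pi\<^sup>2 * t * (1/4) powr (- t / 2 - 1) * real N powr (- t)) \<longlonglongrightarrow> 0" by simp
    show "\<forall>\<^sub>F N in sequentially. norm (real (N - m) * (mult_fun (real N) - mult_fun (real N + 1))) \<le>
        norm (16 * pi\<^sup>2 * t * (1/4) powr (- t / 2 - 1) * real N powr (- t)) * 1"
      using eventually_ge_at_top[of 1]
    proof eventually_elim
      case (elim N)
      have "real (N - m) * \<bar>mult_fun (real N) - mult_fun (real N + 1)\<bar> \<le> real N * \<bar>mult_fun (real N) - mult_fun (real N + 1)\<bar>"
        by (intro mult_right_mono) auto
      also have "\<dots> \<le> 16 * pi\<^sup>2 * t * (1/4) powr (- t / 2 - 1) * real N powr (- t)"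
        by (rule first_diff_bound[OF elim])
      finally show ?case using t by (simp add: abs_mult)
    qed
  qed
  have "(\<lambda>N. mult_fun (real m) - mult_fun (real N) - real (N - m) * (mult_fun (real N) - mult_fun (real N + 1))) \<longlonglongrightarrow> mult_fun (real m) - 0 - 0"
    by (intro tendsto_intros a b)
  moreover have "\<forall>\<^sub>F N in sequentially. mult_fun (real m) - mult_fun (real N) - real (N - m) * (mult_fun (real N) - mult_fun (real N + 1)) =
      (\<Sum>n\<in>{1..N}. real (n - m) * second_diff n)"
    using eventually_ge_at_top[of m] by eventually_elim (simp only: sum_second_diff)
  ultimately show ?thesis by (simp add: tendsto_cong)
qed

text \<open>The function is the Bessel multiplier applied to some \<open>f\<close> in
  \<open>Lp p\<close>, and the multiplier is resummed by weighted Fejer sums that converge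
  uniformly. The bounded sum \<open>w\<close> has the coefficients of \<open>g\<close>, hence equals
  \<open>g\<close> almost everywhere.\<close>

lemma sobolev_embedding_bounded:
  fixes g :: "real \<Rightarrow> complex"
  assumes p: "p > 1" "t > 1 / p" and g: "integrable circ g" and H: "fourier g \<in> Sob t p"
  shows "\<exists>C. AE x in circ. norm (g x) \<le> C"
proof -
  obtain f where f: "f \<in> Lp p" "fourier f = bessel t (fourier g)" using H by (auto simp: Sob_def)
  have fp: "integrable circ (\<lambda>x. norm (f x) powr p)" and fm: "f \<in> borel_measurable circ"
    using f by (auto simp: Lp_def)
  have fi: "integrable circ f"
  proof (rule Bochner_Integration.integrable_bound)
    show "integrable circ (\<lambda>x. 1 + norm (f x) powr p)" using fp by simp
    have "norm (f x) \<le> 1 + norm (f x) powr p" for x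
    proof (cases "norm (f x) \<le> 1")
      case False
      then have "norm (f x) powr 1 \<le> norm (f x) powr p" using p by (intro powr_mono) auto
      then show ?thesis using False by simp
    qed (simp add: add_increasing2)
    then show "AE x in circ. norm (f x) \<le> norm (1 + norm (f x) powr p)"
      by (intro AE_I2) (simp add: abs_of_nonneg)
  qed (rule fm)
  define A where "A = 1 + (LINT y|circ. norm (f y) powr p)"
  have A: "A \<ge> 1" by (simp add: A_def)
  define B where "B = 8 * pi\<^sup>2 * t * (t + 3) * (1/4) powr (- t / 2 - 1)"
  have B: "B \<ge> 0" using t by (simp add: B_def)
  \<comment> \<open>The exponent is \<open>(- t - 2) + 1 + 1 / p\<close>; summability is the
    condition \<open>t > 1 / p\<close>.\<close>
  define c where "c n = B * A * real n powr (- 1 - (t - 1 / p))" for n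
  have c_sum: "summable c" unfolding c_def using p by (intro summable_mult) (simp add: summable_real_powr_iff)
  have c_nonneg: "c n \<ge> 0" for n using A B by (simp add: c_def)
  define h where "h n x = complex_of_real (second_diff n) * fejer_sum f n x" for n x
  have h_le: "norm (h n x) \<le> c n" for n x
  proof (cases "n = 0")
    case True
    then show ?thesis using c_nonneg[of n] by (simp add: h_def fejer_sum_def)
  next
    case False
    have "norm (h n x) = \<bar>second_diff n\<bar> * norm (fejer_sum f n x)" by (simp add: h_def norm_mult)
    also have "\<dots> \<le> (B * real n powr (- t - 2)) * (real n * real n powr (1 / p) * A)"
      using second_diff_bound[of n] norm_fejer_sum_le[OF fi fp p(1), of n x] False B
      by (intro mult_mono) (auto simp: B_def A_def)
    also have "\<dots> = B * A * (real n powr (- t - 2) * (real n powr 1 * real n powr (1 / p)))"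
      using False by simp
    also have "real n powr (- t - 2) * (real n powr 1 * real n powr (1 / p)) = real n powr (- 1 - (t - 1 / p))"
      using False by (simp only: powr_add[symmetric]) (simp add: algebra_simps)
    finally show ?thesis by (simp add: c_def)
  qed
  define G where "G N x = (\<Sum>n\<in>{1..N}. h n x)" for N x
  define w where "w x = (\<Sum>n. h n x)" for x
  have h_sum: "summable (\<lambda>n. h n x)" for x
    by (rule summable_comparison_test'[OF c_sum, where N=0]) (rule h_le)
  have G_lim: "(\<lambda>N. G N x) \<longlonglongrightarrow> w x" for x
  proof -
    have "(\<lambda>N. \<Sum>n\<le>N. h n x) \<longlonglongrightarrow> w x"
      using summable_LIMSEQ'[OF h_sum] by (simp add: w_def)
    moreover have "(\<Sum>n\<le>N. h n x) = G N x" for N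
      unfolding G_def by (rule sum.mono_neutral_right) (auto simp: h_def fejer_sum_def not_le)
    ultimately show ?thesis by simp
  qed
  define C where "C = (\<Sum>n. c n)"
  have G_le: "norm (G N x) \<le> C" for N x
  proof -
    have "norm (G N x) \<le> (\<Sum>n\<in>{1..N}. c n)"
      unfolding G_def by (rule order_trans[OF norm_sum]) (intro sum_mono h_le)
    also have "\<dots> \<le> C" unfolding C_def by (rule sum_le_suminf[OF c_sum]) (auto simp: c_nonneg)
    finally show ?thesis .
  qed
  have w_le: "norm (w x) \<le> C" for x
    by (rule tendsto_upperbound[OF tendsto_norm[OF G_lim]]) (auto intro!: always_eventually G_le)
  have hm: "h n \<in> borel_measurable circ" for n
    unfolding h_def by (intro borel_measurable_circ_continuous continuous_intros continuous_on_subset[OF continuous_fejer_sum]) auto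
  have Gm: "G N \<in> borel_measurable circ" for N
    unfolding G_def by (intro borel_measurable_sum hm)
  have wm: "w \<in> borel_measurable circ"
    by (rule borel_measurable_LIMSEQ_metric[OF Gm G_lim])
  have hi: "integrable circ (h n)" for n by (rule integrable_circ_bounded[OF hm h_le])
  have wi: "integrable circ w" by (rule integrable_circ_bounded[OF wm w_le])
  have fG: "fourier (G N) k = complex_of_real (\<Sum>n\<in>{1..N}. real (n - nat \<bar>k\<bar>) * second_diff n) * fourier f k" for N k
  proof -
    have "fourier (G N) k = (\<Sum>n\<in>{1..N}. fourier (h n) k)"
      unfolding G_def by (intro fourier_sum hi)
    also have "\<dots> = (\<Sum>n\<in>{1..N}. complex_of_real (second_diff n) * (of_nat (n - nat \<bar>k\<bar>) * fourier f k))"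
      unfolding h_def fourier_cmult fourier_fejer_sum ..
    also have "\<dots> = complex_of_real (\<Sum>n\<in>{1..N}. real (n - nat \<bar>k\<bar>) * second_diff n) * fourier f k"
      by (simp only: of_real_sum sum_distrib_right) (intro sum.cong refl, simp add: mult_ac)
    finally show ?thesis .
  qed
  have "fourier w k = fourier g k" for k
  proof -
    have "(\<lambda>N. fourier (G N) k) \<longlonglongrightarrow> fourier w k"
      unfolding fourier_expi
    proof (rule integral_dominated_convergence[where w="\<lambda>_. C"])
      show "AE x in circ. (\<lambda>N. G N x * expi (- k) x) \<longlonglongrightarrow> w x * expi (- k) x"
        by (intro AE_I2 tendsto_intros G_lim)
      show "AE x in circ. norm (G N x * expi (- k) x) \<le> C" for N
        by (intro AE_I2) (simp add: norm_mult G_le)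
    qed (use Gm wm in auto)
    moreover have "(\<lambda>N. fourier (G N) k) \<longlonglongrightarrow> complex_of_real (mult_fun (real (nat \<bar>k\<bar>))) * fourier f k"
      unfolding fG by (intro tendsto_intros tendsto_sum_second_diff)
    ultimately have "fourier w k = complex_of_real (mult_fun (real (nat \<bar>k\<bar>))) * fourier f k"
      by (rule LIMSEQ_unique)
    also have "mult_fun (real (nat \<bar>k\<bar>)) = bessel_wt k powr (- t / 2)"
      by (simp add: mult_fun_def bessel_wt_def power_mult_distrib)
    also have "complex_of_real (bessel_wt k powr (- t / 2)) * fourier f k = complex_of_real (bessel_wt k powr (- t / 2) * bessel_wt k powr (t / 2)) * fourier g k"
      unfolding f(2) bessel_eq by simp
    also have "bessel_wt k powr (- t / 2) * bessel_wt k powr (t / 2) = 1"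
      using less_imp_neq[OF bessel_wt_pos[of k]] by (simp add: powr_add[symmetric])
    finally show ?thesis by simp
  qed
  then have "fourier w = fourier g" by (rule ext)
  then have "AE x in circ. w x = g x" by (rule fourier_inj_AE[OF wi g])
  then have "AE x in circ. norm (g x) \<le> C"
  proof eventually_elim
    case (elim x)
    then show ?case using w_le[of x] by simp
  qed
  then show ?thesis by blast
qed

end

section \<open>The resolvent\<close>

typedef ell2 = "{x :: int \<Rightarrow> complex. sq_summable x}" morphisms coord Ell2
  by (rule exI[of _ "\<lambda>_. 0"]) (simp add: sq_summable_def)

lemma coord_summable [simp]: "sq_summable (coord x)"
  using coord by simp

lemma coord_Ell2 [simp]: "sq_summable x \<Longrightarrow> coord (Ell2 x) = x"
  by (simp add: Ell2_inverse)

lemma ell2_eqI: "(\<And>k. coord x k = coord y k) \<Longrightarrow> x = y"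
  by (simp add: coord_inject[symmetric] fun_eq_iff)

lemma sq_summable_add:
  assumes "sq_summable x" "sq_summable y" shows "sq_summable (\<lambda>k. x k + y k)"
  unfolding sq_summable_def
proof (rule summable_on_comparison_test)
  show "(\<lambda>k. 2 * (norm (x k))\<^sup>2 + 2 * (norm (y k))\<^sup>2) summable_on UNIV"
    using assms unfolding sq_summable_def by (intro summable_on_add summable_on_cmult_right)
  show "(norm (x k + y k))\<^sup>2 \<le> 2 * (norm (x k))\<^sup>2 + 2 * (norm (y k))\<^sup>2" for k
  proof -
    have "(norm (x k + y k))\<^sup>2 \<le> (norm (x k) + norm (y k))\<^sup>2"
      by (intro power_mono norm_triangle_ineq) auto
    also have "\<dots> \<le> 2 * (norm (x k))\<^sup>2 + 2 * (norm (y k))\<^sup>2"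
      using sum_squares_bound[of "norm (x k)" "norm (y k)"] by (simp add: power2_sum)
    finally show ?thesis .
  qed
qed simp

lemma sq_summable_cmult:
  assumes "sq_summable x" shows "sq_summable (\<lambda>k. c * x k)"
  by (rule sq_summable_mono[OF assms, of _ "norm c"]) (simp add: norm_mult)

lemma sq_summable_diff:
  assumes "sq_summable x" "sq_summable y" shows "sq_summable (\<lambda>k. x k - y k)"
  using sq_summable_add[OF assms(1) sq_summable_cmult[OF assms(2), of "-1"]] by simp

lemma summable_Re_mult_cnj:
  assumes "sq_summable x" "sq_summable y"
  shows "(\<lambda>k. Re (x k * cnj (y k))) summable_on UNIV"
proof (rule abs_summable_summable, rule summable_on_comparison_test)
  show "(\<lambda>k. (norm (x k))\<^sup>2 + (norm (y k))\<^sup>2) summable_on UNIV"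
    using assms unfolding sq_summable_def by (intro summable_on_add)
  show "norm (Re (x k * cnj (y k))) \<le> (norm (x k))\<^sup>2 + (norm (y k))\<^sup>2" for k
  proof -
    have "\<bar>Re (x k * cnj (y k))\<bar> \<le> norm (x k) * norm (y k)"
      using abs_Re_le_cmod[of "x k * cnj (y k)"] by (simp add: norm_mult)
    also have "\<dots> \<le> (norm (x k))\<^sup>2 + (norm (y k))\<^sup>2"
      using sum_squares_bound[of "norm (x k)" "norm (y k)"]
        zero_le_power2[of "norm (x k)"] zero_le_power2[of "norm (y k)"] by linarith
    finally show ?thesis by simp
  qed
qed simp

instantiation ell2 :: real_inner
begin

definition "0 = Ell2 (\<lambda>_. 0)"
definition "x + y = Ell2 (\<lambda>k. coord x k + coord y k)"
definition "x - y = Ell2 (\<lambda>k. coord x k - coord y k)"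
definition "- x = Ell2 (\<lambda>k. - coord x k)"
definition "c *\<^sub>R x = Ell2 (\<lambda>k. of_real c * coord x k)"
definition "inner x y = (\<Sum>\<^sub>\<infinity>k. Re (coord x k * cnj (coord y k)))"
definition "norm x = sqrt (inner x (x :: ell2))"
definition "dist x y = norm (x - (y :: ell2))"
definition "sgn x = inverse (norm x) *\<^sub>R (x :: ell2)"
definition [code del]: "(uniformity :: (ell2 \<times> ell2) filter) = (INF e\<in>{0 <..}. principal {(x, y). dist x y < e})"
definition [code del]: "open (U :: ell2 set) \<longleftrightarrow> (\<forall>x\<in>U. \<forall>\<^sub>F (x', y) in uniformity. x' = x \<longrightarrow> y \<in> U)"

lemma coord_zero [simp]: "coord 0 k = 0"
  by (simp add: zero_ell2_def sq_summable_def)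

lemma coord_add [simp]: "coord (x + y) k = coord x k + coord y k"
  by (simp add: plus_ell2_def sq_summable_add)

lemma coord_diff [simp]: "coord (x - y) k = coord x k - coord y k"
  by (simp add: minus_ell2_def sq_summable_diff)

lemma coord_uminus [simp]: "coord (- x) k = - coord x k"
  using sq_summable_cmult[OF coord_summable[of x], of "-1"] by (simp add: uminus_ell2_def)

lemma coord_scaleR [simp]: "coord (c *\<^sub>R x) k = of_real c * coord x k"
  by (simp add: scaleR_ell2_def sq_summable_cmult)

lemma inner_ell2_self: "inner x (x :: ell2) = (\<Sum>\<^sub>\<infinity>k. (norm (coord x k))\<^sup>2)"
  by (simp add: inner_ell2_def cmod_power2) (simp add: power2_eq_square)

instance
proof
  fix x y z :: ell2 and a b :: real
  show "x + y + z = x + (y + z)" "x + y = y + x" "0 + x = x" "- x + x = 0" "x - y = x + - y"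
    "a *\<^sub>R (x + y) = a *\<^sub>R x + a *\<^sub>R y" "(a + b) *\<^sub>R x = a *\<^sub>R x + b *\<^sub>R x"
    "a *\<^sub>R b *\<^sub>R x = (a * b) *\<^sub>R x" "1 *\<^sub>R x = x"
    by (rule ell2_eqI; simp add: algebra_simps)+
  show "dist x y = norm (x - y)" by (rule dist_ell2_def)
  show "sgn x = inverse (norm x) *\<^sub>R x" by (rule sgn_ell2_def)
  show "norm x = sqrt (inner x x)" by (rule norm_ell2_def)
  show "(uniformity :: (ell2 \<times> ell2) filter) = (INF e\<in>{0 <..}. principal {(x, y). dist x y < e})"
    by (rule uniformity_ell2_def)
  show "open U \<longleftrightarrow> (\<forall>x\<in>U. \<forall>\<^sub>F (x', y) in uniformity. x' = x \<longrightarrow> y \<in> U)" for U :: "ell2 set"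
    by (rule open_ell2_def)
  show "inner x y = inner y x"
    by (simp add: inner_ell2_def mult.commute)
  show "inner (x + y) z = inner x z + inner y z"
    unfolding inner_ell2_def
    by (subst infsum_add[symmetric]) (simp_all only: summable_Re_mult_cnj coord_summable coord_add distrib_right plus_complex.sel)
  show "inner (a *\<^sub>R x) y = a * inner x y"
    unfolding inner_ell2_def
    by (subst infsum_cmult_right'[symmetric]) (simp add: algebra_simps)
  show "0 \<le> inner x x"
    unfolding inner_ell2_self by (rule infsum_nonneg) simp
  show "inner x x = 0 \<longleftrightarrow> x = 0"
  proof
    assume "inner x x = 0"
    then have "(norm (coord x k))\<^sup>2 = 0" for k
      using nonneg_has_sum_le_0D[of "\<lambda>k. (norm (coord x k))\<^sup>2" UNIV 0 k]
        has_sum_infsum[OF coord_summable[of x, unfolded sq_summable_def]] by (simp add: inner_ell2_self)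
    then show "x = 0" by (intro ell2_eqI) simp
  qed (simp add: inner_ell2_self)
qed

end

lemma norm_ell2_power2: "((\<lambda>k. (norm (coord x k))\<^sup>2) has_sum (norm x)\<^sup>2) UNIV"
  unfolding power2_norm_eq_inner[of x] inner_ell2_self
  by (rule has_sum_infsum[OF coord_summable[of x, unfolded sq_summable_def]])

lemma norm_coord_le: "norm (coord x k) \<le> norm x"
  by (rule power2_le_imp_le[OF infsum_ge_term[OF norm_ell2_power2]]) auto

lemma norm_ell2_le:
  assumes "C \<ge> 0" "\<And>F. finite F \<Longrightarrow> (\<Sum>k\<in>F. (norm (coord x k))\<^sup>2) \<le> C\<^sup>2"
  shows "norm x \<le> C"
proof -
  have "(norm x)\<^sup>2 \<le> C\<^sup>2" by (rule has_sum_le_finite_sums[OF norm_ell2_power2]) (use assms in auto)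
  then show ?thesis using assms(1) by (rule power2_le_imp_le)
qed

lemma sum_norm_coord_le: "finite F \<Longrightarrow> (\<Sum>k\<in>F. (norm (coord x k))\<^sup>2) \<le> (norm x)\<^sup>2"
  using finite_sum_le_infsum[of "\<lambda>k. (norm (coord x k))\<^sup>2" UNIV F]
    coord_summable[of x, unfolded sq_summable_def] infsumI[OF norm_ell2_power2[of x]] by simp

text \<open>The limit is taken coordinatewise; bounds on finite partial sums pass to it and yield
  both square-summability and convergence in norm.\<close>

instance ell2 :: complete_space
proof
  fix X :: "nat \<Rightarrow> ell2" assume X: "Cauchy X"
  have "Cauchy (\<lambda>n. coord (X n) k)" for k
    unfolding Cauchy_def
  proof (intro allI impI)
    fix e :: real assume "e > 0"
    then obtain N where N: "\<And>m n. m \<ge> N \<Longrightarrow> n \<ge> N \<Longrightarrow> dist (X m) (X n) < e"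
      using X unfolding Cauchy_def by blast
    have "dist (coord (X m) k) (coord (X n) k) < e" if "m \<ge> N" "n \<ge> N" for m n
      using norm_coord_le[of "X m - X n" k] N[OF that] by (simp add: dist_norm)
    then show "\<exists>M. \<forall>m\<ge>M. \<forall>n\<ge>M. dist (coord (X m) k) (coord (X n) k) < e" by blast
  qed
  then have "\<exists>l. (\<lambda>n. coord (X n) k) \<longlonglongrightarrow> l" for k
    by (simp add: Cauchy_convergent_iff convergent_def)
  then obtain y where y: "\<And>k. (\<lambda>n. coord (X n) k) \<longlonglongrightarrow> y k" by metis
  have fin: "\<exists>N. \<forall>n\<ge>N. \<forall>F. finite F \<longrightarrow> (\<Sum>k\<in>F. (norm (coord (X n) k - y k))\<^sup>2) \<le> e\<^sup>2" if e: "e > 0" for e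
  proof -
    obtain N where N: "\<And>m n. m \<ge> N \<Longrightarrow> n \<ge> N \<Longrightarrow> dist (X m) (X n) < e"
      using X e unfolding Cauchy_def by blast
    have "(\<Sum>k\<in>F. (norm (coord (X n) k - y k))\<^sup>2) \<le> e\<^sup>2" if "n \<ge> N" "finite F" for n F
    proof (rule tendsto_upperbound)
      show "(\<lambda>m. \<Sum>k\<in>F. (norm (coord (X n) k - coord (X m) k))\<^sup>2) \<longlonglongrightarrow> (\<Sum>k\<in>F. (norm (coord (X n) k - y k))\<^sup>2)"
        by (intro tendsto_intros y)
      have "(\<Sum>k\<in>F. (norm (coord (X n) k - coord (X m) k))\<^sup>2) \<le> e\<^sup>2" if "m \<ge> N" for m
      proof -
        have "(\<Sum>k\<in>F. (norm (coord (X n) k - coord (X m) k))\<^sup>2) \<le> (norm (X n - X m))\<^sup>2"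
          using sum_norm_coord_le[OF \<open>finite F\<close>, of "X n - X m"] by simp
        also have "\<dots> \<le> e\<^sup>2"
          using N[OF \<open>n \<ge> N\<close> that] by (intro power_mono) (auto simp: dist_norm)
        finally show ?thesis .
      qed
      then show "\<forall>\<^sub>F m in sequentially. (\<Sum>k\<in>F. (norm (coord (X n) k - coord (X m) k))\<^sup>2) \<le> e\<^sup>2"
        unfolding eventually_sequentially by blast
    qed simp
    then show ?thesis by blast
  qed
  obtain N where "\<forall>n\<ge>N. \<forall>F. finite F \<longrightarrow> (\<Sum>k\<in>F. (norm (coord (X n) k - y k))\<^sup>2) \<le> 1\<^sup>2"
    using fin[of 1] by auto
  then have N: "\<And>F. finite F \<Longrightarrow> (\<Sum>k\<in>F. (norm (coord (X N) k - y k))\<^sup>2) \<le> 1" by simp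
  have "sq_summable (\<lambda>k. coord (X N) k - y k)"
    unfolding sq_summable_def
    by (rule nonneg_bdd_above_summable_on) (auto intro!: bdd_aboveI2 N)
  then have ys: "sq_summable y"
    using sq_summable_diff[OF coord_summable[of "X N"], of "\<lambda>k. coord (X N) k - y k"] by simp
  have "X \<longlonglongrightarrow> Ell2 y"
    unfolding LIMSEQ_iff
  proof (intro allI impI)
    fix e :: real assume "e > 0"
    then obtain N where N: "\<forall>n\<ge>N. \<forall>F. finite F \<longrightarrow> (\<Sum>k\<in>F. (norm (coord (X n) k - y k))\<^sup>2) \<le> (e/2)\<^sup>2"
      using fin[of "e/2"] by auto
    have "norm (X n - Ell2 y) < e" if "n \<ge> N" for n
    proof -
      have "norm (X n - Ell2 y) \<le> e/2"
        using N that \<open>e > 0\<close> ys by (intro norm_ell2_le) auto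
      then show ?thesis using \<open>e > 0\<close> by linarith
    qed
    then show "\<exists>no. \<forall>n\<ge>no. norm (X n - Ell2 y) < e" by blast
  qed
  then show "convergent X" by (auto simp: convergent_def)
qed

text \<open>Lax-Milgram with an explicit approximating sequence. The step map contracts since
  \<open>1 - 2 * \<tau> * c + \<tau>\<^sup>2 * L\<^sup>2 \<le> 1 - \<tau> * c\<close> bounds the
  squared contraction factor.\<close>

lemma richardson_iteration:
  fixes T :: "'h::{real_inner,complete_space} \<Rightarrow> 'h" and x :: "nat \<Rightarrow> 'h"
  assumes diff: "\<And>x y. T x - T y = T (x - y)"
    and bound: "\<And>x. norm (T x) \<le> L * norm x" and L: "L \<ge> 0"
    and coercive: "\<And>x. c * (norm x)\<^sup>2 \<le> inner (T x) x" and c: "c > 0"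
    and \<tau>: "\<tau> > 0" "\<tau> * L\<^sup>2 \<le> c"
    and x: "x 0 = 0" "\<And>n. x (Suc n) = x n - \<tau> *\<^sub>R (T (x n) - g)"
  shows "\<exists>y. T y = g \<and> x \<longlonglongrightarrow> y"
proof -
  define r where "r = sqrt (max 0 (1 - \<tau> * c))"
  have r: "0 \<le> r" "r < 1" using c \<tau> by (auto simp: r_def max_def)
  define G where "G z = z - \<tau> *\<^sub>R (T z - g)" for z
  have contr: "dist (G w) (G z) \<le> r * dist w z" for w z
  proof -
    define d where "d = w - z"
    have "G w - G z = d - \<tau> *\<^sub>R T d"
      by (simp add: G_def d_def diff[symmetric] algebra_simps)
    moreover have "(norm (d - \<tau> *\<^sub>R T d))\<^sup>2 \<le> (r * norm d)\<^sup>2"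
    proof -
      have "(norm (d - \<tau> *\<^sub>R T d))\<^sup>2 = (norm d)\<^sup>2 - 2 * \<tau> * inner (T d) d + \<tau>\<^sup>2 * (norm (T d))\<^sup>2"
      proof -
        have "(norm (d - w))\<^sup>2 = (norm d)\<^sup>2 - 2 * inner w d + (norm w)\<^sup>2" for w :: 'h
          by (simp add: power2_norm_eq_inner inner_diff_left inner_diff_right inner_commute)
        from this[of "\<tau> *\<^sub>R T d"] show ?thesis by (simp add: power_mult_distrib)
      qed
      also have "\<dots> \<le> (norm d)\<^sup>2 - 2 * \<tau> * (c * (norm d)\<^sup>2) + \<tau>\<^sup>2 * (L * norm d)\<^sup>2"
        using \<tau> coercive[of d] bound[of d] by (intro add_mono diff_mono mult_left_mono power_mono) auto
      also have "\<tau>\<^sup>2 * (L * norm d)\<^sup>2 = \<tau> * (\<tau> * L\<^sup>2) * (norm d)\<^sup>2" by (simp add: power2_eq_square)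
      also have "\<dots> \<le> \<tau> * c * (norm d)\<^sup>2" using \<tau> by (intro mult_right_mono mult_left_mono) auto
      also have "(norm d)\<^sup>2 - 2 * \<tau> * (c * (norm d)\<^sup>2) + \<tau> * c * (norm d)\<^sup>2 = (1 - \<tau> * c) * (norm d)\<^sup>2"
        by (simp only: left_diff_distrib)
      also have "\<dots> \<le> r\<^sup>2 * (norm d)\<^sup>2"
        by (rule mult_right_mono) (simp_all add: r_def)
      also have "\<dots> = (r * norm d)\<^sup>2" by (simp only: power_mult_distrib)
      finally show ?thesis by simp
    qed
    then have "norm (d - \<tau> *\<^sub>R T d) \<le> r * norm d"
      by (rule power2_le_imp_le) (use r in simp)
    ultimately show ?thesis by (simp add: dist_norm d_def)
  qed
  have "\<exists>!y. G y = y"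
    by (rule banach_fix_type[OF r]) (use contr in blast)
  then obtain y where y: "G y = y" by blast
  have "\<tau> *\<^sub>R (T y - g) = 0" using y by (simp add: G_def)
  then have Ty: "T y = g" using \<tau> by simp
  have "dist (x n) y \<le> r ^ n * dist 0 y" for n
  proof (induction n)
    case (Suc n)
    have "dist (x (Suc n)) y = dist (G (x n)) (G y)" 
      by (simp only: y x(2) G_def[of "x n", symmetric])
    also have "\<dots> \<le> r * dist (x n) y" by (rule contr)
    also have "\<dots> \<le> r * (r ^ n * dist 0 y)" using r Suc by (intro mult_left_mono) auto
    finally show ?case by simp
  qed (simp add: x)
  moreover have "(\<lambda>n. r ^ n * dist 0 y) \<longlonglongrightarrow> 0 * dist 0 y"
    using r by (intro tendsto_intros LIMSEQ_power_zero) auto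
  ultimately have "(\<lambda>n. dist (x n) y) \<longlonglongrightarrow> 0"
    by (auto intro: Lim_null_comparison[where g="\<lambda>n. r ^ n * dist 0 y"])
  then have "x \<longlonglongrightarrow> y" by (rule tendsto_dist_iff[THEN iffD2])
  then show ?thesis using Ty by blast
qed

lemma norm_Ell2_has_sum: "sq_summable x \<Longrightarrow> ((\<lambda>k. (norm (x k))\<^sup>2) has_sum (norm (Ell2 x))\<^sup>2) UNIV"
  using norm_ell2_power2[of "Ell2 x"] by simp

lemma norm_Ell2_le:
  assumes "sq_summable x" "sq_summable y" "\<And>k. norm (x k) \<le> c * norm (y k)" "c \<ge> 0"
  shows "norm (Ell2 x) \<le> c * norm (Ell2 y)"
proof -
  have "(norm (Ell2 x))\<^sup>2 \<le> c\<^sup>2 * (norm (Ell2 y))\<^sup>2"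
  proof (rule has_sum_mono[OF norm_Ell2_has_sum[OF assms(1)] has_sum_cmult_right[OF norm_Ell2_has_sum[OF assms(2)]]])
    show "(norm (x k))\<^sup>2 \<le> c\<^sup>2 * (norm (y k))\<^sup>2" for k
      using power_mono[OF assms(3)[of k], of 2] by (simp add: power_mult_distrib)
  qed
  then have "(norm (Ell2 x))\<^sup>2 \<le> (c * norm (Ell2 y))\<^sup>2" by (simp only: power_mult_distrib)
  then show ?thesis by (rule power2_le_imp_le) (use assms(4) in simp)
qed

lemma Ell2_diff: "sq_summable x \<Longrightarrow> sq_summable y \<Longrightarrow> Ell2 x - Ell2 y = Ell2 (\<lambda>k. x k - y k)"
  by (rule ell2_eqI) (simp add: sq_summable_diff)

text \<open>Coercivity at \<open>v = 0\<close>, tested on a real mode with the frequencies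
  \<open>k\<close> and \<open>- k\<close>. The bound on the symbol then transfers coercivity to
  every coefficient known to be bounded almost everywhere.\<close>

lemma Dq_symbol_ge_if_coercive:
  assumes \<epsilon>: "\<epsilon> > 0"
    and B: "\<And>u. u \<in> H 1 \<Longrightarrow> B_op \<epsilon> q (\<lambda>_. 0) u = (\<lambda>k. cnj (Dq_symbol \<epsilon> q k) * (of_real (\<epsilon>\<^sup>2) * (Dq_symbol \<epsilon> q k * u k)))"
    and coercive: "\<And>\<alpha> v u. \<alpha> > 0 \<Longrightarrow> hoelder \<alpha> v \<Longrightarrow> u \<in> H_real 1 \<Longrightarrow>
           Re (duality (B_op \<epsilon> q v u) u) \<ge> \<delta> * (Sob_norm 1 2 u)\<^sup>2"
  shows "\<delta> * bessel_wt k \<le> \<epsilon>\<^sup>2 * (norm (Dq_symbol \<epsilon> q k))\<^sup>2"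
proof -
  define u :: pdistr where "u l = (if l = k \<or> l = - k then 1 else 0)" for l
  \<comment> \<open>One or two points, according to whether \<open>k = 0\<close>; the factor
    \<open>card I\<close> appears on both sides and cancels.\<close>
  define I where "I = {k, - k}"
  have I: "finite I" "I \<noteq> {}" "\<And>l. l \<notin> I \<Longrightarrow> u l = 0" "\<And>l. l \<in> I \<Longrightarrow> u l = 1" "\<And>l. l \<in> I \<Longrightarrow> - l \<in> I"
    by (auto simp: I_def u_def)
  have u: "u \<in> H 1" by (rule H_finite[OF I(1,3)])
  have ur: "u \<in> H_real 1" using u by (auto simp: Sob_real_def real_distr_def u_def)
  have "hoelder 1 (\<lambda>_. 0)" by (auto simp: hoelder_def intro: exI[of _ 0])
  from coercive[OF _ this ur] have c: "\<delta> * (Sob_norm 1 2 u)\<^sup>2 \<le> Re (duality (B_op \<epsilon> q (\<lambda>_. 0) u) u)" by simp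
  have w: "bessel_wt l powr 1 * (norm (u l))\<^sup>2 = (if l \<in> I then bessel_wt k else 0)" for l
    using I_def bessel_wt_minus[of k] I(3,4)[of l] bessel_wt_pos[of k] by (auto simp: abs_of_pos)
  have "((\<lambda>l. bessel_wt l powr 1 * (norm (u l))\<^sup>2) has_sum (\<Sum>l\<in>I. bessel_wt k)) UNIV"
    unfolding w by (rule has_sum_finite_neutralI) (use I in auto)
  then have S: "(Sob_norm 1 2 u)\<^sup>2 = real (card I) * bessel_wt k"
    using has_sum_unique[OF Sob_norm_power2[OF u]] by simp
  have d: "B_op \<epsilon> q (\<lambda>_. 0) u l * u (- l) = (if l \<in> I then complex_of_real (\<epsilon>\<^sup>2 * (norm (Dq_symbol \<epsilon> q k))\<^sup>2) else 0)" for l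
  proof (cases "l \<in> I")
    case True
    then have "norm (Dq_symbol \<epsilon> q l) = norm (Dq_symbol \<epsilon> q k)"
      by (auto simp: I_def Dq_symbol_uminus)
    then show ?thesis using True I(4)[OF True] I(4)[OF I(5)[OF True]]
      unfolding B[OF u] of_real_mult complex_norm_square[of "Dq_symbol \<epsilon> q k"]
      by (simp add: complex_norm_square[symmetric] mult.commute mult.left_commute flip: of_real_power)
  next
    case False
    then show ?thesis using I(3)[OF False] by (simp add: B[OF u])
  qed
  have "((\<lambda>l. B_op \<epsilon> q (\<lambda>_. 0) u l * u (- l)) has_sum (\<Sum>l\<in>I. complex_of_real (\<epsilon>\<^sup>2 * (norm (Dq_symbol \<epsilon> q k))\<^sup>2))) UNIV"
    unfolding d by (rule has_sum_finite_neutralI) (use I in auto)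
  then have "duality (B_op \<epsilon> q (\<lambda>_. 0) u) u = of_nat (card I) * complex_of_real (\<epsilon>\<^sup>2 * (norm (Dq_symbol \<epsilon> q k))\<^sup>2)"
    unfolding duality_def by (simp only: infsumI sum_constant)
  then have "Re (duality (B_op \<epsilon> q (\<lambda>_. 0) u) u) = real (card I) * (\<epsilon>\<^sup>2 * (norm (Dq_symbol \<epsilon> q k))\<^sup>2)"
  proof -
    have cc: "of_nat (card I) = complex_of_real (real (card I))" by simp
    assume "duality (B_op \<epsilon> q (\<lambda>_. 0) u) u = of_nat (card I) * complex_of_real (\<epsilon>\<^sup>2 * (norm (Dq_symbol \<epsilon> q k))\<^sup>2)"
    then show ?thesis by (simp only: cc of_real_mult[symmetric] Re_complex_of_real)
  qed
  then have "real (card I) * (\<delta> * bessel_wt k) \<le> real (card I) * (\<epsilon>\<^sup>2 * (norm (Dq_symbol \<epsilon> q k))\<^sup>2)"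
    using c S by (simp add: mult_ac)
  moreover have "real (card I) > 0" using I(1,2) by (simp add: card_gt_0_iff)
  ultimately show ?thesis by (simp only: mult_le_cancel_left_pos)
qed

definition coef :: "real \<Rightarrow> (real \<Rightarrow> real) \<Rightarrow> real \<Rightarrow> complex" where
  "coef \<epsilon> v x = of_real (\<epsilon>\<^sup>2 + (v x)\<^sup>2)"

text \<open>Multiplication by \<open>\<epsilon>\<^sup>2 + v\<^sup>2\<close> seen on coefficient
  sequences; which representative \<open>fun_of\<close> picks has no influence after
  \<open>fourier\<close>.\<close>

definition mulF :: "real \<Rightarrow> (real \<Rightarrow> real) \<Rightarrow> (int \<Rightarrow> complex) \<Rightarrow> int \<Rightarrow> complex" where
  "mulF \<epsilon> v s = fourier (\<lambda>x. coef \<epsilon> v x * fun_of s x)"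

context
  fixes \<epsilon> q C :: real and v :: "real \<Rightarrow> real"
  assumes \<epsilon>: "\<epsilon> > 0" and v: "v \<in> borel_measurable circ" "AE x in circ. \<bar>v x\<bar> \<le> C"
begin

lemma coef_measurable [measurable]: "coef \<epsilon> v \<in> borel_measurable circ"
  using v(1) unfolding coef_def[abs_def] by measurable

lemma coef_bound: "AE x in circ. norm (coef \<epsilon> v x) \<le> \<epsilon>\<^sup>2 + C\<^sup>2"
  using v(2)
proof eventually_elim
  case (elim x)
  then have "(v x)\<^sup>2 \<le> C\<^sup>2" using power_mono[of "\<bar>v x\<bar>" C 2] by simp
  then show ?case unfolding coef_def norm_of_real by simp
qed

lemma coef_mult_Lp_2: "\<phi> \<in> Lp 2 \<Longrightarrow> (\<lambda>x. coef \<epsilon> v x * \<phi> x) \<in> Lp 2"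
  by (rule Lp_2_mult_bounded[OF _ coef_measurable coef_bound])

lemma mulF_summable: "sq_summable s \<Longrightarrow> sq_summable (mulF \<epsilon> v s)"
  unfolding mulF_def by (intro sq_summable_fourier coef_mult_Lp_2 fun_of_Lp_2)

lemma mulF_norm:
  assumes s: "sq_summable s" shows "norm (Ell2 (mulF \<epsilon> v s)) \<le> (\<epsilon>\<^sup>2 + C\<^sup>2) * norm (Ell2 s)"
proof -
  have "(norm (Ell2 (mulF \<epsilon> v s)))\<^sup>2 = (LINT x|circ. (norm (coef \<epsilon> v x * fun_of s x))\<^sup>2)"
    using has_sum_unique[OF norm_Ell2_has_sum[OF mulF_summable[OF s]], folded mulF_def]
      parseval_norm[OF coef_mult_Lp_2[OF fun_of_Lp_2[OF s]], folded mulF_def] by simp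
  also have "\<dots> \<le> (LINT x|circ. (\<epsilon>\<^sup>2 + C\<^sup>2)\<^sup>2 * (norm (fun_of s x))\<^sup>2)"
  proof (rule integral_mono_AE)
    show "integrable circ (\<lambda>x. (norm (coef \<epsilon> v x * fun_of s x))\<^sup>2)"
      using coef_mult_Lp_2[OF fun_of_Lp_2[OF s]] by (simp add: Lp_2_iff)
    show "integrable circ (\<lambda>x. (\<epsilon>\<^sup>2 + C\<^sup>2)\<^sup>2 * (norm (fun_of s x))\<^sup>2)"
      using fun_of_Lp_2[OF s] by (simp add: Lp_2_iff)
    show "AE x in circ. (norm (coef \<epsilon> v x * fun_of s x))\<^sup>2 \<le> (\<epsilon>\<^sup>2 + C\<^sup>2)\<^sup>2 * (norm (fun_of s x))\<^sup>2"
      using coef_bound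
    proof eventually_elim
      case (elim x)
      then have "(norm (coef \<epsilon> v x))\<^sup>2 \<le> (\<epsilon>\<^sup>2 + C\<^sup>2)\<^sup>2" by (intro power_mono) auto
      then show ?case unfolding norm_mult power_mult_distrib by (intro mult_right_mono) auto
    qed
  qed
  also have "\<dots> = (\<epsilon>\<^sup>2 + C\<^sup>2)\<^sup>2 * (norm (Ell2 s))\<^sup>2"
    using has_sum_unique[OF norm_Ell2_has_sum[OF s] parseval_norm[OF fun_of_Lp_2[OF s], unfolded fourier_fun_of[OF s]]]
    by simp
  finally have "(norm (Ell2 (mulF \<epsilon> v s)))\<^sup>2 \<le> ((\<epsilon>\<^sup>2 + C\<^sup>2) * norm (Ell2 s))\<^sup>2" by (simp only: power_mult_distrib)
  then show ?thesis by (rule power2_le_imp_le) simp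
qed

lemma fun_of_diff_AE:
  assumes "sq_summable s" "sq_summable t"
  shows "AE x in circ. fun_of (\<lambda>k. s k - t k) x = fun_of s x - fun_of t x"
proof (rule fourier_inj_AE)
  show "fourier (fun_of (\<lambda>k. s k - t k)) = fourier (\<lambda>x. fun_of s x - fun_of t x)"
    using assms by (intro ext)
      (simp add: fourier_fun_of sq_summable_diff fourier_diff integrable_Lp_2 fun_of_Lp_2)
qed (use assms in \<open>auto intro!: integrable_Lp_2 Lp_2_diff fun_of_Lp_2 sq_summable_diff\<close>)

lemma mulF_diff:
  assumes "sq_summable s" "sq_summable t"
  shows "mulF \<epsilon> v (\<lambda>k. s k - t k) k = mulF \<epsilon> v s k - mulF \<epsilon> v t k"
proof -
  note L = coef_mult_Lp_2[OF fun_of_Lp_2]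
  have "mulF \<epsilon> v (\<lambda>k. s k - t k) = fourier (\<lambda>x. coef \<epsilon> v x * fun_of s x - coef \<epsilon> v x * fun_of t x)"
    unfolding mulF_def
  proof (rule fourier_cong_AE)
    show "AE x in circ. coef \<epsilon> v x * fun_of (\<lambda>k. s k - t k) x = coef \<epsilon> v x * fun_of s x - coef \<epsilon> v x * fun_of t x"
      using fun_of_diff_AE[OF assms] by eventually_elim (simp add: right_diff_distrib)
  qed (use Lp_2_measurable[OF L[OF sq_summable_diff[OF assms]]] Lp_2_measurable[OF L[OF assms(1)]]
        Lp_2_measurable[OF L[OF assms(2)]] in auto)
  then show ?thesis
    using fourier_diff[OF integrable_Lp_2[OF L[OF assms(1)]] integrable_Lp_2[OF L[OF assms(2)]]]
    by (simp add: mulF_def)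
qed

text \<open>Parseval turns the form into the integral of
  \<open>\<epsilon>\<^sup>2 + v\<^sup>2\<close> against a squared norm, from which the nonnegative
  \<open>v\<^sup>2\<close> is dropped.\<close>

lemma mulF_form:
  assumes s: "sq_summable s"
  shows "\<exists>R. ((\<lambda>k. Re (mulF \<epsilon> v s k * cnj (s k))) has_sum R) UNIV \<and> \<epsilon>\<^sup>2 * (norm (Ell2 s))\<^sup>2 \<le> R"
proof (intro exI conjI)
  note \<phi> = fun_of_Lp_2[OF s]
  note L = coef_mult_Lp_2[OF \<phi>]
  show "((\<lambda>k. Re (mulF \<epsilon> v s k * cnj (s k))) has_sum Re (LINT x|circ. coef \<epsilon> v x * fun_of s x * cnj (fun_of s x))) UNIV"
    using has_sum_Re[OF parseval[OF L \<phi>]] unfolding fourier_fun_of[OF s] mulF_def[symmetric] .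
  have i: "integrable circ (\<lambda>x. coef \<epsilon> v x * fun_of s x * cnj (fun_of s x))"
    by (rule integrable_mult_Lp_2[OF L Lp_2_cnj[OF \<phi>]])
  have "\<epsilon>\<^sup>2 * (norm (Ell2 s))\<^sup>2 = \<epsilon>\<^sup>2 * (LINT x|circ. (norm (fun_of s x))\<^sup>2)"
    using has_sum_unique[OF norm_Ell2_has_sum[OF s] parseval_norm[OF \<phi>, unfolded fourier_fun_of[OF s]]] by simp
  also have "\<dots> = (LINT x|circ. \<epsilon>\<^sup>2 * (norm (fun_of s x))\<^sup>2)" by simp
  also have "\<dots> \<le> (LINT x|circ. Re (coef \<epsilon> v x * fun_of s x * cnj (fun_of s x)))"
  proof (rule Bochner_Integration.integral_mono)
    show "integrable circ (\<lambda>x. \<epsilon>\<^sup>2 * (norm (fun_of s x))\<^sup>2)" using \<phi> by (simp add: Lp_2_iff)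
    show "integrable circ (\<lambda>x. Re (coef \<epsilon> v x * fun_of s x * cnj (fun_of s x)))" by (rule integrable_Re[OF i])
    fix x
    have "coef \<epsilon> v x * fun_of s x * cnj (fun_of s x) = complex_of_real ((\<epsilon>\<^sup>2 + (v x)\<^sup>2) * (norm (fun_of s x))\<^sup>2)"
      unfolding of_real_mult complex_norm_square coef_def by (simp add: mult.assoc)
    then have "Re (coef \<epsilon> v x * fun_of s x * cnj (fun_of s x)) = (\<epsilon>\<^sup>2 + (v x)\<^sup>2) * (norm (fun_of s x))\<^sup>2"
      by (simp only: Re_complex_of_real)
    then show "\<epsilon>\<^sup>2 * (norm (fun_of s x))\<^sup>2 \<le> Re (coef \<epsilon> v x * fun_of s x * cnj (fun_of s x))"
      by (simp add: mult_right_mono)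
  qed
  also have "\<dots> = Re (LINT x|circ. coef \<epsilon> v x * fun_of s x * cnj (fun_of s x))" by (rule integral_Re[OF i])
  finally show "\<epsilon>\<^sup>2 * (norm (Ell2 s))\<^sup>2 \<le> Re (LINT x|circ. coef \<epsilon> v x * fun_of s x * cnj (fun_of s x))" .
qed

text \<open>Expresses the multiplication through coefficients alone; the measurability of the
  resolvent rests on this formula.\<close>

lemma mulF_convolution:
  assumes s: "sq_summable s"
  shows "((\<lambda>l. fourier (coef \<epsilon> v) (k - l) * s l) has_sum mulF \<epsilon> v s k) UNIV"
proof -
  have L: "(\<lambda>x. coef \<epsilon> v x * expi (- k) x) \<in> Lp 2"
    using coef_mult_Lp_2[OF Lp_2_expi] .
  have "((\<lambda>l. s l * fourier (\<lambda>x. coef \<epsilon> v x * expi (- k) x) (- l)) has_sum (LINT x|circ. fun_of s x * (coef \<epsilon> v x * expi (- k) x))) UNIV"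
    using parseval_bilinear[OF fun_of_Lp_2[OF s] L] unfolding fourier_fun_of[OF s] .
  moreover have "s l * fourier (\<lambda>x. coef \<epsilon> v x * expi (- k) x) (- l) = fourier (coef \<epsilon> v) (k - l) * s l" for l
    unfolding fourier_mult_expi by (simp add: mult.commute)
  moreover have "(LINT x|circ. fun_of s x * (coef \<epsilon> v x * expi (- k) x)) = mulF \<epsilon> v s k"
    unfolding mulF_def fourier_expi by (intro Bochner_Integration.integral_cong refl) (simp add: mult_ac)
  ultimately show ?thesis by simp
qed

lemma Dq_sq_summable:
  assumes "u \<in> H 1" shows "sq_summable (Dq \<epsilon> q u)"
proof (rule sq_summable_mono)
  show "sq_summable (bessel 1 u)" using assms by (simp add: H_iff)
  show "norm (Dq \<epsilon> q u k) \<le> (1 + \<epsilon> powr q) * norm (bessel 1 u k)" for k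
    using mult_right_mono[OF norm_Dq_symbol_le[of \<epsilon> q k], of "norm (u k)"]
    by (simp add: Dq_eq norm_mult bessel_eq powr_half_sqrt less_imp_le)
qed

text \<open>The symbol of the test function moves to the other factor as its conjugate, an
  integration by parts on the Fourier side. Uniqueness follows from testing with the single mode at
  \<open>- k\<close>, as the duality pairs \<open>k\<close> with \<open>- k\<close>.\<close>

lemma B_op_eq:
  assumes \<phi>: "\<phi> \<in> H 1"
  shows "B_op \<epsilon> q v \<phi> = (\<lambda>k. cnj (Dq_symbol \<epsilon> q k) * mulF \<epsilon> v (Dq \<epsilon> q \<phi>) k)"
  unfolding B_op_def
proof (rule the_equality)
  note s = Dq_sq_summable[OF \<phi>]
  let ?w = "\<lambda>k. cnj (Dq_symbol \<epsilon> q k) * mulF \<epsilon> v (Dq \<epsilon> q \<phi>) k"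
  have bs: "sq_summable (bessel (- 1) ?w)"
  proof (rule sq_summable_mono[OF mulF_summable[OF s]])
    fix k
    have c: "bessel_wt k powr (- 1 / 2) * sqrt (bessel_wt k) = 1"
      using less_imp_neq[OF bessel_wt_pos[of k]] by (simp add: powr_half_sqrt[symmetric] less_imp_le powr_add[symmetric])
    have "bessel_wt k powr (- 1 / 2) * norm (Dq_symbol \<epsilon> q k) \<le> bessel_wt k powr (- 1 / 2) * ((1 + \<epsilon> powr q) * sqrt (bessel_wt k))"
      by (intro mult_left_mono norm_Dq_symbol_le) simp
    also have "\<dots> = 1 + \<epsilon> powr q" using c by (simp only: mult.left_commute mult_1_right)
    finally have "(bessel_wt k powr (- 1 / 2) * norm (Dq_symbol \<epsilon> q k)) * norm (mulF \<epsilon> v (Dq \<epsilon> q \<phi>) k) \<le> (1 + \<epsilon> powr q) * norm (mulF \<epsilon> v (Dq \<epsilon> q \<phi>) k)"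
      by (intro mult_right_mono) auto
    then show "norm (bessel (- 1) ?w k) \<le> (1 + \<epsilon> powr q) * norm (mulF \<epsilon> v (Dq \<epsilon> q \<phi>) k)"
      by (simp add: bessel_eq norm_mult mult.assoc)
  qed
  have dual: "duality ?w \<psi> = (LINT x|circ. of_real (\<epsilon>\<^sup>2 + (v x)\<^sup>2) * fun_of (Dq \<epsilon> q \<phi>) x * fun_of (Dq \<epsilon> q \<psi>) x)"
    if \<psi>: "\<psi> \<in> H 1" for \<psi>
  proof -
    note t = Dq_sq_summable[OF \<psi>]
    have "((\<lambda>k. mulF \<epsilon> v (Dq \<epsilon> q \<phi>) k * Dq \<epsilon> q \<psi> (- k)) has_sum (LINT x|circ. coef \<epsilon> v x * fun_of (Dq \<epsilon> q \<phi>) x * fun_of (Dq \<epsilon> q \<psi>) x)) UNIV"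
      using parseval_bilinear[OF coef_mult_Lp_2[OF fun_of_Lp_2[OF s]] fun_of_Lp_2[OF t]]
      unfolding fourier_fun_of[OF t] mulF_def[symmetric] .
    moreover have "mulF \<epsilon> v (Dq \<epsilon> q \<phi>) k * Dq \<epsilon> q \<psi> (- k) = ?w k * \<psi> (- k)" for k
      unfolding Dq_eq[of \<epsilon> q \<psi>] Dq_symbol_uminus by (simp add: mult_ac)
    ultimately show ?thesis unfolding duality_def coef_def by (intro infsumI) simp
  qed
  show "?w \<in> H (- 1) \<and> (\<forall>\<psi>\<in>H 1. duality ?w \<psi> = (LINT x|circ. of_real (\<epsilon>\<^sup>2 + (v x)\<^sup>2) * fun_of (Dq \<epsilon> q \<phi>) x * fun_of (Dq \<epsilon> q \<psi>) x))"
    using bs dual by (simp add: H_iff)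
  fix w assume w: "w \<in> H (- 1) \<and> (\<forall>\<psi>\<in>H 1. duality w \<psi> = (LINT x|circ. of_real (\<epsilon>\<^sup>2 + (v x)\<^sup>2) * fun_of (Dq \<epsilon> q \<phi>) x * fun_of (Dq \<epsilon> q \<psi>) x))"
  show "w = ?w"
  proof (rule ext)
    fix k
    define e :: pdistr where "e l = (if l = - k then 1 else 0)" for l
    have e: "e \<in> H 1" by (rule H_finite[of "{- k}"]) (auto simp: e_def)
    have d: "duality w' e = w' k" for w'
    proof -
      have "((\<lambda>l. w' l * e (- l)) has_sum (\<Sum>l\<in>{k}. w' l * e (- l))) UNIV"
        by (rule has_sum_finite_neutralI[where B="{k}"]) (auto simp: e_def)
      then show ?thesis unfolding duality_def by (intro infsumI) (simp add: e_def)
    qed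
    from w e have "duality w e = (LINT x|circ. of_real (\<epsilon>\<^sup>2 + (v x)\<^sup>2) * fun_of (Dq \<epsilon> q \<phi>) x * fun_of (Dq \<epsilon> q e) x)"
      by blast
    then have "duality w e = duality ?w e" by (simp only: dual[OF e])
    then show "w k = ?w k" by (simp only: d)
  qed
qed

end

text \<open>
  With \<open>y = (I - \<Delta>)\<^bsup>1/2\<^esup> u\<close> the operator \<open>B\<^sub>v - z\<close> becomes a bounded operator on \<open>\<ell>\<^sup>2\<close>.
\<close>

definition scaled_symbol :: "real \<Rightarrow> real \<Rightarrow> int \<Rightarrow> complex" where
  "scaled_symbol \<epsilon> q k = Dq_symbol \<epsilon> q k * of_real (bessel_wt k powr (- 1 / 2))"

definition shifted_op :: "real \<Rightarrow> real \<Rightarrow> (real \<Rightarrow> real) \<Rightarrow> complex \<Rightarrow> ell2 \<Rightarrow> ell2" where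
  "shifted_op \<epsilon> q v z y = Ell2 (\<lambda>k. cnj (scaled_symbol \<epsilon> q k) * mulF \<epsilon> v (\<lambda>l. scaled_symbol \<epsilon> q l * coord y l) k
     - z / of_real (bessel_wt k) * coord y k)"

lemma bessel_wt_powr_half: "bessel_wt k powr (- 1 / 2) = 1 / sqrt (bessel_wt k)"
  by (simp add: powr_minus_divide powr_half_sqrt[symmetric] less_imp_le)

lemma norm_scaled_symbol: "norm (scaled_symbol \<epsilon> q k) = norm (Dq_symbol \<epsilon> q k) / sqrt (bessel_wt k)"
  unfolding scaled_symbol_def norm_mult norm_of_real bessel_wt_powr_half
  by (simp add: less_imp_le)

lemma norm_scaled_symbol_le: "norm (scaled_symbol \<epsilon> q k) \<le> 1 + \<epsilon> powr q"
  unfolding norm_scaled_symbol by (subst pos_divide_le_eq) (simp_all add: norm_Dq_symbol_le)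

lemma scaled_symbol_summable: "sq_summable y \<Longrightarrow> sq_summable (\<lambda>l. scaled_symbol \<epsilon> q l * y l)"
  by (erule sq_summable_mono[where c="1 + \<epsilon> powr q"])
    (simp add: norm_mult mult_right_mono norm_scaled_symbol_le)

lemma cnj_scaled_symbol_summable: "sq_summable y \<Longrightarrow> sq_summable (\<lambda>l. cnj (scaled_symbol \<epsilon> q l) * y l)"
  by (erule sq_summable_mono[where c="1 + \<epsilon> powr q"])
    (simp add: norm_mult mult_right_mono norm_scaled_symbol_le)

lemma norm_div_bessel_wt_le: "norm (z / of_real (bessel_wt k) * w) \<le> norm z * norm w" for z w :: complex
proof -
  have "norm z / bessel_wt k \<le> norm z / 1" using bessel_wt_ge_1[of k] by (intro divide_left_mono) auto
  then have "norm z / bessel_wt k * norm w \<le> norm z * norm w" by (intro mult_right_mono) auto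
  then show ?thesis using less_imp_le[OF bessel_wt_pos[of k]] by (simp only: norm_mult norm_divide norm_of_real abs_of_nonneg)
qed

lemma div_bessel_wt_summable: "sq_summable y \<Longrightarrow> sq_summable (\<lambda>k. z / of_real (bessel_wt k) * y k)"
  by (erule sq_summable_mono[where c="norm z"]) (rule norm_div_bessel_wt_le)

text \<open>If \<open>y\<close> is obtained from \<open>u\<close> by the square root of
  \<open>I - \<Delta>\<close>, this is the squared L2 norm of \<open>u\<close>, whereas
  \<open>(norm y)\<^sup>2\<close> is its squared H1 norm.\<close>

definition low_norm2 :: "ell2 \<Rightarrow> real" where
  "low_norm2 y = (\<Sum>\<^sub>\<infinity>k. (norm (coord y k))\<^sup>2 / bessel_wt k)"

definition scale :: "pdistr \<Rightarrow> ell2" where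
  "scale h = Ell2 (bessel (- 1) h)"

context
  fixes \<epsilon> q \<delta> C :: real and v :: "real \<Rightarrow> real"
  assumes \<epsilon>: "\<epsilon> > 0" and v: "v \<in> borel_measurable circ" "AE x in circ. \<bar>v x\<bar> \<le> C"
    and \<delta>: "\<delta> > 0" and sym: "\<And>k. \<delta> * bessel_wt k \<le> \<epsilon>\<^sup>2 * (norm (Dq_symbol \<epsilon> q k))\<^sup>2"
begin

lemmas mulF_facts = mulF_summable[OF \<epsilon> v] mulF_norm[OF \<epsilon> v] mulF_diff[OF \<epsilon> v] mulF_form[OF \<epsilon> v]

lemma shifted_op_parts:
  "sq_summable (\<lambda>k. cnj (scaled_symbol \<epsilon> q k) * mulF \<epsilon> v (\<lambda>l. scaled_symbol \<epsilon> q l * coord y l) k)"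
  "sq_summable (\<lambda>k. z / of_real (bessel_wt k) * coord y k)"
  by (intro cnj_scaled_symbol_summable mulF_facts(1) scaled_symbol_summable coord_summable div_bessel_wt_summable)+

lemma coord_shifted_op:
  "coord (shifted_op \<epsilon> q v z y) k = cnj (scaled_symbol \<epsilon> q k) * mulF \<epsilon> v (\<lambda>l. scaled_symbol \<epsilon> q l * coord y l) k
     - z / of_real (bessel_wt k) * coord y k"
  unfolding shifted_op_def by (subst coord_Ell2) (rule sq_summable_diff[OF shifted_op_parts], rule refl)

lemma shifted_op_diff: "shifted_op \<epsilon> q v z x - shifted_op \<epsilon> q v z y = shifted_op \<epsilon> q v z (x - y)"
proof (rule ell2_eqI)
  fix k
  have "mulF \<epsilon> v (\<lambda>l. scaled_symbol \<epsilon> q l * coord (x - y) l) k =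
      mulF \<epsilon> v (\<lambda>l. scaled_symbol \<epsilon> q l * coord x l) k - mulF \<epsilon> v (\<lambda>l. scaled_symbol \<epsilon> q l * coord y l) k"
    unfolding coord_diff right_diff_distrib
    by (rule mulF_facts(3)[OF scaled_symbol_summable[OF coord_summable] scaled_symbol_summable[OF coord_summable]])
  then show "coord (shifted_op \<epsilon> q v z x - shifted_op \<epsilon> q v z y) k = coord (shifted_op \<epsilon> q v z (x - y)) k"
    unfolding coord_shifted_op coord_diff by (simp only: right_diff_distrib) simp
qed

lemma norm_shifted_op_le:
  "norm (shifted_op \<epsilon> q v z y) \<le> ((1 + \<epsilon> powr q) * ((\<epsilon>\<^sup>2 + C\<^sup>2) * (1 + \<epsilon> powr q)) + norm z) * norm y"
proof -
  let ?K = "1 + \<epsilon> powr q" and ?s = "\<lambda>l. scaled_symbol \<epsilon> q l * coord y l"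
  note s = scaled_symbol_summable[OF coord_summable, of \<epsilon> q y]
  have K: "?K \<ge> 0" by (simp add: add_nonneg_nonneg)
  have y: "Ell2 (coord y) = y" by (rule coord_inverse)
  have "norm (Ell2 ?s) \<le> ?K * norm (Ell2 (coord y))"
    by (rule norm_Ell2_le[OF s coord_summable _ K]) (simp only: norm_mult mult_right_mono norm_scaled_symbol_le norm_ge_zero)
  then have 1: "norm (Ell2 ?s) \<le> ?K * norm y" by (simp only: y)
  have 2: "norm (Ell2 (mulF \<epsilon> v ?s)) \<le> (\<epsilon>\<^sup>2 + C\<^sup>2) * norm (Ell2 ?s)" by (rule mulF_facts(2)[OF s])
  have 3: "norm (Ell2 (\<lambda>k. cnj (scaled_symbol \<epsilon> q k) * mulF \<epsilon> v ?s k)) \<le> ?K * norm (Ell2 (mulF \<epsilon> v ?s))"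
    by (rule norm_Ell2_le[OF shifted_op_parts(1) mulF_facts(1)[OF s] _ K])
      (simp only: norm_mult complex_mod_cnj mult_right_mono norm_scaled_symbol_le norm_ge_zero)
  have 4: "norm (Ell2 (\<lambda>k. z / of_real (bessel_wt k) * coord y k)) \<le> norm z * norm (Ell2 (coord y))"
    by (rule norm_Ell2_le[OF shifted_op_parts(2) coord_summable norm_div_bessel_wt_le norm_ge_zero])
  have "norm (shifted_op \<epsilon> q v z y) \<le> norm (Ell2 (\<lambda>k. cnj (scaled_symbol \<epsilon> q k) * mulF \<epsilon> v ?s k)) + norm (Ell2 (\<lambda>k. z / of_real (bessel_wt k) * coord y k))"
    unfolding shifted_op_def Ell2_diff[OF shifted_op_parts, symmetric] by (rule norm_triangle_ineq4)
  also have "\<dots> \<le> ?K * ((\<epsilon>\<^sup>2 + C\<^sup>2) * (?K * norm y)) + norm z * norm y"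
  proof (rule add_mono)
    have "(\<epsilon>\<^sup>2 + C\<^sup>2) * norm (Ell2 ?s) \<le> (\<epsilon>\<^sup>2 + C\<^sup>2) * (?K * norm y)"
      by (rule mult_left_mono[OF 1]) simp
    then have "?K * norm (Ell2 (mulF \<epsilon> v ?s)) \<le> ?K * ((\<epsilon>\<^sup>2 + C\<^sup>2) * (?K * norm y))"
      by (intro mult_left_mono[OF order_trans[OF 2] K])
    then show "norm (Ell2 (\<lambda>k. cnj (scaled_symbol \<epsilon> q k) * mulF \<epsilon> v ?s k)) \<le> ?K * ((\<epsilon>\<^sup>2 + C\<^sup>2) * (?K * norm y))"
      by (rule order_trans[OF 3])
    show "norm (Ell2 (\<lambda>k. z / of_real (bessel_wt k) * coord y k)) \<le> norm z * norm y" using 4 by (simp only: y)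
  qed
  finally show ?thesis by (simp only: distrib_right mult.assoc)
qed

lemma low_norm2_has_sum: "((\<lambda>k. (norm (coord y k))\<^sup>2 / bessel_wt k) has_sum low_norm2 y) UNIV"
  unfolding low_norm2_def
proof (rule has_sum_infsum, rule summable_on_comparison_test[OF coord_summable[of y, unfolded sq_summable_def]])
  fix k
  show "(norm (coord y k))\<^sup>2 / bessel_wt k \<le> (norm (coord y k))\<^sup>2"
    using divide_left_mono[OF bessel_wt_ge_1[of k], of "(norm (coord y k))\<^sup>2"] by simp
  show "0 \<le> (norm (coord y k))\<^sup>2 / bessel_wt k" using bessel_wt_pos[of k] by (simp add: less_imp_le)
qed

lemma low_norm2_bounds: "0 \<le> low_norm2 y" "low_norm2 y \<le> (norm y)\<^sup>2"
proof -
  show "0 \<le> low_norm2 y"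
    using bessel_wt_pos by (intro has_sum_nonneg[OF low_norm2_has_sum]) (simp add: less_imp_le)
  show "low_norm2 y \<le> (norm y)\<^sup>2"
    using divide_left_mono[OF bessel_wt_ge_1, of "(norm (coord y k))\<^sup>2" for k]
    by (intro has_sum_mono[OF low_norm2_has_sum norm_ell2_power2]) simp
qed

lemma inner_ell2_has_sum: "((\<lambda>k. Re (coord x k * cnj (coord y k))) has_sum inner x y) UNIV"
  unfolding inner_ell2_def by (rule has_sum_infsum[OF summable_Re_mult_cnj[OF coord_summable coord_summable]])

text \<open>The symbol inequality \<open>sym\<close> turns the lower bound of
  \<open>mulF_form\<close> into \<delta> times the squared norm, and the shift contributes exactly
  its real part.\<close>

lemma inner_shifted_op_ge: "\<delta> * (norm y)\<^sup>2 - Re z * low_norm2 y \<le> inner (shifted_op \<epsilon> q v z y) y"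
proof -
  let ?s = "\<lambda>l. scaled_symbol \<epsilon> q l * coord y l"
  note s = scaled_symbol_summable[OF coord_summable, of \<epsilon> q y]
  obtain R where R: "((\<lambda>k. Re (mulF \<epsilon> v ?s k * cnj (?s k))) has_sum R) UNIV" "\<epsilon>\<^sup>2 * (norm (Ell2 ?s))\<^sup>2 \<le> R"
    using mulF_facts(4)[OF s] by blast
  have eq: "Re (coord (shifted_op \<epsilon> q v z y) k * cnj (coord y k)) =
     Re (mulF \<epsilon> v ?s k * cnj (?s k)) - Re z * ((norm (coord y k))\<^sup>2 / bessel_wt k)" for k
  proof -
    have "coord (shifted_op \<epsilon> q v z y) k * cnj (coord y k) =
        mulF \<epsilon> v ?s k * cnj (?s k) - z / of_real (bessel_wt k) * (coord y k * cnj (coord y k))"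
      unfolding coord_shifted_op complex_cnj_mult by (simp only: left_diff_distrib) (simp only: mult_ac)
    also have "z / of_real (bessel_wt k) * (coord y k * cnj (coord y k)) = z * complex_of_real ((norm (coord y k))\<^sup>2 / bessel_wt k)"
      unfolding complex_norm_square[symmetric] of_real_divide by simp
    finally show ?thesis by simp
  qed
  have "((\<lambda>k. Re (mulF \<epsilon> v ?s k * cnj (?s k)) - Re z * ((norm (coord y k))\<^sup>2 / bessel_wt k)) has_sum R - Re z * low_norm2 y) UNIV"
    using has_sum_add[OF R(1) has_sum_cmult_right[OF low_norm2_has_sum, of "- Re z" y]] by simp
  then have in_eq: "inner (shifted_op \<epsilon> q v z y) y = R - Re z * low_norm2 y"
    using inner_ell2_has_sum[of "shifted_op \<epsilon> q v z y" y] unfolding eq by (rule has_sum_unique[rotated])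
  have "\<delta> * (norm y)\<^sup>2 \<le> \<epsilon>\<^sup>2 * (norm (Ell2 ?s))\<^sup>2"
  proof (rule has_sum_mono[OF has_sum_cmult_right[OF norm_ell2_power2] has_sum_cmult_right[OF norm_Ell2_has_sum[OF s]]])
    fix k
    have "\<delta> \<le> \<epsilon>\<^sup>2 * (norm (scaled_symbol \<epsilon> q k))\<^sup>2"
    proof -
      have "(norm (scaled_symbol \<epsilon> q k))\<^sup>2 = (norm (Dq_symbol \<epsilon> q k))\<^sup>2 / bessel_wt k"
        unfolding norm_scaled_symbol by (simp add: power_divide less_imp_le)
      then show ?thesis using sym[of k] bessel_wt_pos[of k] by (simp add: pos_le_divide_eq)
    qed
    then have "\<delta> * (norm (coord y k))\<^sup>2 \<le> \<epsilon>\<^sup>2 * (norm (scaled_symbol \<epsilon> q k))\<^sup>2 * (norm (coord y k))\<^sup>2"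
      by (intro mult_right_mono) auto
    then show "\<delta> * (norm (coord y k))\<^sup>2 \<le> \<epsilon>\<^sup>2 * (norm (?s k))\<^sup>2"
      by (simp only: norm_mult power_mult_distrib mult.assoc)
  qed
  then show ?thesis using R(2) in_eq by linarith
qed

text \<open>For \<open>0 \<le> Re z \<le> \<delta> / 2\<close> half of the coercivity absorbs the
  shift. For negative real part the shift has the good sign and is kept as a gain that grows with
  \<open>- Re z\<close>.\<close>

lemma shifted_op_coercive:
  assumes "Re z \<le> \<delta> / 2"
  shows "\<delta> / 2 * (norm y)\<^sup>2 + max 0 (- Re z) * low_norm2 y \<le> inner (shifted_op \<epsilon> q v z y) y"
proof (cases "Re z \<ge> 0")
  case True
  have "Re z * low_norm2 y \<le> \<delta> / 2 * (norm y)\<^sup>2"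
    using assms True low_norm2_bounds[of y] by (intro mult_mono) auto
  then show ?thesis using inner_shifted_op_ge[of y z] True by (simp add: max_def)
next
  case False
  have "\<delta> / 2 * (norm y)\<^sup>2 \<le> \<delta> * (norm y)\<^sup>2" using \<delta> by (intro mult_right_mono) auto
  then show ?thesis using inner_shifted_op_ge[of y z] False by (simp add: max_def)
qed

text \<open>Besides the solution, convergence is recorded for every step size up to
  \<open>\<tau>\<^sub>0\<close>. That threshold depends on the bound \<open>C\<close> of
  \<open>v\<close>, which will vary with the sample point without being known to be
  measurable.\<close>

lemma shifted_op_solvable:
  assumes z: "Re z \<le> \<delta> / 2"
  obtains y \<tau>\<^sub>0 where "shifted_op \<epsilon> q v z y = g" "\<And>y'. shifted_op \<epsilon> q v z y' = g \<Longrightarrow> y' = y" "\<tau>\<^sub>0 > 0"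
    "\<And>\<tau> x. 0 < \<tau> \<Longrightarrow> \<tau> \<le> \<tau>\<^sub>0 \<Longrightarrow> x 0 = 0 \<Longrightarrow>
      (\<And>n. x (Suc n) = x n - \<tau> *\<^sub>R (shifted_op \<epsilon> q v z (x n) - g)) \<Longrightarrow> x \<longlonglongrightarrow> y"
proof -
  define L where "L = (1 + \<epsilon> powr q) * ((\<epsilon>\<^sup>2 + C\<^sup>2) * (1 + \<epsilon> powr q)) + norm z"
  have "0 \<le> (1 + \<epsilon> powr q) * ((\<epsilon>\<^sup>2 + C\<^sup>2) * (1 + \<epsilon> powr q))" by (intro mult_nonneg_nonneg add_nonneg_nonneg) auto
  then have L: "L \<ge> 0" by (simp add: L_def)
  have coer: "\<delta> / 2 * (norm y)\<^sup>2 \<le> inner (shifted_op \<epsilon> q v z y) y" for y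
    using shifted_op_coercive[OF z, of y] mult_nonneg_nonneg[OF max.cobounded1[of 0 "- Re z"] low_norm2_bounds(1)[of y]] by linarith
  have uniq: "y' = y" if "shifted_op \<epsilon> q v z y' = shifted_op \<epsilon> q v z y" for y y'
  proof -
    have "shifted_op \<epsilon> q v z (y' - y) = 0" using that by (simp only: shifted_op_diff[symmetric] diff_self)
    then have le: "\<delta> / 2 * (norm (y' - y))\<^sup>2 \<le> 0" using coer[of "y' - y"] by simp
    show ?thesis
    proof (rule ccontr)
      assume "y' \<noteq> y"
      then have "0 < \<delta> / 2 * (norm (y' - y))\<^sup>2" using \<delta> by (intro mult_pos_pos zero_less_power) auto
      with le show False by linarith
    qed
  qed
  define \<tau>\<^sub>0 where "\<tau>\<^sub>0 = (\<delta> / 2) / (L\<^sup>2 + 1)"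
  \<comment> \<open>The summand 1 in the denominator of \<open>\<tau>\<^sub>0\<close> keeps it
    positive when \<open>L = 0\<close>.\<close>
  have L1: "L\<^sup>2 + 1 > 0" by (rule add_nonneg_pos) simp_all
  have \<tau>\<^sub>0: "\<tau>\<^sub>0 > 0" using \<delta> L1 by (simp add: \<tau>\<^sub>0_def)
  have \<tau>L: "\<tau> * L\<^sup>2 \<le> \<delta> / 2" if "0 < \<tau>" "\<tau> \<le> \<tau>\<^sub>0" for \<tau>
  proof -
    have "\<tau> * L\<^sup>2 \<le> \<tau>\<^sub>0 * (L\<^sup>2 + 1)" using that by (intro mult_mono) auto
    also have "\<dots> = \<delta> / 2"
      unfolding \<tau>\<^sub>0_def by (rule nonzero_eq_divide_eq[THEN iffD1, OF _ refl]) (use L1 in linarith)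
    finally show ?thesis .
  qed
  have rich: "\<exists>y. shifted_op \<epsilon> q v z y = g \<and> x \<longlonglongrightarrow> y"
    if "0 < \<tau>" "\<tau> \<le> \<tau>\<^sub>0" "x 0 = 0" "\<And>n. x (Suc n) = x n - \<tau> *\<^sub>R (shifted_op \<epsilon> q v z (x n) - g)" for \<tau> x
  proof (rule richardson_iteration[where T="shifted_op \<epsilon> q v z" and L=L and c="\<delta> / 2" and \<tau>=\<tau>])
    show "norm (shifted_op \<epsilon> q v z y) \<le> L * norm y" for y unfolding L_def by (rule norm_shifted_op_le)
    show "shifted_op \<epsilon> q v z x - shifted_op \<epsilon> q v z y = shifted_op \<epsilon> q v z (x - y)" for x y by (rule shifted_op_diff)
  qed (fact L half_gt_zero[OF \<delta>] coer that \<tau>L[OF that(1,2)])+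
  define X where "X = rec_nat 0 (\<lambda>n w. w - \<tau>\<^sub>0 *\<^sub>R (shifted_op \<epsilon> q v z w - g))"
  obtain y where y: "shifted_op \<epsilon> q v z y = g"
    using rich[OF \<tau>\<^sub>0 order_refl, of X] by (auto simp: X_def)
  show thesis
  proof (rule that[OF y _ \<tau>\<^sub>0])
    show "y' = y" if "shifted_op \<epsilon> q v z y' = g" for y' using uniq[of y' y] that y by simp
    show "x \<longlonglongrightarrow> y" if "0 < \<tau>" "\<tau> \<le> \<tau>\<^sub>0" "x 0 = 0" "\<And>n. x (Suc n) = x n - \<tau> *\<^sub>R (shifted_op \<epsilon> q v z (x n) - g)" for \<tau> x
      using rich[OF that] uniq[of _ y] y by metis
  qed
qed

lemma bessel_inverse: "bessel t (bessel (- t) h) = h"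
proof
  fix k
  have "bessel_wt k powr (t / 2) * bessel_wt k powr (- t / 2) = 1"
    using less_imp_neq[OF bessel_wt_pos[of k]] by (simp add: powr_add[symmetric])
  then show "bessel t (bessel (- t) h) k = h k"
    unfolding bessel_eq mult.assoc[symmetric] of_real_mult[symmetric] by simp
qed

text \<open>The substitution \<open>u = bessel (- 1) (coord y)\<close> is a bijection from
  square-summable sequences onto H1, so solving for \<open>y\<close> and solving for
  \<open>u\<close> are the same problem.\<close>

lemma B_resolvent_scaled:
  assumes h: "h \<in> H (- 1)" and z: "Re z \<le> \<delta> / 2"
    and y: "shifted_op \<epsilon> q v z y = scale h" "\<And>y'. shifted_op \<epsilon> q v z y' = scale h \<Longrightarrow> y' = y"
  shows "B_resolvent \<epsilon> q v z h = bessel (- 1) (coord y)"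
proof -
  have hs: "coord (scale h) = bessel (- 1) h"
    unfolding scale_def by (rule coord_Ell2) (use h in \<open>simp add: H_iff\<close>)
  have ww: "bessel_wt k powr (1 / 2) * bessel_wt k powr (- 1 / 2) = 1" for k
    using less_imp_neq[OF bessel_wt_pos[of k]] by (simp add: powr_add[symmetric])
  have eq: "(\<lambda>k. B_op \<epsilon> q v (bessel (- 1) (coord w)) k - z * bessel (- 1) (coord w) k) = h \<longleftrightarrow> shifted_op \<epsilon> q v z w = scale h" for w
  proof -
    have bH: "bessel (- 1) (coord w) \<in> H 1"
      unfolding H_iff using bessel_inverse[of 1 "coord w"] by simp
    have D: "Dq \<epsilon> q (bessel (- 1) (coord w)) = (\<lambda>l. scaled_symbol \<epsilon> q l * coord w l)"
      unfolding Dq_eq[abs_def] bessel_eq scaled_symbol_def by (simp only: mult.assoc)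
    have pt: "bessel (- 1) (\<lambda>k. B_op \<epsilon> q v (bessel (- 1) (coord w)) k - z * bessel (- 1) (coord w) k) k = coord (shifted_op \<epsilon> q v z w) k" for k
    proof -
      have w2: "bessel_wt k powr (- 1 / 2) * bessel_wt k powr (- 1 / 2) = 1 / bessel_wt k"
        using bessel_wt_pos[of k] by (simp add: powr_add[symmetric] powr_minus_divide abs_of_pos)
      have "complex_of_real (bessel_wt k powr (- 1 / 2)) * (z * (complex_of_real (bessel_wt k powr (- 1 / 2)) * coord w k)) =
          z * complex_of_real (bessel_wt k powr (- 1 / 2) * bessel_wt k powr (- 1 / 2)) * coord w k" by simp
      also have "\<dots> = z / of_real (bessel_wt k) * coord w k" unfolding w2 by simp
      finally have z2: "complex_of_real (bessel_wt k powr (- 1 / 2)) * (z * (complex_of_real (bessel_wt k powr (- 1 / 2)) * coord w k)) =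
          z / of_real (bessel_wt k) * coord w k" .
      show ?thesis
        unfolding B_op_eq[OF \<epsilon> v bH] D coord_shifted_op bessel_eq right_diff_distrib z2
        by (simp only: scaled_symbol_def complex_cnj_mult complex_cnj_complex_of_real mult_ac)
    qed
    have "(\<lambda>k. B_op \<epsilon> q v (bessel (- 1) (coord w)) k - z * bessel (- 1) (coord w) k) = h \<longleftrightarrow>
        bessel (- 1) (\<lambda>k. B_op \<epsilon> q v (bessel (- 1) (coord w)) k - z * bessel (- 1) (coord w) k) = bessel (- 1) h"
      using bessel_inverse[of 1] by metis
    also have "\<dots> \<longleftrightarrow> (\<forall>k. coord (shifted_op \<epsilon> q v z w) k = coord (scale h) k)"
      unfolding hs fun_eq_iff pt ..
    also have "\<dots> \<longleftrightarrow> shifted_op \<epsilon> q v z w = scale h" by (auto intro: ell2_eqI)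
    finally show ?thesis .
  qed
  show ?thesis
    unfolding B_resolvent_def
  proof (rule the_equality)
    show "bessel (- 1) (coord y) \<in> H 1 \<and> (\<lambda>k. B_op \<epsilon> q v (bessel (- 1) (coord y)) k - z * bessel (- 1) (coord y) k) = h"
      using eq[of y] y(1) bessel_inverse[of 1 "coord y"] by (simp add: H_iff)
    fix u assume u: "u \<in> H 1 \<and> (\<lambda>k. B_op \<epsilon> q v u k - z * u k) = h"
    define w where "w = Ell2 (bessel 1 u)"
    have "coord w = bessel 1 u" unfolding w_def using u by (intro coord_Ell2) (simp add: H_iff)
    then have uw: "u = bessel (- 1) (coord w)" using bessel_inverse[of "- 1" u] by simp
    then have "shifted_op \<epsilon> q v z w = scale h" using u eq[of w] by simp
    then show "u = bessel (- 1) (coord y)" using y(2)[of w] uw by simp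
  qed
qed

text \<open>The energy \<open>E\<close> is the sum of
  \<open>(m + x) * \<bar>u k\<bar>\<^sup>2\<close> with \<open>m = bessel_wt k\<close>. The pairing
  with \<open>h\<close> is split by Young's inequality so that \<open>c / 2 * E\<close> can be
  absorbed. Passing from \<open>E\<close> to the L2 norm gains one more power of
  \<open>1 + x\<close>.\<close>

lemma shifted_op_estimate:
  assumes z: "Re z \<le> \<delta> / 2" and h: "h \<in> H s" and s: "- 1 < s" "s \<le> 0"
    and y: "shifted_op \<epsilon> q v z y = scale h"
  shows "low_norm2 y \<le> (Hs_norm s h)\<^sup>2 / (min (\<delta> / 2) 1)\<^sup>2 * (1 + max 0 (- Re z)) powr (- s - 2)"
proof -
  define x where "x = max 0 (- Re z)"
  have x: "x \<ge> 0" by (simp add: x_def)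
  \<comment> \<open>A common lower bound for the two coefficients \<open>\<delta> / 2\<close> and 1
    in \<open>shifted_op_coercive\<close>.\<close>
  define c where "c = min (\<delta> / 2) 1"
  have c: "c > 0" "c \<le> \<delta> / 2" "c \<le> 1" using \<delta> by (auto simp: c_def)
  define E where "E = (norm y)\<^sup>2 + x * low_norm2 y"
  have hH: "h \<in> H (- 1)" using H_mono[OF _ h, of "- 1"] s by simp
  have hs: "coord (scale h) = bessel (- 1) h"
    unfolding scale_def by (rule coord_Ell2) (use hH in \<open>simp add: H_iff\<close>)
  have "c * E \<le> \<delta> / 2 * (norm y)\<^sup>2 + x * low_norm2 y"
    using mult_right_mono[OF c(2), of "(norm y)\<^sup>2"] mult_right_mono[OF c(3), of "x * low_norm2 y"] x low_norm2_bounds(1)[of y]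
    by (simp add: E_def distrib_left)
  also have "\<dots> \<le> inner (shifted_op \<epsilon> q v z y) y"
    using shifted_op_coercive[OF z, of y] by (simp add: x_def)
  also have "\<dots> = inner (scale h) y" by (simp only: y)
  also have "\<dots> \<le> (1 + x) powr (- s - 1) / (2 * c) * (Hs_norm s h)\<^sup>2 + c / 2 * E"
  proof (rule has_sum_mono[OF inner_ell2_has_sum])
    have "((\<lambda>k. (norm (bessel s h k))\<^sup>2) has_sum (Hs_norm s h)\<^sup>2) UNIV"
      using has_sum_infsum[of "\<lambda>k. (norm (bessel s h k))\<^sup>2" UNIV] h
      by (simp add: Hs_norm_def H_iff sq_summable_def infsum_nonneg)
    then show "((\<lambda>k. (1 + x) powr (- s - 1) / (2 * c) * (norm (bessel s h k))\<^sup>2 +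
        c / 2 * ((norm (coord y k))\<^sup>2 + x * ((norm (coord y k))\<^sup>2 / bessel_wt k))) has_sum
        (1 + x) powr (- s - 1) / (2 * c) * (Hs_norm s h)\<^sup>2 + c / 2 * E) UNIV"
      unfolding E_def by (intro has_sum_add has_sum_cmult_right norm_ell2_power2 low_norm2_has_sum)
    fix k
    define m where "m = bessel_wt k"
    have m: "m \<ge> 1" "m > 0" using bessel_wt_ge_1[of k] by (auto simp: m_def)
    define a where "a = (1 + x) powr (- s - 1) * (norm (bessel s h k))\<^sup>2"
    define b where "b = (norm (coord y k))\<^sup>2 + x * ((norm (coord y k))\<^sup>2 / m)"
    have ab: "a \<ge> 0" "b \<ge> 0" using m x by (auto simp: a_def b_def)
    have bfac: "b = (m + x) / m * (norm (coord y k))\<^sup>2" using m by (simp add: b_def field_simps)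
    define p where "p = norm (coord (scale h) k) * norm (coord y k)"
    \<comment> \<open>Because \<open>- s \<ge> 0\<close>, the base may grow from \<open>m\<close> to
      \<open>m + x\<close>; one full power is split off, and the remaining exponent
      \<open>- s - 1\<close> is negative, so its base may shrink to \<open>1 + x\<close>.\<close>
    have "m powr (- s) \<le> (m + x) * (1 + x) powr (- s - 1)"
    proof -
      have "m powr (- s) \<le> (m + x) powr (- s)" using m x s by (intro powr_mono2) auto
      also have "\<dots> = (m + x) powr 1 * (m + x) powr (- s - 1)" by (simp only: powr_add[symmetric]) simp
      also have "\<dots> \<le> (m + x) powr 1 * (1 + x) powr (- s - 1)"
        using m x s by (intro mult_left_mono powr_mono2') auto
      also have "(m + x) powr 1 = m + x" using m x by simp
      finally show ?thesis .
    qed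
    then have "m powr s * m powr (- s) \<le> m powr s * ((m + x) * (1 + x) powr (- s - 1))"
      by (intro mult_left_mono) auto
    moreover have "m powr s * m powr (- s) = 1" using m by (simp add: powr_add[symmetric])
    ultimately have key: "1 \<le> m powr s * ((m + x) * (1 + x) powr (- s - 1))" by simp
    have "p\<^sup>2 = 1 / m * ((norm (h k))\<^sup>2 * (norm (coord y k))\<^sup>2)"
      using m unfolding p_def hs power_mult_distrib norm_bessel_power2 m_def[symmetric] by (simp add: powr_minus_divide)
    moreover have "1 / m * ((norm (h k))\<^sup>2 * (norm (coord y k))\<^sup>2) * 1 \<le> 1 / m * ((norm (h k))\<^sup>2 * (norm (coord y k))\<^sup>2) * (m powr s * ((m + x) * (1 + x) powr (- s - 1)))"
      using m by (intro mult_left_mono key) auto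
    moreover have "1 / m * ((norm (h k))\<^sup>2 * (norm (coord y k))\<^sup>2) * (m powr s * ((m + x) * (1 + x) powr (- s - 1))) = a * b"
      unfolding a_def bfac norm_bessel_power2 m_def[symmetric] by simp
    ultimately have pab: "p\<^sup>2 \<le> a * b" by (simp only: mult_1_right)
    have "p \<le> a / (2 * c) + c / 2 * b"
    proof (rule power2_le_imp_le)
      have "0 \<le> (a / (2 * c) - c / 2 * b)\<^sup>2" by simp
      also have "\<dots> = (a / (2 * c) + c / 2 * b)\<^sup>2 - a * b"
        using c by (simp add: power2_eq_square field_simps)
      finally show "p\<^sup>2 \<le> (a / (2 * c) + c / 2 * b)\<^sup>2" using pab by simp
      show "0 \<le> a / (2 * c) + c / 2 * b" using ab c by simp
    qed
    moreover have "Re (coord (scale h) k * cnj (coord y k)) \<le> p"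
      using complex_Re_le_cmod[of "coord (scale h) k * cnj (coord y k)"] by (simp add: p_def norm_mult)
    ultimately show "Re (coord (scale h) k * cnj (coord y k)) \<le> (1 + x) powr (- s - 1) / (2 * c) * (norm (bessel s h k))\<^sup>2 +
        c / 2 * ((norm (coord y k))\<^sup>2 + x * ((norm (coord y k))\<^sup>2 / bessel_wt k))"
      by (simp add: a_def b_def m_def)
  qed
  finally have "c * E \<le> (1 + x) powr (- s - 1) / (2 * c) * (Hs_norm s h)\<^sup>2 + c / 2 * E" .
  moreover have "c * E = c / 2 * E + c / 2 * E" by (simp add: field_simps)
  ultimately have "c / 2 * E \<le> (1 + x) powr (- s - 1) / (2 * c) * (Hs_norm s h)\<^sup>2" by linarith
  then have "(2 / c) * (c / 2 * E) \<le> (2 / c) * ((1 + x) powr (- s - 1) / (2 * c) * (Hs_norm s h)\<^sup>2)"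
    by (rule mult_left_mono) (rule divide_nonneg_pos[OF _ c(1)], simp)
  moreover have "(2 / c) * (c / 2 * E) = E" using less_imp_neq[OF c(1)] by simp
  moreover have "(2 / c) * (P / (2 * c) * S) = P * (S / c\<^sup>2)" for P S :: real
    by (simp only: power2_eq_square times_divide_eq_right times_divide_eq_left mult.assoc mult.commute mult.left_commute divide_divide_eq_left divide_divide_eq_right)
  ultimately have E_le: "E \<le> (1 + x) powr (- s - 1) * ((Hs_norm s h)\<^sup>2 / c\<^sup>2)" by metis
  have x1: "0 < 1 + x" using x by linarith
  have "(1 + x) * low_norm2 y \<le> E"
    unfolding E_def distrib_right mult_1_left by (rule add_right_mono[OF low_norm2_bounds(2)])
  then have "(1 + x) * low_norm2 y \<le> (1 + x) powr (- s - 1) * ((Hs_norm s h)\<^sup>2 / c\<^sup>2)" using E_le by linarith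
  then have "low_norm2 y * (1 + x) \<le> (1 + x) powr (- s - 1) * ((Hs_norm s h)\<^sup>2 / c\<^sup>2)" by (simp only: mult.commute)
  then have "low_norm2 y \<le> (1 + x) powr (- s - 1) * ((Hs_norm s h)\<^sup>2 / c\<^sup>2) / (1 + x)"
    by (rule pos_le_divide_eq[OF x1, THEN iffD2])
  also have "\<dots> = (Hs_norm s h)\<^sup>2 / c\<^sup>2 * ((1 + x) powr (- s - 1) / (1 + x))"
    by (subst mult.commute) (rule times_divide_eq_right[symmetric])
  also have "\<dots> = (Hs_norm s h)\<^sup>2 / c\<^sup>2 * (1 + x) powr (- s - 2)"
  proof -
    have "(1 + x) powr (- s - 2) = (1 + x) powr ((- s - 1) - 1)" by (rule arg_cong[where f="\<lambda>e. (1 + x) powr e"]) simp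
    also have "\<dots> = (1 + x) powr (- s - 1) / (1 + x)" unfolding powr_diff using x1 by simp
    finally show ?thesis by simp
  qed
  finally show ?thesis by (simp only: x_def c_def)
qed

end

text \<open>Agrees with the unordered sum where that exists; being a limit of a sequence of finite
  sums it is measurable in parameters unconditionally.\<close>

definition symmetric_sum :: "(int \<Rightarrow> complex) \<Rightarrow> complex" where
  "symmetric_sum f = lim (\<lambda>N. \<Sum>l\<in>{- int N..int N}. f l)"

lemma symmetric_sum_eq: "(f has_sum s) UNIV \<Longrightarrow> symmetric_sum f = s"
  unfolding symmetric_sum_def by (rule limI[OF has_sum_imp_symmetric_tendsto])

lemma measurable_symmetric_sum [measurable (raw)]:
  assumes "\<And>l. (\<lambda>\<omega>. f \<omega> l) \<in> borel_measurable M"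
  shows "(\<lambda>\<omega>. symmetric_sum (f \<omega>)) \<in> borel_measurable M"
  unfolding symmetric_sum_def by (intro borel_measurable_lim_metric borel_measurable_sum assms)

text \<open>The Richardson iterates of \<open>shifted_op\<close> started at 0, in coordinates;
  \<open>a\<close> stands for the Fourier coefficients of \<open>coef \<epsilon> v\<close>.\<close>

primrec resolvent_iter ::
  "real \<Rightarrow> real \<Rightarrow> pdistr \<Rightarrow> pdistr \<Rightarrow> complex \<Rightarrow> real \<Rightarrow> nat \<Rightarrow> int \<Rightarrow> complex" where
  "resolvent_iter \<epsilon> q a h z \<tau> 0 = (\<lambda>k. 0)"
| "resolvent_iter \<epsilon> q a h z \<tau> (Suc n) = (\<lambda>k. resolvent_iter \<epsilon> q a h z \<tau> n k - of_real \<tau> *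
     (cnj (scaled_symbol \<epsilon> q k) * symmetric_sum (\<lambda>l. a (k - l) * (scaled_symbol \<epsilon> q l * resolvent_iter \<epsilon> q a h z \<tau> n l))
       - z / of_real (bessel_wt k) * resolvent_iter \<epsilon> q a h z \<tau> n k - bessel (- 1) h k))"

text \<open>The inner limit runs through the iterates for the step \<open>1 / (m + 1)\<close>, the
  outer one through the steps. Only finitely many \<open>m\<close> give too large a step, so the
  values of the inner limit there are irrelevant.\<close>

definition resolvent_lim :: "real \<Rightarrow> real \<Rightarrow> pdistr \<Rightarrow> pdistr \<Rightarrow> complex \<Rightarrow> int \<Rightarrow> complex" where
  "resolvent_lim \<epsilon> q a h z k =
     lim (\<lambda>m. lim (\<lambda>n. bessel (- 1) (resolvent_iter \<epsilon> q a h z (1 / (real m + 1)) n) k))"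

text \<open>The spectral parameter \<open>z\<close> varies along with the data; this yields joint
  measurability in the sample point and the parameter of the contour.\<close>

lemma measurable_resolvent_iter:
  assumes [measurable]: "\<And>k. (\<lambda>\<omega>. a \<omega> k) \<in> borel_measurable M" "\<And>k. (\<lambda>\<omega>. h \<omega> k) \<in> borel_measurable M"
    "z \<in> borel_measurable M"
  shows "(\<lambda>\<omega>. resolvent_iter \<epsilon> q (a \<omega>) (h \<omega>) (z \<omega>) \<tau> n k) \<in> borel_measurable M"
proof (induction n arbitrary: k)
  case (Suc n)
  note Suc [measurable]
  show ?case unfolding resolvent_iter.simps bessel_eq by measurable
qed simp

lemma measurable_resolvent_lim:
  assumes "\<And>k. (\<lambda>\<omega>. a \<omega> k) \<in> borel_measurable M" "\<And>k. (\<lambda>\<omega>. h \<omega> k) \<in> borel_measurable M"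
    "z \<in> borel_measurable M"
  shows "(\<lambda>\<omega>. resolvent_lim \<epsilon> q (a \<omega>) (h \<omega>) (z \<omega>) k) \<in> borel_measurable M"
  unfolding resolvent_lim_def bessel_eq
  by (intro borel_measurable_lim_metric borel_measurable_times borel_measurable_const measurable_resolvent_iter assms)

context
  fixes \<epsilon> q \<delta> C :: real and v :: "real \<Rightarrow> real"
  assumes \<epsilon>: "\<epsilon> > 0" and v: "v \<in> borel_measurable circ" "AE x in circ. \<bar>v x\<bar> \<le> C"
    and \<delta>: "\<delta> > 0" and sym: "\<And>k. \<delta> * bessel_wt k \<le> \<epsilon>\<^sup>2 * (norm (Dq_symbol \<epsilon> q k))\<^sup>2"
begin

lemma coord_richardson:
  assumes h: "h \<in> H (- 1)"
    and x: "x 0 = 0" "\<And>n. x (Suc n) = x n - \<tau> *\<^sub>R (shifted_op \<epsilon> q v z (x n) - scale h)"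
  shows "coord (x n) = resolvent_iter \<epsilon> q (fourier (coef \<epsilon> v)) h z \<tau> n"
proof (induction n)
  case 0
  show ?case unfolding x(1) by (rule ext) simp
next
  case (Suc n)
  have hs: "coord (scale h) = bessel (- 1) h"
    unfolding scale_def by (rule coord_Ell2) (use h in \<open>simp add: H_iff\<close>)
  have m: "mulF \<epsilon> v (\<lambda>l. scaled_symbol \<epsilon> q l * coord (x n) l) k =
      symmetric_sum (\<lambda>l. fourier (coef \<epsilon> v) (k - l) * (scaled_symbol \<epsilon> q l * resolvent_iter \<epsilon> q (fourier (coef \<epsilon> v)) h z \<tau> n l))" for k
    unfolding Suc[symmetric]
    by (rule symmetric_sum_eq[symmetric], rule mulF_convolution[OF \<epsilon> v scaled_symbol_summable[OF coord_summable]])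
  show ?case
    by (rule ext) (simp only: x(2) coord_diff coord_scaleR coord_shifted_op[OF \<epsilon> v \<delta> sym] hs m resolvent_iter.simps, simp only: Suc)
qed

lemma B_resolvent_eq_lim:
  assumes h: "h \<in> H (- 1)" and z: "Re z \<le> \<delta> / 2"
  shows "B_resolvent \<epsilon> q v z h k = resolvent_lim \<epsilon> q (fourier (coef \<epsilon> v)) h z k"
proof -
  obtain y \<tau>\<^sub>0 where y: "shifted_op \<epsilon> q v z y = scale h" "\<And>y'. shifted_op \<epsilon> q v z y' = scale h \<Longrightarrow> y' = y"
    and \<tau>\<^sub>0: "\<tau>\<^sub>0 > 0" and rich: "\<And>\<tau> x. 0 < \<tau> \<Longrightarrow> \<tau> \<le> \<tau>\<^sub>0 \<Longrightarrow> x 0 = 0 \<Longrightarrow>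
      (\<And>n. x (Suc n) = x n - \<tau> *\<^sub>R (shifted_op \<epsilon> q v z (x n) - scale h)) \<Longrightarrow> x \<longlonglongrightarrow> y"
    by (rule shifted_op_solvable[OF \<epsilon> v \<delta> sym z, of "scale h"]) blast
  have inner_lim: "lim (\<lambda>n. bessel (- 1) (resolvent_iter \<epsilon> q (fourier (coef \<epsilon> v)) h z \<tau> n) k) = bessel (- 1) (coord y) k"
    if \<tau>: "0 < \<tau>" "\<tau> \<le> \<tau>\<^sub>0" for \<tau>
  proof (rule limI)
    define x where "x = rec_nat 0 (\<lambda>n w. w - \<tau> *\<^sub>R (shifted_op \<epsilon> q v z w - scale h))"
    have x: "x 0 = 0" "x (Suc n) = x n - \<tau> *\<^sub>R (shifted_op \<epsilon> q v z (x n) - scale h)" for n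
      by (simp_all add: x_def)
    have "x \<longlonglongrightarrow> y" by (rule rich[OF \<tau> x])
    then have n0: "(\<lambda>n. norm (x n - y)) \<longlonglongrightarrow> 0" by (simp only: tendsto_norm_zero_iff LIM_zero_iff)
    have "(\<lambda>n. coord (x n) k - coord y k) \<longlonglongrightarrow> 0"
      by (rule Lim_null_comparison[OF _ n0]) (simp only: coord_diff[symmetric] norm_coord_le eventually_True)
    then have "(\<lambda>n. coord (x n) k) \<longlonglongrightarrow> coord y k" by (simp only: LIM_zero_iff)
    then show "(\<lambda>n. bessel (- 1) (resolvent_iter \<epsilon> q (fourier (coef \<epsilon> v)) h z \<tau> n) k) \<longlonglongrightarrow> bessel (- 1) (coord y) k"
      unfolding bessel_eq coord_richardson[OF h x] by (rule tendsto_mult_left)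
  qed
  have "(\<lambda>m. 1 / (real m + 1)) \<longlonglongrightarrow> 0" using LIMSEQ_inverse_real_of_nat by (simp add: inverse_eq_divide add.commute)
  then have "eventually (\<lambda>m. 1 / (real m + 1) < \<tau>\<^sub>0) sequentially" by (rule order_tendstoD(2)) (rule \<tau>\<^sub>0)
  then have "eventually (\<lambda>m. lim (\<lambda>n. bessel (- 1) (resolvent_iter \<epsilon> q (fourier (coef \<epsilon> v)) h z (1 / (real m + 1)) n) k) =
      bessel (- 1) (coord y) k) sequentially"
    by (rule eventually_mono) (rule inner_lim, simp_all)
  then have "resolvent_lim \<epsilon> q (fourier (coef \<epsilon> v)) h z k = bessel (- 1) (coord y) k"
    unfolding resolvent_lim_def by (intro limI tendsto_eventually)
  then show ?thesis using B_resolvent_scaled[OF \<epsilon> v \<delta> sym h z y] by simp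
qed

end

text \<open>The coefficients of \<open>v\<^sup>2\<close> are a self-convolution, by Parseval for
  \<open>v\<close> and \<open>v\<close> times a character. Thus they depend measurably on the
  coefficients of \<open>v\<close>.\<close>

lemma fourier_coef:
  assumes v: "v \<in> Lp 2"
  shows "fourier (coef \<epsilon> v) j = (if j = 0 then of_real (\<epsilon>\<^sup>2) else 0) +
    symmetric_sum (\<lambda>l. fourier_real v l * fourier_real v (j - l))"
proof -
  let ?v = "\<lambda>x. complex_of_real (v x)"
  have v': "?v \<in> Lp 2" by (rule Lp_2_of_real[OF v])
  have ve: "(\<lambda>x. ?v x * expi (- j) x) \<in> Lp 2"
    using Lp_2_mult_bounded[OF v', of "expi (- j)" 1] by (simp add: mult.commute)
  have "((\<lambda>k. fourier ?v k * fourier (\<lambda>x. ?v x * expi (- j) x) (- k)) has_sum (LINT x|circ. ?v x * (?v x * expi (- j) x))) UNIV"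
    by (rule parseval_bilinear[OF v' ve])
  then have s: "symmetric_sum (\<lambda>l. fourier_real v l * fourier_real v (j - l)) = (LINT x|circ. ?v x * (?v x * expi (- j) x))"
    by (intro symmetric_sum_eq) (simp add: fourier_mult_expi)
  have i: "integrable circ (\<lambda>x. ?v x * ?v x)" by (rule integrable_mult_Lp_2[OF v' v'])
  have c: "integrable circ (\<lambda>x. complex_of_real (\<epsilon>\<^sup>2) * expi 0 x)" by (rule integrable_circ_bounded[where c="\<epsilon>\<^sup>2"]) (auto simp: norm_power norm_mult)
  have "coef \<epsilon> v = (\<lambda>x. of_real (\<epsilon>\<^sup>2) * expi 0 x + ?v x * ?v x)"
    by (rule ext) (simp add: coef_def power2_eq_square expi_def)
  then have "fourier (coef \<epsilon> v) j = of_real (\<epsilon>\<^sup>2) * fourier (expi 0) j + fourier (\<lambda>x. ?v x * ?v x) j"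
    by (simp only: fourier_add[OF c i] fourier_cmult)
  moreover have "fourier (\<lambda>x. ?v x * ?v x) j = (LINT x|circ. ?v x * (?v x * expi (- j) x))"
    by (simp only: fourier_expi mult.assoc)
  ultimately show ?thesis unfolding s by (simp only: fourier_expi_self) simp
qed

section \<open>The contour integral\<close>

text \<open>Minkowski's integral inequality for finitely many coordinates: the vector of integrals
  is paired with itself, and Cauchy-Schwarz is used under the integral.\<close>

lemma sum_integral_power2_le:
  fixes f :: "'i \<Rightarrow> 'a \<Rightarrow> complex" and g :: "'a \<Rightarrow> real"
  assumes f: "\<And>k. k \<in> S \<Longrightarrow> integrable M (f k)" and g: "integrable M g"
    and pos: "\<And>x. x \<in> space M \<Longrightarrow> 0 \<le> g x"
    and le: "\<And>x. x \<in> space M \<Longrightarrow> (\<Sum>k\<in>S. (norm (f k x))\<^sup>2) \<le> (g x)\<^sup>2"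
  shows "(\<Sum>k\<in>S. (norm (LINT x|M. f k x))\<^sup>2) \<le> (LINT x|M. g x)\<^sup>2"
proof -
  define c where "c k = (LINT x|M. f k x)" for k
  define A where "A = (\<Sum>k\<in>S. (norm (c k))\<^sup>2)"
  have A: "A \<ge> 0" by (simp add: A_def sum_nonneg)
  have G: "0 \<le> (LINT x|M. g x)" by (rule integral_nonneg_AE) (use pos in auto)
  have "of_real A = (\<Sum>k\<in>S. cnj (c k) * c k)"
    unfolding A_def of_real_sum complex_norm_square by (simp add: mult.commute)
  also have "\<dots> = (LINT x|M. (\<Sum>k\<in>S. cnj (c k) * f k x))"
    unfolding c_def by (subst Bochner_Integration.integral_sum) (use f in auto)
  finally have "A = norm (LINT x|M. (\<Sum>k\<in>S. cnj (c k) * f k x))"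
    using A by (metis abs_of_nonneg norm_of_real)
  also have "\<dots> \<le> (LINT x|M. sqrt A * g x)"
  proof (rule order_trans[OF integral_norm_bound Bochner_Integration.integral_mono])
    show "integrable M (\<lambda>x. norm (\<Sum>k\<in>S. cnj (c k) * f k x))" by (intro Bochner_Integration.integrable_norm Bochner_Integration.integrable_sum Bochner_Integration.integrable_mult_right f)
    show "integrable M (\<lambda>x. sqrt A * g x)" by (intro Bochner_Integration.integrable_mult_right g)
    fix x assume x: "x \<in> space M"
    have "norm (\<Sum>k\<in>S. cnj (c k) * f k x) \<le> (\<Sum>k\<in>S. \<bar>norm (c k)\<bar> * \<bar>norm (f k x)\<bar>)"
      by (rule order_trans[OF norm_sum]) (simp add: norm_mult)
    also have "\<dots> \<le> L2_set (\<lambda>k. norm (c k)) S * L2_set (\<lambda>k. norm (f k x)) S" by (rule L2_set_mult_ineq)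
    also have "\<dots> \<le> sqrt A * g x"
    proof (rule mult_mono)
      show "L2_set (\<lambda>k. norm (f k x)) S \<le> g x"
        unfolding L2_set_def by (rule real_le_lsqrt[OF pos[OF x] le[OF x]])
    qed (use A in \<open>auto simp: L2_set_def A_def sum_nonneg\<close>)
    finally show "norm (\<Sum>k\<in>S. cnj (c k) * f k x) \<le> sqrt A * g x" .
  qed
  also have "\<dots> = sqrt A * (LINT x|M. g x)" by simp
  finally have le': "sqrt A * sqrt A \<le> sqrt A * (LINT x|M. g x)" using A by simp
  have "sqrt A \<le> (LINT x|M. g x)"
  proof (cases "A = 0")
    case True then show ?thesis using G by simp
  next
    case False
    then have "sqrt A > 0" using A by simp
    then show ?thesis using le' by (rule mult_left_le_imp_le[rotated])
  qed
  then have "A \<le> (LINT x|M. g x)\<^sup>2" using sqrt_le_D by blast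
  then show ?thesis by (simp only: A_def c_def)
qed

lemma set_integrable_shifted_powr:
  assumes "e < - 1"
  shows "set_integrable lborel {..0} (\<lambda>x::real. (1 - x) powr e)"
proof -
  have "(\<lambda>x. x powr e) absolutely_integrable_on {1..}"
    by (rule nonnegative_absolutely_integrable_1) (use has_integral_powr_to_inf[OF assms, of 1] in auto)
  then have "integrable lborel (\<lambda>x. indicator {1..} x *\<^sub>R x powr e)"
    unfolding set_integrable_def by (subst (asm) integrable_completion) auto
  then have "integrable lborel (\<lambda>x. indicator {1..} (1 + (-1) * x) *\<^sub>R (1 + (-1) * x) powr e)"
    by (rule lborel_integrable_real_affine) simp
  moreover have "(\<lambda>x. indicator {1..} (1 + (-1) * x) *\<^sub>R (1 + (-1) * x) powr e) = (\<lambda>x. indicator {..0} x *\<^sub>R (1 - x) powr e)"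
    by (rule ext) (simp add: indicator_def)
  ultimately show ?thesis unfolding set_integrable_def by (simp only:)
qed

lemma has_contour_integral_linepath_shift:
  "(F has_contour_integral I) (linepath (a + c) (b + c)) \<longleftrightarrow> ((\<lambda>z. F (z + c)) has_contour_integral I) (linepath a b)"
proof -
  have "linepath (a + c) (b + c) x = linepath a b x + c" for x
    by (simp add: linepath_def scaleR_conv_of_real algebra_simps)
  then show ?thesis unfolding has_contour_integral_linepath by simp
qed

text \<open>The lower ray is run from left to right and the upper one from right to left, whence the
  minus sign; integrability lets the truncated rays converge.\<close>

lemma contour_integral_gamma_path_tendsto:
  assumes r: "r > 0"
    and lo: "set_integrable lborel {..0} (\<lambda>x. F (Complex x (- r)))"
    and up: "set_integrable lborel {..0} (\<lambda>x. F (Complex x r))"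
    and arc: "set_integrable lborel {- pi / 2..pi / 2} (\<lambda>t. F (of_real r * cis t) * of_real r * \<i> * cis t)"
  shows "((\<lambda>R. contour_integral (gamma_path r R) F) \<longlongrightarrow>
    (LINT x:{..0}|lborel. F (Complex x (- r))) + (LINT t:{- pi / 2..pi / 2}|lborel. F (of_real r * cis t) * of_real r * \<i> * cis t)
     - (LINT x:{..0}|lborel. F (Complex x r))) at_top"
proof -
  let ?A = "LINT t:{- pi / 2..pi / 2}|lborel. F (of_real r * cis t) * of_real r * \<i> * cis t"
  have sub: "set_integrable lborel {- R..0} (\<lambda>x. F (Complex x y))" if "set_integrable lborel {..0} (\<lambda>x. F (Complex x y))" for R y
    by (rule set_integrable_subset[OF that]) auto
  have line: "(F has_contour_integral (LINT x:{- R..0}|lborel. F (Complex x y))) (linepath (Complex (- R) y) (Complex 0 y))"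
    if R: "R > 0" and i: "set_integrable lborel {..0} (\<lambda>x. F (Complex x y))" for R y
  proof -
    have C: "of_real x + Complex 0 y = Complex x y" for x by (simp add: complex_eq_iff)
    have "((\<lambda>x. F (Complex x y)) has_integral (LINT x:{- R..0}|lborel. F (Complex x y))) {- R..0}"
      using set_borel_integral_eq_integral[OF sub[OF i, of R]] by (simp add: has_integral_integral)
    then have "((\<lambda>z. F (z + Complex 0 y)) has_contour_integral (LINT x:{- R..0}|lborel. F (Complex x y))) (linepath (of_real (- R)) (of_real 0))"
      by (subst has_contour_integral_linepath_Reals_iff) (use R in \<open>simp_all only: C Reals_of_real Re_complex_of_real neg_less_0_iff_less\<close>)
    then show ?thesis by (simp only: has_contour_integral_linepath_shift[symmetric] C)
  qed
  have arc': "(F has_contour_integral ?A) (part_circlepath 0 r (- pi / 2) (pi / 2))"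
    by (subst has_contour_integral_part_circlepath_iff)
      (use set_borel_integral_eq_integral[OF arc] in \<open>simp_all add: has_integral_integral\<close>)
  have e: "exp (\<i> * complex_of_real pi / 2) = \<i>" using cis_pi_half by (simp add: cis_conv_exp)
  have eq: "contour_integral (gamma_path r R) F =
      (LINT x:{- R..0}|lborel. F (Complex x (- r))) + (?A + - (LINT x:{- R..0}|lborel. F (Complex x r)))" if R: "R > 0" for R
    unfolding gamma_path_def
    by (intro contour_integral_unique has_contour_integral_join line[OF R lo] arc'
        has_contour_integral_reverse_linepath line[OF R up] valid_path_join)
      (simp_all add: e, simp_all add: complex_eq_iff)
  have lim: "((\<lambda>R. LINT x:{- R..0}|lborel. F (Complex x y)) \<longlongrightarrow> (LINT x:{..0}|lborel. F (Complex x y))) at_top"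
    if "set_integrable lborel {..0} (\<lambda>x. F (Complex x y))" for y
    using filterlim_compose[OF tendsto_set_lebesgue_integral_at_bot[OF _ that] filterlim_uminus_at_bot_at_top] by simp
  have "((\<lambda>R. (LINT x:{- R..0}|lborel. F (Complex x (- r))) + (?A + - (LINT x:{- R..0}|lborel. F (Complex x r)))) \<longlongrightarrow>
      (LINT x:{..0}|lborel. F (Complex x (- r))) + (?A + - (LINT x:{..0}|lborel. F (Complex x r)))) at_top"
    by (intro tendsto_add tendsto_minus tendsto_const lim lo up)
  then have "((\<lambda>R. contour_integral (gamma_path r R) F) \<longlongrightarrow>
      (LINT x:{..0}|lborel. F (Complex x (- r))) + (?A + - (LINT x:{..0}|lborel. F (Complex x r)))) at_top"
    by (rule Lim_transform_eventually) (rule eventually_mono[OF eventually_gt_at_top[of 0]], simp add: eq)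
  then show ?thesis by (simp add: algebra_simps)
qed

text \<open>The parametrised contour integral with \<open>resolvent_lim\<close> in place of the
  resolvent; it sees \<open>v\<close> only through the coefficients \<open>a\<close>.\<close>

definition Gamma_int :: "real \<Rightarrow> real \<Rightarrow> real \<Rightarrow> pdistr \<Rightarrow> pdistr \<Rightarrow> pdistr" where
  "Gamma_int \<epsilon> q r a h k = 1 / (2 * of_real pi * \<i>) *
     ((LINT x:{..0}|lborel. Complex x (- r) powr (- 1 / 2) * resolvent_lim \<epsilon> q a h (Complex x (- r)) k)
      + (LINT t:{- pi / 2..pi / 2}|lborel. (of_real r * cis t) powr (- 1 / 2) * resolvent_lim \<epsilon> q a h (of_real r * cis t) k
           * of_real r * \<i> * cis t)
      - (LINT x:{..0}|lborel. Complex x r powr (- 1 / 2) * resolvent_lim \<epsilon> q a h (Complex x r) k))"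

lemma measurable_Complex [measurable]: "(\<lambda>x. Complex x y) \<in> borel_measurable borel"
  by (simp add: borel_measurable_complex_iff)

lemma measurable_Gamma_int:
  assumes a: "\<And>k. (\<lambda>\<omega>. a \<omega> k) \<in> borel_measurable M" and h: "\<And>k. (\<lambda>\<omega>. h \<omega> k) \<in> borel_measurable M"
  shows "(\<lambda>\<omega>. Gamma_int \<epsilon> q r (a \<omega>) (h \<omega>) k) \<in> borel_measurable M"
proof -
  have int: "(\<lambda>\<omega>. LINT x:A|lborel. z x powr (- 1 / 2) * resolvent_lim \<epsilon> q (a \<omega>) (h \<omega>) (z x) k * w x) \<in> borel_measurable M"
    if z: "z \<in> borel_measurable borel" and w: "w \<in> borel_measurable borel" and A: "A \<in> sets borel"
    for z w :: "real \<Rightarrow> complex" and A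
  proof -
    have z': "z \<in> borel_measurable lborel" and w': "w \<in> borel_measurable lborel"
      and i: "(\<lambda>x. indicator A x :: real) \<in> borel_measurable lborel"
      using z w A by simp_all
    have p: "(\<lambda>x. z x powr (- 1 / 2)) \<in> borel_measurable lborel"
      using z' by (intro powr_complex_measurable borel_measurable_const)
    have "(\<lambda>p. resolvent_lim \<epsilon> q (a (fst p)) (h (fst p)) (z (snd p)) k) \<in> borel_measurable (M \<Otimes>\<^sub>M lborel)"
      by (rule measurable_resolvent_lim[OF measurable_compose[OF measurable_fst a]
          measurable_compose[OF measurable_fst h] measurable_compose[OF measurable_snd z']])
    then have "(\<lambda>p. indicator A (snd p) *\<^sub>R (z (snd p) powr (- 1 / 2) *
        resolvent_lim \<epsilon> q (a (fst p)) (h (fst p)) (z (snd p)) k * w (snd p))) \<in> borel_measurable (M \<Otimes>\<^sub>M lborel)"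
      by (rule borel_measurable_scaleR[OF measurable_compose[OF measurable_snd i]
          borel_measurable_times[OF borel_measurable_times[OF measurable_compose[OF measurable_snd p]]
          measurable_compose[OF measurable_snd w']]])
    then show ?thesis
      unfolding set_lebesgue_integral_def
      by (intro lborel.borel_measurable_lebesgue_integral) (simp only: case_prod_beta')
  qed
  have c: "cis \<in> borel_measurable borel" by (intro borel_measurable_continuous_onI continuous_intros)
  have c1: "(\<lambda>t. of_real r * cis t) \<in> borel_measurable borel"
    by (rule borel_measurable_times[OF borel_measurable_const c])
  have c2: "(\<lambda>t. of_real r * \<i> * cis t) \<in> borel_measurable borel"
    by (rule borel_measurable_times[OF borel_measurable_const c])
  show ?thesis
    unfolding Gamma_int_def
    using int[OF measurable_Complex[of "- r"] borel_measurable_const[of 1], of "{..0}"]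
      int[OF measurable_Complex[of r] borel_measurable_const[of 1], of "{..0}"] int[OF c1 c2, of "{- pi / 2..pi / 2}"]
    by (intro borel_measurable_times[OF borel_measurable_const] borel_measurable_diff borel_measurable_add)
      (simp_all only: mult_1_right mult.assoc atMost_borel atLeastAtMost_borel)
qed

text \<open>The square root compares \<open>norm z powr (- 1 / 2)\<close> with
  \<open>(1 + x) powr (- 1 / 2)\<close> on the contour; the denominator is the constant
  \<open>c\<close> of \<open>shifted_op_estimate\<close>.\<close>

definition gamma_wt :: "real \<Rightarrow> real \<Rightarrow> real" where
  "gamma_wt \<delta> s = sqrt ((1 + \<delta> / 2) / (\<delta> / 2)) / min (\<delta> / 2) 1"

definition decay_int :: "real \<Rightarrow> real" where
  "decay_int s = (LINT x:{..0}|lborel. (1 - x) powr (- ((s + 3) / 2)))"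

text \<open>Each ray contributes \<open>decay_int s\<close> and the arc its length
  \<open>pi * (\<delta> / 2)\<close>. The 3 comes from squaring a sum of three terms, and
  \<open>2 * pi\<close> from the Cauchy prefactor.\<close>

definition Gamma_const :: "real \<Rightarrow> real \<Rightarrow> real" where
  "Gamma_const \<delta> s = gamma_wt \<delta> s * sqrt (3 * (2 * (decay_int s)\<^sup>2 + (pi * (\<delta> / 2))\<^sup>2)) / (2 * pi)"

context
  fixes \<epsilon> q \<delta> C s :: real and v :: "real \<Rightarrow> real" and h :: pdistr
  assumes \<epsilon>: "\<epsilon> > 0" and v: "v \<in> borel_measurable circ" "AE x in circ. \<bar>v x\<bar> \<le> C"
    and \<delta>: "\<delta> > 0" and sym: "\<And>k. \<delta> * bessel_wt k \<le> \<epsilon>\<^sup>2 * (norm (Dq_symbol \<epsilon> q k))\<^sup>2"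
    and h: "h \<in> H s" and s: "- 1 < s" "s \<le> 0"
begin

lemma h_H_minus_1: "h \<in> H (- 1)" using H_mono[OF _ h, of "- 1"] s by simp

text \<open>Both \<open>\<delta> / 2\<close> and \<open>x = max 0 (- Re z)\<close> are at most
  \<open>norm z\<close>, so \<open>1 / norm z\<close> is at most a multiple of
  \<open>1 / (1 + x)\<close>. Together with the resolvent estimate the squared bound has the
  exponent \<open>- (s + 3)\<close>.\<close>

lemma sum_integrand_le:
  assumes z: "Re z \<le> \<delta> / 2" "\<delta> / 2 \<le> norm z" and S: "finite S"
  shows "(\<Sum>k\<in>S. (norm (z powr (- 1 / 2) * resolvent_lim \<epsilon> q (fourier (coef \<epsilon> v)) h z k))\<^sup>2) \<le>
    (gamma_wt \<delta> s * Hs_norm s h * (1 + max 0 (- Re z)) powr (- ((s + 3) / 2)))\<^sup>2"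
proof -
  define x where "x = max 0 (- Re z)"
  define r where "r = \<delta> / 2"
  have r: "r > 0" using \<delta> by (simp add: r_def)
  have x: "x \<ge> 0" by (simp add: x_def)
  have xn: "x \<le> norm z" using abs_Re_le_cmod[of z] by (simp add: x_def)
  obtain y \<tau> where y: "shifted_op \<epsilon> q v z y = scale h" "\<And>y'. shifted_op \<epsilon> q v z y' = scale h \<Longrightarrow> y' = y"
    by (rule shifted_op_solvable[OF \<epsilon> v \<delta> sym z(1), of "scale h"]) blast
  have res: "resolvent_lim \<epsilon> q (fourier (coef \<epsilon> v)) h z = bessel (- 1) (coord y)"
    using B_resolvent_eq_lim[OF \<epsilon> v \<delta> sym h_H_minus_1 z(1)] B_resolvent_scaled[OF \<epsilon> v \<delta> sym h_H_minus_1 z(1) y] by (intro ext) simp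
  have n: "(norm (bessel (- 1) (coord y) k))\<^sup>2 = (norm (coord y k))\<^sup>2 / bessel_wt k" for k
    unfolding norm_bessel_power2 by (simp add: powr_minus_divide less_imp_le)
  have "(\<Sum>k\<in>S. (norm (coord y k))\<^sup>2 / bessel_wt k) \<le> low_norm2 y"
    by (rule finite_sum_le_has_sum[OF low_norm2_has_sum[OF \<epsilon> v \<delta> sym] S]) (auto simp: less_imp_le)
  also have "\<dots> \<le> (Hs_norm s h)\<^sup>2 / (min (\<delta> / 2) 1)\<^sup>2 * (1 + x) powr (- s - 2)"
    unfolding x_def by (rule shifted_op_estimate[OF \<epsilon> v \<delta> sym z(1) h s y(1)])
  finally have sum_le: "(\<Sum>k\<in>S. (norm (coord y k))\<^sup>2 / bessel_wt k) \<le> (Hs_norm s h)\<^sup>2 / (min (\<delta> / 2) 1)\<^sup>2 * (1 + x) powr (- s - 2)" .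
  have z0: "norm z > 0" using z(2) \<delta> by linarith
  have "norm (z powr (- 1 / 2)) = norm z powr (- 1 / 2)"
    using norm_powr_real_powr'[of "- 1 / 2" z] by simp
  then have "(norm (z powr (- 1 / 2)))\<^sup>2 = norm z powr (- 1)"
    by (simp add: power2_eq_square powr_add[symmetric])
  then have nz: "(norm (z powr (- 1 / 2)))\<^sup>2 = 1 / norm z" by (simp add: powr_minus_divide)
  have "r * (1 + x) \<le> norm z * (1 + r)"
  proof -
    have "r * 1 \<le> norm z * 1" using z(2) by (simp add: r_def)
    moreover have "r * x \<le> r * norm z" using xn r by (intro mult_left_mono) auto
    ultimately show ?thesis by (simp only: distrib_left mult.commute[of r])
  qed
  moreover have "1 / N \<le> K / B" if "0 < N" "0 < B" "B \<le> N * K" for N B K :: real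
    using that by (simp add: pos_divide_le_eq pos_le_divide_eq mult.commute)
  moreover have "0 < r * (1 + x)" using r x by (intro mult_pos_pos) auto
  ultimately have "1 / norm z \<le> (1 + r) / (r * (1 + x))" using z0 by blast
  also have "(1 + r) / (r * (1 + x)) = (1 + r) / r * (1 / (1 + x))" by simp
  also have "1 / (1 + x) = (1 + x) powr (- 1)" using x by (simp add: powr_minus_divide)
  finally have zle: "1 / norm z \<le> (1 + r) / r * (1 + x) powr (- 1)" .
  have "(\<Sum>k\<in>S. (norm (z powr (- 1 / 2) * resolvent_lim \<epsilon> q (fourier (coef \<epsilon> v)) h z k))\<^sup>2) =
      1 / norm z * (\<Sum>k\<in>S. (norm (coord y k))\<^sup>2 / bessel_wt k)"
    unfolding res norm_mult power_mult_distrib nz n sum_distrib_left ..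
  also have "\<dots> \<le> (1 + r) / r * (1 + x) powr (- 1) * ((Hs_norm s h)\<^sup>2 / (min (\<delta> / 2) 1)\<^sup>2 * (1 + x) powr (- s - 2))"
    using r by (intro mult_mono[OF zle sum_le] mult_nonneg_nonneg sum_nonneg divide_nonneg_nonneg) (auto simp: less_imp_le)
  also have "\<dots> = (1 + r) / r / (min (\<delta> / 2) 1)\<^sup>2 * (Hs_norm s h)\<^sup>2 * ((1 + x) powr (- 1) * (1 + x) powr (- s - 2))"
    by (simp only: times_divide_eq_right times_divide_eq_left mult_ac)
  also have "\<dots> = (1 + r) / r / (min (\<delta> / 2) 1)\<^sup>2 * (Hs_norm s h)\<^sup>2 * ((1 + x) powr (- ((s + 3) / 2)))\<^sup>2"
  proof -
    have "- 1 + (- s - 2) = - ((s + 3) / 2) + - ((s + 3) / 2)" by (simp add: field_simps)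
    then show ?thesis by (simp only: power2_eq_square powr_add[symmetric])
  qed
  also have "(1 + r) / r / (min (\<delta> / 2) 1)\<^sup>2 = (gamma_wt \<delta> s)\<^sup>2"
    using r by (simp add: gamma_wt_def power_divide r_def)
  finally show ?thesis by (simp only: power_mult_distrib x_def)
qed

lemma gamma_wt_nonneg: "gamma_wt \<delta> s * Hs_norm s h \<ge> 0"
  using \<delta> by (simp add: gamma_wt_def Hs_norm_def infsum_nonneg)

lemma norm_integrand_le:
  assumes z: "Re z \<le> \<delta> / 2" "\<delta> / 2 \<le> norm z"
  shows "norm (z powr (- 1 / 2) * resolvent_lim \<epsilon> q (fourier (coef \<epsilon> v)) h z k) \<le>
    gamma_wt \<delta> s * Hs_norm s h * (1 + max 0 (- Re z)) powr (- ((s + 3) / 2))"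
proof (rule power2_le_imp_le)
  show "0 \<le> gamma_wt \<delta> s * Hs_norm s h * (1 + max 0 (- Re z)) powr (- ((s + 3) / 2))"
    by (rule mult_nonneg_nonneg[OF gamma_wt_nonneg]) simp
qed (use sum_integrand_le[OF z, of "{k}"] in simp)

lemma line_integral_bound:
  assumes y: "\<bar>y\<bar> = \<delta> / 2"
  defines "F \<equiv> \<lambda>k z. z powr (- 1 / 2) * resolvent_lim \<epsilon> q (fourier (coef \<epsilon> v)) h z k"
  shows "set_integrable lborel {..0} (\<lambda>x. F k (Complex x y))"
    and "finite S \<Longrightarrow> (\<Sum>k\<in>S. (norm (LINT x:{..0}|lborel. F k (Complex x y)))\<^sup>2) \<le>
      (gamma_wt \<delta> s * Hs_norm s h * decay_int s)\<^sup>2"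
proof -
  let ?g = "\<lambda>x. gamma_wt \<delta> s * Hs_norm s h * (indicator {..0} x *\<^sub>R (1 - x) powr (- ((s + 3) / 2)))"
  have z: "Re (Complex x y) \<le> \<delta> / 2" "\<delta> / 2 \<le> norm (Complex x y)" "max 0 (- Re (Complex x y)) = - x" if "x \<le> 0" for x
    using that \<delta> abs_Im_le_cmod[of "Complex x y"] y by auto
  have "- ((s + 3) / 2) < - 1" using s by simp
  from set_integrable_shifted_powr[OF this]
  have g: "integrable lborel ?g" unfolding set_integrable_def by (rule Bochner_Integration.integrable_mult_right)
  have m: "(\<lambda>x. indicator {..0} x *\<^sub>R F k (Complex x y)) \<in> borel_measurable lborel" for k
    unfolding F_def
    by (intro borel_measurable_scaleR borel_measurable_times powr_complex_measurable borel_measurable_const measurable_resolvent_lim)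
      (simp_all add: borel_measurable_indicator)
  have i: "integrable lborel (\<lambda>x. indicator {..0} x *\<^sub>R F k (Complex x y))" for k
  proof (rule Bochner_Integration.integrable_bound[OF g m], rule AE_I2)
    fix x
    show "norm (indicator {..0} x *\<^sub>R F k (Complex x y)) \<le> norm (?g x)"
    proof (cases "x \<le> 0")
      case True
      then show ?thesis using norm_integrand_le[OF z(1,2)[OF True], of k] gamma_wt_nonneg unfolding z(3)[OF True] F_def by simp
    qed simp
  qed
  show "set_integrable lborel {..0} (\<lambda>x. F k (Complex x y))" unfolding set_integrable_def by (rule i)
  assume S: "finite S"
  have "(\<Sum>k\<in>S. (norm (LINT x|lborel. indicator {..0} x *\<^sub>R F k (Complex x y)))\<^sup>2) \<le> (LINT x|lborel. ?g x)\<^sup>2"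
  proof (rule sum_integral_power2_le[OF i g])
    show "0 \<le> ?g x" for x using gamma_wt_nonneg by simp
    show "(\<Sum>k\<in>S. (norm (indicator {..0} x *\<^sub>R F k (Complex x y)))\<^sup>2) \<le> (?g x)\<^sup>2" for x
    proof (cases "x \<le> 0")
      case True
      then show ?thesis using sum_integrand_le[OF z(1,2)[OF True] S] unfolding z(3)[OF True] F_def by simp
    qed simp
  qed
  then show "(\<Sum>k\<in>S. (norm (LINT x:{..0}|lborel. F k (Complex x y)))\<^sup>2) \<le> (gamma_wt \<delta> s * Hs_norm s h * decay_int s)\<^sup>2"
    by (simp only: set_lebesgue_integral_def decay_int_def Bochner_Integration.integral_mult_right_zero)
qed

text \<open>On the arc the real part is nonnegative, so the decay factor equals 1 and only the
  length of the arc remains.\<close>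

lemma arc_integral_bound:
  defines "F \<equiv> \<lambda>k z. z powr (- 1 / 2) * resolvent_lim \<epsilon> q (fourier (coef \<epsilon> v)) h z k" and "r \<equiv> \<delta> / 2"
  shows "set_integrable lborel {- pi / 2..pi / 2} (\<lambda>t. F k (of_real r * cis t) * of_real r * \<i> * cis t)"
    and "finite S \<Longrightarrow> (\<Sum>k\<in>S. (norm (LINT t:{- pi / 2..pi / 2}|lborel. F k (of_real r * cis t) * of_real r * \<i> * cis t))\<^sup>2) \<le>
      (gamma_wt \<delta> s * Hs_norm s h * (pi * r))\<^sup>2"
proof -
  have r: "r > 0" using \<delta> by (simp add: r_def)
  let ?G = "\<lambda>k t. F k (of_real r * cis t) * of_real r * \<i> * cis t"
  let ?g = "\<lambda>t. gamma_wt \<delta> s * Hs_norm s h * r * indicator {- pi / 2..pi / 2} t"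
  have z: "Re (of_real r * cis t) \<le> \<delta> / 2" "\<delta> / 2 \<le> norm (of_real r * cis t)" "max 0 (- Re (of_real r * cis t)) = 0"
    if "t \<in> {- pi / 2..pi / 2}" for t
  proof -
    have "0 \<le> cos t" using that by (intro cos_ge_zero) auto
    then show "max 0 (- Re (of_real r * cis t)) = 0" using r by simp
    show "Re (of_real r * cis t) \<le> \<delta> / 2" using r mult_left_mono[of "cos t" 1 r] by (simp add: r_def)
    show "\<delta> / 2 \<le> norm (of_real r * cis t)" using r by (simp add: norm_mult r_def)
  qed
  have nG: "norm (?G k t) = r * norm (F k (of_real r * cis t))" for k t
    using r by (simp add: norm_mult)
  have g: "integrable lborel ?g" by (rule Bochner_Integration.integrable_mult_right) simp
  have c: "cis \<in> borel_measurable lborel" by (simp, intro borel_measurable_continuous_onI continuous_intros)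
  have c1: "(\<lambda>t. of_real r * cis t) \<in> borel_measurable lborel"
    by (rule borel_measurable_times[OF borel_measurable_const c])
  have m: "(\<lambda>t. indicator {- pi / 2..pi / 2} t *\<^sub>R ?G k t) \<in> borel_measurable lborel" for k
    unfolding F_def
    by (intro borel_measurable_scaleR borel_measurable_times[OF _ c] borel_measurable_times[OF _ borel_measurable_const]
        borel_measurable_times[OF powr_complex_measurable[OF c1 borel_measurable_const]] measurable_resolvent_lim c1 borel_measurable_const)
      (simp_all add: borel_measurable_indicator)
  have i: "integrable lborel (\<lambda>t. indicator {- pi / 2..pi / 2} t *\<^sub>R ?G k t)" for k
  proof (rule Bochner_Integration.integrable_bound[OF g m], rule AE_I2)
    fix t
    show "norm (indicator {- pi / 2..pi / 2} t *\<^sub>R ?G k t) \<le> norm (?g t)"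
    proof (cases "t \<in> {- pi / 2..pi / 2}")
      case True
      have "norm (F k (of_real r * cis t)) \<le> gamma_wt \<delta> s * Hs_norm s h"
        using norm_integrand_le[OF z(1,2)[OF True], of k] unfolding z(3)[OF True] F_def by simp
      then have "norm (?G k t) \<le> r * (gamma_wt \<delta> s * Hs_norm s h)" unfolding nG using r by (intro mult_left_mono) auto
      then show ?thesis using True gamma_wt_nonneg r by (simp add: mult.commute abs_of_nonneg del: norm_mult)
    qed simp
  qed
  show "set_integrable lborel {- pi / 2..pi / 2} (?G k)" unfolding set_integrable_def by (rule i)
  assume S: "finite S"
  have "(\<Sum>k\<in>S. (norm (LINT t|lborel. indicator {- pi / 2..pi / 2} t *\<^sub>R ?G k t))\<^sup>2) \<le> (LINT t|lborel. ?g t)\<^sup>2"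
  proof (rule sum_integral_power2_le[OF i g])
    show "0 \<le> ?g t" for t using gamma_wt_nonneg r by simp
    show "(\<Sum>k\<in>S. (norm (indicator {- pi / 2..pi / 2} t *\<^sub>R ?G k t))\<^sup>2) \<le> (?g t)\<^sup>2" for t
    proof (cases "t \<in> {- pi / 2..pi / 2}")
      case True
      have "(\<Sum>k\<in>S. (norm (F k (of_real r * cis t)))\<^sup>2) \<le> (gamma_wt \<delta> s * Hs_norm s h)\<^sup>2"
        using sum_integrand_le[OF z(1,2)[OF True] S] unfolding z(3)[OF True] F_def by simp
      then have "r\<^sup>2 * (\<Sum>k\<in>S. (norm (F k (of_real r * cis t)))\<^sup>2) \<le> r\<^sup>2 * (gamma_wt \<delta> s * Hs_norm s h)\<^sup>2"
        by (rule mult_left_mono) simp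
      then have "(\<Sum>k\<in>S. (norm (?G k t))\<^sup>2) \<le> (gamma_wt \<delta> s * Hs_norm s h * r)\<^sup>2"
        unfolding nG power_mult_distrib sum_distrib_left[symmetric] by (simp only: mult.commute mult.left_commute mult.assoc)
      then show ?thesis using True by simp
    qed simp
  qed
  also have "(LINT t|lborel. ?g t) = gamma_wt \<delta> s * Hs_norm s h * (pi * r)" by simp
  finally show "(\<Sum>k\<in>S. (norm (LINT t:{- pi / 2..pi / 2}|lborel. ?G k t))\<^sup>2) \<le> (gamma_wt \<delta> s * Hs_norm s h * (pi * r))\<^sup>2"
    by (simp only: set_lebesgue_integral_def)
qed

text \<open>The contour stays in \<open>Re z \<le> \<delta> / 2\<close>, where the resolvent exists
  and equals \<open>resolvent_lim\<close>.\<close>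

lemma Gamma_op_eq: "Gamma_op \<epsilon> q \<delta> v h k = Gamma_int \<epsilon> q (\<delta> / 2) (fourier (coef \<epsilon> v)) h k"
proof -
  define r where "r = \<delta> / 2"
  have r: "r > 0" using \<delta> by (simp add: r_def)
  let ?F = "\<lambda>z. z powr (- 1 / 2) * B_resolvent \<epsilon> q v z h k"
  let ?F' = "\<lambda>z. z powr (- 1 / 2) * resolvent_lim \<epsilon> q (fourier (coef \<epsilon> v)) h z k"
  have F: "?F z = ?F' z" if "Re z \<le> r" for z
    using B_resolvent_eq_lim[OF \<epsilon> v \<delta> sym h_H_minus_1, of z] that by (simp add: r_def)
  have lo: "?F (Complex x y) = ?F' (Complex x y)" if "x \<in> {..0}" for x y by (rule F) (use that r in simp)
  have arc: "?F (of_real r * cis t) = ?F' (of_real r * cis t)" for t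
    by (rule F) (use r mult_left_mono[of "cos t" 1 r] in simp)
  have "((\<lambda>R. contour_integral (gamma_path r R) ?F) \<longlongrightarrow>
     (LINT x:{..0}|lborel. ?F (Complex x (- r))) + (LINT t:{- pi / 2..pi / 2}|lborel. ?F (of_real r * cis t) * of_real r * \<i> * cis t)
     - (LINT x:{..0}|lborel. ?F (Complex x r))) at_top"
  proof (rule contour_integral_gamma_path_tendsto[OF r])
    show "set_integrable lborel {..0} (\<lambda>x. ?F (Complex x (- r)))"
      using line_integral_bound(1)[of "- r" k] r by (subst set_integrable_cong[OF refl refl lo]) (simp_all add: r_def)
    show "set_integrable lborel {..0} (\<lambda>x. ?F (Complex x r))"
      using line_integral_bound(1)[of r k] r by (subst set_integrable_cong[OF refl refl lo]) (simp_all add: r_def)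
    show "set_integrable lborel {- pi / 2..pi / 2} (\<lambda>t. ?F (of_real r * cis t) * of_real r * \<i> * cis t)"
      unfolding arc using arc_integral_bound(1)[of k] by (simp only: r_def)
  qed
  then have "Lim at_top (\<lambda>R. contour_integral (gamma_path r R) ?F) =
     (LINT x:{..0}|lborel. ?F (Complex x (- r))) + (LINT t:{- pi / 2..pi / 2}|lborel. ?F (of_real r * cis t) * of_real r * \<i> * cis t)
     - (LINT x:{..0}|lborel. ?F (Complex x r))"
    by (rule tendsto_Lim[rotated]) simp
  also have "\<dots> = (LINT x:{..0}|lborel. ?F' (Complex x (- r))) + (LINT t:{- pi / 2..pi / 2}|lborel. ?F' (of_real r * cis t) * of_real r * \<i> * cis t)
     - (LINT x:{..0}|lborel. ?F' (Complex x r))"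
    unfolding arc using lo by (intro arg_cong2[where f="(-)"] arg_cong2[where f="(+)"] set_lebesgue_integral_cong refl) auto
  finally show ?thesis unfolding Gamma_op_def Gamma_int_def r_def by (rule arg_cong)
qed

lemma sum_Gamma_op_le:
  assumes S: "finite S"
  shows "(\<Sum>k\<in>S. (norm (Gamma_op \<epsilon> q \<delta> v h k))\<^sup>2) \<le> (Gamma_const \<delta> s * Hs_norm s h)\<^sup>2"
proof -
  define F where "F k z = z powr (- 1 / 2) * resolvent_lim \<epsilon> q (fourier (coef \<epsilon> v)) h z k" for k z
  define r where "r = \<delta> / 2"
  define I1 where "I1 k = (LINT x:{..0}|lborel. F k (Complex x (- r)))" for k
  define I2 where "I2 k = (LINT t:{- pi / 2..pi / 2}|lborel. F k (of_real r * cis t) * of_real r * \<i> * cis t)" for k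
  define I3 where "I3 k = (LINT x:{..0}|lborel. F k (Complex x r))" for k
  let ?K = "gamma_wt \<delta> s * Hs_norm s h"
  have three: "(norm (a + b - c))\<^sup>2 \<le> 3 * ((norm a)\<^sup>2 + (norm b)\<^sup>2 + (norm c)\<^sup>2)" for a b c :: complex
  proof -
    have "norm (a + b - c) \<le> norm a + norm b + norm c"
      by (rule order_trans[OF norm_triangle_ineq4]) (simp add: norm_triangle_ineq)
    then have "(norm (a + b - c))\<^sup>2 \<le> (norm a + norm b + norm c)\<^sup>2" by (rule power_mono) simp
    moreover have "0 \<le> (x - y)\<^sup>2 + (y - w)\<^sup>2 + (x - w)\<^sup>2" for x y w :: real by simp
    then have "(x + y + w)\<^sup>2 \<le> 3 * (x\<^sup>2 + y\<^sup>2 + w\<^sup>2)" for x y w :: real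
      by (simp add: power2_eq_square algebra_simps)
    ultimately show ?thesis by (rule order_trans)
  qed
  have "Gamma_op \<epsilon> q \<delta> v h k = 1 / (2 * of_real pi * \<i>) * (I1 k + I2 k - I3 k)" for k
    unfolding Gamma_op_eq Gamma_int_def I1_def I2_def I3_def F_def r_def ..
  then have "norm (Gamma_op \<epsilon> q \<delta> v h k) = 1 / (2 * pi) * norm (I1 k + I2 k - I3 k)" for k
    by (simp add: norm_mult norm_divide)
  then have "(\<Sum>k\<in>S. (norm (Gamma_op \<epsilon> q \<delta> v h k))\<^sup>2) = (1 / (2 * pi))\<^sup>2 * (\<Sum>k\<in>S. (norm (I1 k + I2 k - I3 k))\<^sup>2)"
    by (simp only: power_mult_distrib sum_distrib_left)
  also have "\<dots> \<le> (1 / (2 * pi))\<^sup>2 * (\<Sum>k\<in>S. 3 * ((norm (I1 k))\<^sup>2 + (norm (I2 k))\<^sup>2 + (norm (I3 k))\<^sup>2))"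
    by (intro mult_left_mono sum_mono three) simp
  also have "\<dots> = (1 / (2 * pi))\<^sup>2 * (3 * ((\<Sum>k\<in>S. (norm (I1 k))\<^sup>2) + (\<Sum>k\<in>S. (norm (I2 k))\<^sup>2) + (\<Sum>k\<in>S. (norm (I3 k))\<^sup>2)))"
    by (simp only: sum_distrib_left[symmetric] sum.distrib)
  also have "\<dots> \<le> (1 / (2 * pi))\<^sup>2 * (3 * ((?K * decay_int s)\<^sup>2 + (?K * (pi * r))\<^sup>2 + (?K * decay_int s)\<^sup>2))"
  proof (intro mult_left_mono add_mono)
    show "(\<Sum>k\<in>S. (norm (I1 k))\<^sup>2) \<le> (?K * decay_int s)\<^sup>2"
      unfolding I1_def F_def using line_integral_bound(2)[of "- r", OF _ S] \<delta> by (simp add: r_def)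
    show "(\<Sum>k\<in>S. (norm (I3 k))\<^sup>2) \<le> (?K * decay_int s)\<^sup>2"
      unfolding I3_def F_def using line_integral_bound(2)[of r, OF _ S] \<delta> by (simp add: r_def)
    show "(\<Sum>k\<in>S. (norm (I2 k))\<^sup>2) \<le> (?K * (pi * r))\<^sup>2"
      unfolding I2_def F_def r_def by (rule arc_integral_bound(2)[OF S])
  qed simp_all
  also have "\<dots> = (?K * sqrt (3 * (2 * (decay_int s)\<^sup>2 + (pi * r)\<^sup>2)) / (2 * pi))\<^sup>2"
  proof -
    have "(c / p)\<^sup>2 = (1 / p)\<^sup>2 * c\<^sup>2" for c p :: real by (simp add: power_divide)
    moreover have "(?K * sqrt (3 * (2 * (decay_int s)\<^sup>2 + (pi * r)\<^sup>2)))\<^sup>2 =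
        3 * ((?K * decay_int s)\<^sup>2 + (?K * (pi * r))\<^sup>2 + (?K * decay_int s)\<^sup>2)"
      by (simp add: power_mult_distrib algebra_simps)
    ultimately show ?thesis by metis
  qed
  also have "?K * sqrt (3 * (2 * (decay_int s)\<^sup>2 + (pi * r)\<^sup>2)) / (2 * pi) = Gamma_const \<delta> s * Hs_norm s h"
    by (simp add: Gamma_const_def r_def)
  finally show ?thesis .
qed

end

section \<open>Exponential moments\<close>

text \<open>For a constant coefficient the operator is a Fourier multiplier; this is the instance on
  which \<open>Dq_symbol_ge_if_coercive\<close> relies.\<close>

lemma B_op_zero:
  assumes \<epsilon>: "\<epsilon> > 0" and u: "u \<in> H 1"
  shows "B_op \<epsilon> q (\<lambda>_. 0) u = (\<lambda>k. cnj (Dq_symbol \<epsilon> q k) * (of_real (\<epsilon>\<^sup>2) * (Dq_symbol \<epsilon> q k * u k)))"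
proof -
  have z: "(\<lambda>_. 0 :: real) \<in> borel_measurable circ" "AE x in circ. \<bar>0 :: real\<bar> \<le> 0" by simp_all
  have "mulF \<epsilon> (\<lambda>_. 0) (Dq \<epsilon> q u) k = of_real (\<epsilon>\<^sup>2) * Dq \<epsilon> q u k" for k
    unfolding mulF_def coef_def by (simp add: fourier_cmult fourier_fun_of[OF Dq_sq_summable[OF \<epsilon> z u]])
  then show ?thesis unfolding B_op_eq[OF \<epsilon> z u] by (simp only: Dq_eq)
qed

lemma sq_summable_if_sums_bounded:
  assumes "\<And>S. finite S \<Longrightarrow> (\<Sum>k\<in>S. (norm (u k))\<^sup>2) \<le> B"
  shows "sq_summable u"
  unfolding sq_summable_def by (rule nonneg_bdd_above_summable_on) (auto intro!: bdd_aboveI[of _ B] assms)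

lemma Lp_norm_real_fun_of_le:
  assumes B: "B \<ge> 0" "\<And>S. finite S \<Longrightarrow> (\<Sum>k\<in>S. (norm (u k))\<^sup>2) \<le> B\<^sup>2"
  shows "Lp_norm 2 (real_fun_of u) \<le> B"
proof (rule power2_le_imp_le[OF _ B(1)])
  have s: "sq_summable u" by (rule sq_summable_if_sums_bounded[OF B(2)])
  note L = fun_of_Lp_2[OF s]
  have "(Lp_norm 2 (real_fun_of u))\<^sup>2 = (LINT x|circ. (norm (Re (fun_of u x)))\<^sup>2)"
    unfolding Lp_norm_2_power2 real_fun_of_def ..
  also have "\<dots> \<le> (LINT x|circ. (norm (fun_of u x))\<^sup>2)"
    using Lp_2_Re[OF L] L by (intro Bochner_Integration.integral_mono) (auto simp: Lp_2_iff cmod_power2)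
  also have "\<dots> \<le> B\<^sup>2"
    using parseval_norm[OF L] B(2) unfolding fourier_fun_of[OF s] by (rule has_sum_le_finite_sums)
  finally show "(Lp_norm 2 (real_fun_of u))\<^sup>2 \<le> B\<^sup>2" .
qed

text \<open>Taking the real part symmetrises the coefficients, and Parseval reads the norm off from
  them, whichever representative \<open>fun_of\<close> selects.\<close>

lemma borel_measurable_Lp_norm_real_fun_of:
  assumes m: "\<And>k. (\<lambda>\<omega>. u \<omega> k) \<in> borel_measurable M" and s: "\<And>\<omega>. \<omega> \<in> space M \<Longrightarrow> sq_summable (u \<omega>)"
  shows "(\<lambda>\<omega>. Lp_norm 2 (real_fun_of (u \<omega>))) \<in> borel_measurable M"
proof -
  have "(\<lambda>\<omega>. cnj (u \<omega> (- k))) \<in> borel_measurable M" for k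
    by (rule measurable_compose[OF m borel_measurable_continuous_onI]) (intro continuous_intros)
  then have "(\<lambda>\<omega>. (u \<omega> k + cnj (u \<omega> (- k))) / 2) \<in> borel_measurable M" for k
    by (intro borel_measurable_divide borel_measurable_add m borel_measurable_const)
  moreover have "sq_summable (\<lambda>k. (u \<omega> k + cnj (u \<omega> (- k))) / 2)" if "\<omega> \<in> space M" for \<omega>
    using sq_summable_fourier[OF Lp_2_of_real[OF real_fun_of_Lp_2[OF s[OF that]]]]
    by (simp only: fourier_real_fun_of[OF s[OF that], abs_def])
  ultimately have "(\<lambda>\<omega>. sqrt (\<Sum>\<^sub>\<infinity>k. (norm ((u \<omega> k + cnj (u \<omega> (- k))) / 2))\<^sup>2)) \<in> borel_measurable M"
    by (intro measurable_compose[OF _ borel_measurable_sqrt] borel_measurable_infsum_norm)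
  moreover have "Lp_norm 2 (real_fun_of (u \<omega>)) = sqrt (\<Sum>\<^sub>\<infinity>k. (norm ((u \<omega> k + cnj (u \<omega> (- k))) / 2))\<^sup>2)" if "\<omega> \<in> space M" for \<omega>
    using Lp_norm_2_eq_infsum[OF real_fun_of_Lp_2[OF s[OF that]]] unfolding fourier_real_fun_of[OF s[OF that]] .
  ultimately show ?thesis by (simp cong: measurable_cong)
qed

lemma Gamma_const_nonneg: "\<delta> > 0 \<Longrightarrow> Gamma_const \<delta> s \<ge> 0"
  by (simp add: Gamma_const_def gamma_wt_def)

text \<open>The root is at most \<open>u + w\<close>, so the exponential is dominated by a product.
  Tonelli integrates over the first sample point with the second one fixed, where the bound
  \<open>A\<close> is uniform; the dependence of both fields on the second sample point is therefore
  harmless.\<close>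

lemma exp_pair_integrable:
  fixes u :: "'a \<times> 'b \<Rightarrow> real" and w :: "'b \<Rightarrow> real"
  assumes M: "prob_space M1" "prob_space M2" and b: "b \<ge> 0"
    and u: "u \<in> borel_measurable (M1 \<Otimes>\<^sub>M M2)" "\<And>\<omega>. 0 \<le> u \<omega>"
    and w: "w \<in> borel_measurable M2" "\<And>\<omega>. 0 \<le> w \<omega>"
    and A: "A \<ge> 0" "\<And>\<omega>2. \<omega>2 \<in> space M2 \<Longrightarrow> (\<integral>\<^sup>+\<omega>1. ennreal (exp (b * u (\<omega>1, \<omega>2))) \<partial>M1) \<le> ennreal A"
    and B: "B \<ge> 0" "(\<integral>\<^sup>+\<omega>2. ennreal (exp (b * w \<omega>2)) \<partial>M2) \<le> ennreal B"
  shows "integrable (completion (M1 \<Otimes>\<^sub>M M2)) (\<lambda>\<omega>. exp (b * sqrt ((u \<omega>)\<^sup>2 + (w (snd \<omega>))\<^sup>2)))"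
    and "(LINT \<omega>|completion (M1 \<Otimes>\<^sub>M M2). exp (b * sqrt ((u \<omega>)\<^sup>2 + (w (snd \<omega>))\<^sup>2))) \<le> A * B"
proof -
  interpret M1: prob_space M1 by fact
  interpret M2: prob_space M2 by fact
  interpret pair_sigma_finite M1 M2 ..
  let ?f = "\<lambda>\<omega>. exp (b * sqrt ((u \<omega>)\<^sup>2 + (w (snd \<omega>))\<^sup>2))"
  note [measurable] = u(1) w(1)
  have m: "?f \<in> borel_measurable (M1 \<Otimes>\<^sub>M M2)" by measurable
  have le: "?f \<omega> \<le> exp (b * u \<omega>) * exp (b * w (snd \<omega>))" for \<omega>
  proof -
    have "sqrt ((u \<omega>)\<^sup>2 + (w (snd \<omega>))\<^sup>2) \<le> u \<omega> + w (snd \<omega>)"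
      using sqrt_sum_squares_le_sum[OF u(2) w(2)] .
    then have "b * sqrt ((u \<omega>)\<^sup>2 + (w (snd \<omega>))\<^sup>2) \<le> b * (u \<omega> + w (snd \<omega>))" using b by (rule mult_left_mono)
    then show ?thesis by (simp add: exp_add[symmetric] distrib_left)
  qed
  have "(\<integral>\<^sup>+\<omega>. ennreal (?f \<omega>) \<partial>(M1 \<Otimes>\<^sub>M M2)) \<le> (\<integral>\<^sup>+\<omega>. ennreal (exp (b * u \<omega>)) * ennreal (exp (b * w (snd \<omega>))) \<partial>(M1 \<Otimes>\<^sub>M M2))"
    by (rule nn_integral_mono) (simp only: ennreal_mult[symmetric] exp_ge_zero ennreal_leI le)
  also have "\<dots> = (\<integral>\<^sup>+\<omega>2. \<integral>\<^sup>+\<omega>1. ennreal (exp (b * u (\<omega>1, \<omega>2))) * ennreal (exp (b * w (snd (\<omega>1, \<omega>2)))) \<partial>M1 \<partial>M2)"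
    by (rule nn_integral_snd[symmetric]) measurable
  also have "\<dots> = (\<integral>\<^sup>+\<omega>2. (\<integral>\<^sup>+\<omega>1. ennreal (exp (b * u (\<omega>1, \<omega>2))) \<partial>M1) * ennreal (exp (b * w \<omega>2)) \<partial>M2)"
    by (rule nn_integral_cong) (simp add: nn_integral_multc)
  also have "\<dots> \<le> (\<integral>\<^sup>+\<omega>2. ennreal A * ennreal (exp (b * w \<omega>2)) \<partial>M2)"
    by (rule nn_integral_mono) (rule mult_right_mono[OF A(2)], simp_all)
  also have "\<dots> = ennreal A * (\<integral>\<^sup>+\<omega>2. ennreal (exp (b * w \<omega>2)) \<partial>M2)"
    by (rule nn_integral_cmult) measurable
  also have "\<dots> \<le> ennreal A * ennreal B" by (rule mult_left_mono[OF B(2)]) simp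
  also have "\<dots> = ennreal (A * B)" using A(1) B(1) by (simp add: ennreal_mult)
  finally have nn: "(\<integral>\<^sup>+\<omega>. ennreal (?f \<omega>) \<partial>(M1 \<Otimes>\<^sub>M M2)) \<le> ennreal (A * B)" .
  have "integrable (M1 \<Otimes>\<^sub>M M2) ?f"
    by (rule integrableI_nonneg[OF m _ le_less_trans[OF nn ennreal_less_top[unfolded infinity_ennreal_def[symmetric]]]]) simp
  then show "integrable (completion (M1 \<Otimes>\<^sub>M M2)) ?f" by (simp only: integrable_completion[OF m])
  show "(LINT \<omega>|completion (M1 \<Otimes>\<^sub>M M2). ?f \<omega>) \<le> A * B"
    unfolding integral_completion[OF m] by (rule integral_real_bounded[OF _ nn]) (use A(1) B(1) in simp)
qed

context
  fixes \<epsilon> q \<delta> s t\<^sub>0 p\<^sub>0 :: real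
    and M1 :: "'a measure" and M2 :: "'b measure"
    and V :: "'b \<Rightarrow> real \<Rightarrow> real" and W :: "'a \<Rightarrow> pdistr"
  assumes \<epsilon>: "\<epsilon> > 0" and M: "prob_space M1" "prob_space M2"
    and tp: "1 < p\<^sub>0" "t\<^sub>0 > 1 / p\<^sub>0"
    and V: "gaussian_L2 M2 V (\<lambda>x. 1) (C_V \<epsilon>)"
      "(\<lambda>\<omega>. fourier_real (V \<omega>)) \<in> measurable M2 (Sob_borel t\<^sub>0 p\<^sub>0)"
    and \<delta>: "\<delta> > 0"
    and sym: "\<And>k. \<delta> * bessel_wt k \<le> \<epsilon>\<^sup>2 * (norm (Dq_symbol \<epsilon> q k))\<^sup>2"
    and s: "- 1 < s" "s < - 1 / 2"
    and W: "white_noise M1 s W"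
begin

lemma V_Lp_2: "\<omega> \<in> space M2 \<Longrightarrow> V \<omega> \<in> Lp 2"
  using V(1) by (simp add: gaussian_L2_def)

text \<open>The measurable map takes its values in the Sobolev space, to which the embedding
  applies. The bound may vary with \<open>\<omega>\<close>; the final constants do not involve
  it.\<close>

lemma V_bounded:
  assumes "\<omega> \<in> space M2" obtains C where "AE x in circ. \<bar>V \<omega> x\<bar> \<le> C"
proof -
  have "fourier_real (V \<omega>) \<in> space (Sob_borel t\<^sub>0 p\<^sub>0)" by (rule measurable_space[OF V(2) assms])
  then have "fourier_real (V \<omega>) \<in> Sob t\<^sub>0 p\<^sub>0" by (simp add: Sob_borel_def space_measure_of_conv Sob_real_def)
  moreover have "0 < t\<^sub>0" by (rule less_trans[OF _ tp(2)]) (use tp(1) in simp)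
  ultimately obtain C where "AE x in circ. norm (complex_of_real (V \<omega> x)) \<le> C"
    using sobolev_embedding_bounded[OF _ tp integrable_Lp_2[OF Lp_2_of_real[OF V_Lp_2[OF assms]]]] by blast
  then show thesis using that by simp
qed

lemma W_H: "\<omega> \<in> space M1 \<Longrightarrow> W \<omega> \<in> H s"
  using W by (simp add: white_noise_def Sob_real_def)

lemma Gamma_op_VW:
  assumes \<omega>: "\<omega>1 \<in> space M1" "\<omega>2 \<in> space M2"
  shows "Gamma_op \<epsilon> q \<delta> (V \<omega>2) (W \<omega>1) k = Gamma_int \<epsilon> q (\<delta> / 2) (fourier (coef \<epsilon> (V \<omega>2))) (W \<omega>1) k"
    and "finite S \<Longrightarrow> (\<Sum>k\<in>S. (norm (Gamma_op \<epsilon> q \<delta> (V \<omega>2) (W \<omega>1) k))\<^sup>2) \<le> (Gamma_const \<delta> s * Hs_norm s (W \<omega>1))\<^sup>2"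
proof -
  obtain C where C: "AE x in circ. \<bar>V \<omega>2 x\<bar> \<le> C" by (rule V_bounded[OF \<omega>(2)])
  have s0: "s \<le> 0" using s by simp
  note facts = \<epsilon> Lp_2_measurable[OF V_Lp_2[OF \<omega>(2)]] C \<delta> sym W_H[OF \<omega>(1)] s(1) s0
  show "Gamma_op \<epsilon> q \<delta> (V \<omega>2) (W \<omega>1) k = Gamma_int \<epsilon> q (\<delta> / 2) (fourier (coef \<epsilon> (V \<omega>2))) (W \<omega>1) k"
    by (rule Gamma_op_eq[OF facts])
  show "finite S \<Longrightarrow> (\<Sum>k\<in>S. (norm (Gamma_op \<epsilon> q \<delta> (V \<omega>2) (W \<omega>1) k))\<^sup>2) \<le> (Gamma_const \<delta> s * Hs_norm s (W \<omega>1))\<^sup>2"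
    by (rule sum_Gamma_op_le[OF facts])
qed

lemma Hs_norm_nonneg: "Hs_norm t u \<ge> 0"
  by (simp add: Hs_norm_def infsum_nonneg)

lemma U_cont_norm_le:
  assumes \<omega>: "\<omega>1 \<in> space M1" "\<omega>2 \<in> space M2"
  shows "Lp_norm 2 (U_cont \<epsilon> q \<delta> W V (\<omega>1, \<omega>2)) \<le> Gamma_const \<delta> s * Hs_norm s (W \<omega>1)"
  unfolding U_cont_def fst_conv snd_conv
  by (rule Lp_norm_real_fun_of_le[OF mult_nonneg_nonneg[OF Gamma_const_nonneg[OF \<delta>] Hs_norm_nonneg] Gamma_op_VW(2)[OF \<omega>]])

text \<open>At each sample point the operator equals \<open>Gamma_int\<close>, into which
  \<open>V\<close> enters through the convolution formula \<open>fourier_coef\<close>.\<close>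

lemma U_cont_norm_measurable: "(\<lambda>\<omega>. Lp_norm 2 (U_cont \<epsilon> q \<delta> W V \<omega>)) \<in> borel_measurable (M1 \<Otimes>\<^sub>M M2)"
  unfolding U_cont_def
proof (rule borel_measurable_Lp_norm_real_fun_of)
  have sp: "fst \<omega> \<in> space M1" "snd \<omega> \<in> space M2" if "\<omega> \<in> space (M1 \<Otimes>\<^sub>M M2)" for \<omega>
    using that by (auto simp: space_pair_measure)
  show "sq_summable (Gamma_op \<epsilon> q \<delta> (V (snd \<omega>)) (W (fst \<omega>)))" if "\<omega> \<in> space (M1 \<Otimes>\<^sub>M M2)" for \<omega>
    by (rule sq_summable_if_sums_bounded[OF Gamma_op_VW(2)[OF sp[OF that]]])
  have Vm: "(\<lambda>\<omega>. fourier_real (V \<omega>) k) \<in> borel_measurable M2" for k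
    by (rule V_coeff_measurable[OF \<epsilon> M(2) V(1) order_refl])
  have "(\<lambda>\<omega>. (if j = 0 then complex_of_real (\<epsilon>\<^sup>2) else 0) + symmetric_sum (\<lambda>l. fourier_real (V \<omega>) l * fourier_real (V \<omega>) (j - l))) \<in> borel_measurable M2" for j
    by (intro borel_measurable_add borel_measurable_const measurable_symmetric_sum borel_measurable_times Vm)
  then have a: "(\<lambda>\<omega>. fourier (coef \<epsilon> (V \<omega>)) j) \<in> borel_measurable M2" for j
    by (subst measurable_cong[OF fourier_coef[OF V_Lp_2]])
  have h: "(\<lambda>\<omega>. W \<omega> k) \<in> borel_measurable M1" for k
    using W_coeff_measurable[OF M(1) W s(2)] by blast
  show "(\<lambda>\<omega>. Gamma_op \<epsilon> q \<delta> (V (snd \<omega>)) (W (fst \<omega>)) k) \<in> borel_measurable (M1 \<Otimes>\<^sub>M M2)" for k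
  proof (rule measurable_cong[THEN iffD2])
    show "(\<lambda>\<omega>. Gamma_int \<epsilon> q (\<delta> / 2) (fourier (coef \<epsilon> (V (snd \<omega>)))) (W (fst \<omega>)) k) \<in> borel_measurable (M1 \<Otimes>\<^sub>M M2)"
      by (rule measurable_Gamma_int[OF measurable_compose[OF measurable_snd a] measurable_compose[OF measurable_fst h]])
  qed (rule Gamma_op_VW(1)[OF sp])
qed

lemma U_cont_exp_bound:
  assumes b: "b \<ge> 0" and \<omega>2: "\<omega>2 \<in> space M2"
  shows "(\<integral>\<^sup>+\<omega>1. ennreal (exp (b * Lp_norm 2 (U_cont \<epsilon> q \<delta> W V (\<omega>1, \<omega>2)))) \<partial>M1) \<le>
    ennreal (2 * exp ((b * Gamma_const \<delta> s)\<^sup>2 * (\<Sum>\<^sub>\<infinity>k. bessel_wt k powr s)))"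
proof -
  have "(\<integral>\<^sup>+\<omega>1. ennreal (exp (b * Lp_norm 2 (U_cont \<epsilon> q \<delta> W V (\<omega>1, \<omega>2)))) \<partial>M1) \<le>
      (\<integral>\<^sup>+\<omega>1. ennreal (exp ((b * Gamma_const \<delta> s) * Hs_norm s (W \<omega>1))) \<partial>M1)"
    using mult_left_mono[OF U_cont_norm_le[OF _ \<omega>2] b]
    by (intro nn_integral_mono ennreal_leI) (simp add: mult.assoc)
  also have "\<dots> \<le> ennreal (2 * exp ((b * Gamma_const \<delta> s)\<^sup>2 * (\<Sum>\<^sub>\<infinity>k. bessel_wt k powr s)))"
    using W_exp_bound[OF M(1) W s(2)] by blast
  finally show ?thesis .
qed

end

theorem lemma9:
  fixes \<epsilon> q \<delta> s t\<^sub>0 p\<^sub>0 :: real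
    and M1 :: "'a measure" and M2 :: "'b measure"
    and V :: "'b \<Rightarrow> real \<Rightarrow> real" and W :: "'a \<Rightarrow> pdistr"
    and f g :: "nat \<Rightarrow> real \<Rightarrow> real"
    and VV :: "nat \<Rightarrow> nat \<Rightarrow> 'b \<Rightarrow> real" and WN :: "nat \<Rightarrow> 'a \<Rightarrow> real vec"
  assumes "\<epsilon> > 0" and "q > 1"
    and "prob_space M1" and "prob_space M2"
    and "t\<^sub>0 < 1 / 2" and "1 < p\<^sub>0" and "t\<^sub>0 > 1 / p\<^sub>0"
    and "gaussian_L2 M2 V (\<lambda>x. 1) (C_V \<epsilon>)"
    and "(\<lambda>\<omega>. fourier_real (V \<omega>)) \<in> measurable M2 (Sob_borel t\<^sub>0 p\<^sub>0)"
    and "\<delta> > 0"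
    and "\<And>\<alpha> v u. \<alpha> > 0 \<Longrightarrow> hoelder \<alpha> v \<Longrightarrow> u \<in> H_real 1 \<Longrightarrow>
           Re (duality (B_op \<epsilon> q v u) u) \<ge> \<delta> * (Sob_norm 1 2 u)\<^sup>2"
    and "- 1 < s" and "s < - 1 / 2"
    and "white_noise M1 s W"
    and "orthonormal_basis_H1 (ip_V \<epsilon>) (\<lambda>j. fourier_real (g j))" and "spans_PL g"
    and "orthonormal_basis_H1 (ip_D \<epsilon> q) (\<lambda>j. fourier_real (f j))" and "spans_PL f"
    and "\<And>n. prob_space.indep_vars M2 (\<lambda>_. borel) (VV n) {..<2^n}"
    and "\<And>n j. j < 2^n \<Longrightarrow> distributed M2 lborel (VV n j) std_normal_density"
    and "\<And>n. gaussian_vec_id M1 (2^n) (WN n)"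
  shows "\<forall>b>0. \<exists>C>0.
    (let \<Omega> = completion (M1 \<Otimes>\<^sub>M M2);
         X = (\<lambda>n \<omega>. exp (b * L2_pair_norm (U_disc \<epsilon> q f (V_disc g VV) WN n \<omega>) (V_disc g VV n (snd \<omega>))));
         Y = (\<lambda>\<omega>. exp (b * L2_pair_norm (U_cont \<epsilon> q \<delta> W V \<omega>) (V (snd \<omega>))))
     in (\<forall>n. integrable \<Omega> (X n) \<and> (LINT \<omega>|\<Omega>. X n \<omega>) < C) \<and>
        integrable \<Omega> Y \<and> (LINT \<omega>|\<Omega>. Y \<omega>) < C)"
proof (intro allI impI)
  fix b :: real assume b0: "b > 0"
  then have b: "b \<ge> 0" by simp
  have z: "0 \<le> (0 :: real)" by simp
  note M = assms(3,4) and \<epsilon> = assms(1) and g = assms(15,16) and f = assms(17,18)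
  note ind = assms(19) and normal = assms(20) and WN = assms(21)
  have sym: "\<delta> * bessel_wt k \<le> \<epsilon>\<^sup>2 * (norm (Dq_symbol \<epsilon> q k))\<^sup>2" for k
    by (rule Dq_symbol_ge_if_coercive[OF \<epsilon> B_op_zero[OF \<epsilon>] assms(11)])
  note cont = \<epsilon> M assms(6,7,8,9,10) sym assms(12,13,14)
  \<comment> \<open>One constant serves the discrete and the continuous \<open>V\<close>, because
    their coefficients share the variance bound \<open>1 / prior_wt \<epsilon> k\<close>.\<close>
  define Av where "Av = exp (2 * b) * (2 * exp ((2 * b)\<^sup>2 * (\<Sum>\<^sub>\<infinity>k. 1 / prior_wt \<epsilon> k)))"
  define Ad where "Ad = 2 * exp (b\<^sup>2 * (\<Sum>\<^sub>\<infinity>k. (1 / \<epsilon>)\<^sup>2 * (1 / (norm (Dq_symbol \<epsilon> q k))\<^sup>2)))"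
  define Ac where "Ac = 2 * exp ((b * Gamma_const \<delta> s)\<^sup>2 * (\<Sum>\<^sub>\<infinity>k. bessel_wt k powr s))"
  have pos: "0 < Av" "0 < Ad" "0 < Ac" by (simp_all add: Av_def Ad_def Ac_def)
  have VVm: "VV n j \<in> borel_measurable M2" if "j < 2^n" for n j
    using distributed_measurable[OF normal[OF that]] by simp
  have Ad: "(\<integral>\<^sup>+\<omega>1. ennreal (exp (b * Lp_norm 2 (U_disc \<epsilon> q f (V_disc g VV) WN n (\<omega>1, \<omega>2)))) \<partial>M1) \<le> ennreal Ad" for n \<omega>2
    unfolding Ad_def by (rule U_disc_exp_bound[OF \<epsilon> f M(1) WN])
  have Ac: "(\<integral>\<^sup>+\<omega>1. ennreal (exp (b * Lp_norm 2 (U_cont \<epsilon> q \<delta> W V (\<omega>1, \<omega>2)))) \<partial>M1) \<le> ennreal Ac" if "\<omega>2 \<in> space M2" for \<omega>2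
    unfolding Ac_def by (rule U_cont_exp_bound[OF cont b that])
  note Av_disc = V_disc_exp_bound[OF \<epsilon> M(2) g ind normal b, folded Av_def]
    and Av_cont = V_exp_bound[OF \<epsilon> M(2) assms(8) b, folded Av_def]
  note d = exp_pair_integrable[OF M b U_disc_norm_measurable[OF \<epsilon> f V_disc_cell_measurable[OF g(2) VVm] WN] Lp_norm_nonneg
      V_disc_norm_measurable[OF \<epsilon> M(2) g ind normal b] Lp_norm_nonneg less_imp_le[OF pos(2)] Ad less_imp_le[OF pos(1)] Av_disc,
      folded L2_pair_norm_def]
    and c = exp_pair_integrable[OF M b U_cont_norm_measurable[OF cont] Lp_norm_nonneg
      V_norm_measurable[OF \<epsilon> M(2) assms(8) b] Lp_norm_nonneg less_imp_le[OF pos(3)] Ac less_imp_le[OF pos(1)] Av_cont,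
      folded L2_pair_norm_def]
  have "0 < Ad * Av" "0 < Ac * Av" using pos by simp_all
  \<comment> \<open>A single constant that strictly exceeds both products, as the claim asks for one
    \<open>C\<close> and strict inequalities.\<close>
  then have lt: "Ad * Av < Ad * Av + Ac * Av + 1" "Ac * Av < Ad * Av + Ac * Av + 1" "0 < Ad * Av + Ac * Av + 1" by linarith+
  show "\<exists>C>0.
    (let \<Omega> = completion (M1 \<Otimes>\<^sub>M M2);
         X = (\<lambda>n \<omega>. exp (b * L2_pair_norm (U_disc \<epsilon> q f (V_disc g VV) WN n \<omega>) (V_disc g VV n (snd \<omega>))));
         Y = (\<lambda>\<omega>. exp (b * L2_pair_norm (U_cont \<epsilon> q \<delta> W V \<omega>) (V (snd \<omega>))))
     in (\<forall>n. integrable \<Omega> (X n) \<and> (LINT \<omega>|\<Omega>. X n \<omega>) < C) \<and>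
        integrable \<Omega> Y \<and> (LINT \<omega>|\<Omega>. Y \<omega>) < C)"
    unfolding Let_def
    by (rule exI[of _ "Ad * Av + Ac * Av + 1"])
      (intro conjI allI lt d(1) c(1) le_less_trans[OF d(2) lt(1)] le_less_trans[OF c(2) lt(2)])
qed

end
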